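(* Let $\mathbf{W} = \{\mathbf{W}(t) : t \ge 0\}$ be a standard planar Brownian motion started at the origin and let $\mathbf{B} = \{\mathbf{B}(t) : t \in [0,1]\}$ be a standard planar Brownian bridge, with $\mathbf{W}$ and $\mathbf{B}$ independent. Let $$\mathrm{H} = \operatorname{hull}\left(\{\mathbf{W}(t) : t \in [0,1]\} \cup \{\mathbf{B}(t) : t \in [0,1]\}\right),$$ and let $\mathsf{A}$ be the area of $\mathrm{H}$. Then $$\mathbb{E}[\mathsf{A}] = \frac{(25 - 7\sqrt{5})\pi}{12}.$$
   Context: A standard planar Brownian motion is $\mathbf{W}(t) = (W_1(t), W_2(t))$ with $W_1, W_2$ independent standard one-dimensional Brownian motions started at $0$. A standard planar Brownian bridge is $\mathbf{B}(t) = (B_1(t), B_2(t))$, $t\in[0,1]$, with $B_1, B_2$ independent standard one-dimensional Brownian bridges (standard Brownian motion started at $0$ and conditioned to return to $0$ at time $1$). For $A \subseteq \mathbb{R}^2$, $\operatorname{hull}(A)$ denotes the convex hull of $A$, i.e. the smallest convex subset of $\mathbb{R}^2$ containing $A$. *)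

theory Defs
  imports "HOL-Probability.Probability"
begin

locale brownian_motion = prob_space M
  for M :: "'w measure" and W :: "real \<Rightarrow> 'w \<Rightarrow> real" +
  assumes bm_measurable: "\<And>t. 0 \<le> t \<Longrightarrow> W t \<in> borel_measurable M"
    and bm_start: "\<And>\<omega>. \<omega> \<in> space M \<Longrightarrow> W 0 \<omega> = 0"
    and bm_continuous: "\<And>\<omega>. \<omega> \<in> space M \<Longrightarrow> continuous_on {0..} (\<lambda>t. W t \<omega>)"
    and bm_increments_indep:
      "\<And>n (t :: nat \<Rightarrow> real). 0 \<le> t 0 \<Longrightarrow> strict_mono_on {..n} t \<Longrightarrow>
         indep_vars (\<lambda>_. borel) (\<lambda>i \<omega>. W (t (Suc i)) \<omega> - W (t i) \<omega>) {..<n}"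
    and bm_increments_normal:
      "\<And>s t. 0 \<le> s \<Longrightarrow> s < t \<Longrightarrow>
         distributed M lborel (\<lambda>\<omega>. W t \<omega> - W s \<omega>) (normal_density 0 (sqrt (t - s)))"

text \<open>
  For \<open>0 < t 0 < \<dots> < t (n - 1)\<close> this is the joint density, at \<open>(x 0, \<dots>, x (n - 1))\<close>, of
  standard one-dimensional Brownian motion at the times \<open>t 0, \<dots>, t (n - 1)\<close>: a product of
  Gaussian transition densities, starting in \<open>0\<close> at time \<open>0\<close>.
\<close>

definition bm_joint_density :: "nat \<Rightarrow> (nat \<Rightarrow> real) \<Rightarrow> (nat \<Rightarrow> real) \<Rightarrow> real" where
  "bm_joint_density n t x =
     (\<Prod>i<n. normal_density (if i = 0 then 0 else x (i - 1))
                (sqrt (t i - (if i = 0 then 0 else t (i - 1)))) (x i))"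

text \<open>
  Conditioning Brownian motion on the null event that it is at \<open>0\<close> at time \<open>1\<close> is understood
  through conditional densities: the joint density at the times \<open>t 0, \<dots>, t (n - 1), 1\<close>,
  evaluated at \<open>(x 0, \<dots>, x (n - 1), 0)\<close>, is divided by the density at time \<open>1\<close>, evaluated
  at \<open>0\<close>.
\<close>

definition bm_bridge_density :: "nat \<Rightarrow> (nat \<Rightarrow> real) \<Rightarrow> (nat \<Rightarrow> real) \<Rightarrow> real" where
  "bm_bridge_density n t x =
     bm_joint_density (Suc n) (t(n := 1)) (x(n := 0)) / bm_joint_density 1 (\<lambda>_. 1) (\<lambda>_. 0)"

locale brownian_bridge = prob_space M
  for M :: "'w measure" and B :: "real \<Rightarrow> 'w \<Rightarrow> real" +
  assumes bridge_measurable: "\<And>t. t \<in> {0..1} \<Longrightarrow> B t \<in> borel_measurable M"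
    and bridge_start: "\<And>\<omega>. \<omega> \<in> space M \<Longrightarrow> B 0 \<omega> = 0"
    and bridge_end: "\<And>\<omega>. \<omega> \<in> space M \<Longrightarrow> B 1 \<omega> = 0"
    and bridge_continuous: "\<And>\<omega>. \<omega> \<in> space M \<Longrightarrow> continuous_on {0..1} (\<lambda>t. B t \<omega>)"
    and bridge_distributed:
      "\<And>n (t :: nat \<Rightarrow> real). t ` {..<n} \<subseteq> {0<..<1} \<Longrightarrow> strict_mono_on {..<n} t \<Longrightarrow>
         distributed M (\<Pi>\<^sub>M i\<in>{..<n}. lborel) (\<lambda>\<omega>. \<lambda>i\<in>{..<n}. B (t i) \<omega>) (bm_bridge_density n t)"

text \<open>
  Independence of processes is independence of the sigma-algebras they generate, i.e. of the
  paths as random elements of the product space over the index set.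
\<close>

definition (in prob_space) indep_processes ::
  "'i set \<Rightarrow> ('i \<Rightarrow> 'a \<Rightarrow> 'b :: topological_space) \<Rightarrow>
   'i set \<Rightarrow> ('i \<Rightarrow> 'a \<Rightarrow> 'b) \<Rightarrow> bool" where
  "indep_processes I X J Y \<longleftrightarrow>
     indep_var (\<Pi>\<^sub>M i\<in>I. borel) (\<lambda>\<omega>. \<lambda>i\<in>I. X i \<omega>) (\<Pi>\<^sub>M j\<in>J. borel) (\<lambda>\<omega>. \<lambda>j\<in>J. Y j \<omega>)"

locale planar_brownian_motion =
  W1: brownian_motion M "\<lambda>t \<omega>. fst (W t \<omega>)" + W2: brownian_motion M "\<lambda>t \<omega>. snd (W t \<omega>)"
  for M :: "'w measure" and W :: "real \<Rightarrow> 'w \<Rightarrow> real \<times> real" +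
  assumes components_indep:
    "prob_space.indep_processes M {0..} (\<lambda>t \<omega>. fst (W t \<omega>)) {0..} (\<lambda>t \<omega>. snd (W t \<omega>))"

locale planar_brownian_bridge =
  B1: brownian_bridge M "\<lambda>t \<omega>. fst (B t \<omega>)" + B2: brownian_bridge M "\<lambda>t \<omega>. snd (B t \<omega>)"
  for M :: "'w measure" and B :: "real \<Rightarrow> 'w \<Rightarrow> real \<times> real" +
  assumes components_indep:
    "prob_space.indep_processes M {0..1} (\<lambda>t \<omega>. fst (B t \<omega>)) {0..1} (\<lambda>t \<omega>. snd (B t \<omega>))"

end

theory Submission
  imports Defs "HOL-Real_Asymp.Real_Asymp"
begin

text \<open>
  Sample \<open>W\<close> and \<open>B\<close> on the grid of mesh \<open>1 / N\<close>. A point \<open>x\<close> outside the convex hull of finitely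
  many points in general position sees exactly one of them with all the others strictly to the left
  of the line from \<open>x\<close> through it. Integrate this dichotomy against \<open>exp (- \<epsilon> |x|\<^sup>2 / 2)\<close>: the law of the
  sample is invariant under rotations and its two coordinate vectors are independent, so the
  contribution of a sample point is a Gaussian integral times the probability that the point has the
  largest first coordinate. As \<open>\<epsilon> \<rightarrow> 0\<close> the expected area of the hull of the sample becomes
  \<open>\<pi> \<Sum>\<^sub>i E[X\<^sub>i\<^sup>2 - K\<^sub>i; X\<^sub>i maximal]\<close> with \<open>K\<^sub>i\<close> the variance of the \<open>i\<close>-th point.

  As \<open>N \<rightarrow> \<infinity>\<close> this tends to \<open>\<pi> (E m\<^sup>2 - E K)\<close>, where \<open>m\<close> is the larger of the maxima of the two first
  coordinates, attained at time \<open>\<tau>\<close>, and \<open>K\<close> is \<open>\<tau>\<close> or \<open>\<tau> (1 - \<tau>)\<close> according to whether the motion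
  or the bridge attains it. The laws of the maximum and of its position come from the reflection
  principle; the bridge is an \<open>h\<close>-transform of the motion on \<open>[0, s]\<close>, \<open>s < 1\<close>. What remains
  is a handful of elementary integrals.
\<close>

text \<open>The limit formula is the mean of Cauchy's area formula: the area is half the integral
  over directions of \<open>h^2 - h'^2\<close>, \<open>h\<close> the support function. In the frame
  of a direction, \<open>h\<close> and \<open>h'\<close> are the two coordinates of the supporting
  point, and given the first coordinates \<open>h'\<close> is Gaussian with variance
  \<open>K\<close>. Counting tangent points replaces differentiating \<open>h\<close>. The Gaussian
  weight is there because the outside of a hull has infinite area; the diverging terms
  \<open>2 * pi / \<epsilon>\<close> cancel since exactly one sample point has the largest first
  coordinate. The obstacle is the bridge, whose law on all of [0, 1] is singular to that of the
  motion. It is handled on [0, s], and the density concentrates at end value 0 as s tends to 1. The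
  time \<tau> is never constructed. Its moments E \<tau> and E \<tau> (1 - \<tau>) are integrals
  over r, with densities 1 and 2 r - 1, of probabilities that the maximum is attained up to time r,
  so only such events occur. The square roots of 5 come from multiplying the factor exp (- a^2 / 2)
  of the motion by the factor exp (- 2 a^2) of the bridge.\<close>

abbreviation (input) borel2 where "borel2 \<equiv> borel \<Otimes>\<^sub>M borel"

abbreviation (input) lvec :: "'i set \<Rightarrow> ('i \<Rightarrow> real) measure" where
  "lvec I \<equiv> \<Pi>\<^sub>M i\<in>I. lborel"

abbreviation (input) in_01 :: "real \<Rightarrow> ennreal" where
  "in_01 r \<equiv> of_bool (0 < r \<and> r < 1)"

section \<open>Maxima of continuous paths\<close>

definition path_max :: "(real \<Rightarrow> real) \<Rightarrow> real \<Rightarrow> real \<Rightarrow> real" where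
  "path_max f a b = Sup (f ` {a..b})"

lemma path_max_attained:
  assumes "a \<le> b" "continuous_on {a..b} f"
  obtains t where "t \<in> {a..b}" "path_max f a b = f t" "\<And>u. u \<in> {a..b} \<Longrightarrow> f u \<le> f t"
proof -
  have "\<exists>x\<in>{a..b}. \<forall>y\<in>{a..b}. f y \<le> f x"
    using assms by (intro continuous_attains_sup) auto
  then obtain t where t: "t \<in> {a..b}" "\<And>u. u \<in> {a..b} \<Longrightarrow> f u \<le> f t" by auto
  moreover have "path_max f a b = f t"
    unfolding path_max_def using t by (intro cSup_eq_maximum) auto
  ultimately show ?thesis using that by blast
qed

lemma path_max_upper:
  assumes "continuous_on {a..b} f" "u \<in> {a..b}"
  shows "f u \<le> path_max f a b"
proof -
  have "a \<le> b" using assms by auto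
  from path_max_attained[OF this assms(1)] show ?thesis using assms(2) by metis
qed

lemma path_max_less_iff:
  assumes "a \<le> b" "continuous_on {a..b} f"
  shows "y < path_max f a b \<longleftrightarrow> (\<exists>u\<in>{a..b}. y < f u)"
  using path_max_attained[OF assms] path_max_upper[OF assms(2)] by (metis less_le_trans)

lemma path_max_union:
  assumes "a \<le> b" "b \<le> c" "continuous_on {a..c} f"
  shows "path_max f a c = max (path_max f a b) (path_max f b c)"
proof -
  have c: "continuous_on {a..b} f" "continuous_on {b..c} f"
    using assms by (auto elim: continuous_on_subset)
  \<comment> \<open>Equality of the two reals is tested on strict lower bounds, where a maximum
    becomes an existential quantifier over times.\<close>
  have "y < path_max f a c \<longleftrightarrow> y < max (path_max f a b) (path_max f b c)" for y
  proof -
    have "{a..c} = {a..b} \<union> {b..c}" using assms by auto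
    then show ?thesis using assms c by (simp add: path_max_less_iff less_max_iff_disj bex_Un)
  qed
  then show ?thesis by (metis linorder_less_linear order_less_irrefl)
qed

lemma path_max_shift:
  "path_max (\<lambda>u. f (r + u) - c) 0 (b - r) = path_max f r b - c" if "r \<le> b" "continuous_on {r..b} f"
proof -
  have c: "continuous_on {0..b - r} (\<lambda>u. f (r + u) - c)"
    by (intro continuous_intros continuous_on_compose2[OF that(2)]) auto
  have eq: "(\<exists>u\<in>{0..b-r}. y < f (r + u) - c) \<longleftrightarrow> (\<exists>u\<in>{r..b}. y + c < f u)" for y
  proof
    assume "\<exists>u\<in>{r..b}. y + c < f u"
    then obtain u where "u \<in> {r..b}" "y + c < f u" by auto
    then show "\<exists>u\<in>{0..b-r}. y < f (r + u) - c" by (intro bexI[of _ "u - r"]) auto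
  next
    assume "\<exists>u\<in>{0..b-r}. y < f (r + u) - c"
    then obtain u where "u \<in> {0..b-r}" "y < f (r + u) - c" by auto
    then show "\<exists>u\<in>{r..b}. y + c < f u" by (intro bexI[of _ "r + u"]) auto
  qed
  have "y < path_max (\<lambda>u. f (r + u) - c) 0 (b - r) \<longleftrightarrow> y < path_max f r b - c" for y
    using path_max_less_iff[OF _ c] path_max_less_iff[OF that, of "y + c"] that(1)
    by (simp add: less_diff_eq eq[unfolded less_diff_eq])
  then show ?thesis by (metis linorder_less_linear order_less_irrefl)
qed

lemma Max_le_path_max:
  assumes "continuous_on {a..b} f" "finite S" "S \<noteq> {}" "S \<subseteq> {a..b}"
  shows "Max (f ` S) \<le> path_max f a b"
  using assms by (subst Max_le_iff) (auto intro!: path_max_upper)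

lemma Max_tendsto_path_max:
  assumes ab: "a < b" and cont: "continuous_on {a..b} f"
    and S: "\<And>n. finite (S n)" "\<And>n. S n \<noteq> {}" "\<And>n. S n \<subseteq> {a..b}"
    and dense: "\<And>u v. a < u \<Longrightarrow> u < v \<Longrightarrow> v < b \<Longrightarrow> \<forall>\<^sub>F n in sequentially. S n \<inter> {u<..<v} \<noteq> {}"
  shows "(\<lambda>n. Max (f ` S n)) \<longlonglongrightarrow> path_max f a b"
proof (rule order_tendstoI)
  fix y assume "path_max f a b < y"
  then show "\<forall>\<^sub>F n in sequentially. Max (f ` S n) < y"
    using Max_le_path_max[OF cont S] by (intro always_eventually) (auto intro: le_less_trans)
next
  fix y assume y: "y < path_max f a b"
  then obtain t where t: "t \<in> {a..b}" "y < f t"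
    using path_max_less_iff[of a b f y] ab cont by auto
  obtain d where d: "d > 0" "\<And>t'. t' \<in> {a..b} \<Longrightarrow> dist t' t < d \<Longrightarrow> dist (f t') (f t) < f t - y"
    using cont t unfolding continuous_on_iff by (metis diff_gt_0_iff_gt)
  \<comment> \<open>The maximiser \<open>t\<close> may be an end point, while density is only
    assumed strictly inside. A margin \<open>e\<close> is cut off both ends; at a quarter of the
    radius and of the length it leaves a nonempty interval near \<open>t\<close>.\<close>
  obtain u v where uv: "a < u" "u < v" "v < b" "t - d < u" "v < t + d"
  proof -
    define e where "e = min (d / 4) ((b - a) / 4)"
    have e: "0 < e" "e \<le> d / 4" "e \<le> (b - a) / 4" unfolding e_def using d(1) ab by (simp_all only: min.cobounded1 min.cobounded2) simp
    define u where "u = max (t - d / 2) (a + e)"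
    define v where "v = min (t + d / 2) (b - e)"
    have "a < u" "v < b" "t - d < u" "v < t + d" using d(1) e(1)
      by (auto simp: u_def v_def less_max_iff_disj min_less_iff_disj)
    moreover have "t - d / 2 < t + d / 2" "t - d / 2 < b - e" "a + e < t + d / 2" "a + e < b - e"
      using d(1) e t(1) ab by (auto simp: field_simps)
    then have "u < v" by (simp add: u_def v_def)
    ultimately show ?thesis using that by blast
  qed
  show "\<forall>\<^sub>F n in sequentially. y < Max (f ` S n)"
    using dense[OF uv(1-3)]
  proof eventually_elim
    case (elim n)
    then obtain s where s: "s \<in> S n" "u < s" "s < v" by auto
    then have "dist (f s) (f t) < f t - y" using d(2)[of s] S(3)[of n] uv by (auto simp: dist_real_def)
    then have "y < f s" by (auto simp: dist_real_def)
    also have "f s \<le> Max (f ` S n)" using S(1) s(1) by auto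
    finally show ?case .
  qed
qed

text \<open>With \<open>Suc N\<close> cells the denominator is never zero, and both end points
  belong to every grid.\<close>

definition grid :: "real \<Rightarrow> real \<Rightarrow> nat \<Rightarrow> nat \<Rightarrow> real" where
  "grid a b N k = a + (b - a) * real k / real (Suc N)"

lemma grid_0 [simp]: "grid a b N 0 = a"
  and grid_last [simp]: "grid a b N (Suc N) = b"
  by (simp_all add: grid_def)

lemma grid_less_iff: "a < b \<Longrightarrow> grid a b N k < grid a b N l \<longleftrightarrow> k < l"
  by (simp add: grid_def divide_less_cancel)

lemma grid_strict_mono: "a < b \<Longrightarrow> strict_mono (grid a b N)"
  by (auto simp: strict_mono_def grid_less_iff)

lemma grid_in: "a < b \<Longrightarrow> k \<le> Suc N \<Longrightarrow> grid a b N k \<in> {a..b}"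
  using strict_mono_leD[OF grid_strict_mono[of a b N], of 0 k] strict_mono_leD[OF grid_strict_mono[of a b N], of k "Suc N"]
  by auto

lemma grid_dense:
  assumes "a < b" "a < u" "u < v" "v < b"
  shows "\<forall>\<^sub>F N in sequentially. grid a b N ` {..Suc N} \<inter> {u<..<v} \<noteq> {}"
proof -
  obtain N0 :: nat where N0: "(b - a) / (v - u) < real N0" using reals_Archimedean2 by blast
  show ?thesis
  proof (rule eventually_sequentiallyI[of N0])
    fix N assume "N0 \<le> N"
    then have N: "(b - a) / (v - u) < real (Suc N)" using N0 by linarith
    \<comment> \<open>Index of the first grid point strictly to the right of \<open>u\<close>; the
      next-to-left one is at most \<open>u\<close>, so one cell shorter than \<open>v - u\<close>
      suffices to land before \<open>v\<close>.\<close>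
    define k where "k = nat (floor ((u - a) / (b - a) * real (Suc N))) + 1"
    have k: "real k = of_int (floor ((u - a) / (b - a) * real (Suc N))) + 1"
      using assms by (simp add: k_def)
    have "(u - a) / (b - a) * real (Suc N) < real k" "real k \<le> (u - a) / (b - a) * real (Suc N) + 1"
      unfolding k by linarith+
    moreover have "(b - a) * ((u - a) / (b - a) * real (Suc N)) = (u - a) * real (Suc N)" using assms by simp
    ultimately have "(u - a) * real (Suc N) < (b - a) * real k" "(b - a) * real k \<le> (u - a) * real (Suc N) + (b - a)"
      using mult_strict_left_mono[of "(u - a) / (b - a) * real (Suc N)" "real k" "b - a"]
        mult_left_mono[of "real k" "(u - a) / (b - a) * real (Suc N) + 1" "b - a"] assms
      by (simp_all only: distrib_left mult_1_right diff_gt_0_iff_gt)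
    then have 1: "u - a < (b - a) * real k / real (Suc N)" and 2: "(b - a) * real k / real (Suc N) \<le> u - a + (b - a) / real (Suc N)"
      using divide_right_mono[of "(b - a) * real k" "(u - a) * real (Suc N) + (b - a)" "real (Suc N)"]
      by (simp_all add: pos_less_divide_eq add_divide_distrib del: of_nat_Suc)
    have "(b - a) / real (Suc N) < v - u" using N assms by (simp add: field_simps)
    then have g: "u < grid a b N k" "grid a b N k < v" using 1 2 by (auto simp: grid_def)
    have "k \<le> Suc N" using g(2) assms grid_less_iff[of a b N "Suc N" k] by force
    then show "grid a b N ` {..Suc N} \<inter> {u<..<v} \<noteq> {}" using g by auto
  qed
qed

lemma grid_max_tendsto:
  assumes "a < b" "continuous_on {a..b} f"
  shows "(\<lambda>N. Max (f ` grid a b N ` {..Suc N})) \<longlonglongrightarrow> path_max f a b"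
  by (rule Max_tendsto_path_max) (use assms grid_in grid_dense in auto)

text \<open>Approximation from below makes the comparison eventually constant even when
  \<open>l = y\<close>. Hence probabilities of such events converge without any continuity of the
  limit law.\<close>

lemma of_bool_le_tendsto:
  fixes x :: "nat \<Rightarrow> real"
  assumes "x \<longlonglongrightarrow> l" "\<And>n. x n \<le> l"
  shows "\<forall>\<^sub>F n in sequentially. (x n \<le> y) = (l \<le> y)"
proof (cases "l \<le> y")
  case True
  then have "x n \<le> y" for n using assms(2)[of n] by linarith
  with True show ?thesis by simp
next
  case False
  then have "\<forall>\<^sub>F n in sequentially. x n > y" using assms(1) by (auto intro: order_tendstoD)
  then show ?thesis by eventually_elim (use False in auto)
qed

text \<open>The supremum runs over uncountably many times; by continuity it is a limit of maxima
  over finite grids.\<close>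

lemma borel_measurable_path_max [measurable (raw)]:
  assumes "a < b" "\<And>t. t \<in> {a..b} \<Longrightarrow> X t \<in> borel_measurable M"
    "\<And>w. w \<in> space M \<Longrightarrow> continuous_on {a..b} (\<lambda>t. X t w)"
  shows "(\<lambda>w. path_max (\<lambda>t. X t w) a b) \<in> borel_measurable M"
proof (rule borel_measurable_LIMSEQ_real)
  show "(\<lambda>N. Max ((\<lambda>t. X t w) ` grid a b N ` {..Suc N})) \<longlonglongrightarrow> path_max (\<lambda>t. X t w) a b" if "w \<in> space M" for w
    by (rule grid_max_tendsto) (use assms that in auto)
  show "(\<lambda>w. Max ((\<lambda>t. X t w) ` grid a b N ` {..Suc N})) \<in> borel_measurable M" for N
    unfolding image_image using assms(2) grid_in[OF assms(1)]
    by (intro borel_measurable_Max) auto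
qed

context brownian_motion begin

lemma W_normal: "0 < t \<Longrightarrow> distributed M lborel (W t) (normal_density 0 (sqrt t))"
proof -
  assume t: "0 < t"
  have "distr M lborel (W t) = distr M lborel (\<lambda>w. W t w - W 0 w)"
    by (intro distr_cong) (auto simp: bm_start)
  then show ?thesis
    using bm_increments_normal[of 0 t] t bm_measurable[of t] by (auto simp: distributed_def)
qed

lemma W_cont: "w \<in> space M \<Longrightarrow> 0 \<le> a \<Longrightarrow> continuous_on {a..b} (\<lambda>t. W t w)"
  by (rule continuous_on_subset[OF bm_continuous]) auto

lemma path_max_W [measurable]: "0 \<le> a \<Longrightarrow> a < b \<Longrightarrow> (\<lambda>w. path_max (\<lambda>t. W t w) a b) \<in> borel_measurable M"
  by (rule borel_measurable_path_max) (auto intro: bm_measurable W_cont)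

lemma normal_no_atom:
  assumes "distributed M lborel Z (normal_density 0 \<sigma>)"
  shows "AE w in M. Z w \<noteq> c"
proof -
  have [measurable]: "Z \<in> borel_measurable M" using assms by (auto simp: distributed_def)
  have "emeasure M (Z -` {c} \<inter> space M) = emeasure (distr M lborel Z) {c}"
    by (subst emeasure_distr) auto
  also have "\<dots> = 0"
    unfolding distributed_distr_eq_density[OF assms] by (subst emeasure_density) (auto intro!: nn_integral_null_set)
  finally show ?thesis by (intro AE_I[of _ _ "Z -` {c} \<inter> space M"]) auto
qed

lemma past_future_indep:
  fixes t :: "nat \<Rightarrow> real"
  assumes t: "0 \<le> t 0" "strict_mono_on {..n} t" and "k \<le> n"
  shows "indep_var (\<Pi>\<^sub>M i\<in>{..<k}. borel) (\<lambda>w. \<lambda>i\<in>{..<k}. W (t (Suc i)) w - W (t i) w)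
    (\<Pi>\<^sub>M i\<in>{k..<n}. borel) (\<lambda>w. \<lambda>i\<in>{k..<n}. W (t (Suc i)) w - W (t i) w)"
  by (rule indep_var_restrict[OF bm_increments_indep[OF t]]) (use assms(3) in auto)

end

section \<open>Independent random elements and the reflection principle\<close>

lemma measure_eqI_rectangles:
  assumes s: "sets \<mu> = sets (A \<Otimes>\<^sub>M B)" "sets \<nu> = sets (A \<Otimes>\<^sub>M B)" and fin: "emeasure \<mu> (space A \<times> space B) \<noteq> \<infinity>"
    and eq: "\<And>a b. a \<in> sets A \<Longrightarrow> b \<in> sets B \<Longrightarrow> emeasure \<mu> (a \<times> b) = emeasure \<nu> (a \<times> b)"
  shows "\<mu> = \<nu>"
  by (rule measure_eqI_generator_eq[OF Int_stable_pair_measure_generator[of A B], where A="\<lambda>_. space A \<times> space B" and \<Omega>="space A \<times> space B"])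
     (use sets.space_closed[of A] sets.space_closed[of B] s fin eq in \<open>auto simp: sets_pair_measure\<close>)

section \<open>Independence, product laws and convergence of probabilities\<close>

context prob_space begin

text \<open>Dominated convergence for indicators. It carries statements about grid maxima over to
  path maxima.\<close>

lemma prob_eventually_eq:
  assumes [measurable]: "\<And>n :: nat. Measurable.pred M (P n)" "Measurable.pred M Q"
    and ev: "AE w in M. \<forall>\<^sub>F n in sequentially. P n w = Q w"
  shows "(\<lambda>n. prob {w \<in> space M. P n w}) \<longlonglongrightarrow> prob {w \<in> space M. Q w}"
proof -
  have "(\<lambda>n. \<integral>w. of_bool (P n w) \<partial>M) \<longlonglongrightarrow> (\<integral>w. of_bool (Q w) \<partial>M :: real)"
  proof (rule integral_dominated_convergence[where w="\<lambda>_. 1"])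
    show "AE w in M. (\<lambda>n. of_bool (P n w) :: real) \<longlonglongrightarrow> of_bool (Q w)"
      using ev by eventually_elim (auto intro!: tendsto_eventually elim: eventually_mono)
  qed auto
  moreover have "(\<integral>w. of_bool (R w) \<partial>M) = prob {w \<in> space M. R w}" if [measurable]: "Measurable.pred M R" for R
  proof -
    have "(\<integral>w. of_bool (R w) \<partial>M) = (\<integral>w. indicator {w \<in> space M. R w} w \<partial>M)"
      by (intro Bochner_Integration.integral_cong) (auto split: split_indicator)
    also have "\<dots> = prob {w \<in> space M. R w}" by simp
    finally show ?thesis .
  qed
  ultimately show ?thesis by simp
qed

text \<open>The two value types may differ: a vector of increments is to be independent of a single
  real. The product rule on preimages is all that the Fubini arguments below use.\<close>

definition indep_rv :: "'b measure \<Rightarrow> ('a \<Rightarrow> 'b) \<Rightarrow> 'c measure \<Rightarrow> ('a \<Rightarrow> 'c) \<Rightarrow> bool" where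
  "indep_rv S X T Y \<longleftrightarrow> X \<in> M \<rightarrow>\<^sub>M S \<and> Y \<in> M \<rightarrow>\<^sub>M T \<and> (\<forall>A\<in>sets S. \<forall>B\<in>sets T.
     emeasure M (X -` A \<inter> Y -` B \<inter> space M) = emeasure M (X -` A \<inter> space M) * emeasure M (Y -` B \<inter> space M))"

lemma indep_rv_of_indep_var: "indep_var S X T Y \<Longrightarrow> indep_rv S X T Y"
proof -
  assume i: "indep_var S X T Y"
  have e: "X -` A \<inter> Y -` B \<inter> space M = (\<lambda>x. (X x, Y x)) -` (A \<times> B) \<inter> space M" for A B by auto
  show ?thesis unfolding indep_rv_def e emeasure_eq_measure
    using indep_varD[OF i] indep_var_rv1[OF i] indep_var_rv2[OF i] by (auto simp: ennreal_mult'[symmetric])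
qed

lemma indep_rv_compose:
  assumes "indep_rv S X T Y" "f \<in> S \<rightarrow>\<^sub>M S'" "g \<in> T \<rightarrow>\<^sub>M T'"
  shows "indep_rv S' (\<lambda>w. f (X w)) T' (\<lambda>w. g (Y w))"
proof -
  have X[measurable]: "X \<in> M \<rightarrow>\<^sub>M S" and Y[measurable]: "Y \<in> M \<rightarrow>\<^sub>M T" using assms by (auto simp: indep_rv_def)
  note [measurable] = assms(2,3)
  have "emeasure M ((\<lambda>w. f (X w)) -` A \<inter> (\<lambda>w. g (Y w)) -` B \<inter> space M)
    = emeasure M ((\<lambda>w. f (X w)) -` A \<inter> space M) * emeasure M ((\<lambda>w. g (Y w)) -` B \<inter> space M)"
    if "A \<in> sets S'" "B \<in> sets T'" for A B
  proof -
    have *: "(\<lambda>w. f (X w)) -` A \<inter> space M = X -` (f -` A \<inter> space S) \<inter> space M"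
      "(\<lambda>w. g (Y w)) -` B \<inter> space M = Y -` (g -` B \<inter> space T) \<inter> space M"
      "(\<lambda>w. f (X w)) -` A \<inter> (\<lambda>w. g (Y w)) -` B \<inter> space M = X -` (f -` A \<inter> space S) \<inter> Y -` (g -` B \<inter> space T) \<inter> space M"
      using measurable_space[OF X] measurable_space[OF Y] by auto
    have "f -` A \<inter> space S \<in> sets S" "g -` B \<inter> space T \<in> sets T" using that by measurable
    then show ?thesis using assms(1) unfolding * indep_rv_def by blast
  qed
  then show ?thesis unfolding indep_rv_def by simp
qed

lemma indep_rv_distr:
  assumes "indep_rv S X T Y"
  shows "distr M (S \<Otimes>\<^sub>M T) (\<lambda>w. (X w, Y w)) = distr M S X \<Otimes>\<^sub>M distr M T Y"
proof -
  have X[measurable]: "X \<in> M \<rightarrow>\<^sub>M S" and Y[measurable]: "Y \<in> M \<rightarrow>\<^sub>M T" using assms by (auto simp: indep_rv_def)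
  interpret X: prob_space "distr M S X" by (rule prob_space_distr) simp
  interpret Y: prob_space "distr M T Y" by (rule prob_space_distr) simp
  show ?thesis
  proof (rule pair_measure_eqI[symmetric])
    show "sigma_finite_measure (distr M S X)" "sigma_finite_measure (distr M T Y)" ..
    show "sets (distr M S X \<Otimes>\<^sub>M distr M T Y) = sets (distr M (S \<Otimes>\<^sub>M T) (\<lambda>w. (X w, Y w)))"
      by (simp cong: sets_pair_measure_cong)
    fix A B assume AB: "A \<in> sets (distr M S X)" "B \<in> sets (distr M T Y)"
    have "(\<lambda>w. (X w, Y w)) -` (A \<times> B) \<inter> space M = X -` A \<inter> Y -` B \<inter> space M" by auto
    then show "emeasure (distr M S X) A * emeasure (distr M T Y) B = emeasure (distr M (S \<Otimes>\<^sub>M T) (\<lambda>w. (X w, Y w))) (A \<times> B)"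
      using AB assms by (simp add: emeasure_distr indep_rv_def)
  qed
qed

text \<open>Fubini on the product law, with \<open>Y\<close> integrated over a second copy of
  \<open>M\<close> instead of over its law, so that results about integrals over \<open>M\<close>
  apply again to the inner integral.\<close>

lemma indep_rv_nn_integral:
  assumes i: "indep_rv S X T Y" and F[measurable]: "F \<in> borel_measurable (S \<Otimes>\<^sub>M T)"
  shows "(\<integral>\<^sup>+w. F (X w, Y w) \<partial>M) = (\<integral>\<^sup>+w. \<integral>\<^sup>+w'. F (X w, Y w') \<partial>M \<partial>M)"
proof -
  have X[measurable]: "X \<in> M \<rightarrow>\<^sub>M S" and Y[measurable]: "Y \<in> M \<rightarrow>\<^sub>M T" using i by (auto simp: indep_rv_def)
  interpret Y: prob_space "distr M T Y" by (rule prob_space_distr) simp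
  have "(\<integral>\<^sup>+w. F (X w, Y w) \<partial>M) = (\<integral>\<^sup>+z. F z \<partial>(distr M S X \<Otimes>\<^sub>M distr M T Y))"
    unfolding indep_rv_distr[OF i, symmetric] by (subst nn_integral_distr) auto
  also have "\<dots> = (\<integral>\<^sup>+x. \<integral>\<^sup>+y. F (x, y) \<partial>distr M T Y \<partial>distr M S X)"
    by (rule Y.nn_integral_fst[symmetric]) measurable
  also have "\<dots> = (\<integral>\<^sup>+w. \<integral>\<^sup>+y. F (X w, y) \<partial>distr M T Y \<partial>M)"
    by (subst nn_integral_distr) (auto intro: Y.borel_measurable_nn_integral)
  also have "\<dots> = (\<integral>\<^sup>+w. \<integral>\<^sup>+w'. F (X w, Y w') \<partial>M \<partial>M)"
    by (intro nn_integral_cong nn_integral_distr) (auto intro: measurable_compose[OF measurable_Pair1' F] measurable_space[OF X])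
  finally show ?thesis .
qed

text \<open>The events \<open>U w \<le> a \<and> V w \<le> b\<close> form a pi-system that generates
  the sigma-algebra of the pair. Factorised distribution functions therefore suffice, and these are
  what survives the limit from grids to paths.\<close>

lemma indep_pairI:
  fixes X1 X2 Y1 Y2 :: "'a \<Rightarrow> real"
  assumes [measurable]: "X1 \<in> borel_measurable M" "X2 \<in> borel_measurable M" "Y1 \<in> borel_measurable M" "Y2 \<in> borel_measurable M"
    and eq: "\<And>a b c d. prob {w \<in> space M. X1 w \<le> a \<and> X2 w \<le> b \<and> Y1 w \<le> c \<and> Y2 w \<le> d}
      = prob {w \<in> space M. X1 w \<le> a \<and> X2 w \<le> b} * prob {w \<in> space M. Y1 w \<le> c \<and> Y2 w \<le> d}"
  shows "indep_var borel2 (\<lambda>w. (X1 w, X2 w)) borel2 (\<lambda>w. (Y1 w, Y2 w))"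
proof -
  define E where "E U V = {{w \<in> space M. U w \<le> a \<and> V w \<le> b} | a b :: real. True}" for U V :: "'a \<Rightarrow> real"
  have stable: "Int_stable (E U V)" for U V
  proof (rule Int_stableI)
    fix A B assume "A \<in> E U V" "B \<in> E U V"
    then obtain a b a' b' where "A = {w \<in> space M. U w \<le> a \<and> V w \<le> b}" "B = {w \<in> space M. U w \<le> a' \<and> V w \<le> b'}"
      by (auto simp: E_def)
    then have "A \<inter> B = {w \<in> space M. U w \<le> min a a' \<and> V w \<le> min b b'}" by auto
    then show "A \<inter> B \<in> E U V" unfolding E_def by blast
  qed
  have sub: "E U V \<subseteq> events" if [measurable]: "U \<in> borel_measurable M" "V \<in> borel_measurable M" for U V
    by (auto simp: E_def)
  have gen: "{(\<lambda>w. (U w, V w)) -` A \<inter> space M | A. A \<in> sets borel2} \<subseteq> sigma_sets (space M) (E U V)" for U V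
  proof -
    let ?S = "sigma (space M) (E U V)"
    have P: "E U V \<subseteq> Pow (space M)" by (auto simp: E_def)
    have UV: "{w \<in> space M. U w \<le> a \<and> V w \<le> b} \<in> sets ?S" for a b using P by (auto simp: E_def)
    \<comment> \<open>A bound on one variable alone is the countable union of the generating events
      over integer bounds on the other.\<close>
    have "{w \<in> space M. U w \<le> a} = (\<Union>n. {w \<in> space M. U w \<le> a \<and> V w \<le> real n})" for a
      using real_arch_simple by auto
    moreover have "(\<Union>n. {w \<in> space M. U w \<le> a \<and> V w \<le> real n}) \<in> sets ?S" for a by (intro sets.countable_UN) (use UV in auto)
    ultimately have U: "U \<in> borel_measurable ?S" by (intro borel_measurableI_le) (simp add: space_measure_of_conv)
    have "{w \<in> space M. V w \<le> a} = (\<Union>n. {w \<in> space M. U w \<le> real n \<and> V w \<le> a})" for a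
      using real_arch_simple by auto
    moreover have "(\<Union>n. {w \<in> space M. U w \<le> real n \<and> V w \<le> a}) \<in> sets ?S" for a by (intro sets.countable_UN) (use UV in auto)
    ultimately have V: "V \<in> borel_measurable ?S" by (intro borel_measurableI_le) (simp add: space_measure_of_conv)
    have "(\<lambda>w. (U w, V w)) \<in> measurable ?S borel2" using U V by measurable
    from measurable_sets[OF this] show ?thesis using P by (auto simp: space_measure_of_conv sets_measure_of)
  qed
  have "indep_set (E X1 X2) (E Y1 Y2)"
    unfolding indep_set_def
  proof (rule indep_setsI)
    show "\<And>i. i \<in> UNIV \<Longrightarrow> (case i of True \<Rightarrow> E X1 X2 | False \<Rightarrow> E Y1 Y2) \<subseteq> events"
      using sub by (auto split: bool.split)
  next
    fix A J assume J: "J \<noteq> {}" "J \<subseteq> (UNIV :: bool set)" "finite J" "\<forall>j\<in>J. A j \<in> (case j of True \<Rightarrow> E X1 X2 | False \<Rightarrow> E Y1 Y2)"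
    have "prob (A True \<inter> A False) = prob (A True) * prob (A False)" if AE: "A True \<in> E X1 X2" "A False \<in> E Y1 Y2"
    proof -
      obtain a b c d where *: "A True = {w \<in> space M. X1 w \<le> a \<and> X2 w \<le> b}" "A False = {w \<in> space M. Y1 w \<le> c \<and> Y2 w \<le> d}"
        using AE by (auto simp: E_def)
      have "A True \<inter> A False = {w \<in> space M. X1 w \<le> a \<and> X2 w \<le> b \<and> Y1 w \<le> c \<and> Y2 w \<le> d}" unfolding * by auto
      then show ?thesis unfolding * by (simp add: eq)
    qed
    moreover have "J = {True} \<or> J = {False} \<or> J = {True, False}" using J(1) by (cases "True \<in> J"; cases "False \<in> J") (auto, (metis (full_types))+)
    ultimately show "prob (\<Inter>j\<in>J. A j) = (\<Prod>j\<in>J. prob (A j))" using J(4) by auto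
  qed
  then have i: "indep_set (sigma_sets (space M) (E X1 X2)) (sigma_sets (space M) (E Y1 Y2))"
    by (rule indep_set_sigma_sets) (rule stable)+
  have "sigma_sets (space M) {(\<lambda>w. (U w, V w)) -` A \<inter> space M | A. A \<in> sets borel2} \<subseteq> sigma_sets (space M) (E U V)" for U V
    using gen[of U V] by (rule sigma_sets_mono)
  then have "indep_set (sigma_sets (space M) {(\<lambda>w. (X1 w, X2 w)) -` A \<inter> space M | A. A \<in> sets borel2})
     (sigma_sets (space M) {(\<lambda>w. (Y1 w, Y2 w)) -` A \<inter> space M | A. A \<in> sets borel2})"
    using i unfolding indep_set_def by (elim indep_sets_mono_sets) (auto split: bool.split)
  then show ?thesis unfolding indep_var_eq by simp
qed

end

section \<open>The reflection principle\<close>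

context brownian_motion begin

lemma W_eq_sum_increments:
  fixes t :: "nat \<Rightarrow> real"
  assumes "t 0 = 0" "w \<in> space M"
  shows "W (t i) w = (\<Sum>j<i. W (t (Suc j)) w - W (t j) w)"
  by (induction i) (use assms bm_start in auto)

text \<open>Whether \<open>k\<close> is the first index above \<open>y\<close> depends on the first
  \<open>k\<close> increments only. The remaining displacement \<open>V\<close> is independent of
  them and symmetric, and replacing \<open>V\<close> by \<open>- V\<close> turns
  \<open>W (t n)\<close> into \<open>2 * W (t k) - W (t n)\<close>.\<close>

lemma reflection_step:
  fixes t :: "nat \<Rightarrow> real"
  assumes t: "t 0 = 0" "strict_mono_on {..n} t" and k: "k < n"
  shows "prob {w \<in> space M. (\<forall>i<k. W (t i) w \<le> y) \<and> W (t k) w > y \<and> W (t n) w > c}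
    = prob {w \<in> space M. (\<forall>i<k. W (t i) w \<le> y) \<and> W (t k) w > y \<and> 2 * W (t k) w - W (t n) w > c}"
proof -
  define X where "X w = (\<lambda>i\<in>{..<k}. W (t (Suc i)) w - W (t i) w)" for w
  define V where "V w = W (t n) w - W (t k) w" for w
  have tpos: "0 \<le> t i" if "i \<le> n" for i
    using t strict_mono_on_leD[OF t(2), of 0 i] that by auto
  have [measurable]: "i \<le> n \<Longrightarrow> W (t i) \<in> borel_measurable M" for i using bm_measurable tpos by simp
  have [measurable]: "i \<in> {..<k} \<Longrightarrow> W (t i) \<in> borel_measurable M" "i \<in> {..<k} \<Longrightarrow> W (t (Suc i)) \<in> borel_measurable M" for i
    using bm_measurable[OF tpos] k by auto
  have [measurable]: "k \<le> n" using k by simp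
  have X[measurable]: "X \<in> M \<rightarrow>\<^sub>M (\<Pi>\<^sub>M i\<in>{..<k}. borel)" unfolding X_def by measurable
  have V[measurable]: "V \<in> borel_measurable M" unfolding V_def using k by measurable
  have Vsum: "V w = (\<Sum>j\<in>{k..<n}. (\<lambda>i\<in>{k..<n}. W (t (Suc i)) w - W (t i) w) j)" for w
    using sum_Suc_diff'[of k n "\<lambda>i. W (t i) w"] k by (simp add: V_def)
  have ind: "indep_rv (\<Pi>\<^sub>M i\<in>{..<k}. borel) X borel V"
    unfolding X_def Vsum
    by (rule indep_rv_compose[OF indep_rv_of_indep_var[OF past_future_indep[OF _ t(2), of k]], of "\<lambda>x. x"]) (use t(1) k in auto)
  have Vn: "distributed M lborel V (normal_density 0 (sqrt (t n - t k)))"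
    unfolding V_def using tpos[of k] k strict_mono_onD[OF t(2), of k n] by (intro bm_increments_normal) auto
  have lb: "distr M lborel Z = distr M borel Z" for Z :: "'w \<Rightarrow> real" by (rule distr_cong) auto
  have "distr M borel V = distr M borel (\<lambda>w. - V w)"
  proof -
    have "distributed M lborel (\<lambda>w. 0 + (-1) * V w) (normal_density (0 + 0 * (-1)) (\<bar>-1\<bar> * sqrt (t n - t k)))"
      using normal_density_affine[OF Vn, of "-1" 0] k strict_mono_onD[OF t(2), of k n] by simp
    then have "distr M lborel V = distr M lborel (\<lambda>w. - V w)"
      using Vn by (simp add: distributed_distr_eq_density)
    then show ?thesis by (simp only: lb)
  qed
  then have "distr M ((\<Pi>\<^sub>M i\<in>{..<k}. borel) \<Otimes>\<^sub>M borel) (\<lambda>w. (X w, V w)) = distr M ((\<Pi>\<^sub>M i\<in>{..<k}. borel) \<Otimes>\<^sub>M borel) (\<lambda>w. (X w, - V w))"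
    using indep_rv_distr[OF ind] indep_rv_distr[OF indep_rv_compose[OF ind, of "\<lambda>x. x" _ uminus borel]] by simp
  then have eq: "measure (distr M ((\<Pi>\<^sub>M i\<in>{..<k}. borel) \<Otimes>\<^sub>M borel) (\<lambda>w. (X w, V w))) A
      = measure (distr M ((\<Pi>\<^sub>M i\<in>{..<k}. borel) \<Otimes>\<^sub>M borel) (\<lambda>w. (X w, - V w))) A" for A by simp
  \<comment> \<open>The event as a predicate of the first \<open>k\<close> increments
    \<open>x\<close> and the remaining displacement \<open>v\<close>; positions are partial sums of
    \<open>x\<close>.\<close>
  define Q :: "(nat \<Rightarrow> real) \<times> real \<Rightarrow> bool" where "Q = (\<lambda>(x, v). (\<forall>i\<in>{..<k}. (\<Sum>j<i. x j) \<le> y) \<and> (\<Sum>j<k. x j) > y \<and> (\<Sum>j<k. x j) + v > c)"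
  have Q[measurable]: "Measurable.pred ((\<Pi>\<^sub>M i\<in>{..<k}. borel) \<Otimes>\<^sub>M borel) Q" unfolding Q_def by measurable
  have WX: "(\<Sum>j<i. X w j) = W (t i) w" if "w \<in> space M" "i \<le> k" for i w
    by (rule trans[OF _ W_eq_sum_increments[of t, OF t(1) that(1), symmetric]], rule sum.cong) (use that in \<open>auto simp: X_def\<close>)
  have "prob {w \<in> space M. Q (X w, V w)} = prob {w \<in> space M. Q (X w, - V w)}"
  proof -
    have *: "prob {w \<in> space M. Q (X w, U w)} = measure (distr M ((\<Pi>\<^sub>M i\<in>{..<k}. borel) \<Otimes>\<^sub>M borel) (\<lambda>w. (X w, U w)))
       {z \<in> space ((\<Pi>\<^sub>M i\<in>{..<k}. borel) \<Otimes>\<^sub>M borel). Q z}" if [measurable]: "U \<in> borel_measurable M" for U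
    proof -
      have "(\<lambda>w. (X w, U w)) -` {z \<in> space ((\<Pi>\<^sub>M i\<in>{..<k}. borel) \<Otimes>\<^sub>M borel). Q z} \<inter> space M = {w \<in> space M. Q (X w, U w)}"
        using measurable_space[OF X] by (auto simp: space_pair_measure)
      then show ?thesis by (subst measure_distr) simp_all
    qed
    show ?thesis using *[of V] *[of "\<lambda>w. - V w"] eq by simp
  qed
  moreover have "{w \<in> space M. Q (X w, V w)} = {w \<in> space M. (\<forall>i<k. W (t i) w \<le> y) \<and> W (t k) w > y \<and> W (t n) w > c}"
    by (auto simp: Q_def WX V_def)
  moreover have "{w \<in> space M. Q (X w, - V w)} = {w \<in> space M. (\<forall>i<k. W (t i) w \<le> y) \<and> W (t k) w > y \<and> 2 * W (t k) w - W (t n) w > c}"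
    by (auto simp: Q_def WX V_def)
  ultimately show ?thesis by simp
qed

text \<open>Split according to the first index above \<open>y\<close>. The case
  \<open>k = n\<close>, outside \<open>reflection_step\<close>, is trivial because
  \<open>2 * W (t n) - W (t n) = W (t n)\<close>.\<close>

lemma reflection_grid:
  fixes t :: "nat \<Rightarrow> real"
  assumes t: "t 0 = 0" "strict_mono_on {..n} t"
  shows "prob {w \<in> space M. (\<exists>k\<le>n. W (t k) w > y) \<and> W (t n) w > c}
    = prob {w \<in> space M. \<exists>k\<le>n. (\<forall>i<k. W (t i) w \<le> y) \<and> W (t k) w > y \<and> 2 * W (t k) w - W (t n) w > c}"
proof -
  have tpos: "0 \<le> t i" if "i \<le> n" for i
    using t strict_mono_on_leD[OF t(2), of 0 i] that by auto
  have [measurable]: "i \<le> n \<Longrightarrow> W (t i) \<in> borel_measurable M" for i using bm_measurable tpos by simp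
  define A where "A k = {w \<in> space M. (\<forall>i<k. W (t i) w \<le> y) \<and> W (t k) w > y \<and> W (t n) w > c}" for k
  define B where "B k = {w \<in> space M. (\<forall>i<k. W (t i) w \<le> y) \<and> W (t k) w > y \<and> 2 * W (t k) w - W (t n) w > c}" for k
  have m: "k \<le> n \<Longrightarrow> A k \<in> events" "k \<le> n \<Longrightarrow> B k \<in> events" for k
  proof -
    assume k[measurable]: "k \<le> n"
    have [measurable]: "i \<in> {..<k} \<Longrightarrow> W (t i) \<in> borel_measurable M" for i using k by simp
    have e: "(\<forall>i<k. W (t i) w \<le> y) \<longleftrightarrow> (\<forall>i\<in>{..<k}. W (t i) w \<le> y)" for w by auto
    show "A k \<in> events" "B k \<in> events" unfolding A_def B_def e by measurable
  qed
  have disj: "disjoint_family_on A {..n}" "disjoint_family_on B {..n}"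
    unfolding disjoint_family_on_def A_def B_def by (auto, (metis linorder_neqE_nat not_less)+)
  have "{w \<in> space M. (\<exists>k\<le>n. W (t k) w > y) \<and> W (t n) w > c} = (\<Union>k\<le>n. A k)"
  proof (intro set_eqI iffI)
    fix w assume w: "w \<in> {w \<in> space M. (\<exists>k\<le>n. W (t k) w > y) \<and> W (t n) w > c}"
    then obtain k where k: "k \<le> n" "W (t k) w > y" by auto
    define k0 where "k0 = (LEAST k. W (t k) w > y)"
    have k0: "W (t k0) w > y" "k0 \<le> k" "\<And>i. i < k0 \<Longrightarrow> W (t i) w \<le> y"
      unfolding k0_def using k(2) by (auto intro: LeastI Least_le dest: not_less_Least)
    then have "w \<in> A k0" using w by (auto simp: A_def)
    then show "w \<in> (\<Union>k\<le>n. A k)" using k0(2) k(1) by auto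
  qed (auto simp: A_def)
  then have "prob {w \<in> space M. (\<exists>k\<le>n. W (t k) w > y) \<and> W (t n) w > c} = (\<Sum>k\<le>n. prob (A k))"
    using disj m by (simp add: finite_measure_finite_Union image_subset_iff)
  also have "\<dots> = (\<Sum>k\<le>n. prob (B k))"
  proof (intro sum.cong refl)
    fix k assume "k \<in> {..n}"
    then consider "k < n" | "k = n" by force
    then show "prob (A k) = prob (B k)"
      by cases (use reflection_step[OF t, of k y c] in \<open>auto simp: A_def B_def\<close>)
  qed
  also have "\<dots> = prob (\<Union>k\<le>n. B k)"
    using disj m by (simp add: finite_measure_finite_Union image_subset_iff)
  also have "(\<Union>k\<le>n. B k) = {w \<in> space M. \<exists>k\<le>n. (\<forall>i<k. W (t i) w \<le> y) \<and> W (t k) w > y \<and> 2 * W (t k) w - W (t n) w > c}"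
    by (auto simp: B_def)
  finally show ?thesis .
qed

text \<open>On a grid the path is reflected at \<open>W (t k)\<close>, slightly above
  \<open>y\<close>. As the mesh shrinks this overshoot vanishes by uniform continuity, and replacing
  \<open>W (t k)\<close> by \<open>y\<close> changes nothing eventually, except on the null event
  \<open>W s = 2 * y - c\<close>.\<close>

lemma reflection:
  assumes s: "0 < s" and y: "0 \<le> y"
  shows "prob {w \<in> space M. path_max (\<lambda>t. W t w) 0 s > y \<and> W s w > c}
    = prob {w \<in> space M. path_max (\<lambda>t. W t w) 0 s > y \<and> 2 * y - W s w > c}"
proof -
  let ?t = "grid 0 s"
  have [measurable]: "W s \<in> borel_measurable M" using s bm_measurable by simp
  have Wt[measurable]: "k \<in> {..Suc N} \<Longrightarrow> W (?t N k) \<in> borel_measurable M" for k N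
    using bm_measurable grid_in[OF s, of k N] by simp
  have t: "?t N 0 = 0" "strict_mono_on {..Suc N} (?t N)" for N
    using grid_strict_mono[OF s] by (auto simp: strict_mono_def strict_mono_on_def)
  have g: "prob {w \<in> space M. (\<exists>k\<in>{..Suc N}. W (?t N k) w > y) \<and> W s w > c}
    = prob {w \<in> space M. \<exists>k\<in>{..Suc N}. (\<forall>i\<in>{..<k}. W (?t N i) w \<le> y) \<and> W (?t N k) w > y \<and> 2 * W (?t N k) w - W s w > c}" for N
    using reflection_grid[OF t, of N y c] by (simp add: Bex_def Ball_def del: atMost_Suc)
  have cont: "continuous_on {0..s} (\<lambda>t. W t w)" if "w \<in> space M" for w using W_cont[OF that] by simp
  have ev: "\<forall>\<^sub>F N in sequentially. (\<exists>k\<in>{..Suc N}. W (?t N k) w > y) = (path_max (\<lambda>t. W t w) 0 s > y)" if w: "w \<in> space M" for w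
  proof -
    have "\<forall>\<^sub>F N in sequentially. (Max ((\<lambda>t. W t w) ` ?t N ` {..Suc N}) \<le> y) = (path_max (\<lambda>t. W t w) 0 s \<le> y)"
      by (intro of_bool_le_tendsto grid_max_tendsto s cont w Max_le_path_max) (use grid_in[OF s] in \<open>auto simp del: atMost_Suc\<close>)
    then show ?thesis
    proof eventually_elim
      case (elim N)
      have "(Max ((\<lambda>t. W t w) ` ?t N ` {..Suc N}) \<le> y) \<longleftrightarrow> (\<forall>k\<in>{..Suc N}. W (?t N k) w \<le> y)"
        by (subst Max_le_iff) (auto simp del: atMost_Suc)
      then show ?case using elim by (metis not_le)
    qed
  qed
  have 1: "(\<lambda>N. prob {w \<in> space M. (\<exists>k\<in>{..Suc N}. W (?t N k) w > y) \<and> W s w > c})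
     \<longlonglongrightarrow> prob {w \<in> space M. path_max (\<lambda>t. W t w) 0 s > y \<and> W s w > c}"
  proof (rule prob_eventually_eq)
    show "AE w in M. \<forall>\<^sub>F N in sequentially. ((\<exists>k\<in>{..Suc N}. W (?t N k) w > y) \<and> W s w > c) = (path_max (\<lambda>t. W t w) 0 s > y \<and> W s w > c)"
      by (rule AE_I2, rule eventually_mono[OF ev]) auto
  qed (use s in measurable)
  have 2: "(\<lambda>N. prob {w \<in> space M. \<exists>k\<in>{..Suc N}. (\<forall>i\<in>{..<k}. W (?t N i) w \<le> y) \<and> W (?t N k) w > y \<and> 2 * W (?t N k) w - W s w > c})
     \<longlonglongrightarrow> prob {w \<in> space M. path_max (\<lambda>t. W t w) 0 s > y \<and> 2 * y - W s w > c}"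
  proof (rule prob_eventually_eq)
    show "Measurable.pred M (\<lambda>w. \<exists>k\<in>{..Suc N}. (\<forall>i\<in>{..<k}. W (?t N i) w \<le> y) \<and> W (?t N k) w > y \<and> 2 * W (?t N k) w - W s w > c)" for N
    proof (rule pred_intros_finite(4))
      fix k assume k[measurable]: "k \<in> {..Suc N}"
      have [measurable]: "i \<in> {..<k} \<Longrightarrow> W (?t N i) \<in> borel_measurable M" for i using Wt[of i N] k by auto
      show "Measurable.pred M (\<lambda>w. (\<forall>i\<in>{..<k}. W (?t N i) w \<le> y) \<and> W (?t N k) w > y \<and> 2 * W (?t N k) w - W s w > c)"
        by measurable
    qed simp
    show "AE w in M. \<forall>\<^sub>F N in sequentially. (\<exists>k\<in>{..Suc N}. (\<forall>i\<in>{..<k}. W (?t N i) w \<le> y) \<and> W (?t N k) w > y \<and> 2 * W (?t N k) w - W s w > c)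
      = (path_max (\<lambda>t. W t w) 0 s > y \<and> 2 * y - W s w > c)"
      using normal_no_atom[OF W_normal[OF s], of "2 * y - c"] AE_space
    proof eventually_elim
      case (elim w)
      \<comment> \<open>Half the distance of \<open>W s\<close> from the critical value
        \<open>2 * y - c\<close>: an overshoot below \<delta> is doubled in
        \<open>2 * W (t k)\<close> and still cannot flip the comparison with
        \<open>c\<close>.\<close>
      define \<delta> where "\<delta> = \<bar>2 * y - W s w - c\<bar> / 2"
      have \<delta>: "\<delta> > 0" using elim(1) by (auto simp: \<delta>_def)
      have "uniformly_continuous_on {0..s} (\<lambda>t. W t w)"
        by (rule compact_uniformly_continuous[OF cont[OF elim(2)]]) simp
      then obtain d where d: "d > 0" "\<And>u v. u \<in> {0..s} \<Longrightarrow> v \<in> {0..s} \<Longrightarrow> dist v u < d \<Longrightarrow> dist (W v w) (W u w) < \<delta>"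
        using \<delta> unfolding uniformly_continuous_on_def by meson
      have "(\<lambda>N. s / real (Suc N)) \<longlonglongrightarrow> 0" by real_asymp
      then have "\<forall>\<^sub>F N in sequentially. s / real (Suc N) < d" using d(1) by (rule order_tendstoD)
      with ev[OF elim(2)] show ?case
      proof eventually_elim
        case (elim N)
        show ?case
        proof (cases "path_max (\<lambda>t. W t w) 0 s > y")
          case False
          then show ?thesis using elim by auto
        next
          case True
          then obtain k where k: "k \<in> {..Suc N}" "W (?t N k) w > y" using elim by auto
          define k0 where "k0 = (LEAST k. W (?t N k) w > y)"
          have k0: "W (?t N k0) w > y" "k0 \<le> k" "\<And>i. i < k0 \<Longrightarrow> W (?t N i) w \<le> y"
            unfolding k0_def using k(2) by (auto intro: LeastI Least_le dest: not_less_Least)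
          \<comment> \<open>The path starts at 0, which is at most \<open>y\<close>. So the first
            index above \<open>y\<close> has a predecessor with value at most \<open>y\<close>, and
            continuity across one cell bounds the overshoot.\<close>
          have "k0 \<noteq> 0" using k0(1) y bm_start[OF \<open>w \<in> space M\<close>] by (intro notI) simp
          then obtain j where j: "k0 = Suc j" using not0_implies_Suc by blast
          have "?t N k0 - ?t N j = s / real (Suc N)" by (simp add: j grid_def diff_divide_distrib[symmetric] right_diff_distrib[symmetric])
          moreover have "?t N k0 \<in> {0..s}" "?t N j \<in> {0..s}" using k0(2) k(1) j by (auto intro!: grid_in[OF s, simplified] simp del: grid_last)
          ultimately have "dist (W (?t N k0) w) (W (?t N j) w) < \<delta>"
            using d(2)[of "?t N j" "?t N k0"] elim(2) s by (simp add: dist_real_def)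
          then have close: "W (?t N k0) w < y + \<delta>" using k0(3)[of j] j by (auto simp: dist_real_def)
          have uniq: "l = k0" if "\<forall>i\<in>{..<l}. W (?t N i) w \<le> y" "W (?t N l) w > y" for l
          proof (rule ccontr)
            assume "l \<noteq> k0"
            then consider "l < k0" | "k0 < l" by linarith
            then show False using that k0(1) k0(3)[of l] by cases force+
          qed
          have "(\<exists>k\<in>{..Suc N}. (\<forall>i\<in>{..<k}. W (?t N i) w \<le> y) \<and> W (?t N k) w > y \<and> 2 * W (?t N k) w - W s w > c)
            \<longleftrightarrow> 2 * W (?t N k0) w - W s w > c"
          proof
            assume "\<exists>k\<in>{..Suc N}. (\<forall>i\<in>{..<k}. W (?t N i) w \<le> y) \<and> W (?t N k) w > y \<and> 2 * W (?t N k) w - W s w > c"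
            then obtain l where "\<forall>i\<in>{..<l}. W (?t N i) w \<le> y" "W (?t N l) w > y" "2 * W (?t N l) w - W s w > c" by blast
            then show "2 * W (?t N k0) w - W s w > c" using uniq by blast
          next
            assume "2 * W (?t N k0) w - W s w > c"
            moreover have "k0 \<in> {..Suc N}" using k0(2) k(1) by simp
            ultimately show "\<exists>k\<in>{..Suc N}. (\<forall>i\<in>{..<k}. W (?t N i) w \<le> y) \<and> W (?t N k) w > y \<and> 2 * W (?t N k) w - W s w > c"
              using k0(1,3) by blast
          qed
          also have "\<dots> \<longleftrightarrow> 2 * y - W s w > c"
          proof (cases "2 * y - W s w > c")
            case True
            then show ?thesis using k0(1) by simp
          next
            case False
            then have "\<delta> = (c - (2 * y - W s w)) / 2" by (simp add: \<delta>_def)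
            then show ?thesis using close False by simp
          qed
          finally show ?thesis using True by simp
        qed
      qed
    qed
  qed (use s in measurable)
  show ?thesis using LIMSEQ_unique[OF 1[unfolded g] 2] .
qed

end

section \<open>The maximum of Brownian motion\<close>

definition heat :: "real \<Rightarrow> real \<Rightarrow> real" where
  "heat v x = normal_density 0 (sqrt v) x"

abbreviation (input) normal_above :: "real \<Rightarrow> real \<Rightarrow> ennreal" where
  "normal_above p q \<equiv> \<integral>\<^sup>+n. ennreal (heat 1 n) * of_bool (p < q * n) \<partial>lborel"

text \<open>Distribution function of the maximum of the motion on [0, 1].\<close>

abbreviation (input) half_normal_cdf :: "real \<Rightarrow> ennreal" where
  "half_normal_cdf a \<equiv> \<integral>\<^sup>+y. of_bool (0 < y \<and> y \<le> a) * ennreal (2 * heat 1 y) \<partial>lborel"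

text \<open>Density of the maximum of the bridge, the derivative of
  \<open>1 - exp (- 2 * a^2)\<close>.\<close>

abbreviation (input) rayleigh :: "real \<Rightarrow> ennreal" where
  "rayleigh a \<equiv> of_bool (0 < a) * ennreal (4 * a * exp (- 2 * a\<^sup>2))"

text \<open>The conditional mean of \<tau> (1 - \<tau>) given that the bridge has maximum
  \<open>a\<close>: the integrand is \<open>r0 * (1 - r0)\<close> for the threshold
  \<open>r0\<close> found in \<open>argmax_time_B_inner\<close>.\<close>

abbreviation (input) time_defect :: "real \<Rightarrow> ennreal" where
  "time_defect a \<equiv> \<integral>\<^sup>+n. ennreal (heat 1 n) * ennreal (a\<^sup>2 / (n\<^sup>2 + 4 * a\<^sup>2)) \<partial>lborel"

lemma borel_measurable_heat [measurable]: "heat v \<in> borel_measurable borel"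
  unfolding heat_def[abs_def] by measurable

lemma heat_nonneg [simp]: "0 \<le> heat v x"
  by (simp add: heat_def)

lemma heat_eq: "0 < v \<Longrightarrow> heat v x = exp (- x\<^sup>2 / (2 * v)) / sqrt (2 * pi * v)"
  by (simp add: heat_def normal_density_def)

lemma heat_minus [simp]: "heat v (- x) = heat v x"
  by (simp add: heat_def normal_density_def)

lemma heat_diff_commute: "heat v (x - y) = heat v (y - x)"
  using heat_minus[of v "x - y"] by simp

lemma heat_bound: "0 < v \<Longrightarrow> heat v x \<le> 1 / sqrt (2 * pi * v)"
  unfolding heat_eq by (intro divide_right_mono) auto

lemma DERIV_heat [derivative_intros]:
  assumes "0 < v" "(f has_real_derivative f') (at x)"
  shows "((\<lambda>x. heat v (f x)) has_real_derivative - (f x / v) * heat v (f x) * f') (at x)"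
proof -
  define C where "C = sqrt (2 * pi * v)"
  have C: "C > 0" using assms by (simp add: C_def)
  show ?thesis unfolding heat_eq[OF assms(1)] C_def[symmetric] using assms C
    by (auto intro!: derivative_eq_intros simp: field_simps)
qed

lemma heat_at_top: "0 < v \<Longrightarrow> (heat v \<longlongrightarrow> 0) at_top"
proof -
  assume v: "0 < v"
  have "filterlim (\<lambda>x. (1 / (2 * v)) * x\<^sup>2) at_top at_top"
    using v by (intro filterlim_tendsto_pos_mult_at_top[OF tendsto_const] filterlim_pow_at_top filterlim_ident) auto
  then have "((\<lambda>x. exp (- ((1 / (2 * v)) * x\<^sup>2))) \<longlongrightarrow> 0) at_top"
    by (intro filterlim_compose[OF exp_at_bot] filterlim_uminus_at_top[THEN iffD1])
  then have "((\<lambda>x. exp (- ((1 / (2 * v)) * x\<^sup>2)) / sqrt (2 * pi * v)) \<longlongrightarrow> 0 / sqrt (2 * pi * v)) at_top"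
    using v by (intro tendsto_divide tendsto_const) auto
  moreover have "heat v = (\<lambda>x. exp (- ((1 / (2 * v)) * x\<^sup>2)) / sqrt (2 * pi * v))"
    using v by (simp add: heat_eq fun_eq_iff)
  ultimately show ?thesis by simp
qed

lemma nn_integral_heat: "0 < v \<Longrightarrow> (\<integral>\<^sup>+x. ennreal (heat v x) \<partial>lborel) = 1"
  using prob_space.emeasure_space_1[OF prob_space_normal_density[of "sqrt v" 0]] by (simp add: emeasure_density heat_def)

lemma nn_integral_reflect:
  fixes f :: "real \<Rightarrow> ennreal"
  assumes "f \<in> borel_measurable borel"
  shows "(\<integral>\<^sup>+x. f x \<partial>lborel) = (\<integral>\<^sup>+x. f (c - x) \<partial>lborel)"
  using nn_integral_real_affine[OF assms, of "-1" c] by simp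

lemma nn_integral_translate:
  fixes f :: "real \<Rightarrow> ennreal"
  assumes "f \<in> borel_measurable borel"
  shows "(\<integral>\<^sup>+x. f x \<partial>lborel) = (\<integral>\<^sup>+x. f (c + x) \<partial>lborel)"
  using nn_integral_real_affine[OF assms, of 1 c] by simp

lemma nn_integral_heat_scale:
  assumes [measurable]: "f \<in> borel_measurable borel" and "0 < v"
  shows "(\<integral>\<^sup>+x. ennreal (heat v (x - m)) * f x \<partial>lborel) = (\<integral>\<^sup>+n. ennreal (heat 1 n) * f (m + sqrt v * n) \<partial>lborel)"
proof -
  have h: "sqrt v * heat v (sqrt v * n) = heat 1 n" for n
    using assms(2) by (simp add: heat_eq power_mult_distrib real_sqrt_mult)
  have "(\<integral>\<^sup>+x. ennreal (heat v (x - m)) * f x \<partial>lborel) = \<bar>sqrt v\<bar> * (\<integral>\<^sup>+n. ennreal (heat v (sqrt v * n)) * f (m + sqrt v * n) \<partial>lborel)"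
    using assms(2) by (subst nn_integral_real_affine[of _ "sqrt v" m]) auto
  also have "\<dots> = (\<integral>\<^sup>+n. ennreal (heat 1 n) * f (m + sqrt v * n) \<partial>lborel)"
    using assms(2) by (subst nn_integral_cmult[symmetric]) (auto simp flip: h mult.assoc simp: ennreal_mult)
  finally show ?thesis .
qed

lemma of_bool_less_AE_indicator: "AE x in lborel. of_bool (m < x) = (indicator {m..} x :: ennreal)" for m :: real
  using AE_lborel_singleton[of m] by eventually_elim (auto split: split_indicator)

lemma heat_tail_integral:
  assumes s: "0 < s" and m: "b \<le> 2 * m"
  shows "(\<integral>\<^sup>+a. ennreal (2 * (2 * a - b) / s * heat s (2 * a - b)) * of_bool (m < a) \<partial>lborel) = ennreal (heat s (2 * m - b))"
proof -
  have "(\<integral>\<^sup>+a. ennreal (2 * (2 * a - b) / s * heat s (2 * a - b)) * of_bool (m < a) \<partial>lborel)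
      = (\<integral>\<^sup>+a. ennreal (2 * (2 * a - b) / s * heat s (2 * a - b)) * indicator {m..} a \<partial>lborel)"
    by (rule nn_integral_cong_AE) (use of_bool_less_AE_indicator[of m] in \<open>eventually_elim, simp\<close>)
  also have "\<dots> = ennreal (0 - (- heat s (2 * m - b)))"
  proof (rule nn_integral_FTC_atLeast)
    show "((\<lambda>a. - heat s (2 * a - b)) \<longlongrightarrow> 0) at_top"
    proof -
      have "filterlim (\<lambda>a :: real. 2 * a - b) at_top at_top" by real_asymp
      from filterlim_compose[OF heat_at_top[OF s] this] show ?thesis using tendsto_minus by fastforce
    qed
    show "((\<lambda>a. - heat s (2 * a - b)) has_real_derivative 2 * (2 * a - b) / s * heat s (2 * a - b)) (at a)" for a
      by (auto intro!: derivative_eq_intros s)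
    show "0 \<le> 2 * (2 * a - b) / s * heat s (2 * a - b)" if "m \<le> a" for a
      using m s that by (intro mult_nonneg_nonneg divide_nonneg_pos) auto
  qed measurable
  finally show ?thesis by simp
qed

text \<open>Bayes' rule for independent centred Gaussians \<open>a + v\<close> and \<open>v\<close>
  of variances \<open>r\<close> and \<open>1 - r\<close>: their difference has variance 1, and given
  that it equals \<open>a\<close>, the second has mean \<open>- a * (1 - r)\<close> and variance
  \<open>r * (1 - r)\<close>.\<close>

lemma heat_mult:
  assumes "0 < r" "r < 1"
  shows "heat (1 - r) v * heat r (a + v) = heat 1 a * heat (r * (1 - r)) (v + a * (1 - r))"
proof -
  have e: "- v\<^sup>2 / (2 * (1 - r)) + - (a + v)\<^sup>2 / (2 * r) = - a\<^sup>2 / (2 * 1) + - (v + a * (1 - r))\<^sup>2 / (2 * (r * (1 - r)))"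
    using assms by (simp add: divide_simps) (simp add: power2_eq_square algebra_simps)
  have "heat (1 - r) v * heat r (a + v) = exp (- v\<^sup>2 / (2 * (1 - r)) + - (a + v)\<^sup>2 / (2 * r)) / (sqrt (2 * pi * (1 - r)) * sqrt (2 * pi * r))"
    using assms by (simp only: heat_eq diff_gt_0_iff_gt exp_add times_divide_times_eq)
  also have "sqrt (2 * pi * (1 - r)) * sqrt (2 * pi * r) = sqrt (2 * pi * 1) * sqrt (2 * pi * (r * (1 - r)))"
    by (simp add: real_sqrt_mult)
  finally show ?thesis unfolding e using assms
    by (simp only: heat_eq mult_pos_pos diff_gt_0_iff_gt zero_less_one exp_add times_divide_times_eq)
qed

text \<open>Joint density of maximum and end point on [0, s]. It is minus the
  \<open>a\<close>-derivative of \<open>heat s (2 * a - b)\<close>, which by reflection is the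
  density of ending at \<open>b\<close> after exceeding \<open>a\<close>.\<close>

definition max_end_density :: "real \<Rightarrow> real \<Rightarrow> real \<Rightarrow> real" where
  "max_end_density s a b = (if 0 < a \<and> b < a then 2 * (2 * a - b) / s * heat s (2 * a - b) else 0)"

lemma borel_measurable_max_end_density [measurable]:
  "(\<lambda>(a, b). max_end_density s a b) \<in> borel_measurable borel2"
  unfolding max_end_density_def by measurable

lemma max_end_density_nonneg: "0 < s \<Longrightarrow> 0 \<le> max_end_density s a b"
  by (auto simp: max_end_density_def intro!: mult_nonneg_nonneg divide_nonneg_pos)

text \<open>The maximum dominates both the start 0 and the end \<open>b\<close>, hence the effective
  threshold is the largest of \<open>y\<close>, 0 and \<open>b\<close>; above it the density is a
  total derivative.\<close>

lemma max_end_density_tail: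
  assumes s: "0 < s"
  shows "(\<integral>\<^sup>+a. ennreal (max_end_density s a b) * of_bool (y < a) \<partial>lborel) = ennreal (heat s (2 * max y (max 0 b) - b))"
proof -
  have "(\<integral>\<^sup>+a. ennreal (max_end_density s a b) * of_bool (y < a) \<partial>lborel)
    = (\<integral>\<^sup>+a. ennreal (2 * (2 * a - b) / s * heat s (2 * a - b)) * of_bool (max y (max 0 b) < a) \<partial>lborel)"
    by (intro nn_integral_cong) (auto simp: max_end_density_def of_bool_def)
  also have "\<dots> = ennreal (heat s (2 * max y (max 0 b) - b))"
    by (rule heat_tail_integral[OF s]) auto
  finally show ?thesis .
qed

section \<open>Joint law of the maximum and the end point\<close>

context brownian_motion begin

abbreviation (input) mx where "mx a b w \<equiv> path_max (\<lambda>t. W t w) a b"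

lemma W_nn_integral:
  assumes "0 < s" "h \<in> borel_measurable borel"
  shows "(\<integral>\<^sup>+w. h (W s w) \<partial>M) = (\<integral>\<^sup>+b. ennreal (heat s b) * h b \<partial>lborel)"
  using distributed_nn_integral[OF W_normal[OF assms(1)], of h] assms(2) by (simp add: heat_def)

lemma mx_ge_W: "0 < s \<Longrightarrow> w \<in> space M \<Longrightarrow> W s w \<le> mx 0 s w"
  by (rule path_max_upper[OF W_cont]) auto

lemma mx_nonneg: "0 < s \<Longrightarrow> w \<in> space M \<Longrightarrow> 0 \<le> mx 0 s w"
  using path_max_upper[OF W_cont[of w 0 s], of 0] bm_start[of w] by simp

text \<open>Restricted to paths above \<open>y\<close>, \<open>W s\<close> and its reflection have
  equal finite tails by \<open>reflection\<close>, hence equal laws.\<close>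

lemma reflection_nn_integral:
  assumes s: "0 < s" and y: "0 \<le> y" and h[measurable]: "h \<in> borel_measurable borel"
  shows "(\<integral>\<^sup>+w. h (W s w) * of_bool (y < mx 0 s w) \<partial>M) = (\<integral>\<^sup>+w. h (2 * y - W s w) * of_bool (y < mx 0 s w) \<partial>M)"
proof -
  have [measurable]: "W s \<in> borel_measurable M" using s bm_measurable by simp
  have [measurable]: "mx 0 s \<in> borel_measurable M" using s by simp
  define R where "R U = distr (density M (\<lambda>w. of_bool (y < mx 0 s w) :: ennreal)) borel U" for U :: "'w \<Rightarrow> real"
  have R: "(\<integral>\<^sup>+w. g (U w) * of_bool (y < mx 0 s w) \<partial>M) = (\<integral>\<^sup>+x. g x \<partial>R U)"
    if [measurable]: "U \<in> borel_measurable M" "g \<in> borel_measurable borel" for U g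
    unfolding R_def by (simp add: nn_integral_distr nn_integral_density mult.commute)
  have RE: "emeasure (R U) {c<..} = ennreal (prob {w \<in> space M. mx 0 s w > y \<and> U w > c})"
    if [measurable]: "U \<in> borel_measurable M" for U c
  proof -
    have "emeasure (R U) {c<..} = (\<integral>\<^sup>+w. indicator {c<..} (U w) * of_bool (y < mx 0 s w) \<partial>M)"
      by (subst R) (auto simp: R_def)
    also have "\<dots> = (\<integral>\<^sup>+w. indicator {w \<in> space M. mx 0 s w > y \<and> U w > c} w \<partial>M)"
      by (intro nn_integral_cong) (auto split: split_indicator)
    also have "\<dots> = ennreal (prob {w \<in> space M. mx 0 s w > y \<and> U w > c})"
      by (subst nn_integral_indicator) (auto simp: emeasure_eq_measure)
    finally show ?thesis .
  qed
  have "R (W s) = R (\<lambda>w. 2 * y - W s w)"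
  proof (rule measure_eqI_lessThan)
    show "emeasure (R (W s)) {c<..} = emeasure (R (\<lambda>w. 2 * y - W s w)) {c<..}" for c
      by (simp add: RE reflection[OF s y])
    show "emeasure (R (W s)) {c<..} < \<infinity>" for c by (simp add: RE)
  qed (simp_all add: R_def)
  then show ?thesis using R[of "W s" h] R[of "\<lambda>w. 2 * y - W s w" h] by simp
qed

text \<open>If the end point is above \<open>y\<close> then so is the maximum, and the plain density
  applies; if it is below, reflection moves it above. The argument \<open>2 * max y b - b\<close>
  merges the cases: it is \<open>b\<close> in the first and \<open>2 * y - b\<close> in the
  second.\<close>

lemma above_nn_integral:
  assumes s: "0 < s" and y: "0 \<le> y" and h[measurable]: "h \<in> borel_measurable borel"
  shows "(\<integral>\<^sup>+w. h (W s w) * of_bool (y < mx 0 s w) \<partial>M) = (\<integral>\<^sup>+b. h b * ennreal (heat s (2 * max y b - b)) \<partial>lborel)"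
proof -
  have [measurable]: "W s \<in> borel_measurable M" using s bm_measurable by simp
  have [measurable]: "mx 0 s \<in> borel_measurable M" using s by simp
  have up: "(\<integral>\<^sup>+w. g (W s w) * of_bool (y \<le> W s w) * of_bool (y < mx 0 s w) \<partial>M) = (\<integral>\<^sup>+b. g b * of_bool (y \<le> b) * ennreal (heat s b) \<partial>lborel)"
    if [measurable]: "g \<in> borel_measurable borel" for g
  proof -
    have "(\<integral>\<^sup>+w. g (W s w) * of_bool (y \<le> W s w) * of_bool (y < mx 0 s w) \<partial>M) = (\<integral>\<^sup>+w. g (W s w) * of_bool (y \<le> W s w) \<partial>M)"
    proof (rule nn_integral_cong_AE)
      show "AE w in M. g (W s w) * of_bool (y \<le> W s w) * of_bool (y < mx 0 s w) = g (W s w) * of_bool (y \<le> W s w)"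
        using normal_no_atom[OF W_normal[OF s], of y] AE_space
      proof eventually_elim
        case (elim w)
        then show ?case using mx_ge_W[OF s elim(2)] by (cases "y \<le> W s w") auto
      qed
    qed
    then show ?thesis by (simp add: W_nn_integral[OF s, of "\<lambda>b. g b * of_bool (y \<le> b)"] mult_ac)
  qed
  have [measurable]: "(\<lambda>b. h (2 * y - b)) \<in> borel_measurable borel" by measurable
  have "(\<integral>\<^sup>+w. h (W s w) * of_bool (y < mx 0 s w) \<partial>M)
     = (\<integral>\<^sup>+w. h (W s w) * of_bool (y \<le> W s w) * of_bool (y < mx 0 s w) + h (W s w) * of_bool (W s w < y) * of_bool (y < mx 0 s w) \<partial>M)"
    by (intro nn_integral_cong) auto
  also have "\<dots> = (\<integral>\<^sup>+w. h (W s w) * of_bool (y \<le> W s w) * of_bool (y < mx 0 s w) \<partial>M) + (\<integral>\<^sup>+w. h (W s w) * of_bool (W s w < y) * of_bool (y < mx 0 s w) \<partial>M)"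
    by (rule nn_integral_add) measurable
  also have "(\<integral>\<^sup>+w. h (W s w) * of_bool (W s w < y) * of_bool (y < mx 0 s w) \<partial>M)
     = (\<integral>\<^sup>+w. h (2 * y - W s w) * of_bool (y < W s w) * of_bool (y < mx 0 s w) \<partial>M)"
    by (subst reflection_nn_integral[OF s y, of "\<lambda>b. h b * of_bool (b < y)"]) (auto intro!: nn_integral_cong)
  also have "\<dots> = (\<integral>\<^sup>+w. h (2 * y - W s w) * of_bool (y \<le> W s w) * of_bool (y < mx 0 s w) \<partial>M)"
    by (rule nn_integral_cong_AE) (use normal_no_atom[OF W_normal[OF s], of y] in \<open>eventually_elim, auto simp: of_bool_def\<close>)
  also have "\<dots> = (\<integral>\<^sup>+b. h (2 * y - b) * of_bool (y \<le> b) * ennreal (heat s b) \<partial>lborel)"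
    by (rule up) measurable
  also have "\<dots> = (\<integral>\<^sup>+b. h b * of_bool (b \<le> y) * ennreal (heat s (2 * y - b)) \<partial>lborel)"
    by (subst nn_integral_reflect[of _ "2 * y"]) (auto intro!: nn_integral_cong simp: of_bool_def)
  also have "(\<integral>\<^sup>+w. h (W s w) * of_bool (y \<le> W s w) * of_bool (y < mx 0 s w) \<partial>M) = (\<integral>\<^sup>+b. h b * of_bool (y \<le> b) * ennreal (heat s b) \<partial>lborel)"
    by (rule up) measurable
  also have "(\<integral>\<^sup>+b. h b * of_bool (y \<le> b) * ennreal (heat s b) \<partial>lborel) + (\<integral>\<^sup>+b. h b * of_bool (b \<le> y) * ennreal (heat s (2 * y - b)) \<partial>lborel)
     = (\<integral>\<^sup>+b. h b * of_bool (y \<le> b) * ennreal (heat s b) + h b * of_bool (b \<le> y) * ennreal (heat s (2 * y - b)) \<partial>lborel)"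
    by (rule nn_integral_add[symmetric]) measurable
  also have "\<dots> = (\<integral>\<^sup>+b. h b * ennreal (heat s (2 * max y b - b)) \<partial>lborel)"
  proof (rule nn_integral_cong_AE)
    show "AE b in lborel. h b * of_bool (y \<le> b) * ennreal (heat s b) + h b * of_bool (b \<le> y) * ennreal (heat s (2 * y - b)) = h b * ennreal (heat s (2 * max y b - b))"
      using AE_lborel_singleton[of y] by eventually_elim (auto simp: of_bool_def max_def)
  qed
  finally show ?thesis .
qed

text \<open>For a fixed Borel set of end points the laws of the maximum are compared by their tails,
  with \<open>above_nn_integral\<close> on one side and Fubini with
  \<open>max_end_density_tail\<close> on the other. Rectangles then determine the joint law.\<close>

lemma mx_end_nn_integral:
  assumes s: "0 < s" and F[measurable]: "F \<in> borel_measurable borel2"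
  shows "(\<integral>\<^sup>+w. F (mx 0 s w, W s w) \<partial>M) = (\<integral>\<^sup>+a. \<integral>\<^sup>+b. F (a, b) * ennreal (max_end_density s a b) \<partial>lborel \<partial>lborel)"
proof -
  have [measurable]: "W s \<in> borel_measurable M" using s bm_measurable by simp
  have [measurable]: "mx 0 s \<in> borel_measurable M" using s by simp
  define \<mu> where "\<mu> = distr M borel2 (\<lambda>w. (mx 0 s w, W s w))"
  define \<nu> where "\<nu> = density (lborel \<Otimes>\<^sub>M lborel) (\<lambda>(a, b). ennreal (max_end_density s a b))"
  have s2: "sets (borel2 :: (real \<times> real) measure) = sets (lborel \<Otimes>\<^sub>M lborel)"
    by (rule sets_pair_measure_cong) auto
  have rect: "emeasure \<mu> (A \<times> C) = emeasure \<nu> (A \<times> C)" if C[measurable]: "C \<in> sets borel" and A[measurable]: "A \<in> sets borel" for A C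
  proof -
    define \<mu>' where "\<mu>' = distr (density M (\<lambda>w. indicator C (W s w) :: ennreal)) borel (mx 0 s)"
    define \<nu>' where "\<nu>' = density lborel (\<lambda>a. \<integral>\<^sup>+b. indicator C b * ennreal (max_end_density s a b) \<partial>lborel)"
    have m: "emeasure \<mu>' B = (\<integral>\<^sup>+w. indicator C (W s w) * indicator B (mx 0 s w) \<partial>M)" if [measurable]: "B \<in> sets borel" for B
      unfolding \<mu>'_def by (subst emeasure_distr, simp, simp, subst emeasure_density) (auto intro!: nn_integral_cong split: split_indicator)
    have n: "emeasure \<nu>' B = (\<integral>\<^sup>+a. \<integral>\<^sup>+b. indicator B a * indicator C b * ennreal (max_end_density s a b) \<partial>lborel \<partial>lborel)" if [measurable]: "B \<in> sets borel" for B
      unfolding \<nu>'_def by (subst emeasure_density) (auto intro!: nn_integral_cong split: split_indicator)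
    have "\<mu>' = \<nu>'"
    proof (rule measure_eqI_lessThan)
      fix y
      show "emeasure \<mu>' {y<..} < \<infinity>"
      proof -
        have "emeasure \<mu>' {y<..} \<le> (\<integral>\<^sup>+w. 1 \<partial>M)"
          unfolding m[OF borel_open[OF open_greaterThan]] by (intro nn_integral_mono) (auto split: split_indicator)
        also have "\<dots> < \<infinity>" by (simp add: emeasure_space_1)
        finally show ?thesis .
      qed
      have "emeasure \<nu>' {y<..} = (\<integral>\<^sup>+b. \<integral>\<^sup>+a. indicator C b * (ennreal (max_end_density s a b) * of_bool (y < a)) \<partial>lborel \<partial>lborel)"
        unfolding n[OF borel_open[OF open_greaterThan]]
        by (subst lborel_pair.Fubini') (auto intro!: nn_integral_cong split: split_indicator)
      also have "\<dots> = (\<integral>\<^sup>+b. indicator C b * ennreal (heat s (2 * max y (max 0 b) - b)) \<partial>lborel)"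
        by (intro nn_integral_cong) (simp add: nn_integral_cmult max_end_density_tail[OF s])
      also have "\<dots> = (\<integral>\<^sup>+w. indicator C (W s w) * of_bool (y < mx 0 s w) \<partial>M)"
      proof (cases "0 \<le> y")
        case True
        then have "max y (max 0 b) = max y b" for b by auto
        then show ?thesis using above_nn_integral[OF s True, of "indicator C"] by simp
      next
        case False
        have "heat s (2 * max y (max 0 b) - b) = heat s b" for b
          using False by (cases "0 \<le> b") (auto simp: max_def)
        moreover have "(\<integral>\<^sup>+w. indicator C (W s w) * of_bool (y < mx 0 s w) \<partial>M) = (\<integral>\<^sup>+w. indicator C (W s w) \<partial>M)"
        proof (intro nn_integral_cong)
          fix w assume "w \<in> space M"
          from mx_nonneg[OF s this] False show "indicator C (W s w) * of_bool (y < mx 0 s w) = (indicator C (W s w) :: ennreal)" by simp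
        qed
        ultimately show ?thesis by (simp add: W_nn_integral[OF s] mult.commute)
      qed
      also have "\<dots> = emeasure \<mu>' {y<..}"
        unfolding m[OF borel_open[OF open_greaterThan]] by (intro nn_integral_cong) (auto split: split_indicator)
      finally show "emeasure \<mu>' {y<..} = emeasure \<nu>' {y<..}" by simp
    qed (simp_all add: \<mu>'_def \<nu>'_def)
    moreover have "emeasure \<mu> (A \<times> C) = emeasure \<mu>' A"
    proof -
      have "emeasure \<mu> (A \<times> C) = (\<integral>\<^sup>+z. indicator (A \<times> C) z \<partial>\<mu>)" by (simp add: \<mu>_def)
      also have "\<dots> = emeasure \<mu>' A" unfolding m[OF A] \<mu>_def
        by (subst nn_integral_distr) (auto intro!: nn_integral_cong split: split_indicator)
      finally show ?thesis .
    qed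
    moreover have "emeasure \<nu> (A \<times> C) = emeasure \<nu>' A"
    proof -
      have "emeasure \<nu> (A \<times> C) = (\<integral>\<^sup>+z. (case z of (a, b) \<Rightarrow> ennreal (max_end_density s a b)) * indicator (A \<times> C) z \<partial>(lborel \<Otimes>\<^sub>M lborel))"
        unfolding \<nu>_def by (subst emeasure_density) auto
      also have "\<dots> = emeasure \<nu>' A" unfolding n[OF A]
        by (subst lborel.nn_integral_fst[symmetric]) (auto intro!: nn_integral_cong split: split_indicator)
      finally show ?thesis .
    qed
    ultimately show ?thesis by simp
  qed
  have "\<mu> = \<nu>"
  proof (rule measure_eqI_rectangles)
    show "sets \<mu> = sets borel2" by (simp add: \<mu>_def)
    show "sets \<nu> = sets borel2" unfolding \<nu>_def sets_density by (rule s2[symmetric])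
    show "emeasure \<mu> (space borel \<times> space borel) \<noteq> \<infinity>"
      using finite_measure.emeasure_finite[OF finite_measure_distr, of "\<lambda>w. (mx 0 s w, W s w)"] by (simp add: \<mu>_def)
  qed (use rect in auto)
  then have "(\<integral>\<^sup>+z. F z \<partial>\<mu>) = (\<integral>\<^sup>+z. F z \<partial>\<nu>)" by simp
  moreover have "(\<integral>\<^sup>+z. F z \<partial>\<mu>) = (\<integral>\<^sup>+w. F (mx 0 s w, W s w) \<partial>M)"
    unfolding \<mu>_def by (subst nn_integral_distr) auto
  moreover have "(\<integral>\<^sup>+z. F z \<partial>\<nu>) = (\<integral>\<^sup>+a. \<integral>\<^sup>+b. F (a, b) * ennreal (max_end_density s a b) \<partial>lborel \<partial>lborel)"
  proof -
    have F'[measurable]: "F \<in> borel_measurable (lborel \<Otimes>\<^sub>M lborel)" using F measurable_cong_sets[OF s2 refl] by blast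
    have "(\<integral>\<^sup>+z. F z \<partial>\<nu>) = (\<integral>\<^sup>+z. (case z of (a, b) \<Rightarrow> ennreal (max_end_density s a b)) * F z \<partial>(lborel \<Otimes>\<^sub>M lborel))"
      unfolding \<nu>_def by (rule nn_integral_density) measurable
    also have "\<dots> = (\<integral>\<^sup>+a. \<integral>\<^sup>+b. ennreal (max_end_density s a b) * F (a, b) \<partial>lborel \<partial>lborel)"
      by (subst lborel.nn_integral_fst[symmetric]) simp_all
    finally show ?thesis by (simp add: mult.commute)
  qed
  ultimately show ?thesis by simp
qed

text \<open>In the gap \<open>d = a - b\<close> one has \<open>2 * a - b = a + d\<close>, so the
  density is a total derivative in \<open>d\<close> as well. With \<open>v = 0\<close> this gives
  the law of the maximum; positive \<open>v\<close> serves comparison with a later rise of the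
  path.\<close>

lemma max_end_density_marginal:
  assumes s: "0 < s" and v: "0 \<le> v"
  shows "(\<integral>\<^sup>+b. of_bool (v < a - b) * ennreal (max_end_density s a b) \<partial>lborel) = of_bool (0 < a) * ennreal (2 * heat s (a + v))"
proof (cases "0 < a")
  case True
  have d: "((\<lambda>d. - 2 * heat s (a + d)) has_real_derivative 2 * (a + d) / s * heat s (a + d)) (at d)" for d
    by (auto intro!: derivative_eq_intros s)
  have l: "((\<lambda>d. - 2 * heat s (a + d)) \<longlongrightarrow> 0) at_top"
  proof -
    have "filterlim (\<lambda>d :: real. a + d) at_top at_top" by real_asymp
    from tendsto_mult[OF tendsto_const filterlim_compose[OF heat_at_top[OF s] this], of "-2"] show ?thesis by simp
  qed
  have "(\<integral>\<^sup>+b. of_bool (v < a - b) * ennreal (max_end_density s a b) \<partial>lborel) = (\<integral>\<^sup>+d. of_bool (v < d) * ennreal (max_end_density s a (a - d)) \<partial>lborel)"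
    by (subst nn_integral_reflect[of _ a]) auto
  also have "\<dots> = (\<integral>\<^sup>+d. ennreal (2 * (a + d) / s * heat s (a + d)) * indicator {v..} d \<partial>lborel)"
  proof (rule nn_integral_cong_AE)
    show "AE d in lborel. of_bool (v < d) * ennreal (max_end_density s a (a - d)) = ennreal (2 * (a + d) / s * heat s (a + d)) * indicator {v..} d"
      using of_bool_less_AE_indicator[of v]
    proof eventually_elim
      case (elim d)
      have "2 * a - (a - d) = a + d" by simp
      then show ?case using v True elim by (auto simp: max_end_density_def split: split_indicator)
    qed
  qed
  also have "\<dots> = ennreal (0 - (- 2 * heat s (a + v)))"
    by (rule nn_integral_FTC_atLeast[OF _ d _ l]) (use True v s in \<open>auto intro!: mult_nonneg_nonneg divide_nonneg_pos\<close>)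
  finally show ?thesis using True by simp
qed (auto simp: max_end_density_def)

lemma mx_nn_integral:
  assumes s: "0 < s" and h[measurable]: "h \<in> borel_measurable borel"
  shows "(\<integral>\<^sup>+w. h (mx 0 s w) \<partial>M) = (\<integral>\<^sup>+a. h a * (of_bool (0 < a) * ennreal (2 * heat s a)) \<partial>lborel)"
proof -
  have e: "ennreal (max_end_density s a b) = of_bool (0 < a - b) * ennreal (max_end_density s a b)" for a b
    by (auto simp: max_end_density_def)
  have "(\<integral>\<^sup>+w. h (mx 0 s w) \<partial>M) = (\<integral>\<^sup>+a. h a * (\<integral>\<^sup>+b. ennreal (max_end_density s a b) \<partial>lborel) \<partial>lborel)"
    using mx_end_nn_integral[OF s, of "\<lambda>z. h (fst z)"] by (simp add: nn_integral_cmult)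
  also have "\<dots> = (\<integral>\<^sup>+a. h a * (of_bool (0 < a) * ennreal (2 * heat s a)) \<partial>lborel)"
    by (subst e, subst max_end_density_marginal[OF s]) auto
  finally show ?thesis .
qed

lemma mx_no_atom: "0 < s \<Longrightarrow> AE w in M. mx 0 s w \<noteq> c"
proof -
  assume s: "0 < s"
  have [measurable]: "mx 0 s \<in> borel_measurable M" using s by simp
  have "(\<integral>\<^sup>+w. of_bool (mx 0 s w = c) \<partial>M) = (\<integral>\<^sup>+a. of_bool (a = c) * (of_bool (0 < a) * ennreal (2 * heat s a)) \<partial>lborel)"
    by (rule mx_nn_integral[OF s]) measurable
  also have "\<dots> = (\<integral>\<^sup>+a. 0 \<partial>(lborel :: real measure))"
    by (rule nn_integral_cong_AE) (use AE_lborel_singleton[of c] in \<open>eventually_elim, simp\<close>)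
  finally have "(\<integral>\<^sup>+w. of_bool (mx 0 s w = c) \<partial>M) = 0" by simp
  then have "AE w in M. of_bool (mx 0 s w = c) = (0 :: ennreal)"
    by (subst (asm) nn_integral_0_iff_AE) auto
  then show ?thesis by eventually_elim auto
qed

lemma shifted: "0 \<le> r \<Longrightarrow> brownian_motion M (\<lambda>t w. W (r + t) w - W r w)"
proof (unfold_locales, goal_cases)
  case (1 t) then show ?case using bm_measurable by simp
next
  case (3 w)
  then show ?case by (intro continuous_intros continuous_on_compose2[OF bm_continuous[OF 3(2)]]) auto
next
  case (4 n t)
  have "0 \<le> r + t 0" "strict_mono_on {..n} (\<lambda>i. r + t i)" using 4 by (auto simp: strict_mono_on_def)
  from bm_increments_indep[OF this] show ?case by simp
next
  case (5 s t)
  then show ?case using bm_increments_normal[of "r + s" "r + t"] by simp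
qed simp

end

section \<open>Blocks before and after a time, and the time of the maximum\<close>

lemma (in prob_space) indep_rv_cong:
  assumes i: "indep_rv S X T Y" and e: "\<And>w. w \<in> space M \<Longrightarrow> X w = X' w" "\<And>w. w \<in> space M \<Longrightarrow> Y w = Y' w"
  shows "indep_rv S X' T Y'"
proof -
  have *: "X -` A \<inter> space M = X' -` A \<inter> space M" "Y -` B \<inter> space M = Y' -` B \<inter> space M"
    "X -` A \<inter> Y -` B \<inter> space M = X' -` A \<inter> Y' -` B \<inter> space M" for A B using e by auto
  have "X' \<in> M \<rightarrow>\<^sub>M S" "Y' \<in> M \<rightarrow>\<^sub>M T"
    using i e by (auto simp: indep_rv_def cong: measurable_cong)
  then show ?thesis using i unfolding indep_rv_def * by blast
qed

context brownian_motion begin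

text \<open>On a grid containing \<open>r\<close> the two pairs are functions of disjoint blocks of
  increments. The factorisation of their distribution functions passes to the limit of fine
  grids.\<close>

lemma block_indep:
  assumes r: "0 < r" "r < s"
  shows "indep_rv borel2 (\<lambda>w. (mx 0 r w, W r w)) borel2 (\<lambda>w. (mx r s w - W r w, W s w - W r w))"
proof -
  have [measurable]: "W r \<in> borel_measurable M" "W s \<in> borel_measurable M" using r bm_measurable by auto
  have [measurable]: "mx 0 r \<in> borel_measurable M" "mx r s \<in> borel_measurable M" using r by auto
  \<comment> \<open>Two grids of \<open>Suc N\<close> cells glued at \<open>r\<close>, which gets
    index \<open>Suc N\<close>; the cut between the two blocks of increments falls exactly
    there.\<close>
  define t where "t N k = (if k \<le> Suc N then grid 0 r N k else grid r s N (k - Suc N))" for N k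
  have t_shift: "t N (Suc N + j) = grid r s N j" for N j by (auto simp: t_def)
  have t_mono: "strict_mono_on {..2 * Suc N} (t N)" for N
  proof (rule strict_mono_onI)
    fix i j assume ij: "i \<in> {..2 * Suc N}" "j \<in> {..2 * Suc N}" "i < j"
    show "t N i < t N j"
    proof (cases "j \<le> Suc N")
      case True
      then show ?thesis using ij r by (simp add: t_def grid_less_iff)
    next
      case False
      have "t N j > r" using grid_less_iff[OF r(2), of N 0 "j - Suc N"] False by (simp add: t_def)
      moreover have "t N i \<le> r" if "i \<le> Suc N" using grid_in[OF r(1) that] that by (simp add: t_def)
      ultimately show ?thesis using ij r False by (cases "i \<le> Suc N") (auto simp: t_def grid_less_iff intro: le_less_trans)
    qed
  qed
  have t0: "t N 0 = 0" for N by (simp add: t_def)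
  define g where "g N w = Max ((\<lambda>u. W u w) ` grid 0 r N ` {..Suc N})" for N w
  define g' where "g' N w = Max ((\<lambda>u. W u w - W r w) ` grid r s N ` {..Suc N})" for N w
  have ind: "indep_rv borel2 (\<lambda>w. (g N w, W r w)) borel2 (\<lambda>w. (g' N w, W s w - W r w))" for N
  proof -
    define X where "X w = (\<lambda>i\<in>{..<Suc N}. W (t N (Suc i)) w - W (t N i) w)" for w
    define Y where "Y w = (\<lambda>i\<in>{Suc N..<2 * Suc N}. W (t N (Suc i)) w - W (t N i) w)" for w
    have XY: "indep_rv (\<Pi>\<^sub>M i\<in>{..<Suc N}. borel) X (\<Pi>\<^sub>M i\<in>{Suc N..<2 * Suc N}. borel) Y"
      unfolding X_def Y_def
      by (rule indep_rv_of_indep_var, rule past_future_indep) (use t_mono[of N] t0 in auto)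
    define f1 where "f1 x = (Max ((\<lambda>k. \<Sum>j<k. x j) ` {..Suc N}), \<Sum>j<Suc N. x j)" for x :: "nat \<Rightarrow> real"
    define f2 where "f2 x = (Max ((\<lambda>k. \<Sum>j\<in>{Suc N..<Suc N + k}. x j) ` {..Suc N}), \<Sum>j\<in>{Suc N..<2 * Suc N}. x j)" for x :: "nat \<Rightarrow> real"
    have [measurable]: "f1 \<in> (\<Pi>\<^sub>M i\<in>{..<Suc N}. borel) \<rightarrow>\<^sub>M borel2"
      unfolding f1_def[abs_def]
      by (intro measurable_Pair borel_measurable_Max borel_measurable_sum measurable_component_singleton) auto
    have [measurable]: "f2 \<in> (\<Pi>\<^sub>M i\<in>{Suc N..<2 * Suc N}. borel) \<rightarrow>\<^sub>M borel2"
      unfolding f2_def[abs_def]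
      by (intro measurable_Pair borel_measurable_Max borel_measurable_sum measurable_component_singleton) auto
    have s1: "(\<Sum>j<k. X w j) = W (t N k) w - W (t N 0) w" if "k \<le> Suc N" for k w
      using that sum_Suc_diff'[of 0 k "\<lambda>i. W (t N i) w"] by (simp add: X_def atLeast0LessThan)
    have s2: "(\<Sum>j\<in>{Suc N..<Suc N + k}. Y w j) = W (t N (Suc N + k)) w - W (t N (Suc N)) w" if "k \<le> Suc N" for k w
      using that sum_Suc_diff'[of "Suc N" "Suc N + k" "\<lambda>i. W (t N i) w"] by (simp add: Y_def)
    have e1: "f1 (X w) = (g N w, W r w)" if "w \<in> space M" for w
    proof -
      have "(\<lambda>k. \<Sum>j<k. X w j) ` {..Suc N} = (\<lambda>u. W u w) ` grid 0 r N ` {..Suc N}"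
        unfolding image_image using bm_start[OF that] by (intro image_cong refl) (simp add: s1 t0, simp add: t_def)
      moreover have "(\<Sum>j<Suc N. X w j) = W r w"
        using s1[of "Suc N" w] bm_start[OF that] by (simp add: t0 del: sum.lessThan_Suc) (simp add: t_def)
      ultimately show ?thesis by (simp only: f1_def g_def)
    qed
    have e2: "f2 (Y w) = (g' N w, W s w - W r w)" for w
    proof -
      have tN: "t N (Suc N) = r" by (simp add: t_def)
      have "(\<lambda>k. \<Sum>j\<in>{Suc N..<Suc N + k}. Y w j) ` {..Suc N} = (\<lambda>u. W u w - W r w) ` grid r s N ` {..Suc N}"
        unfolding image_image by (intro image_cong refl) (simp only: s2 t_shift tN atMost_iff)
      moreover have "(\<Sum>j\<in>{Suc N..<2 * Suc N}. Y w j) = W s w - W r w"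
        using s2[of "Suc N" w] t_shift[of N "Suc N"] by (simp only: tN mult_2 grid_last order_refl)
      ultimately show ?thesis by (simp only: f2_def g'_def)
    qed
    have "indep_rv borel2 (\<lambda>w. f1 (X w)) borel2 (\<lambda>w. f2 (Y w))"
      by (rule indep_rv_compose[OF XY]) measurable
    then show ?thesis by (rule indep_rv_cong) (rule e1 e2, assumption?)+
  qed
  have gm[measurable]: "g N \<in> borel_measurable M" "g' N \<in> borel_measurable M" for N
  proof -
    have "(\<lambda>w. fst (g N w, W r w)) \<in> borel_measurable M" "(\<lambda>w. fst (g' N w, W s w - W r w)) \<in> borel_measurable M"
      using ind[of N] by (auto simp: indep_rv_def simp del: fst_conv intro!: measurable_compose[OF _ measurable_fst])
    then show "g N \<in> borel_measurable M" "g' N \<in> borel_measurable M" by simp_all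
  qed
  have ev1: "\<forall>\<^sub>F N in sequentially. (g N w \<le> a) = (mx 0 r w \<le> a)" if "w \<in> space M" for w a
    unfolding g_def
    by (intro of_bool_le_tendsto grid_max_tendsto Max_le_path_max) (use W_cont[OF that] r grid_in[OF r(1)] in auto)
  have ev2: "\<forall>\<^sub>F N in sequentially. (g' N w \<le> a) = (mx r s w - W r w \<le> a)" if "w \<in> space M" for w a
  proof -
    have "\<forall>\<^sub>F N in sequentially. (Max ((\<lambda>u. W u w) ` grid r s N ` {..Suc N}) \<le> a + W r w) = (mx r s w \<le> a + W r w)"
      by (intro of_bool_le_tendsto grid_max_tendsto Max_le_path_max) (use W_cont[OF that] r grid_in[OF r(2)] in auto)
    then show ?thesis by eventually_elim (auto simp: g'_def algebra_simps simp del: atMost_Suc)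
  qed
  have lim: "(\<lambda>N. prob {w \<in> space M. g N w \<le> a \<and> W r w \<le> b}) \<longlonglongrightarrow> prob {w \<in> space M. mx 0 r w \<le> a \<and> W r w \<le> b}" for a b
    by (rule prob_eventually_eq, measurable) (use r in \<open>auto intro!: AE_I2 eventually_mono[OF ev1]\<close>)
  have lim': "(\<lambda>N. prob {w \<in> space M. g' N w \<le> a \<and> W s w - W r w \<le> b}) \<longlonglongrightarrow> prob {w \<in> space M. mx r s w - W r w \<le> a \<and> W s w - W r w \<le> b}" for a b
    by (rule prob_eventually_eq, measurable) (use r in \<open>auto intro!: AE_I2 eventually_mono[OF ev2]\<close>)
  have lim2: "(\<lambda>N. prob {w \<in> space M. g N w \<le> a \<and> W r w \<le> b \<and> g' N w \<le> c \<and> W s w - W r w \<le> d})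
     \<longlonglongrightarrow> prob {w \<in> space M. mx 0 r w \<le> a \<and> W r w \<le> b \<and> mx r s w - W r w \<le> c \<and> W s w - W r w \<le> d}" for a b c d
    by (rule prob_eventually_eq, measurable) (use r in \<open>auto intro!: AE_I2 eventually_mono[OF eventually_conj[OF ev1 ev2]]\<close>)
  have prod: "prob {w \<in> space M. g N w \<le> a \<and> W r w \<le> b \<and> g' N w \<le> c \<and> W s w - W r w \<le> d}
    = prob {w \<in> space M. g N w \<le> a \<and> W r w \<le> b} * prob {w \<in> space M. g' N w \<le> c \<and> W s w - W r w \<le> d}" for N a b c d
  proof -
    have "emeasure M ((\<lambda>w. (g N w, W r w)) -` ({..a} \<times> {..b}) \<inter> (\<lambda>w. (g' N w, W s w - W r w)) -` ({..c} \<times> {..d}) \<inter> space M)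
      = emeasure M ((\<lambda>w. (g N w, W r w)) -` ({..a} \<times> {..b}) \<inter> space M) * emeasure M ((\<lambda>w. (g' N w, W s w - W r w)) -` ({..c} \<times> {..d}) \<inter> space M)"
      using ind[of N] by (auto simp: indep_rv_def)
    also have "(\<lambda>w. (g N w, W r w)) -` ({..a} \<times> {..b}) \<inter> (\<lambda>w. (g' N w, W s w - W r w)) -` ({..c} \<times> {..d}) \<inter> space M
       = {w \<in> space M. g N w \<le> a \<and> W r w \<le> b \<and> g' N w \<le> c \<and> W s w - W r w \<le> d}" by auto
    also have "(\<lambda>w. (g N w, W r w)) -` ({..a} \<times> {..b}) \<inter> space M = {w \<in> space M. g N w \<le> a \<and> W r w \<le> b}" by auto
    also have "(\<lambda>w. (g' N w, W s w - W r w)) -` ({..c} \<times> {..d}) \<inter> space M = {w \<in> space M. g' N w \<le> c \<and> W s w - W r w \<le> d}" by auto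
    finally show ?thesis by (simp add: emeasure_eq_measure ennreal_mult'[symmetric])
  qed
  have "prob {w \<in> space M. mx 0 r w \<le> a \<and> W r w \<le> b \<and> mx r s w - W r w \<le> c \<and> W s w - W r w \<le> d}
    = prob {w \<in> space M. mx 0 r w \<le> a \<and> W r w \<le> b} * prob {w \<in> space M. mx r s w - W r w \<le> c \<and> W s w - W r w \<le> d}" for a b c d
    by (rule LIMSEQ_unique[OF lim2[unfolded prod] tendsto_mult[OF lim lim']])
  then show ?thesis
    by (intro indep_rv_of_indep_var indep_pairI) (use r in measurable)
qed

lemma mx_shift: "0 \<le> r \<Longrightarrow> r \<le> s \<Longrightarrow> w \<in> space M \<Longrightarrow> path_max (\<lambda>u. W (r + u) w - W r w) 0 (s - r) = mx r s w - W r w"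
  by (rule path_max_shift) (auto intro: W_cont)

lemma future_mx_nn_integral:
  assumes r: "0 \<le> r" "r < s" and h: "h \<in> borel_measurable borel"
  shows "(\<integral>\<^sup>+w. h (mx r s w - W r w) \<partial>M) = (\<integral>\<^sup>+v. h v * (of_bool (0 < v) * ennreal (2 * heat (s - r) v)) \<partial>lborel)"
proof -
  interpret S: brownian_motion M "\<lambda>t w. W (r + t) w - W r w" by (rule shifted[OF r(1)])
  show ?thesis using S.mx_nn_integral[of "s - r" h] h r
    by (simp add: mx_shift cong: nn_integral_cong)
qed

text \<open>A tie means that the rise \<open>mx r s w - W r w\<close> of the later block equals the
  gap \<open>mx 0 r w - W r w\<close> of the earlier one. The two are independent and the rise has a
  density.\<close>

lemma block_no_tie:
  assumes r: "0 < r" "r < s"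
  shows "AE w in M. mx 0 r w \<noteq> mx r s w"
proof -
  have [measurable]: "W r \<in> borel_measurable M" "mx 0 r \<in> borel_measurable M" "mx r s \<in> borel_measurable M" using r bm_measurable by auto
  define F :: "(real \<times> real) \<times> (real \<times> real) \<Rightarrow> ennreal" where "F z = of_bool (fst (snd z) = fst (fst z) - snd (fst z))" for z
  have [measurable]: "F \<in> borel_measurable (borel2 \<Otimes>\<^sub>M borel2)" unfolding F_def[abs_def] by measurable
  have "(\<integral>\<^sup>+w. of_bool (mx 0 r w = mx r s w) \<partial>M) = (\<integral>\<^sup>+w. F ((mx 0 r w, W r w), (mx r s w - W r w, W s w - W r w)) \<partial>M)"
    by (auto simp: F_def intro!: nn_integral_cong)
  also have "\<dots> = (\<integral>\<^sup>+w. \<integral>\<^sup>+w'. of_bool (mx r s w' - W r w' = mx 0 r w - W r w) \<partial>M \<partial>M)"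
    by (subst indep_rv_nn_integral[OF block_indep[OF r]]) (auto simp: F_def)
  also have "\<dots> = (\<integral>\<^sup>+w. 0 \<partial>M)"
  proof (intro nn_integral_cong)
    fix w
    have "(\<integral>\<^sup>+w'. of_bool (mx r s w' - W r w' = mx 0 r w - W r w) \<partial>M)
      = (\<integral>\<^sup>+v. of_bool (v = mx 0 r w - W r w) * (of_bool (0 < v) * ennreal (2 * heat (s - r) v)) \<partial>lborel)"
      by (rule future_mx_nn_integral) (use r in auto)
    also have "\<dots> = (\<integral>\<^sup>+v. 0 \<partial>(lborel :: real measure))"
      by (rule nn_integral_cong_AE) (use AE_lborel_singleton[of "mx 0 r w - W r w"] in \<open>eventually_elim, simp\<close>)
    finally show "(\<integral>\<^sup>+w'. of_bool (mx r s w' - W r w' = mx 0 r w - W r w) \<partial>M) = 0" by simp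
  qed
  finally have "(\<integral>\<^sup>+w. of_bool (mx 0 r w = mx r s w) \<partial>M) = 0" by simp
  then have "AE w in M. of_bool (mx 0 r w = mx r s w) = (0 :: ennreal)"
    by (subst (asm) nn_integral_0_iff_AE) auto
  then show ?thesis by eventually_elim auto
qed

text \<open>The maximum is attained up to time \<open>r\<close> iff the later rise \<open>v\<close>
  does not exceed the gap \<open>a - b\<close>. Integrating out \<open>b\<close> leaves
  \<open>heat r (a + v)\<close>, and \<open>heat_mult\<close> turns the integral over
  \<open>v\<close> into a Gaussian tail times \<open>heat 1 a\<close>.\<close>

lemma argmax_law:
  assumes r: "0 < r" "r < 1" and f[measurable]: "f \<in> borel_measurable borel"
  shows "(\<integral>\<^sup>+w. f (mx 0 r w) * of_bool (mx r 1 w \<le> mx 0 r w) \<partial>M)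
    = (\<integral>\<^sup>+a. f a * (of_bool (0 < a) * ennreal (4 * heat 1 a)) * normal_above (a * (1 - r)) (sqrt (r * (1 - r))) \<partial>lborel)"
proof -
  have [measurable]: "W r \<in> borel_measurable M" "mx 0 r \<in> borel_measurable M" "mx r 1 \<in> borel_measurable M" using r bm_measurable by auto
  define F :: "(real \<times> real) \<times> (real \<times> real) \<Rightarrow> ennreal" where "F z = f (fst (fst z)) * of_bool (fst (snd z) \<le> fst (fst z) - snd (fst z))" for z
  have [measurable]: "F \<in> borel_measurable (borel2 \<Otimes>\<^sub>M borel2)" unfolding F_def[abs_def] by measurable
  define k where "k v = of_bool (0 < v) * ennreal (2 * heat (1 - r) v)" for v
  have k[measurable]: "k \<in> borel_measurable borel" unfolding k_def by measurable
  have "(\<integral>\<^sup>+w. f (mx 0 r w) * of_bool (mx r 1 w \<le> mx 0 r w) \<partial>M) = (\<integral>\<^sup>+w. F ((mx 0 r w, W r w), (mx r 1 w - W r w, W 1 w - W r w)) \<partial>M)"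
    by (auto simp: F_def intro!: nn_integral_cong)
  also have "\<dots> = (\<integral>\<^sup>+w. \<integral>\<^sup>+w'. f (mx 0 r w) * of_bool (mx r 1 w' - W r w' \<le> mx 0 r w - W r w) \<partial>M \<partial>M)"
    by (subst indep_rv_nn_integral[OF block_indep[OF r]]) (auto simp: F_def)
  also have "\<dots> = (\<integral>\<^sup>+w. f (mx 0 r w) * (\<integral>\<^sup>+v. of_bool (v \<le> mx 0 r w - W r w) * k v \<partial>lborel) \<partial>M)"
    unfolding k_def
    by (intro nn_integral_cong, subst nn_integral_cmult, measurable)
       (subst future_mx_nn_integral[of r 1 "\<lambda>v. of_bool (v \<le> _)"], use r in auto)
  also have "\<dots> = (\<integral>\<^sup>+a. \<integral>\<^sup>+b. f a * (\<integral>\<^sup>+v. of_bool (v \<le> a - b) * k v \<partial>lborel) * ennreal (max_end_density r a b) \<partial>lborel \<partial>lborel)"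
    using mx_end_nn_integral[OF r(1), of "\<lambda>(a, b). f a * (\<integral>\<^sup>+v. of_bool (v \<le> a - b) * k v \<partial>lborel)"] by simp
  also have "\<dots> = (\<integral>\<^sup>+a. f a * (of_bool (0 < a) * ennreal (4 * heat 1 a)) * normal_above (a * (1 - r)) (sqrt (r * (1 - r))) \<partial>lborel)"
  proof (intro nn_integral_cong)
    fix a :: real
    have rr: "0 < r * (1 - r)" using r by simp
    have "(\<integral>\<^sup>+b. f a * (\<integral>\<^sup>+v. of_bool (v \<le> a - b) * k v \<partial>lborel) * ennreal (max_end_density r a b) \<partial>lborel)
      = f a * (\<integral>\<^sup>+b. \<integral>\<^sup>+v. of_bool (v \<le> a - b) * k v * ennreal (max_end_density r a b) \<partial>lborel \<partial>lborel)"
      unfolding mult.assoc[of "f a"] by (subst nn_integral_cmult, measurable) (simp add: nn_integral_multc)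
    also have "(\<integral>\<^sup>+b. \<integral>\<^sup>+v. of_bool (v \<le> a - b) * k v * ennreal (max_end_density r a b) \<partial>lborel \<partial>lborel)
      = (\<integral>\<^sup>+v. \<integral>\<^sup>+b. of_bool (v \<le> a - b) * k v * ennreal (max_end_density r a b) \<partial>lborel \<partial>lborel)"
      by (rule lborel_pair.Fubini') measurable
    also have "\<dots> = (\<integral>\<^sup>+v. k v * (\<integral>\<^sup>+b. of_bool (v < a - b) * ennreal (max_end_density r a b) \<partial>lborel) \<partial>lborel)"
    proof (intro nn_integral_cong)
      fix v :: real
      have "(\<integral>\<^sup>+b. of_bool (v \<le> a - b) * k v * ennreal (max_end_density r a b) \<partial>lborel)
         = (\<integral>\<^sup>+b. k v * (of_bool (v < a - b) * ennreal (max_end_density r a b)) \<partial>lborel)"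
        by (rule nn_integral_cong_AE) (use AE_lborel_singleton[of "a - v"] in \<open>eventually_elim, auto simp: of_bool_def\<close>)
      then show "(\<integral>\<^sup>+b. of_bool (v \<le> a - b) * k v * ennreal (max_end_density r a b) \<partial>lborel)
         = k v * (\<integral>\<^sup>+b. of_bool (v < a - b) * ennreal (max_end_density r a b) \<partial>lborel)"
        by (simp add: nn_integral_cmult)
    qed
    also have "\<dots> = (\<integral>\<^sup>+v. of_bool (0 < a) * ennreal (4 * heat 1 a) * (ennreal (heat (r * (1 - r)) (v - - (a * (1 - r)))) * of_bool (0 < v)) \<partial>lborel)"
    proof (intro nn_integral_cong)
      fix v :: real
      show "k v * (\<integral>\<^sup>+b. of_bool (v < a - b) * ennreal (max_end_density r a b) \<partial>lborel)
        = of_bool (0 < a) * ennreal (4 * heat 1 a) * (ennreal (heat (r * (1 - r)) (v - - (a * (1 - r)))) * of_bool (0 < v))"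
      proof (cases "0 < v")
        case True
        have "2 * heat (1 - r) v * (2 * heat r (a + v)) = 4 * heat 1 a * heat (r * (1 - r)) (v - - (a * (1 - r)))"
          using heat_mult[OF r, of v a] by simp
        then show ?thesis using True max_end_density_marginal[OF r(1), of v a]
          by (cases "0 < a") (simp_all add: k_def ennreal_mult[symmetric])
      qed (simp add: k_def)
    qed
    also have "\<dots> = of_bool (0 < a) * ennreal (4 * heat 1 a) * normal_above (a * (1 - r)) (sqrt (r * (1 - r)))"
      by (subst nn_integral_cmult, measurable, subst nn_integral_heat_scale[OF _ rr]) auto
    finally show "(\<integral>\<^sup>+b. f a * (\<integral>\<^sup>+v. of_bool (v \<le> a - b) * k v \<partial>lborel) * ennreal (max_end_density r a b) \<partial>lborel)
      = f a * (of_bool (0 < a) * ennreal (4 * heat 1 a)) * normal_above (a * (1 - r)) (sqrt (r * (1 - r)))"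
      by (simp add: mult.assoc)
  qed
  finally show ?thesis .
qed

end

section \<open>Finite-dimensional laws of Brownian motion\<close>

lemma normal_density_eq_heat: "normal_density m (sqrt v) y = heat v (y - m)"
  by (simp add: heat_def normal_density_def)

lemma bm_joint_density_nonneg: "0 \<le> bm_joint_density n t x"
  unfolding bm_joint_density_def by (intro prod_nonneg) auto

lemma borel_measurable_bm_joint_density [measurable]:
  "bm_joint_density n t \<in> borel_measurable (lvec {..<n})"
proof -
  have "(\<lambda>x. normal_density (if i = 0 then 0 else x (i - 1)) (sqrt (t i - (if i = 0 then 0 else t (i - 1)))) (x i)) \<in> borel_measurable (lvec {..<n})"
    if "i < n" for i
  proof -
    have c: "(\<lambda>x. x i) \<in> borel_measurable (lvec {..<n})" "(\<lambda>x. x (i - 1)) \<in> borel_measurable (lvec {..<n})"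
      using that measurable_component_singleton[of _ "{..<n}" "\<lambda>_. lborel :: real measure"] by auto
    have h: "(\<lambda>x. heat v (g x)) \<in> borel_measurable (lvec {..<n})" if "g \<in> borel_measurable (lvec {..<n})" for g and v
      by (rule measurable_compose[OF that borel_measurable_heat])
    show ?thesis unfolding normal_density_eq_heat
      using h[OF c(1)] h[OF borel_measurable_diff[OF c]] by (cases "i = 0") simp_all
  qed
  then show ?thesis unfolding bm_joint_density_def[abs_def] by (intro borel_measurable_prod) auto
qed

lemma bm_joint_density_Suc:
  "bm_joint_density (Suc n) t (x(n := y)) = bm_joint_density n t x *
     heat (t n - (if n = 0 then 0 else t (n - 1))) (y - (if n = 0 then 0 else x (n - 1)))"
  unfolding bm_joint_density_def prod.lessThan_Suc
  by (intro arg_cong2[where f="(*)"] prod.cong refl) (auto simp: normal_density_eq_heat)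

context brownian_motion begin

text \<open>Induction on the number of times: the last increment is independent of the earlier
  positions, and its density, translated by the previous position, is the last factor of the joint
  density.\<close>

lemma bm_joint_nn_integral:
  assumes "t ` {..<n} \<subseteq> {0<..}" "strict_mono_on {..<n} t" "F \<in> borel_measurable (lvec {..<n})"
  shows "(\<integral>\<^sup>+w. F (\<lambda>i\<in>{..<n}. W (t i) w) \<partial>M) = (\<integral>\<^sup>+x. F x * ennreal (bm_joint_density n t x) \<partial>(lvec {..<n}))"
  using assms
proof (induction n arbitrary: F)
  case 0
  show ?case by (simp add: PiM_empty nn_integral_count_space_finite bm_joint_density_def emeasure_space_1 restrict_def)
next
  case (Suc n)
  interpret P: product_sigma_finite "\<lambda>_ :: nat. lborel :: real measure" ..
  note F[measurable] = Suc.prems(3)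
  have ins: "{..<Suc n} = insert n {..<n}" by auto
  define pt where "pt = (if n = 0 then 0 else t (n - 1))"
  define px where "px x = (if n = 0 then 0 else x (n - 1))" for x :: "nat \<Rightarrow> real"
  have pxt: "px t = pt" by (simp add: px_def pt_def)
  have px[measurable]: "px \<in> borel_measurable (lvec {..<n})"
  proof (cases "n = 0")
    case False
    then have [measurable]: "n - 1 \<in> {..<n}" by simp
    show ?thesis unfolding px_def[abs_def] using False by simp measurable
  qed (simp add: px_def[abs_def])
  have tpos: "0 < t i" if "i \<le> n" for i
    using subsetD[OF Suc.prems(1), of "t i"] that by simp
  have pt: "0 \<le> pt" "pt < t n"
    using tpos[of n] tpos[of "n - 1"] strict_mono_onD[OF Suc.prems(2), of "n - 1" n] by (auto simp: pt_def)
  have [measurable]: "i \<in> {..<n} \<Longrightarrow> W (t i) \<in> borel_measurable M" for i using bm_measurable less_imp_le[OF tpos] by simp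
  have [measurable]: "W (t n) \<in> borel_measurable M" "W pt \<in> borel_measurable M" using bm_measurable less_imp_le[OF tpos[of n]] pt by auto
  define V where "V w = (\<lambda>i\<in>{..<n}. W (t i) w)" for w
  have V[measurable]: "V \<in> M \<rightarrow>\<^sub>M (lvec {..<n})" unfolding V_def by measurable
  define D where "D w = W (t n) w - W pt w" for w
  have D[measurable]: "D \<in> borel_measurable M" unfolding D_def by measurable
  have Vpx: "px (V w) = W pt w" if "w \<in> space M" for w
    using bm_start[OF that] by (simp add: px_def pt_def V_def)
  have ind: "indep_rv (lvec {..<n}) V borel D"
  proof -
    \<comment> \<open>Time 0 is put in front, so that positions become sums of increments.\<close>
    define \<tau> where "\<tau> i = (if i = 0 then 0 else t (i - 1))" for i
    have \<tau>: "0 \<le> \<tau> 0" "strict_mono_on {..Suc n} \<tau>"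
      using tpos strict_mono_onD[OF Suc.prems(2)] by (auto simp: \<tau>_def strict_mono_on_def)
    have sum: "(\<Sum>j\<le>i. (\<lambda>i\<in>{..<n}. W (\<tau> (Suc i)) w - W (\<tau> i) w) j) = W (t i) w" if "i < n" "w \<in> space M" for i w
    proof -
      have "(\<Sum>j\<le>i. (\<lambda>i\<in>{..<n}. W (\<tau> (Suc i)) w - W (\<tau> i) w) j) = (\<Sum>j<Suc i. W (\<tau> (Suc j)) w - W (\<tau> j) w)"
        using that by (intro sum.cong) auto
      also have "\<dots> = W (\<tau> (Suc i)) w" using that by (intro W_eq_sum_increments[symmetric]) (auto simp: \<tau>_def)
      finally show ?thesis by (simp add: \<tau>_def)
    qed
    have "indep_rv (lvec {..<n}) (\<lambda>w. (\<lambda>x. \<lambda>i\<in>{..<n}. \<Sum>j\<le>i. x j) (\<lambda>i\<in>{..<n}. W (\<tau> (Suc i)) w - W (\<tau> i) w))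
       borel (\<lambda>w. (\<lambda>x. x n) (\<lambda>i\<in>{n..<Suc n}. W (\<tau> (Suc i)) w - W (\<tau> i) w))"
    proof (rule indep_rv_compose[OF indep_rv_of_indep_var[OF past_future_indep[OF \<tau>, of n]]])
      show "(\<lambda>x. \<lambda>i\<in>{..<n}. \<Sum>j\<le>i. x j) \<in> (\<Pi>\<^sub>M i\<in>{..<n}. borel) \<rightarrow>\<^sub>M (lvec {..<n})"
      proof (rule measurable_restrict)
        fix i assume "i \<in> {..<n}"
        then have [measurable]: "j \<in> {..i} \<Longrightarrow> j \<in> {..<n}" for j by auto
        show "(\<lambda>x. \<Sum>j\<le>i. x j) \<in> (\<Pi>\<^sub>M i\<in>{..<n}. borel) \<rightarrow>\<^sub>M (lborel :: real measure)" by measurable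
      qed
      show "(\<lambda>x. x n) \<in> borel_measurable (\<Pi>\<^sub>M i\<in>{n..<Suc n}. borel)" by (rule measurable_component_singleton) simp
    qed simp
    then show ?thesis
    proof (rule indep_rv_cong)
      fix w assume w: "w \<in> space M"
      show "(\<lambda>x. \<lambda>i\<in>{..<n}. \<Sum>j\<le>i. x j) (\<lambda>i\<in>{..<n}. W (\<tau> (Suc i)) w - W (\<tau> i) w) = V w"
        unfolding V_def by (rule restrict_ext) (use sum[OF _ w] in simp)
      show "(\<lambda>x. x n) (\<lambda>i\<in>{n..<Suc n}. W (\<tau> (Suc i)) w - W (\<tau> i) w) = D w"
        by (simp add: D_def \<tau>_def pt_def)
    qed
  qed
  have Dn: "(\<integral>\<^sup>+w. h (D w) \<partial>M) = (\<integral>\<^sup>+d. ennreal (heat (t n - pt) d) * h d \<partial>lborel)" if "h \<in> borel_measurable borel" for h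
    unfolding D_def using distributed_nn_integral[OF bm_increments_normal[OF pt], of h] that by (simp add: heat_def)
  have upd[measurable]: "(\<lambda>(x, y). x(n := y)) \<in> (lvec {..<n}) \<Otimes>\<^sub>M lborel \<rightarrow>\<^sub>M (lvec {..<Suc n})"
    unfolding ins by (rule measurable_add_dim)
  have upd1: "(\<lambda>z. (fst z)(n := px (fst z) + snd z)) \<in> (lvec {..<n}) \<Otimes>\<^sub>M borel \<rightarrow>\<^sub>M (lvec {..<Suc n})"
    using measurable_compose[OF _ upd, of "\<lambda>z. (fst z, px (fst z) + snd z)"] by simp
  define G where "G x = (\<integral>\<^sup>+y. ennreal (heat (t n - pt) (y - px x)) * F (x(n := y)) \<partial>lborel)" for x
  have G[measurable]: "G \<in> borel_measurable (lvec {..<n})"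
  proof -
    have [measurable]: "(\<lambda>z. F ((fst z)(n := snd z))) \<in> borel_measurable ((lvec {..<n}) \<Otimes>\<^sub>M lborel)"
      using measurable_compose[OF upd F] by (simp add: case_prod_beta' fun_upd_def)
    show ?thesis unfolding G_def by measurable
  qed
  have "(\<integral>\<^sup>+w. F (\<lambda>i\<in>{..<Suc n}. W (t i) w) \<partial>M) = (\<integral>\<^sup>+w. (\<lambda>z. F ((fst z)(n := px (fst z) + snd z))) (V w, D w) \<partial>M)"
  proof (intro nn_integral_cong)
    fix w assume w: "w \<in> space M"
    have "(\<lambda>i\<in>{..<Suc n}. W (t i) w) = (V w)(n := px (V w) + D w)"
      unfolding Vpx[OF w] by (auto simp: fun_eq_iff V_def D_def less_Suc_eq)
    then show "F (\<lambda>i\<in>{..<Suc n}. W (t i) w) = (\<lambda>z. F ((fst z)(n := px (fst z) + snd z))) (V w, D w)" by simp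
  qed
  also have "\<dots> = (\<integral>\<^sup>+w. \<integral>\<^sup>+w'. F ((V w)(n := px (V w) + D w')) \<partial>M \<partial>M)"
    by (subst indep_rv_nn_integral[OF ind]) (auto intro: measurable_compose[OF upd1 F])
  also have "\<dots> = (\<integral>\<^sup>+w. G (V w) \<partial>M)"
  proof (intro nn_integral_cong)
    fix w assume w: "w \<in> space M"
    have v: "V w \<in> space (lvec {..<n})" using measurable_space[OF V w] .
    have [measurable]: "(\<lambda>y. F ((V w)(n := y))) \<in> borel_measurable borel"
      using measurable_compose[OF measurable_Pair1'[OF v] measurable_compose[OF upd F]] by (simp add: fun_upd_def)
    have "(\<integral>\<^sup>+w'. F ((V w)(n := px (V w) + D w')) \<partial>M) = (\<integral>\<^sup>+d. ennreal (heat (t n - pt) d) * F ((V w)(n := px (V w) + d)) \<partial>lborel)"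
      by (rule Dn) measurable
    also have "\<dots> = G (V w)"
      unfolding G_def by (subst (2) nn_integral_translate[of _ "px (V w)"]) auto
    finally show "(\<integral>\<^sup>+w'. F ((V w)(n := px (V w) + D w')) \<partial>M) = G (V w)" .
  qed
  also have "\<dots> = (\<integral>\<^sup>+x. G x * ennreal (bm_joint_density n t x) \<partial>(lvec {..<n}))"
    unfolding V_def using Suc.prems(2) tpos by (intro Suc.IH G) (auto simp: strict_mono_on_def)
  also have "\<dots> = (\<integral>\<^sup>+x. \<integral>\<^sup>+y. F (x(n := y)) * ennreal (bm_joint_density (Suc n) t (x(n := y))) \<partial>lborel \<partial>(lvec {..<n}))"
  proof (intro nn_integral_cong)
    fix x :: "nat \<Rightarrow> real" assume x: "x \<in> space (lvec {..<n})"
    have [measurable]: "(\<lambda>y. F (x(n := y))) \<in> borel_measurable borel"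
      using measurable_compose[OF measurable_Pair1'[OF x] measurable_compose[OF upd F]] by (simp add: fun_upd_def)
    show "G x * ennreal (bm_joint_density n t x) = (\<integral>\<^sup>+y. F (x(n := y)) * ennreal (bm_joint_density (Suc n) t (x(n := y))) \<partial>lborel)"
      unfolding G_def bm_joint_density_Suc px_def[symmetric] pxt
      by (subst nn_integral_multc[symmetric]) (auto simp: ennreal_mult'[OF bm_joint_density_nonneg] mult_ac intro!: nn_integral_cong)
  qed
  also have "\<dots> = (\<integral>\<^sup>+x. F x * ennreal (bm_joint_density (Suc n) t x) \<partial>(lvec {..<Suc n}))"
    unfolding ins by (rule P.product_nn_integral_insert[symmetric]) (auto simp flip: ins)
  finally show ?case .
qed

end

section \<open>Transfer from Brownian motion to the bridge\<close>

text \<open>The tail criterion on the line is applied twice: first in the first coordinate with the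
  second in a half-line, then in the second with the first in any Borel set.\<close>

lemma measure_eqI_quadrants:
  fixes \<mu> \<nu> :: "(real \<times> real) measure"
  assumes s: "sets \<mu> = sets borel2" "sets \<nu> = sets borel2"
    and fin: "finite_measure \<mu>"
    and eq: "\<And>a b. emeasure \<mu> ({a<..} \<times> {b<..}) = emeasure \<nu> ({a<..} \<times> {b<..})"
  shows "\<mu> = \<nu>"
proof -
  interpret finite_measure \<mu> by (rule fin)
  have [measurable]: "A \<times> B \<in> sets \<mu>" "A \<times> B \<in> sets \<nu>" if "A \<in> sets borel" "B \<in> sets borel" for A B :: "real set"
    using that s by auto
  \<comment> \<open>The law under \<open>m\<close> of one coordinate \<open>f\<close> on the strip
    \<open>S\<close>, a measure on the line.\<close>
  define sec where "sec m f S = distr (density m (\<lambda>z. indicator S z :: ennreal)) borel f" for m :: "(real \<times> real) measure" and f :: "real \<times> real \<Rightarrow> real" and S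
  have sec: "emeasure (sec m f S) A = emeasure m (f -` A \<inter> S)"
    if m: "sets m = sets borel2" and A: "A \<in> sets borel" and f: "f \<in> borel_measurable borel2" and S: "S \<in> sets borel2" for m f S A
  proof -
    have fm: "f \<in> borel_measurable m" using f measurable_cong_sets[OF m refl] by auto
    have sp: "space m = UNIV" using sets_eq_imp_space_eq[OF m] by (simp add: space_pair_measure)
    have fA: "f -` A \<in> sets m" using measurable_sets[OF fm A] sp by simp
    have Sm: "S \<in> sets m" using S m by simp
    have "emeasure (sec m f S) A = emeasure (density m (indicator S)) (f -` A)"
      unfolding sec_def using fm A sp by (subst emeasure_distr) auto
    also have "\<dots> = (\<integral>\<^sup>+z. indicator S z * indicator (f -` A) z \<partial>m)"
      using fA Sm by (subst emeasure_density) auto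
    also have "\<dots> = (\<integral>\<^sup>+z. indicator (f -` A \<inter> S) z \<partial>m)"
      by (intro nn_integral_cong) (auto split: split_indicator)
    also have "\<dots> = emeasure m (f -` A \<inter> S)" using fA Sm by (subst nn_integral_indicator) auto
    finally show ?thesis .
  qed
  have Sx: "UNIV \<times> B \<in> sets borel2" "B \<times> UNIV \<in> sets borel2" if "B \<in> sets borel" for B :: "real set"
    using that by auto
  have le: "emeasure \<mu> X < top" for X using emeasure_finite[of X] by (simp add: less_top[symmetric])
  have fst_eq: "fst -` A \<inter> UNIV \<times> B = A \<times> B" "snd -` B \<inter> A \<times> UNIV = A \<times> B" for A B :: "real set" by auto
  have 1: "emeasure \<mu> (A \<times> {b<..}) = emeasure \<nu> (A \<times> {b<..})" if A: "A \<in> sets borel" for A b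
  proof -
    have "sec \<mu> fst (UNIV \<times> {b<..}) = sec \<nu> fst (UNIV \<times> {b<..})"
    proof (rule measure_eqI_lessThan)
      show "emeasure (sec \<mu> fst (UNIV \<times> {b<..})) {x<..} < \<infinity>" for x
        using sec[OF s(1) _ measurable_fst Sx(1), of "{x<..}" "{b<..}"] by (simp add: le)
      show "emeasure (sec \<mu> fst (UNIV \<times> {b<..})) {x<..} = emeasure (sec \<nu> fst (UNIV \<times> {b<..})) {x<..}" for x
        using sec[OF s(1) _ measurable_fst Sx(1), of "{x<..}" "{b<..}"] sec[OF s(2) _ measurable_fst Sx(1), of "{x<..}" "{b<..}"] by (simp add: fst_eq eq)
    qed (simp_all add: sec_def)
    then show ?thesis
      using sec[OF s(1) A measurable_fst Sx(1), of "{b<..}"] sec[OF s(2) A measurable_fst Sx(1), of "{b<..}"] by (simp add: fst_eq)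
  qed
  have 2: "emeasure \<mu> (A \<times> B) = emeasure \<nu> (A \<times> B)" if A: "A \<in> sets borel" and B: "B \<in> sets borel" for A B
  proof -
    have "sec \<mu> snd (A \<times> UNIV) = sec \<nu> snd (A \<times> UNIV)"
    proof (rule measure_eqI_lessThan)
      show "emeasure (sec \<mu> snd (A \<times> UNIV)) {x<..} < \<infinity>" for x
        using sec[OF s(1) _ measurable_snd Sx(2)[OF A], of "{x<..}"] by (simp add: le)
      show "emeasure (sec \<mu> snd (A \<times> UNIV)) {x<..} = emeasure (sec \<nu> snd (A \<times> UNIV)) {x<..}" for x
        using sec[OF s(1) _ measurable_snd Sx(2)[OF A], of "{x<..}"] sec[OF s(2) _ measurable_snd Sx(2)[OF A], of "{x<..}"] by (simp add: fst_eq 1[OF A])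
    qed (simp_all add: sec_def)
    then show ?thesis
      using sec[OF s(1) B measurable_snd Sx(2)[OF A]] sec[OF s(2) B measurable_snd Sx(2)[OF A]] by (simp add: fst_eq)
  qed
  show ?thesis
  proof (rule measure_eqI_rectangles[OF s])
    show "emeasure \<mu> (space borel \<times> space borel) \<noteq> \<infinity>" using le[of "space borel \<times> space borel"] by simp
  qed (rule 2)
qed

context brownian_bridge begin

abbreviation (input) bmx where "bmx a b w \<equiv> path_max (\<lambda>t. B t w) a b"

lemma B_cont: "w \<in> space M \<Longrightarrow> 0 \<le> a \<Longrightarrow> b \<le> 1 \<Longrightarrow> continuous_on {a..b} (\<lambda>t. B t w)"
  by (rule continuous_on_subset[OF bridge_continuous]) auto

lemma path_max_B [measurable]: "0 \<le> a \<Longrightarrow> a < b \<Longrightarrow> b \<le> 1 \<Longrightarrow> (\<lambda>w. bmx a b w) \<in> borel_measurable M"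
  by (rule borel_measurable_path_max) (auto intro: bridge_measurable B_cont)

text \<open>The extra factor is the transition from the last position to 0 during the remaining
  time, and \<open>heat\<close> is even. It depends on the last position only, which makes the
  bridge an h-transform.\<close>

lemma bridge_density_eq:
  assumes "0 < n"
  shows "bm_bridge_density n t x = bm_joint_density n t x * (heat (1 - t (n - 1)) (x (n - 1)) / heat 1 0)"
proof -
  have "bm_joint_density (Suc n) (t(n := 1)) (x(n := 0)) = bm_joint_density n (t(n := 1)) x * heat (1 - t (n - 1)) (x (n - 1))"
    using assms by (subst bm_joint_density_Suc) (cases n, simp_all)
  also have "bm_joint_density n (t(n := 1)) x = bm_joint_density n t x"
    unfolding bm_joint_density_def by (intro prod.cong refl) auto
  finally have e: "bm_joint_density (Suc n) (t(n := 1)) (x(n := 0)) = bm_joint_density n t x * heat (1 - t (n - 1)) (x (n - 1))" .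
  have "bm_joint_density 1 (\<lambda>_. 1) (\<lambda>_. 0) = heat 1 0" by (simp add: bm_joint_density_def heat_def)
  then show ?thesis unfolding bm_bridge_density_def e by simp
qed

text \<open>
  Up to a time \<open>s < 1\<close> the bridge is absolutely continuous with respect to Brownian motion, with
  density \<open>heat (1 - s) (W s) / heat 1 0\<close>.
\<close>

lemma bridge_transfer:
  fixes n :: nat
  assumes W: "brownian_motion N W"
    and t: "t ` {..<n} \<subseteq> {0<..<1}" "strict_mono_on {..<n} t" "0 < n"
    and F[measurable]: "F \<in> borel_measurable (lvec {..<n})"
  shows "(\<integral>\<^sup>+w. F (\<lambda>i\<in>{..<n}. B (t i) w) \<partial>M)
    = (\<integral>\<^sup>+w. F (\<lambda>i\<in>{..<n}. W (t i) w) * ennreal (heat (1 - t (n - 1)) (W (t (n - 1)) w) / heat 1 0) \<partial>N)"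
proof -
  interpret W: brownian_motion N W by (rule W)
  have [measurable]: "n - 1 \<in> {..<n}" using t(3) by simp
  have "(\<integral>\<^sup>+w. F (\<lambda>i\<in>{..<n}. B (t i) w) \<partial>M) = (\<integral>\<^sup>+x. ennreal (bm_bridge_density n t x) * F x \<partial>(lvec {..<n}))"
    by (rule distributed_nn_integral[OF bridge_distributed[OF t(1,2)] F, symmetric])
  also have "\<dots> = (\<integral>\<^sup>+x. (F x * ennreal (heat (1 - t (n - 1)) (x (n - 1)) / heat 1 0)) * ennreal (bm_joint_density n t x) \<partial>(lvec {..<n}))"
    by (intro nn_integral_cong, subst bridge_density_eq[OF t(3)], subst ennreal_mult) (auto simp: bm_joint_density_nonneg mult_ac)
  also have "\<dots> = (\<integral>\<^sup>+w. F (\<lambda>i\<in>{..<n}. W (t i) w) * ennreal (heat (1 - t (n - 1)) ((\<lambda>i\<in>{..<n}. W (t i) w) (n - 1)) / heat 1 0) \<partial>N)"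
    using t by (intro W.bm_joint_nn_integral[symmetric]) (auto simp: image_subset_iff)
  finally show ?thesis using t(3) by simp
qed

end

lemma nn_integral_of_bool:
  "Measurable.pred M P \<Longrightarrow> (\<integral>\<^sup>+w. of_bool (P w) \<partial>M) = emeasure M {w \<in> space M. P w}"
proof -
  assume [measurable]: "Measurable.pred M P"
  have "(\<integral>\<^sup>+w. of_bool (P w) \<partial>M) = (\<integral>\<^sup>+w. indicator {w \<in> space M. P w} w \<partial>M)"
    by (intro nn_integral_cong) (auto split: split_indicator)
  then show ?thesis by simp
qed

text \<open>The motion may live on another probability space, since the bridge is compared with it
  in law only.\<close>

locale bridge_and_motion = brownian_bridge M B + W: brownian_motion N W
  for M :: "'w measure" and B :: "real \<Rightarrow> 'w \<Rightarrow> real" and N :: "'v measure" and W :: "real \<Rightarrow> 'v \<Rightarrow> real"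
begin

abbreviation (input) wmx where "wmx a b w \<equiv> path_max (\<lambda>t. W t w) a b"

definition weight where "weight s w = heat (1 - s) (W s w) / heat 1 0"

lemma heat_1_0_pos: "0 < heat 1 0"
  by (simp add: heat_eq)

lemma weight_measurable [measurable]: "0 \<le> s \<Longrightarrow> weight s \<in> borel_measurable N"
  unfolding weight_def[abs_def] using W.bm_measurable[of s] by measurable

lemma prob_space_weight:
  assumes s: "0 < s" "s < 1"
  shows "prob_space (density N (\<lambda>w. ennreal (weight s w)))"
proof
  have "(\<integral>\<^sup>+w. 1 \<partial>M) = (\<integral>\<^sup>+w. 1 * ennreal (heat (1 - s) (W s w) / heat 1 0) \<partial>N)"
  proof -
    have "strict_mono_on {..<1 :: nat} (\<lambda>_. s)" by (rule strict_mono_onI) simp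
    then show ?thesis
      using bridge_transfer[OF W.brownian_motion_axioms, of "\<lambda>_. s" 1 "\<lambda>_. 1"] s by (simp add: image_subset_iff)
  qed
  then have "(\<integral>\<^sup>+w. ennreal (weight s w) \<partial>N) = 1"
    by (simp add: weight_def emeasure_space_1)
  moreover have "(\<integral>\<^sup>+w. ennreal (weight s w) * indicator (space N) w \<partial>N) = (\<integral>\<^sup>+w. ennreal (weight s w) \<partial>N)"
    by (intro nn_integral_cong) simp
  ultimately show "emeasure (density N (\<lambda>w. ennreal (weight s w))) (space (density N (\<lambda>w. ennreal (weight s w)))) = 1"
    using s by (simp add: emeasure_density)
qed

text \<open>\<open>bridge_transfer\<close> identifies the laws at finitely many times; both block
  maxima are limits of maxima over such times, and the weight stays the same since \<open>s\<close>
  is always the last time.\<close>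

lemma block_law:
  assumes r: "0 < r" "r < s" "s < 1"
  shows "distr M borel2 (\<lambda>w. (bmx 0 r w, bmx r s w))
    = distr (density N (\<lambda>w. ennreal (weight s w))) borel2 (\<lambda>w. (wmx 0 r w, wmx r s w))"
proof -
  define Q where "Q = density N (\<lambda>w. ennreal (weight s w))"
  interpret Q: prob_space Q unfolding Q_def using r by (intro prob_space_weight) auto
  have [simp]: "space Q = space N" by (simp add: Q_def)
  have mQ: "measurable Q A = measurable N A" for A :: "'z measure" by (rule measurable_cong_sets) (simp_all add: Q_def)
  have bm[measurable]: "(\<lambda>w. bmx 0 r w) \<in> borel_measurable M" "(\<lambda>w. bmx r s w) \<in> borel_measurable M" using r by auto
  have wm: "(\<lambda>w. wmx 0 r w) \<in> borel_measurable Q" "(\<lambda>w. wmx r s w) \<in> borel_measurable Q" unfolding mQ using r by auto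
  note wm[measurable]
  \<comment> \<open>Bridge densities need positive times, so 0 is left out: indices 0 to
    \<open>K\<close> fill (0, r], index \<open>K\<close> is \<open>r\<close>, and the grid of [r, s]
    continues from there up to index \<open>2 * Suc K - 1\<close>.\<close>
  define t where "t K i = (if i \<le> K then grid 0 r K (Suc i) else grid r s K (i - K))" for K i
  let ?b = "\<lambda>K w. (\<lambda>i\<in>{..<2 * Suc K}. B (t K i) w)"
  let ?w = "\<lambda>K w. (\<lambda>i\<in>{..<2 * Suc K}. W (t K i) w)"
  have t_shift: "t K (K + j) = grid r s K j" for K j by (cases j) (auto simp: t_def)
  have t_lo: "i \<le> K \<Longrightarrow> t K i = grid 0 r K (Suc i)" for K i by (simp add: t_def)
  have t_pos: "0 < t K i" for K i
  proof (cases "i \<le> K")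
    case True then show ?thesis using grid_less_iff[OF r(1), of K 0 "Suc i"] by (simp add: t_def)
  next
    case False then show ?thesis using grid_less_iff[OF r(2), of K 0 "i - K"] r by (simp add: t_def)
  qed
  have t_less: "t K i < t K j" if "i < j" for K i j
  proof (cases "j \<le> K")
    case True then show ?thesis using that r by (simp add: t_def grid_less_iff)
  next
    case False
    have "r < t K j" using grid_less_iff[OF r(2), of K 0 "j - K"] False by (simp add: t_def)
    moreover have "t K i \<le> r" if "i \<le> K" using grid_in[OF r(1), of "Suc i" K] that by (simp add: t_def)
    ultimately show ?thesis using that r False by (cases "i \<le> K") (auto simp: t_def grid_less_iff intro: le_less_trans)
  qed
  have t_last: "t K (2 * Suc K - 1) = s" for K
  proof -
    have "2 * Suc K - 1 = K + Suc K" by simp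
    then show ?thesis using t_shift[of K "Suc K"] by (simp only: grid_last)
  qed
  have t_le: "t K i \<le> s" if "i < 2 * Suc K" for K i
    using t_less[of i "2 * Suc K - 1" K] t_last[of K] that by (cases "i = 2 * Suc K - 1") auto
  have t_lt1: "t K i < 1" if "i < 2 * Suc K" for K i using t_le[OF that] r by simp
  define gx where "gx f a b K = Max (f ` grid a b K ` {..Suc K})" for f :: "real \<Rightarrow> real" and a b K
  have gx_gt: "y < gx f a b K \<longleftrightarrow> (\<exists>k\<in>{..Suc K}. y < f (grid a b K k))" for y f a b K
    unfolding gx_def by (subst Max_gr_iff) (auto simp del: atMost_Suc)
  \<comment> \<open>The disjunct \<open>a < 0\<close> stands for the omitted time 0, where the path
    has value 0. Index \<open>K\<close>, which is time \<open>r\<close>, counts for both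
    blocks.\<close>
  define P where "P a c K x \<longleftrightarrow> (a < 0 \<or> (\<exists>i\<in>{..K}. a < x i)) \<and> (\<exists>i\<in>{K..<2 * Suc K}. c < x i)" for a c :: real and K and x :: "nat \<Rightarrow> real"
  have P: "P a c K (\<lambda>i\<in>{..<2 * Suc K}. f (t K i)) \<longleftrightarrow> a < gx f 0 r K \<and> c < gx f r s K" if "f 0 = 0" for f :: "real \<Rightarrow> real" and a c K
  proof -
    have "{..Suc K} = insert 0 (Suc ` {..K})" by (simp add: atMost_Suc_eq_insert_0)
    then have 1: "(a < 0 \<or> (\<exists>i\<in>{..K}. a < f (t K i))) \<longleftrightarrow> a < gx f 0 r K"
    proof -
      have "(\<exists>i\<in>{..K}. a < f (t K i)) \<longleftrightarrow> (\<exists>i\<in>{..K}. a < f (grid 0 r K (Suc i)))"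
        by (intro bex_cong refl) (simp add: t_lo)
      moreover have "a < gx f 0 r K \<longleftrightarrow> a < f 0 \<or> (\<exists>i\<in>{..K}. a < f (grid 0 r K (Suc i)))"
        unfolding gx_gt \<open>{..Suc K} = _\<close> by simp
      ultimately show ?thesis using that by simp
    qed
    have "{K..<2 * Suc K} = (\<lambda>j. K + j) ` {..Suc K}"
      by (simp add: image_add_atLeastAtMost atMost_atLeast0 del: image_add_atLeastAtMost' ) auto
    then have 2: "(\<exists>i\<in>{K..<2 * Suc K}. c < f (t K i)) \<longleftrightarrow> c < gx f r s K"
      unfolding gx_gt by (simp add: t_shift del: atMost_Suc)
    show ?thesis unfolding 1[symmetric] 2[symmetric] P_def by (intro conj_cong disj_cong bex_cong refl) auto
  qed
  have Pm[measurable]: "Measurable.pred (lvec {..<2 * Suc K}) (P a c K)" for a c K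
  proof -
    have [measurable]: "i \<in> {..K} \<Longrightarrow> i \<in> {..<2 * Suc K}" "i \<in> {K..<2 * Suc K} \<Longrightarrow> i \<in> {..<2 * Suc K}" for i by auto
    show ?thesis unfolding P_def[abs_def] by measurable
  qed
  have Bv: "(\<lambda>w. \<lambda>i\<in>{..<2 * Suc K}. B (t K i) w) \<in> M \<rightarrow>\<^sub>M (lvec {..<2 * Suc K})" for K
    using less_imp_le[OF t_pos[of K]] less_imp_le[OF t_lt1[of _ K]] by (intro measurable_restrict) (auto intro!: bridge_measurable)
  have Wv: "(\<lambda>w. \<lambda>i\<in>{..<2 * Suc K}. W (t K i) w) \<in> Q \<rightarrow>\<^sub>M (lvec {..<2 * Suc K})" for K
    unfolding mQ using t_pos[of K] by (intro measurable_restrict) (auto intro!: W.bm_measurable less_imp_le)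
  have eqK: "prob {w \<in> space M. P a c K (?b K w)} = Q.prob {w \<in> space Q. P a c K (?w K w)}" for a c K
  proof -
    have pm: "(\<lambda>x. of_bool (P a c K x) :: ennreal) \<in> borel_measurable (lvec {..<2 * Suc K})"
      by (rule measurable_compose[OF Pm measurable_of_bool])
    have "emeasure M {w \<in> space M. P a c K (?b K w)} = (\<integral>\<^sup>+w. of_bool (P a c K (?b K w)) \<partial>M)"
      by (rule nn_integral_of_bool[OF measurable_compose[OF Bv Pm], symmetric])
    also have "\<dots> = (\<integral>\<^sup>+w. of_bool (P a c K (?w K w)) * ennreal (weight s w) \<partial>N)"
      using bridge_transfer[OF W.brownian_motion_axioms, of "t K" "2 * Suc K" "\<lambda>x. of_bool (P a c K x)"] t_pos[of K] t_lt1[of _ K] t_less[of _ _ K] t_last[of K] pm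
      by (simp add: weight_def strict_mono_on_def image_subset_iff)
    also have "\<dots> = (\<integral>\<^sup>+w. of_bool (P a c K (?w K w)) \<partial>Q)"
    proof -
      have "(\<lambda>w. of_bool (P a c K (?w K w)) :: ennreal) \<in> borel_measurable N"
        using measurable_compose[OF measurable_compose[OF Wv Pm] measurable_of_bool] unfolding mQ by simp
      then show ?thesis
        unfolding Q_def using r by (subst nn_integral_density) (auto simp: mult.commute)
    qed
    also have "\<dots> = emeasure Q {w \<in> space Q. P a c K (?w K w)}"
      by (rule nn_integral_of_bool[OF measurable_compose[OF Wv Pm]])
    finally show ?thesis by (simp add: emeasure_eq_measure Q.emeasure_eq_measure)
  qed
  have ev: "\<forall>\<^sub>F K in sequentially. (a < gx f u v K) = (a < path_max f u v)" if "u < v" "continuous_on {u..v} f" for a f u v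
  proof -
    have "\<forall>\<^sub>F K in sequentially. (gx f u v K \<le> a) = (path_max f u v \<le> a)"
      unfolding gx_def by (intro of_bool_le_tendsto grid_max_tendsto Max_le_path_max that) (use grid_in[OF that(1)] in auto)
    then show ?thesis by eventually_elim (auto simp: not_le[symmetric])
  qed
  have ev2: "\<forall>\<^sub>F K in sequentially. P a c K (\<lambda>i\<in>{..<2 * Suc K}. f (t K i)) = (a < path_max f 0 r \<and> c < path_max f r s)"
    if "f 0 = 0" "continuous_on {0..s} f" for f a c
  proof -
    have "continuous_on {0..r} f" "continuous_on {r..s} f" using that(2) r by (auto elim: continuous_on_subset)
    from eventually_conj[OF ev[OF r(1) this(1), of a] ev[OF r(2) this(2), of c]]
    show ?thesis by eventually_elim (simp only: P[of f, OF that(1)])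
  qed
  have Bcont: "continuous_on {0..s} (\<lambda>t. B t w)" if "w \<in> space M" for w using B_cont[OF that, of 0 s] r by simp
  have Wcont: "continuous_on {0..s} (\<lambda>t. W t w)" if "w \<in> space N" for w using W.W_cont[OF that, of 0 s] r by simp
  have eq: "prob {w \<in> space M. a < bmx 0 r w \<and> c < bmx r s w} = Q.prob {w \<in> space Q. a < wmx 0 r w \<and> c < wmx r s w}" for a c
  proof (rule LIMSEQ_unique)
    show "(\<lambda>K. prob {w \<in> space M. P a c K (?b K w)}) \<longlonglongrightarrow> prob {w \<in> space M. a < bmx 0 r w \<and> c < bmx r s w}"
    proof (rule prob_eventually_eq)
      show "Measurable.pred M (\<lambda>w. P a c K (?b K w))" for K
        by (rule measurable_compose[OF Bv Pm])
      show "AE w in M. \<forall>\<^sub>F K in sequentially. P a c K (?b K w) = (a < bmx 0 r w \<and> c < bmx r s w)"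
        by (rule AE_I2, rule ev2[OF bridge_start Bcont])
    qed measurable
    show "(\<lambda>K. prob {w \<in> space M. P a c K (?b K w)}) \<longlonglongrightarrow> Q.prob {w \<in> space Q. a < wmx 0 r w \<and> c < wmx r s w}"
      unfolding eqK
    proof (rule Q.prob_eventually_eq)
      show "Measurable.pred Q (\<lambda>w. P a c K (?w K w))" for K
        by (rule measurable_compose[OF Wv Pm])
      show "AE w in Q. \<forall>\<^sub>F K in sequentially. P a c K (?w K w) = (a < wmx 0 r w \<and> c < wmx r s w)"
        by (rule AE_I2, rule ev2[OF W.bm_start Wcont]) simp_all
    qed measurable
  qed
  show ?thesis unfolding Q_def[symmetric]
  proof (rule measure_eqI_quadrants)
    show "finite_measure (distr M borel2 (\<lambda>w. (bmx 0 r w, bmx r s w)))"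
      by (rule finite_measure_distr) measurable
    fix a c :: real
    have "emeasure (distr M borel2 (\<lambda>w. (bmx 0 r w, bmx r s w))) ({a<..} \<times> {c<..}) = emeasure M {w \<in> space M. a < bmx 0 r w \<and> c < bmx r s w}"
      by (subst emeasure_distr) (auto intro!: arg_cong[where f="emeasure M"])
    moreover have "emeasure (distr Q borel2 (\<lambda>w. (wmx 0 r w, wmx r s w))) ({a<..} \<times> {c<..}) = emeasure Q {w \<in> space Q. a < wmx 0 r w \<and> c < wmx r s w}"
      by (subst emeasure_distr) (auto intro!: arg_cong[where f="emeasure Q"])
    ultimately show "emeasure (distr M borel2 (\<lambda>w. (bmx 0 r w, bmx r s w))) ({a<..} \<times> {c<..})
       = emeasure (distr Q borel2 (\<lambda>w. (wmx 0 r w, wmx r s w))) ({a<..} \<times> {c<..})"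
      using eq[of a c] by (simp add: emeasure_eq_measure Q.emeasure_eq_measure)
  qed simp_all
qed

lemma block_transfer:
  assumes r: "0 < r" "r < s" "s < 1" and F[measurable]: "F \<in> borel_measurable borel2"
  shows "(\<integral>\<^sup>+w. F (bmx 0 r w, bmx r s w) \<partial>M) = (\<integral>\<^sup>+w. F (wmx 0 r w, wmx r s w) * ennreal (weight s w) \<partial>N)"
proof -
  have [measurable]: "(\<lambda>w. bmx 0 r w) \<in> borel_measurable M" "(\<lambda>w. bmx r s w) \<in> borel_measurable M"
    "(\<lambda>w. wmx 0 r w) \<in> borel_measurable N" "(\<lambda>w. wmx r s w) \<in> borel_measurable N" "weight s \<in> borel_measurable N" using r by auto
  have "(\<integral>\<^sup>+w. F (bmx 0 r w, bmx r s w) \<partial>M) = (\<integral>\<^sup>+z. F z \<partial>distr M borel2 (\<lambda>w. (bmx 0 r w, bmx r s w)))"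
    by (subst nn_integral_distr) auto
  also have "\<dots> = (\<integral>\<^sup>+w. F (wmx 0 r w, wmx r s w) \<partial>density N (\<lambda>w. ennreal (weight s w)))"
    unfolding block_law[OF r] by (subst nn_integral_distr) auto
  also have "\<dots> = (\<integral>\<^sup>+w. F (wmx 0 r w, wmx r s w) * ennreal (weight s w) \<partial>N)"
    by (subst nn_integral_density) (auto simp: mult.commute)
  finally show ?thesis .
qed

lemma AE_transfer:
  assumes r: "0 < r" "r < s" "s < 1" and P[measurable]: "Measurable.pred borel2 P"
    and ae: "AE w in N. P (wmx 0 r w, wmx r s w)"
  shows "AE w in M. P (bmx 0 r w, bmx r s w)"
proof -
  have [measurable]: "(\<lambda>w. bmx 0 r w) \<in> borel_measurable M" "(\<lambda>w. bmx r s w) \<in> borel_measurable M" using r by auto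
  have "(\<integral>\<^sup>+w. of_bool (\<not> P (bmx 0 r w, bmx r s w)) \<partial>M) = (\<integral>\<^sup>+w. of_bool (\<not> P (wmx 0 r w, wmx r s w)) * ennreal (weight s w) \<partial>N)"
    using block_transfer[OF r, of "\<lambda>z. of_bool (\<not> P z)"] by simp
  also have "\<dots> = (\<integral>\<^sup>+w. 0 \<partial>N)"
    by (rule nn_integral_cong_AE) (use ae in \<open>eventually_elim, simp\<close>)
  finally have "(\<integral>\<^sup>+w. of_bool (\<not> P (bmx 0 r w, bmx r s w)) \<partial>M) = 0" by simp
  then have "AE w in M. of_bool (\<not> P (bmx 0 r w, bmx r s w)) = (0 :: ennreal)"
    by (subst (asm) nn_integral_0_iff_AE) auto
  then show ?thesis by eventually_elim (auto simp: of_bool_def split: if_splits)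
qed

end

section \<open>The maximum of the bridge\<close>

lemma heat_antimono:
  assumes "0 < v" "\<bar>x\<bar> \<le> \<bar>y\<bar>"
  shows "heat v y \<le> heat v x"
proof -
  have "x\<^sup>2 \<le> y\<^sup>2" using assms(2) by (simp add: abs_le_square_iff)
  then show ?thesis using assms(1) by (simp add: heat_eq divide_right_mono)
qed

lemma heat_tendsto:
  assumes "(u \<longlongrightarrow> v) F" "(x \<longlongrightarrow> y) F" "0 < v"
  shows "((\<lambda>n. heat (u n) (x n)) \<longlongrightarrow> heat v y) F"
proof -
  have "((\<lambda>n. exp (- (x n)\<^sup>2 / (2 * u n)) / sqrt (2 * pi * u n)) \<longlongrightarrow> exp (- y\<^sup>2 / (2 * v)) / sqrt (2 * pi * v)) F"
    using assms by (intro tendsto_intros assms) auto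
  moreover have "\<forall>\<^sub>F n in F. exp (- (x n)\<^sup>2 / (2 * u n)) / sqrt (2 * pi * u n) = heat (u n) (x n)"
    using order_tendstoD(1)[OF assms(1,3)] by eventually_elim (simp add: heat_eq)
  ultimately show ?thesis using assms(3) by (simp add: heat_eq tendsto_cong)
qed

text \<open>Transition density of the motion from 0 to \<open>c\<close> without exceeding
  \<open>d\<close>, by the method of images with the source reflected to
  \<open>2 * d\<close>.\<close>

definition killed_heat :: "real \<Rightarrow> real \<Rightarrow> real \<Rightarrow> real" where
  "killed_heat u d c = of_bool (c \<le> d) * (heat u c - heat u (2 * d - c))"

lemma borel_measurable_killed_heat [measurable]: "killed_heat u d \<in> borel_measurable borel"
  unfolding killed_heat_def[abs_def] by measurable

lemma killed_heat_nonneg: "0 < u \<Longrightarrow> 0 \<le> d \<Longrightarrow> 0 \<le> killed_heat u d c"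
  by (auto simp: killed_heat_def intro!: heat_antimono)

lemma killed_heat_le: "0 < u \<Longrightarrow> killed_heat u d c \<le> 1 / sqrt (2 * pi * u)"
proof -
  assume u: "0 < u"
  have "heat u c - heat u (2 * d - c) \<le> 1 / sqrt (2 * pi * u)"
    using heat_bound[OF u, of c] heat_nonneg[of u "2 * d - c"] by linarith
  then show ?thesis using u by (auto simp: killed_heat_def)
qed

text \<open>As \<delta> tends to 0 the first kernel forces the path to end at level 0, that is
  \<open>c = - b\<close>. The substitution \<open>c = - b + sqrt (\<delta> n) * z\<close> moves the
  limit into \<open>killed_heat\<close>, which is bounded because \<open>u n \<ge> v / 2\<close>;
  \<open>0 < d + b\<close> keeps the end value strictly below the killing level.\<close>

lemma killed_heat_bridge_limit:
  assumes v: "0 < v" and d: "0 \<le> d" "0 < d + b"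
    and u: "\<And>n :: nat. v / 2 \<le> u n" "u \<longlonglongrightarrow> v" and \<delta>: "\<And>n. 0 < \<delta> n" "\<delta> \<longlonglongrightarrow> 0"
  shows "(\<lambda>n. \<integral>\<^sup>+c. ennreal (heat (\<delta> n) (b + c)) * ennreal (killed_heat (u n) d c) \<partial>lborel) \<longlonglongrightarrow> ennreal (heat v b - heat v (2 * d + b))"
proof -
  have up: "0 < u n" for n using u(1)[of n] v by linarith
  have eq: "(\<integral>\<^sup>+c. ennreal (heat (\<delta> n) (b + c)) * ennreal (killed_heat (u n) d c) \<partial>lborel)
     = (\<integral>\<^sup>+z. ennreal (heat 1 z) * ennreal (killed_heat (u n) d (- b + sqrt (\<delta> n) * z)) \<partial>lborel)" for n
    using nn_integral_heat_scale[OF _ \<delta>(1)[of n], of "\<lambda>c. ennreal (killed_heat (u n) d c)" "- b"] by (simp add: add.commute)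
  have "(\<lambda>n. \<integral>\<^sup>+z. ennreal (heat 1 z) * ennreal (killed_heat (u n) d (- b + sqrt (\<delta> n) * z)) \<partial>lborel)
    \<longlonglongrightarrow> (\<integral>\<^sup>+z. ennreal (heat 1 z) * ennreal (heat v b - heat v (2 * d + b)) \<partial>lborel)"
  proof (rule nn_integral_dominated_convergence[where w="\<lambda>z. ennreal (heat 1 z) * ennreal (1 / sqrt (2 * pi * (v / 2)))"])
    show "AE z in lborel. ennreal (heat 1 z) * ennreal (killed_heat (u n) d (- b + sqrt (\<delta> n) * z)) \<le> ennreal (heat 1 z) * ennreal (1 / sqrt (2 * pi * (v / 2)))" for n
    proof (intro AE_I2 mult_left_mono ennreal_leI)
      fix z
      have "killed_heat (u n) d (- b + sqrt (\<delta> n) * z) \<le> 1 / sqrt (2 * pi * u n)" by (rule killed_heat_le[OF up])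
      also have "\<dots> \<le> 1 / sqrt (2 * pi * (v / 2))" using u(1)[of n] v by (intro divide_left_mono) auto
      finally show "killed_heat (u n) d (- b + sqrt (\<delta> n) * z) \<le> 1 / sqrt (2 * pi * (v / 2))" .
    qed simp
    show "(\<integral>\<^sup>+z. ennreal (heat 1 z) * ennreal (1 / sqrt (2 * pi * (v / 2))) \<partial>lborel) < \<infinity>"
      by (simp add: nn_integral_multc nn_integral_heat)
    show "AE z in lborel. (\<lambda>n. ennreal (heat 1 z) * ennreal (killed_heat (u n) d (- b + sqrt (\<delta> n) * z))) \<longlonglongrightarrow> ennreal (heat 1 z) * ennreal (heat v b - heat v (2 * d + b))"
    proof (rule AE_I2)
      fix z
      have l: "(\<lambda>n. - b + sqrt (\<delta> n) * z) \<longlonglongrightarrow> - b + sqrt 0 * z" by (intro tendsto_intros \<delta>(2))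
      then have l': "(\<lambda>n. - b + sqrt (\<delta> n) * z) \<longlonglongrightarrow> - b" by simp
      have ev: "\<forall>\<^sub>F n in sequentially. - b + sqrt (\<delta> n) * z < d" using l' d(2) by (intro order_tendstoD(2)[OF l']) auto
      have "(\<lambda>n. heat (u n) (- b + sqrt (\<delta> n) * z) - heat (u n) (2 * d - (- b + sqrt (\<delta> n) * z))) \<longlonglongrightarrow> heat v (- b) - heat v (2 * d - - b)"
        by (intro tendsto_diff heat_tendsto u(2) v l' tendsto_const)
      then have "(\<lambda>n. killed_heat (u n) d (- b + sqrt (\<delta> n) * z)) \<longlonglongrightarrow> heat v (- b) - heat v (2 * d - - b)"
        by (rule Lim_transform_eventually) (use ev in \<open>eventually_elim, simp add: killed_heat_def\<close>)
      then have "(\<lambda>n. killed_heat (u n) d (- b + sqrt (\<delta> n) * z)) \<longlonglongrightarrow> heat v b - heat v (2 * d + b)" by simp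
      then show "(\<lambda>n. ennreal (heat 1 z) * ennreal (killed_heat (u n) d (- b + sqrt (\<delta> n) * z))) \<longlonglongrightarrow> ennreal (heat 1 z) * ennreal (heat v b - heat v (2 * d + b))"
        by (intro tendsto_mult_ennreal tendsto_const tendsto_ennrealI) auto
    qed
  qed measurable
  then show ?thesis unfolding eq by (simp add: nn_integral_multc nn_integral_heat)
qed

text \<open>The complement of \<open>above_nn_integral\<close>. The common part \<open>U\<close> is
  cancelled rather than subtracted, and the bound \<open>C\<close> makes it finite.\<close>

lemma (in brownian_motion) below_nn_integral:
  assumes s: "0 < s" and d: "0 \<le> d" and h[measurable]: "h \<in> borel_measurable borel" and C: "\<And>x. h x \<le> C" "C < top"
  shows "(\<integral>\<^sup>+w. of_bool (mx 0 s w \<le> d) * h (W s w) \<partial>M) = (\<integral>\<^sup>+c. h c * ennreal (killed_heat s d c) \<partial>lborel)"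
proof -
  have [measurable]: "W s \<in> borel_measurable M" "mx 0 s \<in> borel_measurable M" using s bm_measurable by auto
  define U where "U = (\<integral>\<^sup>+b. h b * ennreal (heat s (2 * max d b - b)) \<partial>lborel)"
  have "(\<integral>\<^sup>+w. h (W s w) \<partial>M) = (\<integral>\<^sup>+w. of_bool (mx 0 s w \<le> d) * h (W s w) + h (W s w) * of_bool (d < mx 0 s w) \<partial>M)"
    by (intro nn_integral_cong) (auto simp: of_bool_def)
  also have "\<dots> = (\<integral>\<^sup>+w. of_bool (mx 0 s w \<le> d) * h (W s w) \<partial>M) + U"
    unfolding U_def above_nn_integral[OF s d h, symmetric] by (rule nn_integral_add) measurable
  finally have 1: "(\<integral>\<^sup>+w. h (W s w) \<partial>M) = (\<integral>\<^sup>+w. of_bool (mx 0 s w \<le> d) * h (W s w) \<partial>M) + U" .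
  have "(\<integral>\<^sup>+w. h (W s w) \<partial>M) = (\<integral>\<^sup>+c. h c * ennreal (killed_heat s d c) + h c * ennreal (heat s (2 * max d c - c)) \<partial>lborel)"
    unfolding W_nn_integral[OF s h]
  proof (intro nn_integral_cong)
    fix c
    have "heat s c = killed_heat s d c + heat s (2 * max d c - c)"
      by (auto simp: killed_heat_def max_def)
    then have "ennreal (heat s c) = ennreal (killed_heat s d c) + ennreal (heat s (2 * max d c - c))"
      using killed_heat_nonneg[OF s d, of c] by (simp add: ennreal_plus[symmetric] del: ennreal_plus)
    then show "ennreal (heat s c) * h c = h c * ennreal (killed_heat s d c) + h c * ennreal (heat s (2 * max d c - c))"
      by (simp add: distrib_left mult.commute)
  qed
  also have "\<dots> = (\<integral>\<^sup>+c. h c * ennreal (killed_heat s d c) \<partial>lborel) + U"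
    unfolding U_def by (rule nn_integral_add) measurable
  finally have 2: "(\<integral>\<^sup>+w. h (W s w) \<partial>M) = (\<integral>\<^sup>+c. h c * ennreal (killed_heat s d c) \<partial>lborel) + U" .
  have "U \<le> (\<integral>\<^sup>+w. h (W s w) \<partial>M)" unfolding 1 by simp
  also have "\<dots> \<le> (\<integral>\<^sup>+w. C \<partial>M)" by (intro nn_integral_mono C)
  also have "\<dots> < top" using C(2) by (simp add: emeasure_space_1)
  finally have "U \<noteq> \<infinity>" by simp
  moreover have "U + (\<integral>\<^sup>+w. of_bool (mx 0 s w \<le> d) * h (W s w) \<partial>M) = U + (\<integral>\<^sup>+c. h c * ennreal (killed_heat s d c) \<partial>lborel)"
    using trans[OF 1[symmetric] 2] by (simp only: add.commute[of U])
  ultimately show ?thesis by (auto simp: ennreal_add_left_cancel)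
qed

lemma path_max_tendsto_right:
  assumes ab: "a < b" and cont: "continuous_on {a..b} f" and s: "\<And>n :: nat. a < s n" "\<And>n. s n < b" "s \<longlonglongrightarrow> b"
  shows "(\<lambda>n. path_max f a (s n)) \<longlonglongrightarrow> path_max f a b"
proof (rule order_tendstoI)
  fix y assume y: "path_max f a b < y"
  show "\<forall>\<^sub>F n in sequentially. path_max f a (s n) < y"
  proof (intro always_eventually allI)
    fix n
    have "path_max f a b = max (path_max f a (s n)) (path_max f (s n) b)"
      using s[of] by (intro path_max_union) (auto intro: less_imp_le cont)
    then show "path_max f a (s n) < y" using y by simp
  qed
next
  fix y assume "y < path_max f a b"
  then obtain t where t: "t \<in> {a..b}" "y < f t" using path_max_less_iff[of a b f y] ab cont by auto
  have fs: "(\<lambda>n. f (s n)) \<longlonglongrightarrow> f b"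
    using cont s by (intro continuous_on_tendsto_compose[OF cont s(3)]) (auto intro!: always_eventually less_imp_le simp: ab)
  have c: "continuous_on {a..s n} f" for n using s(2)[of n] by (intro continuous_on_subset[OF cont]) auto
  show "\<forall>\<^sub>F n in sequentially. y < path_max f a (s n)"
  proof (cases "t = b")
    case True
    then have "\<forall>\<^sub>F n in sequentially. y < f (s n)" using fs t by (intro order_tendstoD) auto
    then show ?thesis
    proof eventually_elim
      case (elim n)
      have "f (s n) \<le> path_max f a (s n)" using s(1)[of n] by (intro path_max_upper c) auto
      then show ?case using elim by simp
    qed
  next
    case False
    then have "\<forall>\<^sub>F n in sequentially. t < s n" using t s(3) by (intro order_tendstoD) auto
    then show ?thesis
    proof eventually_elim
      case (elim n)
      have "f t \<le> path_max f a (s n)" using t elim by (intro path_max_upper c) auto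
      then show ?case using t by simp
    qed
  qed
qed

context bridge_and_motion begin

text \<open>Up to \<open>s < 1\<close> this is a weighted integral of the killed kernel. In the
  limit it becomes \<open>(heat 1 0 - heat 1 (2 * x)) / heat 1 0\<close>, the method of images for a
  path pinned at 0.\<close>

lemma bmx_cdf:
  assumes x: "0 < x"
  shows "emeasure M {w \<in> space M. bmx 0 1 w \<le> x} = ennreal (1 - exp (- 2 * x\<^sup>2))"
proof -
  define \<delta> where "\<delta> n = 1 / (2 * real (Suc n))" for n
  define s where "s n = 1 - \<delta> n" for n
  have \<delta>: "0 < \<delta> n" "\<delta> n \<le> 1 / 2" for n by (auto simp: \<delta>_def field_simps)
  have \<delta>0: "\<delta> \<longlonglongrightarrow> 0" unfolding \<delta>_def by real_asymp
  have s: "0 < s n" "s n < 1" "1 / 2 \<le> s n" for n using \<delta>[of n] by (auto simp: s_def)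
  have s1: "s \<longlonglongrightarrow> 1" unfolding s_def using tendsto_diff[OF tendsto_const \<delta>0, of 1] by simp
  have [measurable]: "(\<lambda>w. bmx 0 (s n) w) \<in> borel_measurable M" for n using s[of n] by simp
  have [measurable]: "(\<lambda>w. bmx 0 1 w) \<in> borel_measurable M" by simp
  \<comment> \<open>\<open>block_transfer\<close> concerns two adjacent blocks; a single block is
    recovered by cutting [0, s n] at its midpoint.\<close>
  have un: "path_max f 0 (s n) = max (path_max f 0 (s n / 2)) (path_max f (s n / 2) (s n))" if "continuous_on {0..s n} f" for f n
    using s[of n] that by (intro path_max_union) auto
  have eq: "emeasure M {w \<in> space M. bmx 0 (s n) w \<le> x} = (\<integral>\<^sup>+c. ennreal (heat (\<delta> n) (0 + c)) * ennreal (killed_heat (s n) x c) \<partial>lborel) * ennreal (1 / heat 1 0)" for n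
  proof -
    have "emeasure M {w \<in> space M. bmx 0 (s n) w \<le> x} = (\<integral>\<^sup>+w. of_bool (bmx 0 (s n) w \<le> x) \<partial>M)"
      by (rule nn_integral_of_bool[symmetric]) measurable
    also have "\<dots> = (\<integral>\<^sup>+w. (\<lambda>z. of_bool (fst z \<le> x \<and> snd z \<le> x)) (bmx 0 (s n / 2) w, bmx (s n / 2) (s n) w) \<partial>M)"
      by (intro nn_integral_cong) (use s[of n] in \<open>simp add: un[OF B_cont]\<close>)
    also have "\<dots> = (\<integral>\<^sup>+w. (\<lambda>z. of_bool (fst z \<le> x \<and> snd z \<le> x)) (wmx 0 (s n / 2) w, wmx (s n / 2) (s n) w) * ennreal (weight (s n) w) \<partial>N)"
      using s[of n] by (intro block_transfer) auto
    also have "\<dots> = (\<integral>\<^sup>+w. of_bool (wmx 0 (s n) w \<le> x) * ennreal (heat (1 - s n) (W (s n) w) / heat 1 0) \<partial>N)"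
      by (intro nn_integral_cong) (use s[of n] in \<open>simp add: un[OF W.W_cont] weight_def\<close>)
    also have "\<dots> = (\<integral>\<^sup>+c. ennreal (heat (1 - s n) c / heat 1 0) * ennreal (killed_heat (s n) x c) \<partial>lborel)"
    proof (rule W.below_nn_integral)
      show "ennreal (heat (1 - s n) c / heat 1 0) \<le> ennreal (1 / sqrt (2 * pi * (1 - s n)) / heat 1 0)" for c
        using s(2)[of n] heat_1_0_pos by (intro ennreal_leI divide_right_mono heat_bound) auto
    qed (use s[of n] x in auto)
    also have "\<dots> = (\<integral>\<^sup>+c. (ennreal (heat (\<delta> n) (0 + c)) * ennreal (killed_heat (s n) x c)) * ennreal (1 / heat 1 0) \<partial>lborel)"
    proof (intro nn_integral_cong)
      fix c
      have "heat (1 - s n) c / heat 1 0 = heat (\<delta> n) (0 + c) * (1 / heat 1 0)" by (simp add: s_def)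
      then show "ennreal (heat (1 - s n) c / heat 1 0) * ennreal (killed_heat (s n) x c) = (ennreal (heat (\<delta> n) (0 + c)) * ennreal (killed_heat (s n) x c)) * ennreal (1 / heat 1 0)"
        by (simp only: ennreal_mult'' heat_nonneg divide_nonneg_nonneg zero_le_one) (simp add: mult_ac)
    qed
    also have "\<dots> = (\<integral>\<^sup>+c. ennreal (heat (\<delta> n) (0 + c)) * ennreal (killed_heat (s n) x c) \<partial>lborel) * ennreal (1 / heat 1 0)"
      by (rule nn_integral_multc) measurable
    finally show ?thesis .
  qed
  have "(\<lambda>n. \<integral>\<^sup>+c. ennreal (heat (\<delta> n) (0 + c)) * ennreal (killed_heat (s n) x c) \<partial>lborel) \<longlonglongrightarrow> ennreal (heat 1 0 - heat 1 (2 * x + 0))"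
    by (rule killed_heat_bridge_limit) (use x s s1 \<delta> \<delta>0 in auto)
  then have A: "(\<lambda>n. emeasure M {w \<in> space M. bmx 0 (s n) w \<le> x}) \<longlonglongrightarrow> ennreal (heat 1 0 - heat 1 (2 * x + 0)) * ennreal (1 / heat 1 0)"
    unfolding eq by (intro tendsto_mult_ennreal tendsto_const) auto
  have E: "ennreal (heat 1 0 - heat 1 (2 * x + 0)) * ennreal (1 / heat 1 0) = ennreal (1 - exp (- 2 * x\<^sup>2))"
  proof -
    have "heat 1 (2 * x) \<le> heat 1 0" by (rule heat_antimono) auto
    moreover have "(heat 1 0 - heat 1 (2 * x)) * (1 / heat 1 0) = 1 - exp (- 2 * x\<^sup>2)"
    proof -
      have "heat 1 (2 * x) = heat 1 0 * exp (- 2 * x\<^sup>2)" by (simp add: heat_eq power_mult_distrib)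
      then show ?thesis using heat_1_0_pos by (simp add: field_simps)
    qed
    ultimately show ?thesis using heat_1_0_pos by (simp add: ennreal_mult[symmetric])
  qed
  have L: "(\<lambda>n. emeasure M {w \<in> space M. bmx 0 (s n) w \<le> x}) \<longlonglongrightarrow> emeasure M {w \<in> space M. bmx 0 1 w \<le> x}"
  proof -
    have "(\<lambda>n. prob {w \<in> space M. bmx 0 (s n) w \<le> x}) \<longlonglongrightarrow> prob {w \<in> space M. bmx 0 1 w \<le> x}"
    proof (rule prob_eventually_eq)
      show "AE w in M. \<forall>\<^sub>F n in sequentially. (bmx 0 (s n) w \<le> x) = (bmx 0 1 w \<le> x)"
      proof (rule AE_I2)
        fix w assume w: "w \<in> space M"
        have c: "continuous_on {0..1} (\<lambda>t. B t w)" using B_cont[OF w] by simp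
        have "bmx 0 (s n) w \<le> bmx 0 1 w" for n
          using path_max_union[of 0 "s n" 1, OF _ _ c] s[of n] by simp
        then show "\<forall>\<^sub>F n in sequentially. (bmx 0 (s n) w \<le> x) = (bmx 0 1 w \<le> x)"
          by (intro of_bool_le_tendsto path_max_tendsto_right c s s1) auto
      qed
    qed measurable
    then show ?thesis by (simp add: emeasure_eq_measure)
  qed
  show ?thesis by (rule LIMSEQ_unique[OF L A[unfolded E]])
qed

end

lemma integrable_heat_moment:
  assumes "0 < g"
  shows "integrable lborel (\<lambda>p. (p - m) * heat g (p - m))"
  using integrable_normal_moment[of "sqrt g" m 1] assms by (simp add: heat_def normal_density_def mult.commute)

lemma integrable_heat: "0 < g \<Longrightarrow> integrable lborel (\<lambda>p. heat g (p - m))"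
  unfolding normal_density_eq_heat[symmetric] using integrable_normal_density[of "sqrt g" m] by simp

text \<open>
  With \<open>p = 2 a - b\<close>, the product of the density of (maximum, endpoint) on \<open>[0, r]\<close> and of the
  killed transition density on \<open>[r, 1]\<close> is a total derivative (which integrates to \<open>0\<close>) plus a
  Gaussian density.
\<close>

lemma bridge_argmax_density:
  assumes r: "0 < r" "r < 1" and a: "0 < a"
  shows "(\<integral>\<^sup>+b. ennreal ((heat (1 - r) b - heat (1 - r) (2 * a - b)) / heat 1 0) * ennreal (max_end_density r a b) \<partial>lborel)
    = ennreal (4 * a * exp (- 2 * a\<^sup>2)) * normal_above (a * (1 - 2 * r)) (sqrt (r * (1 - r)))"
proof -
  define g where "g = r * (1 - r)"
  have g: "0 < g" using r by (simp add: g_def)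
  define e where "e = exp (- 2 * a\<^sup>2)"
  have h0: "0 < heat 1 0" by (simp add: heat_eq)
  have h2: "heat 1 (2 * a) = heat 1 0 * e" by (simp add: heat_eq power_mult_distrib e_def)
  define L where "L p = 2 * p / r * (e * heat g (p - 2 * a * r) - heat g p)" for p
  define Z where "Z p = 2 * g / r * (heat g p - e * heat g (p - 2 * a * r))" for p
  define Z' where "Z' p = 2 / r * (e * ((p - 2 * a * r) * heat g (p - 2 * a * r)) - (p - 0) * heat g (p - 0))" for p
  have LZ: "L p = Z' p + 4 * a * e * heat g (p - 2 * a * r)" for p
    using r by (simp add: L_def Z'_def field_simps)
  have ind: "integrable lborel (\<lambda>p. indicator {a<..} p * h p)" if "integrable lborel h" for h :: "real \<Rightarrow> real"
    using integrable_real_mult_indicator[OF _ that, of "{a<..}"] by (simp add: mult.commute)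
  have intH: "integrable lborel (\<lambda>p. heat g (p - 2 * a * r))" by (rule integrable_heat[OF g])
  have intZ: "integrable lborel Z'"
    unfolding Z'_def[abs_def] by (intro integrable_mult_right Bochner_Integration.integrable_diff integrable_heat_moment g)
  have intL: "integrable lborel L"
    unfolding LZ[abs_def] by (intro Bochner_Integration.integrable_add integrable_mult_right intZ intH)
  \<comment> \<open>The variable \<open>p = 2 * a - b\<close> is the position reflected at
    \<open>a\<close>. This product pins the path at 0 and \<open>2 * a\<close>, hence the mean
    \<open>2 * a * r\<close>; the product in \<open>i2\<close> pins it at 0 and 0.\<close>
  have i1: "heat r p * heat (1 - r) (2 * a - p) = heat 1 0 * (e * heat g (p - 2 * a * r))" for p
  proof -
    have "heat r p * heat (1 - r) (2 * a - p) = heat (1 - r) (p - 2 * a) * heat r (2 * a + (p - 2 * a))"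
      by (simp add: heat_diff_commute mult.commute)
    also have "\<dots> = heat 1 (2 * a) * heat (r * (1 - r)) (p - 2 * a + 2 * a * (1 - r))" by (rule heat_mult[OF r])
    also have "p - 2 * a + 2 * a * (1 - r) = p - 2 * a * r" by (simp add: algebra_simps)
    finally show ?thesis by (simp add: h2 g_def)
  qed
  have i2: "heat r p * heat (1 - r) p = heat 1 0 * heat g p" for p
    using heat_mult[OF r, of p 0] by (simp add: g_def mult.commute)
  have Lb: "(heat (1 - r) (2 * a - p) - heat (1 - r) p) / heat 1 0 * (2 * p / r * heat r p) = L p" for p
  proof -
    have "(heat (1 - r) (2 * a - p) - heat (1 - r) p) / heat 1 0 * (2 * p / r * heat r p)
      = 2 * p / r * ((heat r p * heat (1 - r) (2 * a - p)) / heat 1 0 - (heat r p * heat (1 - r) p) / heat 1 0)"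
      by (simp add: diff_divide_distrib algebra_simps)
    then show ?thesis using h0 unfolding i1 i2 by (simp add: L_def)
  qed
  have Lpos: "0 \<le> L p" if "a < p" for p
  proof -
    have "heat (1 - r) p \<le> heat (1 - r) (2 * a - p)" using r a that by (intro heat_antimono) auto
    then show ?thesis unfolding Lb[symmetric] using r a that h0 by (intro mult_nonneg_nonneg divide_nonneg_nonneg) auto
  qed
  have "(\<integral>\<^sup>+b. ennreal ((heat (1 - r) b - heat (1 - r) (2 * a - b)) / heat 1 0) * ennreal (max_end_density r a b) \<partial>lborel)
    = (\<integral>\<^sup>+p. ennreal ((heat (1 - r) (2 * a - p) - heat (1 - r) p) / heat 1 0) * ennreal (max_end_density r a (2 * a - p)) \<partial>lborel)"
    by (subst nn_integral_reflect[of _ "2 * a"]) auto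
  also have "\<dots> = (\<integral>\<^sup>+p. ennreal (indicator {a<..} p * L p) \<partial>lborel)"
  proof (intro nn_integral_cong)
    fix p
    show "ennreal ((heat (1 - r) (2 * a - p) - heat (1 - r) p) / heat 1 0) * ennreal (max_end_density r a (2 * a - p)) = ennreal (indicator {a<..} p * L p)"
    proof (cases "a < p")
      case True
      have "0 \<le> max_end_density r a (2 * a - p)" by (rule max_end_density_nonneg[OF r(1)])
      moreover have "max_end_density r a (2 * a - p) = 2 * p / r * heat r p" using True a by (simp add: max_end_density_def)
      ultimately show ?thesis using True Lb[of p] by (simp add: ennreal_mult''[symmetric])
    qed (simp add: max_end_density_def)
  qed
  also have "\<dots> = ennreal (\<integral>p. indicator {a<..} p * L p \<partial>lborel)"
  proof (rule nn_integral_eq_integral)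
    show "integrable lborel (\<lambda>p. indicator {a<..} p * L p)"
      by (rule ind[OF intL])
    show "AE p in lborel. 0 \<le> indicator {a<..} p * L p" using Lpos by (auto simp: indicator_def)
  qed
  also have "(\<integral>p. indicator {a<..} p * L p \<partial>lborel) = (\<integral>p. indicator {a<..} p * Z' p + 4 * a * e * (indicator {a<..} p * heat g (p - 2 * a * r)) \<partial>lborel)"
    by (intro Bochner_Integration.integral_cong refl) (simp add: LZ algebra_simps)
  also have "\<dots> = (\<integral>p. indicator {a<..} p * Z' p \<partial>lborel) + (\<integral>p. 4 * a * e * (indicator {a<..} p * heat g (p - 2 * a * r)) \<partial>lborel)"
  proof (rule Bochner_Integration.integral_add)
    show "integrable lborel (\<lambda>p. indicator {a<..} p * Z' p)"
      by (rule ind[OF intZ])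
    show "integrable lborel (\<lambda>p. 4 * a * e * (indicator {a<..} p * heat g (p - 2 * a * r)))"
      by (intro integrable_mult_right ind intH)
  qed
  also have "(\<integral>p. indicator {a<..} p * Z' p \<partial>lborel) = 0"
  proof -
    have ei: "einterval (ereal a) \<infinity> = {a<..}" by (auto simp: einterval_def)
    have "(LBINT p=ereal a..\<infinity>. Z' p) = 0 - 0"
    proof (rule interval_integral_FTC_integrable)
      show "(Z has_vector_derivative Z' p) (at p)" for p
        unfolding has_real_derivative_iff_has_vector_derivative[symmetric] Z_def Z'_def using g r
        by (auto intro!: derivative_eq_intros simp: field_simps)
      show "isCont Z' p" for p
        unfolding Z'_def heat_eq[OF g] using g r by (intro continuous_intros) auto
      show "set_integrable lborel (einterval (ereal a) \<infinity>) Z'"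
        unfolding ei set_integrable_def
        using ind[OF intZ] by simp
      \<comment> \<open>At \<open>p = a\<close> position and reflected position coincide, so the two
        images cancel and no boundary term remains.\<close>
      have Za: "Z a = 0"
      proof -
        have "e * heat g (a - 2 * a * r) = heat g a"
          using i1[of a] i2[of a] h0 by simp
        then show ?thesis by (simp add: Z_def)
      qed
      have Zc: "isCont Z a" unfolding Z_def heat_eq[OF g] using g r by (intro continuous_intros) auto
      have "((Z \<circ> real_of_ereal) \<longlongrightarrow> Z a) (at_right (ereal a))"
        unfolding comp_def using Zc by (intro isCont_tendsto_compose[OF Zc]) (auto intro!: tendsto_intros simp: ereal_tendsto_simps filterlim_at)
      then show "((Z \<circ> real_of_ereal) \<longlongrightarrow> 0) (at_right (ereal a))" by (simp add: Za)
      have t: "filterlim (\<lambda>p :: real. p - 2 * a * r) at_top at_top" by real_asymp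
      have "(Z \<longlongrightarrow> 2 * g / r * (0 - e * 0)) at_top"
        unfolding Z_def by (intro tendsto_intros heat_at_top[OF g] filterlim_compose[OF heat_at_top[OF g] t])
      then show "((Z \<circ> real_of_ereal) \<longlongrightarrow> 0) (at_left \<infinity>)" by (simp add: ereal_tendsto_simps1)
    qed simp
    then show ?thesis by (simp add: interval_lebesgue_integral_def ei set_lebesgue_integral_def)
  qed
  also have "ennreal (0 + (\<integral>p. 4 * a * e * (indicator {a<..} p * heat g (p - 2 * a * r)) \<partial>lborel)) = ennreal (4 * a * e) * ennreal (\<integral>p. indicator {a<..} p * heat g (p - 2 * a * r) \<partial>lborel)"
    using a by (simp add: ennreal_mult' e_def)
  also have "ennreal (\<integral>p. indicator {a<..} p * heat g (p - 2 * a * r) \<partial>lborel) = (\<integral>\<^sup>+p. ennreal (indicator {a<..} p * heat g (p - 2 * a * r)) \<partial>lborel)"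
    by (intro nn_integral_eq_integral[symmetric] ind intH) simp
  also have "\<dots> = (\<integral>\<^sup>+p. ennreal (heat g (p - 2 * a * r)) * of_bool (a < p) \<partial>lborel)"
    by (intro nn_integral_cong) (auto split: split_indicator)
  also have "\<dots> = (\<integral>\<^sup>+n. ennreal (heat 1 n) * of_bool (a < 2 * a * r + sqrt g * n) \<partial>lborel)"
    by (rule nn_integral_heat_scale[OF _ g]) measurable
  also have "\<dots> = normal_above (a * (1 - 2 * r)) (sqrt (r * (1 - r)))"
    by (intro nn_integral_cong) (simp add: g_def algebra_simps)
  finally show ?thesis by (simp add: e_def)
qed

context bridge_and_motion begin

text \<open>At time \<open>s n < 1\<close> the weight is split at \<open>r\<close>. The later block
  starts at \<open>W r\<close> and is killed at the gap below the maximum; as the missing time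
  \<delta> vanishes, its contribution tends to a difference of two images. The integral over the
  position at \<open>r\<close> is then \<open>bridge_argmax_density\<close>.\<close>

lemma bridge_argmax_law:
  assumes r: "0 < r" "r < 1" and f[measurable]: "f \<in> borel_measurable borel" and f1: "\<And>x. f x \<le> 1"
  shows "(\<integral>\<^sup>+w. f (bmx 0 r w) * of_bool (bmx r 1 w \<le> bmx 0 r w) \<partial>M)
    = (\<integral>\<^sup>+a. f a * rayleigh a * normal_above (a * (1 - 2 * r)) (sqrt (r * (1 - r))) \<partial>lborel)"
proof -
  \<comment> \<open>At most half of \<open>1 - r\<close>, so that the later block has length
    \<open>u n\<close> at least \<open>(1 - r) / 2\<close>; this gives the uniform bound
    \<open>C\<close>.\<close>
  define \<delta> where "\<delta> n = (1 - r) / (2 * real (Suc n))" for n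
  define s where "s n = 1 - \<delta> n" for n
  define u where "u n = s n - r" for n
  have \<delta>: "0 < \<delta> n" "\<delta> n \<le> (1 - r) / 2" for n
  proof -
    show "0 < \<delta> n" using r by (simp add: \<delta>_def)
    show "\<delta> n \<le> (1 - r) / 2" unfolding \<delta>_def by (rule divide_left_mono) (use r in auto)
  qed
  have \<delta>0: "\<delta> \<longlonglongrightarrow> 0" unfolding \<delta>_def using r by real_asymp
  have s: "r < s n" "s n < 1" "0 < s n" for n using \<delta>[of n] r by (auto simp: s_def field_simps)
  have s1: "s \<longlonglongrightarrow> 1" unfolding s_def using tendsto_diff[OF tendsto_const \<delta>0, of 1] by simp
  have u: "(1 - r) / 2 \<le> u n" "0 < u n" for n using \<delta>[of n] r by (auto simp: u_def s_def field_simps)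
  have u1: "u \<longlonglongrightarrow> 1 - r" unfolding u_def by (intro tendsto_intros s1)
  have [measurable]: "(\<lambda>w. bmx 0 r w) \<in> borel_measurable M" "(\<lambda>w. bmx r (s n) w) \<in> borel_measurable M" "(\<lambda>w. bmx r 1 w) \<in> borel_measurable M" for n
    using r s[of n] by auto
  have [measurable]: "(\<lambda>w. wmx 0 r w) \<in> borel_measurable N" "(\<lambda>w. wmx r (s n) w) \<in> borel_measurable N" "W r \<in> borel_measurable N" "W (s n) \<in> borel_measurable N" for n
    using r s[of n] W.bm_measurable by auto
  define \<kappa> where "\<kappa> n d b = (\<integral>\<^sup>+c. ennreal (heat (\<delta> n) (b + c)) * ennreal (killed_heat (u n) d c) \<partial>lborel)" for n d b
  let ?J = "\<lambda>w. ennreal (heat (1 - r) (W r w) - heat (1 - r) (2 * wmx 0 r w - W r w)) * ennreal (1 / heat 1 0)"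
  let ?K = "\<lambda>n w. \<kappa> n (wmx 0 r w - W r w) (W r w) * ennreal (1 / heat 1 0)"
  have \<kappa>m[measurable]: "(\<lambda>w. \<kappa> n (wmx 0 r w - W r w) (W r w)) \<in> borel_measurable N" for n
    unfolding \<kappa>_def killed_heat_def by measurable
  have eq: "(\<integral>\<^sup>+w. f (bmx 0 r w) * of_bool (bmx r (s n) w \<le> bmx 0 r w) \<partial>M)
    = (\<integral>\<^sup>+w. f (wmx 0 r w) * (?K n w) \<partial>N)" for n
  proof -
    interpret S: brownian_motion N "\<lambda>t w. W (r + t) w - W r w" using r by (intro W.shifted) auto
    have un: "u n = s n - r" by (simp add: u_def)
    define F :: "(real \<times> real) \<times> (real \<times> real) \<Rightarrow> ennreal" where
      "F z = f (fst (fst z)) * (of_bool (fst (snd z) \<le> fst (fst z) - snd (fst z)) * ennreal (heat (\<delta> n) (snd (fst z) + snd (snd z)) / heat 1 0))" for z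
    have [measurable]: "F \<in> borel_measurable (borel2 \<Otimes>\<^sub>M borel2)" unfolding F_def[abs_def] by measurable
    have "(\<integral>\<^sup>+w. f (bmx 0 r w) * of_bool (bmx r (s n) w \<le> bmx 0 r w) \<partial>M)
      = (\<integral>\<^sup>+w. (\<lambda>z. f (fst z) * of_bool (snd z \<le> fst z)) (wmx 0 r w, wmx r (s n) w) * ennreal (weight (s n) w) \<partial>N)"
      using block_transfer[OF r(1) s(1,2)[of n], of "\<lambda>z. f (fst z) * of_bool (snd z \<le> fst z)"] by simp
    also have "\<dots> = (\<integral>\<^sup>+w. F ((wmx 0 r w, W r w), (wmx r (s n) w - W r w, W (s n) w - W r w)) \<partial>N)"
      by (intro nn_integral_cong) (simp add: F_def weight_def s_def mult.assoc)
    also have "\<dots> = (\<integral>\<^sup>+w. \<integral>\<^sup>+w'. F ((wmx 0 r w, W r w), (wmx r (s n) w' - W r w', W (s n) w' - W r w')) \<partial>N \<partial>N)"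
      by (rule W.indep_rv_nn_integral[OF W.block_indep[OF r(1) s(1)]]) measurable
    also have "\<dots> = (\<integral>\<^sup>+w. f (wmx 0 r w) * (?K n w) \<partial>N)"
    proof (intro nn_integral_cong)
      fix w assume w: "w \<in> space N"
      define d b where "d = wmx 0 r w - W r w" and "b = W r w"
      have d: "0 \<le> d" using W.mx_ge_W[OF r(1) w] by (simp add: d_def)
      have "(\<integral>\<^sup>+w'. F ((wmx 0 r w, W r w), (wmx r (s n) w' - W r w', W (s n) w' - W r w')) \<partial>N)
        = f (wmx 0 r w) * (\<integral>\<^sup>+w'. of_bool (wmx r (s n) w' - W r w' \<le> d) * ennreal (heat (\<delta> n) (b + (W (s n) w' - W r w')) / heat 1 0) \<partial>N)"
        by (subst nn_integral_cmult[symmetric]) (simp_all add: F_def d_def b_def)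
      also have "(\<integral>\<^sup>+w'. of_bool (wmx r (s n) w' - W r w' \<le> d) * ennreal (heat (\<delta> n) (b + (W (s n) w' - W r w')) / heat 1 0) \<partial>N)
        = (\<integral>\<^sup>+w'. of_bool (path_max (\<lambda>t. W (r + t) w' - W r w') 0 (u n) \<le> d) * ennreal (heat (\<delta> n) (b + (W (r + u n) w' - W r w')) / heat 1 0) \<partial>N)"
        using r s(1)[of n] by (intro nn_integral_cong) (simp add: un W.mx_shift)
      also have "\<dots> = (\<integral>\<^sup>+c. ennreal (heat (\<delta> n) (b + c) / heat 1 0) * ennreal (killed_heat (u n) d c) \<partial>lborel)"
      proof (rule S.below_nn_integral[OF u(2) d])
        show "ennreal (heat (\<delta> n) (b + x) / heat 1 0) \<le> ennreal (1 / sqrt (2 * pi * \<delta> n) / heat 1 0)" for x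
          using heat_1_0_pos \<delta>(1)[of n] by (intro ennreal_leI divide_right_mono heat_bound) auto
      qed auto
      also have "\<dots> = (\<integral>\<^sup>+c. (ennreal (heat (\<delta> n) (b + c)) * ennreal (killed_heat (u n) d c)) * ennreal (1 / heat 1 0) \<partial>lborel)"
      proof (intro nn_integral_cong)
        fix c
        have "ennreal (heat (\<delta> n) (b + c) / heat 1 0) = ennreal (heat (\<delta> n) (b + c)) * ennreal (1 / heat 1 0)"
          by (subst ennreal_mult[symmetric]) auto
        then show "ennreal (heat (\<delta> n) (b + c) / heat 1 0) * ennreal (killed_heat (u n) d c) = (ennreal (heat (\<delta> n) (b + c)) * ennreal (killed_heat (u n) d c)) * ennreal (1 / heat 1 0)"
          by (simp only: mult_ac)
      qed
      also have "\<dots> = \<kappa> n d b * ennreal (1 / heat 1 0)"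
        unfolding \<kappa>_def by (rule nn_integral_multc) measurable
      finally show "(\<integral>\<^sup>+w'. F ((wmx 0 r w, W r w), (wmx r (s n) w' - W r w', W (s n) w' - W r w')) \<partial>N)
        = f (wmx 0 r w) * (?K n w)"
        by (simp only: d_def b_def)
    qed
    finally show ?thesis .
  qed
  define C where "C = ennreal (1 / sqrt (2 * pi * ((1 - r) / 2)))"
  have \<kappa>le: "\<kappa> n d b \<le> C" if "0 \<le> d" for n d b
  proof -
    have "\<kappa> n d b \<le> (\<integral>\<^sup>+c. ennreal (heat (\<delta> n) (b + c)) * C \<partial>lborel)"
      unfolding \<kappa>_def C_def
    proof (intro nn_integral_mono mult_left_mono ennreal_leI)
      fix c
      have "killed_heat (u n) d c \<le> 1 / sqrt (2 * pi * u n)" by (rule killed_heat_le[OF u(2)])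
      also have "\<dots> \<le> 1 / sqrt (2 * pi * ((1 - r) / 2))" using u[of n] r by (intro divide_left_mono) auto
      finally show "killed_heat (u n) d c \<le> 1 / sqrt (2 * pi * ((1 - r) / 2))" .
    qed simp
    also have "\<dots> = C"
      using nn_integral_translate[of "\<lambda>c. ennreal (heat (\<delta> n) c)" b] nn_integral_heat[OF \<delta>(1)[of n]] by (simp add: nn_integral_multc)
    finally show ?thesis .
  qed
  have "(\<lambda>n. \<integral>\<^sup>+w. f (bmx 0 r w) * of_bool (bmx r (s n) w \<le> bmx 0 r w) \<partial>M)
    \<longlonglongrightarrow> (\<integral>\<^sup>+w. f (bmx 0 r w) * of_bool (bmx r 1 w \<le> bmx 0 r w) \<partial>M)"
  proof (rule nn_integral_dominated_convergence[where w="\<lambda>_. 1"])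
    show "AE w in M. f (bmx 0 r w) * of_bool (bmx r (s n) w \<le> bmx 0 r w) \<le> 1" for n
      using f1 by (auto simp: of_bool_def)
    show "AE w in M. (\<lambda>n. f (bmx 0 r w) * of_bool (bmx r (s n) w \<le> bmx 0 r w)) \<longlonglongrightarrow> f (bmx 0 r w) * of_bool (bmx r 1 w \<le> bmx 0 r w)"
    proof (rule AE_I2)
      fix w assume w: "w \<in> space M"
      have c: "continuous_on {r..1} (\<lambda>t. B t w)" using B_cont[OF w, of r 1] r by simp
      have le: "bmx r (s n) w \<le> bmx r 1 w" for n using path_max_union[of r "s n" 1, OF _ _ c] s[of n] by simp
      have "\<forall>\<^sub>F n in sequentially. (bmx r (s n) w \<le> bmx 0 r w) = (bmx r 1 w \<le> bmx 0 r w)"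
        by (rule of_bool_le_tendsto[OF path_max_tendsto_right[OF r(2) c s(1,2) s1] le])
      then show "(\<lambda>n. f (bmx 0 r w) * of_bool (bmx r (s n) w \<le> bmx 0 r w)) \<longlonglongrightarrow> f (bmx 0 r w) * of_bool (bmx r 1 w \<le> bmx 0 r w)"
        by (intro tendsto_eventually) (erule eventually_mono, simp)
    qed
  qed (simp_all add: emeasure_space_1)
  moreover have "(\<lambda>n. \<integral>\<^sup>+w. f (wmx 0 r w) * (?K n w) \<partial>N)
    \<longlonglongrightarrow> (\<integral>\<^sup>+w. f (wmx 0 r w) * (?J w) \<partial>N)"
  proof (rule nn_integral_dominated_convergence[where w="\<lambda>_. C * ennreal (1 / heat 1 0)"])
    show "AE w in N. f (wmx 0 r w) * (?K n w) \<le> C * ennreal (1 / heat 1 0)" for n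
    proof (rule AE_I2)
      fix w assume "w \<in> space N"
      then have "\<kappa> n (wmx 0 r w - W r w) (W r w) \<le> C" using W.mx_ge_W[OF r(1)] by (intro \<kappa>le) auto
      then have "f (wmx 0 r w) * (?K n w) \<le> 1 * (C * ennreal (1 / heat 1 0))"
        by (intro mult_mono f1) auto
      then show "f (wmx 0 r w) * (?K n w) \<le> C * ennreal (1 / heat 1 0)" by simp
    qed
    show "(\<integral>\<^sup>+w. C * ennreal (1 / heat 1 0) \<partial>N) < \<infinity>" by (simp add: C_def W.emeasure_space_1 ennreal_mult_less_top)
    show "AE w in N. (\<lambda>n. f (wmx 0 r w) * (?K n w))
      \<longlonglongrightarrow> f (wmx 0 r w) * (?J w)"
      using W.mx_no_atom[OF r(1), of 0] AE_space
    proof eventually_elim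
      case (elim w)
      define d b where "d = wmx 0 r w - W r w" and "b = W r w"
      have d: "0 \<le> d" using W.mx_ge_W[OF r(1) elim(2)] by (simp add: d_def)
      \<comment> \<open>The sum \<open>d + b\<close> is the maximum up to \<open>r\<close>, almost
        surely positive: the end value 0 lies strictly below it.\<close>
      have "0 < d + b" using W.mx_nonneg[OF r(1) elim(2)] elim(1) by (simp add: d_def b_def)
      then have "(\<lambda>n. \<kappa> n d b) \<longlonglongrightarrow> ennreal (heat (1 - r) b - heat (1 - r) (2 * d + b))"
        unfolding \<kappa>_def using r by (intro killed_heat_bridge_limit d u(1) u1 \<delta>(1) \<delta>0) auto
      moreover have "2 * d + b = 2 * wmx 0 r w - W r w" by (simp add: d_def b_def)
      moreover have "f (wmx 0 r w) < top" using f1[of "wmx 0 r w"] by (auto intro: le_less_trans)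
      ultimately show ?case unfolding d_def[symmetric] b_def[symmetric]
        by (intro ennreal_tendsto_cmult tendsto_mult_ennreal tendsto_const) (auto simp: b_def d_def)
    qed
  qed measurable
  ultimately have "(\<integral>\<^sup>+w. f (bmx 0 r w) * of_bool (bmx r 1 w \<le> bmx 0 r w) \<partial>M)
    = (\<integral>\<^sup>+w. f (wmx 0 r w) * (?J w) \<partial>N)"
    unfolding eq by (rule LIMSEQ_unique)
  also have "\<dots> = (\<integral>\<^sup>+w. (\<lambda>(a, b). f a * ennreal ((heat (1 - r) b - heat (1 - r) (2 * a - b)) / heat 1 0)) (wmx 0 r w, W r w) \<partial>N)"
    by (intro nn_integral_cong) (simp add: ennreal_mult''[symmetric])
  also have "\<dots> = (\<integral>\<^sup>+a. \<integral>\<^sup>+b. f a * (ennreal ((heat (1 - r) b - heat (1 - r) (2 * a - b)) / heat 1 0) * ennreal (max_end_density r a b)) \<partial>lborel \<partial>lborel)"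
    by (subst W.mx_end_nn_integral[OF r(1)]) (simp_all add: mult.assoc)
  also have "\<dots> = (\<integral>\<^sup>+a. f a * (\<integral>\<^sup>+b. ennreal ((heat (1 - r) b - heat (1 - r) (2 * a - b)) / heat 1 0) * ennreal (max_end_density r a b) \<partial>lborel) \<partial>lborel)"
    by (intro nn_integral_cong nn_integral_cmult) measurable
  also have "\<dots> = (\<integral>\<^sup>+a. f a * rayleigh a * normal_above (a * (1 - 2 * r)) (sqrt (r * (1 - r))) \<partial>lborel)"
  proof (intro nn_integral_cong)
    fix a :: real
    show "f a * (\<integral>\<^sup>+b. ennreal ((heat (1 - r) b - heat (1 - r) (2 * a - b)) / heat 1 0) * ennreal (max_end_density r a b) \<partial>lborel)
      = f a * rayleigh a * normal_above (a * (1 - 2 * r)) (sqrt (r * (1 - r)))"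
    proof (cases "0 < a")
      case True
      then show ?thesis using bridge_argmax_density[OF r True] by (simp add: mult.assoc)
    qed (simp add: max_end_density_def)
  qed
  finally show ?thesis .
qed

text \<open>For each \<open>s < 1\<close> ties are null by absolute continuity. The maximum up to
  \<open>r\<close> is almost surely not 0, so an equal maximum on [r, 1] is not attained at time 1
  and already occurs before some \<open>s n\<close>.\<close>

lemma bridge_no_tie:
  assumes r: "0 < r" "r < 1"
  shows "AE w in M. bmx 0 r w \<noteq> bmx r 1 w"
proof -
  define s where "s n = 1 - (1 - r) / (2 * real (Suc n))" for n
  have s: "r < s n" "s n < 1" for n
  proof -
    have "(1 - r) / (2 * real (Suc n)) \<le> (1 - r) / 2" by (rule divide_left_mono) (use r in auto)
    then show "r < s n" using r by (simp add: s_def field_simps)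
    show "s n < 1" using r by (simp add: s_def)
  qed
  have s1: "s \<longlonglongrightarrow> 1" unfolding s_def by real_asymp
  have "AE w in M. \<forall>n. bmx 0 r w \<noteq> bmx r (s n) w"
    unfolding AE_all_countable
  proof
    fix n
    show "AE w in M. bmx 0 r w \<noteq> bmx r (s n) w"
      using AE_transfer[OF r(1) s[of n], of "\<lambda>z. fst z \<noteq> snd z"] W.block_no_tie[OF r(1) s(1)[of n]] by simp
  qed
  moreover have "AE w in M. bmx 0 r w \<noteq> 0"
    using AE_transfer[OF r(1) s[of 0], of "\<lambda>z. fst z \<noteq> 0"] W.mx_no_atom[OF r(1), of 0] by simp
  ultimately show ?thesis using AE_space
  proof eventually_elim
    case (elim w)
    have c: "continuous_on {r..1} (\<lambda>t. B t w)" "continuous_on {0..r} (\<lambda>t. B t w)" using B_cont[OF elim(3)] r by auto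
    show ?case
    proof
      assume e: "bmx 0 r w = bmx r 1 w"
      obtain t where t: "t \<in> {r..1}" "bmx r 1 w = B t w" "\<And>u. u \<in> {r..1} \<Longrightarrow> B u w \<le> B t w"
        using path_max_attained[of r 1, OF _ c(1)] r by auto
      have "t \<noteq> 1" using e t(2) elim(2) bridge_end[OF elim(3)] by auto
      then have "\<forall>\<^sub>F n in sequentially. t < s n" using t(1) s1 by (intro order_tendstoD) auto
      then obtain n where n: "t < s n" using eventually_happens by force
      have cs: "continuous_on {r..s n} (\<lambda>t. B t w)" using s(2)[of n] by (intro continuous_on_subset[OF c(1)]) auto
      have "B t w \<le> bmx r (s n) w" using n t(1) by (intro path_max_upper cs) auto
      moreover have "bmx r (s n) w \<le> bmx r 1 w" using path_max_union[of r "s n" 1, OF _ _ c(1)] s[of n] by simp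
      ultimately have "bmx 0 r w = bmx r (s n) w" using e t(2) by simp
      then show False using elim(1) by blast
    qed
  qed
qed

end

section \<open>Rotation invariance\<close>

lemma nn_integral_PiM_lborel_translate:
  fixes a :: "'i \<Rightarrow> real"
  assumes fin: "finite I" and F[measurable]: "F \<in> borel_measurable (lvec I)"
  shows "(\<integral>\<^sup>+x. F (\<lambda>i\<in>I. x i + a i) \<partial>(lvec I)) = (\<integral>\<^sup>+x. F x \<partial>(lvec I))"
proof -
  interpret product_sigma_finite "\<lambda>_ :: 'i. lborel :: real measure" ..
  let ?P = "lvec I"
  have T[measurable]: "(\<lambda>x. \<lambda>i\<in>I. x i + a i) \<in> ?P \<rightarrow>\<^sub>M ?P"
  proof (rule measurable_restrict)
    fix i assume "i \<in> I"
    then have "(\<lambda>x. x i) \<in> borel_measurable ?P" using measurable_component_singleton[of i I "\<lambda>_. lborel :: real measure"] by simp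
    then show "(\<lambda>x. x i + a i) \<in> ?P \<rightarrow>\<^sub>M lborel" by simp
  qed
  have "distr ?P ?P (\<lambda>x. \<lambda>i\<in>I. x i + a i) = ?P"
  proof (rule PiM_eqI[OF fin])
    fix A assume A: "\<And>i. i \<in> I \<Longrightarrow> A i \<in> sets (lborel :: real measure)"
    define A' where "A' i = (\<lambda>y. y + a i) -` A i" for i
    have A': "A' i \<in> sets lborel" if "i \<in> I" for i
    proof -
      have "(\<lambda>y. y + a i) \<in> borel_measurable borel" by measurable
      from measurable_sets[OF this, of "A i"] A[OF that] show ?thesis by (simp add: A'_def)
    qed
    have e: "emeasure lborel (A' i) = emeasure lborel (A i)" if "i \<in> I" for i
    proof -
      have "emeasure lborel (A i) = emeasure (distr lborel borel ((+) (a i))) (A i)" by (simp add: lborel_distr_plus)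
      also have "\<dots> = emeasure lborel ((+) (a i) -` A i)" using A[OF that] by (subst emeasure_distr) auto
      also have "(+) (a i) -` A i = A' i" by (auto simp: A'_def add.commute)
      finally show ?thesis by simp
    qed
    have "emeasure (distr ?P ?P (\<lambda>x. \<lambda>i\<in>I. x i + a i)) (Pi\<^sub>E I A) = emeasure ?P ((\<lambda>x. \<lambda>i\<in>I. x i + a i) -` (Pi\<^sub>E I A) \<inter> space ?P)"
      using A fin by (intro emeasure_distr T sets_PiM_I_finite) auto
    also have "(\<lambda>x. \<lambda>i\<in>I. x i + a i) -` (Pi\<^sub>E I A) \<inter> space ?P = Pi\<^sub>E I A'"
      by (auto simp: A'_def space_PiM PiE_iff)
    also have "emeasure ?P (Pi\<^sub>E I A') = (\<Prod>i\<in>I. emeasure lborel (A i))"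
      using A' e fin by (simp add: emeasure_PiM)
    finally show "emeasure (distr ?P ?P (\<lambda>x. \<lambda>i\<in>I. x i + a i)) (Pi\<^sub>E I A) = (\<Prod>i\<in>I. emeasure lborel (A i))" .
  qed simp
  then show ?thesis using nn_integral_distr[OF T, of F] by simp
qed

definition vadd :: "'i set \<Rightarrow> real \<Rightarrow> ('i \<Rightarrow> real) \<Rightarrow> real \<Rightarrow> ('i \<Rightarrow> real) \<Rightarrow> 'i \<Rightarrow> real" where
  "vadd I a x b y = (\<lambda>i\<in>I. a * x i + b * y i)"

definition rotv :: "'i set \<Rightarrow> real \<Rightarrow> real \<Rightarrow> ('i \<Rightarrow> real) \<times> ('i \<Rightarrow> real) \<Rightarrow> ('i \<Rightarrow> real) \<times> ('i \<Rightarrow> real)" where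
  "rotv I c s z = (vadd I c (fst z) (- s) (snd z), vadd I s (fst z) c (snd z))"

lemma measurable_vadd [measurable (raw)]:
  assumes f: "f \<in> M \<rightarrow>\<^sub>M (lvec I)" and g: "g \<in> M \<rightarrow>\<^sub>M (lvec I)"
  shows "(\<lambda>z. vadd I a (f z) b (g z)) \<in> M \<rightarrow>\<^sub>M (lvec I)"
  unfolding vadd_def
proof (rule measurable_restrict)
  fix i assume "i \<in> I"
  then have "(\<lambda>x. x i) \<in> borel_measurable (lvec I)"
    using measurable_component_singleton[of i I "\<lambda>_. lborel :: real measure"] by simp
  from measurable_compose[OF f this] measurable_compose[OF g this]
  show "(\<lambda>z. a * f z i + b * g z i) \<in> M \<rightarrow>\<^sub>M lborel" by simp
qed

lemma measurable_rotv [measurable]: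
  "rotv I c s \<in> (lvec I) \<Otimes>\<^sub>M (lvec I) \<rightarrow>\<^sub>M (lvec I) \<Otimes>\<^sub>M (lvec I)"
  unfolding rotv_def[abs_def] by measurable

text \<open>A rotation of the plane is a product of three shears (or of two quarter turns).\<close>

lemma nn_integral_rotv:
  fixes F :: "('i \<Rightarrow> real) \<times> ('i \<Rightarrow> real) \<Rightarrow> ennreal"
  assumes fin: "finite I" and cs: "c\<^sup>2 + s\<^sup>2 = 1"
    and F: "F \<in> borel_measurable ((lvec I) \<Otimes>\<^sub>M (lvec I))"
  shows "(\<integral>\<^sup>+x. \<integral>\<^sup>+y. F (rotv I c s (x, y)) \<partial>(lvec I) \<partial>(lvec I)) = (\<integral>\<^sup>+x. \<integral>\<^sup>+y. F (x, y) \<partial>(lvec I) \<partial>(lvec I))"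
proof -
  interpret product_sigma_finite "\<lambda>_ :: 'i. lborel :: real measure" ..
  let ?P = "lvec I"
  let ?I = "\<lambda>G. (\<integral>\<^sup>+x. \<integral>\<^sup>+y. G (x, y) \<partial>?P \<partial>?P)"
  interpret P: sigma_finite_measure ?P by (rule sigma_finite[OF fin])
  interpret PP: pair_sigma_finite ?P ?P ..
  have shear_y: "(\<integral>\<^sup>+x. \<integral>\<^sup>+y. G (x, vadd I k x 1 y) \<partial>?P \<partial>?P) = (?I G)"
    if G[measurable]: "G \<in> borel_measurable (?P \<Otimes>\<^sub>M ?P)" for G :: "('i \<Rightarrow> real) \<times> ('i \<Rightarrow> real) \<Rightarrow> ennreal" and k
  proof (rule nn_integral_cong)
    fix x assume x: "x \<in> space ?P"
    have e: "vadd I k x 1 y = (\<lambda>i\<in>I. y i + k * x i)" for y by (simp add: vadd_def add.commute)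
    show "(\<integral>\<^sup>+y. G (x, vadd I k x 1 y) \<partial>?P) = (\<integral>\<^sup>+y. G (x, y) \<partial>?P)"
      unfolding e by (rule nn_integral_PiM_lborel_translate[OF fin]) (rule measurable_compose[OF measurable_Pair1'[OF x] G])
  qed
  have shear_x: "(\<integral>\<^sup>+x. \<integral>\<^sup>+y. G (vadd I 1 x k y, y) \<partial>?P \<partial>?P) = (?I G)"
    if G[measurable]: "G \<in> borel_measurable (?P \<Otimes>\<^sub>M ?P)" for G :: "('i \<Rightarrow> real) \<times> ('i \<Rightarrow> real) \<Rightarrow> ennreal" and k
  proof -
    have "(\<integral>\<^sup>+x. \<integral>\<^sup>+y. G (vadd I 1 x k y, y) \<partial>?P \<partial>?P) = (\<integral>\<^sup>+y. \<integral>\<^sup>+x. G (vadd I 1 x k y, y) \<partial>?P \<partial>?P)"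
      by (rule PP.Fubini'[symmetric]) measurable
    also have "\<dots> = (\<integral>\<^sup>+y. \<integral>\<^sup>+x. G (x, y) \<partial>?P \<partial>?P)"
    proof (rule nn_integral_cong)
      fix y assume y: "y \<in> space ?P"
      have e: "vadd I 1 x k y = (\<lambda>i\<in>I. x i + k * y i)" for x by (simp add: vadd_def)
      show "(\<integral>\<^sup>+x. G (vadd I 1 x k y, y) \<partial>?P) = (\<integral>\<^sup>+x. G (x, y) \<partial>?P)"
        unfolding e by (rule nn_integral_PiM_lborel_translate[OF fin]) (rule measurable_compose[OF measurable_Pair2'[OF y] G])
    qed
    also have "\<dots> = (?I G)"
      by (rule PP.Fubini') measurable
    finally show ?thesis .
  qed
  have gen: "(\<integral>\<^sup>+x. \<integral>\<^sup>+y. G (rotv I c s (x, y)) \<partial>?P \<partial>?P) = (?I G)"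
    if s: "s \<noteq> 0" "c\<^sup>2 + s\<^sup>2 = 1" and G[measurable]: "G \<in> borel_measurable (?P \<Otimes>\<^sub>M ?P)" for G :: "('i \<Rightarrow> real) \<times> ('i \<Rightarrow> real) \<Rightarrow> ennreal" and c s
  proof -
    \<comment> \<open>Minus the tangent of half the angle: the coefficient of the two outer shears,
      the middle one having coefficient \<open>s\<close>.\<close>
    define t where "t = (c - 1) / s"
    have ts: "1 + s * t = c" "t * (1 + c) = - s"
    proof -
      show "1 + s * t = c" using s by (simp add: t_def)
      have "(c - 1) * (1 + c) = - s * s" using s(2) by (simp add: power2_eq_square algebra_simps)
      then show "t * (1 + c) = - s" using s(1) by (simp add: t_def field_simps)
    qed
    define G1 where "G1 z = G (vadd I 1 (fst z) t (snd z), snd z)" for z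
    define G2 where "G2 z = G1 (fst z, vadd I s (fst z) 1 (snd z))" for z
    have [measurable]: "G1 \<in> borel_measurable (?P \<Otimes>\<^sub>M ?P)" unfolding G1_def by measurable
    have [measurable]: "G2 \<in> borel_measurable (?P \<Otimes>\<^sub>M ?P)" unfolding G2_def by measurable
    have "G (rotv I c s (x, y)) = G2 (vadd I 1 x t y, y)" for x y
    proof -
      have 1: "vadd I s (vadd I 1 x t y) 1 y = vadd I s x c y"
        using ts(1) by (auto simp: vadd_def fun_eq_iff algebra_simps) (metis distrib_right mult.assoc mult.commute mult_1)?
      have 2: "vadd I 1 (vadd I 1 x t y) t (vadd I s x c y) = vadd I c x (- s) y"
      proof
        fix i
        have "x i + t * y i + t * (s * x i + c * y i) = (1 + s * t) * x i + (t * (1 + c)) * y i" by (simp add: algebra_simps)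
        then show "vadd I 1 (vadd I 1 x t y) t (vadd I s x c y) i = vadd I c x (- s) y i"
          unfolding ts by (simp add: vadd_def)
      qed
      show ?thesis by (simp add: G2_def G1_def rotv_def 1 2)
    qed
    then have "(\<integral>\<^sup>+x. \<integral>\<^sup>+y. G (rotv I c s (x, y)) \<partial>?P \<partial>?P) = (\<integral>\<^sup>+x. \<integral>\<^sup>+y. G2 (x, y) \<partial>?P \<partial>?P)"
      by (simp add: shear_x)
    also have "\<dots> = (\<integral>\<^sup>+x. \<integral>\<^sup>+y. G1 (x, y) \<partial>?P \<partial>?P)" unfolding G2_def by (simp add: shear_y)
    also have "\<dots> = (?I G)" unfolding G1_def by (simp add: shear_x)
    finally show ?thesis .
  qed
  show ?thesis
  proof (cases "s = 0")
    case False
    then show ?thesis by (rule gen[OF _ cs F])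
  next
    case True
    then have "c = 1 \<or> c = - 1" using cs by (simp add: power2_eq_1_iff)
    then show ?thesis
    proof
      assume c: "c = 1"
      have "rotv I c s (x, y) = (x, y)" if "x \<in> space ?P" "y \<in> space ?P" for x y
        using that True c by (auto simp: rotv_def vadd_def space_PiM PiE_iff extensional_def fun_eq_iff)
      then show ?thesis by (simp cong: nn_integral_cong)
    next
      assume c: "c = - 1"
      have "rotv I c s (x, y) = rotv I 0 1 (rotv I 0 1 (x, y))" for x y
        using True c by (auto simp: rotv_def vadd_def fun_eq_iff)
      then have "(\<integral>\<^sup>+x. \<integral>\<^sup>+y. F (rotv I c s (x, y)) \<partial>?P \<partial>?P) = (\<integral>\<^sup>+x. \<integral>\<^sup>+y. F (rotv I 0 1 (x, y)) \<partial>?P \<partial>?P)"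
        using gen[of 1 0 "\<lambda>z. F (rotv I 0 1 z)"] measurable_compose[OF measurable_rotv F] by simp
      also have "\<dots> = (\<integral>\<^sup>+x. \<integral>\<^sup>+y. F (x, y) \<partial>?P \<partial>?P)" by (rule gen) (use F in auto)
      finally show ?thesis .
    qed
  qed
qed

lemma heat_rotate:
  assumes "c\<^sup>2 + s\<^sup>2 = 1"
  shows "heat v (c * u - s * w) * heat v (s * u + c * w) = heat v u * heat v w"
proof -
  have e: "(c * u - s * w)\<^sup>2 + (s * u + c * w)\<^sup>2 = u\<^sup>2 + w\<^sup>2"
  proof -
    have "(c * u - s * w)\<^sup>2 + (s * u + c * w)\<^sup>2 = (c\<^sup>2 + s\<^sup>2) * (u\<^sup>2 + w\<^sup>2)" by (simp add: power2_eq_square algebra_simps)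
    then show ?thesis by (simp add: assms)
  qed
  have h: "heat v a * heat v b = (1 / sqrt (2 * pi * (sqrt v)\<^sup>2))\<^sup>2 * exp (- (a\<^sup>2 + b\<^sup>2) / (2 * (sqrt v)\<^sup>2))" for a b
    by (simp add: heat_def normal_density_def power2_eq_square exp_add[symmetric] add_divide_distrib diff_divide_distrib)
  show ?thesis unfolding h e ..
qed

lemma bm_joint_density_rotate:
  assumes cs: "c\<^sup>2 + s\<^sup>2 = 1"
  shows "bm_joint_density n t (\<lambda>i. c * x i - s * y i) * bm_joint_density n t (\<lambda>i. s * x i + c * y i) = bm_joint_density n t x * bm_joint_density n t y"
  unfolding bm_joint_density_def prod.distrib[symmetric]
proof (intro prod.cong refl)
  fix i
  define px py where "px = (if i = 0 then 0 else x (i - 1))" and "py = (if i = 0 then 0 else y (i - 1))"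
  have p: "(if i = 0 then 0 else c * x (i - 1) - s * y (i - 1)) = c * px - s * py"
    "(if i = 0 then 0 else s * x (i - 1) + c * y (i - 1)) = s * px + c * py" by (auto simp: px_def py_def)
  have q: "c * x i - s * y i - (c * px - s * py) = c * (x i - px) - s * (y i - py)" "s * x i + c * y i - (s * px + c * py) = s * (x i - px) + c * (y i - py)"
    by (simp_all add: algebra_simps)
  show "normal_density (if i = 0 then 0 else c * x (i - 1) - s * y (i - 1)) (sqrt (t i - (if i = 0 then 0 else t (i - 1)))) (c * x i - s * y i) *
    normal_density (if i = 0 then 0 else s * x (i - 1) + c * y (i - 1)) (sqrt (t i - (if i = 0 then 0 else t (i - 1)))) (s * x i + c * y i) =
    normal_density (if i = 0 then 0 else x (i - 1)) (sqrt (t i - (if i = 0 then 0 else t (i - 1)))) (x i) *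
    normal_density (if i = 0 then 0 else y (i - 1)) (sqrt (t i - (if i = 0 then 0 else t (i - 1)))) (y i)"
    unfolding p px_def[symmetric] py_def[symmetric] normal_density_eq_heat q by (rule heat_rotate[OF cs])
qed

lemma bm_joint_density_cong: "(\<And>i. i < n \<Longrightarrow> x i = y i) \<Longrightarrow> bm_joint_density n t x = bm_joint_density n t y"
  unfolding bm_joint_density_def by (intro prod.cong refl) auto

lemma bm_bridge_density_rotate:
  assumes cs: "c\<^sup>2 + s\<^sup>2 = 1"
  shows "bm_bridge_density n t (\<lambda>i. c * x i - s * y i) * bm_bridge_density n t (\<lambda>i. s * x i + c * y i) = bm_bridge_density n t x * bm_bridge_density n t y"
proof -
  have e: "(\<lambda>i. c * x i - s * y i)(n := 0) = (\<lambda>i. c * (x(n := 0)) i - s * (y(n := 0)) i)"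
    "(\<lambda>i. s * x i + c * y i)(n := 0) = (\<lambda>i. s * (x(n := 0)) i + c * (y(n := 0)) i)" by auto
  show ?thesis unfolding bm_bridge_density_def e times_divide_times_eq bm_joint_density_rotate[OF cs] ..
qed

lemma bm_bridge_density_cong: "(\<And>i. i < n \<Longrightarrow> x i = y i) \<Longrightarrow> bm_bridge_density n t x = bm_bridge_density n t y"
  unfolding bm_bridge_density_def by (intro arg_cong2[where f="(/)"] bm_joint_density_cong) (auto simp: less_Suc_eq)

text \<open>The pair has the density \<open>f x * f y\<close>, unchanged by the rotation
  (\<open>frot\<close>), and Lebesgue measure is rotation invariant. \<open>fcong\<close> bridges
  the gap between functions of all indices and the vectors cut to \<open>{..<n}\<close> by
  \<open>rotv\<close>.\<close>

lemma (in prob_space) rotation_invariant_law: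
  fixes X Y :: "'a \<Rightarrow> nat \<Rightarrow> real" and f :: "(nat \<Rightarrow> real) \<Rightarrow> real"
  assumes ind: "indep_rv (lvec {..<n}) X (lvec {..<n}) Y"
    and fm[measurable]: "f \<in> borel_measurable (lvec {..<n})" and f0: "\<And>x. 0 \<le> f x"
    and X: "\<And>F. F \<in> borel_measurable (lvec {..<n}) \<Longrightarrow> (\<integral>\<^sup>+w. F (X w) \<partial>M) = (\<integral>\<^sup>+x. F x * ennreal (f x) \<partial>(lvec {..<n}))"
    and Y: "\<And>F. F \<in> borel_measurable (lvec {..<n}) \<Longrightarrow> (\<integral>\<^sup>+w. F (Y w) \<partial>M) = (\<integral>\<^sup>+x. F x * ennreal (f x) \<partial>(lvec {..<n}))"
    and frot: "\<And>x y. f (\<lambda>i. c * x i - s * y i) * f (\<lambda>i. s * x i + c * y i) = f x * f y"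
    and fcong: "\<And>x y. (\<And>i. i < n \<Longrightarrow> x i = y i) \<Longrightarrow> f x = f y"
    and cs: "c\<^sup>2 + s\<^sup>2 = 1"
  shows "distr M ((lvec {..<n}) \<Otimes>\<^sub>M (lvec {..<n})) (\<lambda>w. (X w, Y w))
    = distr M ((lvec {..<n}) \<Otimes>\<^sub>M (lvec {..<n})) (\<lambda>w. rotv {..<n} c s (X w, Y w))"
proof -
  interpret product_sigma_finite "\<lambda>_ :: nat. lborel :: real measure" ..
  let ?P = "lvec {..<n}"
  interpret P: sigma_finite_measure ?P by (rule sigma_finite) simp
  have [measurable]: "X \<in> M \<rightarrow>\<^sub>M ?P" "Y \<in> M \<rightarrow>\<^sub>M ?P" using ind by (auto simp: indep_rv_def)
  have law: "(\<integral>\<^sup>+w. F (X w, Y w) \<partial>M) = (\<integral>\<^sup>+x. \<integral>\<^sup>+y. F (x, y) * ennreal (f x * f y) \<partial>?P \<partial>?P)"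
    if F[measurable]: "F \<in> borel_measurable (?P \<Otimes>\<^sub>M ?P)" for F
  proof -
    have "(\<integral>\<^sup>+w. F (X w, Y w) \<partial>M) = (\<integral>\<^sup>+w. \<integral>\<^sup>+w'. F (X w, Y w') \<partial>M \<partial>M)"
      by (rule indep_rv_nn_integral[OF ind F])
    also have "\<dots> = (\<integral>\<^sup>+w. (\<lambda>x. \<integral>\<^sup>+y. F (x, y) * ennreal (f y) \<partial>?P) (X w) \<partial>M)"
    proof (rule nn_integral_cong)
      fix w assume "w \<in> space M"
      then have "X w \<in> space ?P" by (rule measurable_space[rotated]) simp
      then show "(\<integral>\<^sup>+w'. F (X w, Y w') \<partial>M) = (\<lambda>x. \<integral>\<^sup>+y. F (x, y) * ennreal (f y) \<partial>?P) (X w)"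
        using Y[OF measurable_compose[OF measurable_Pair1' F], of "X w"] by simp
    qed
    also have "\<dots> = (\<integral>\<^sup>+x. (\<integral>\<^sup>+y. F (x, y) * ennreal (f y) \<partial>?P) * ennreal (f x) \<partial>?P)"
      by (rule X) measurable
    also have "\<dots> = (\<integral>\<^sup>+x. \<integral>\<^sup>+y. F (x, y) * ennreal (f x * f y) \<partial>?P \<partial>?P)"
    proof (rule nn_integral_cong)
      fix x assume x: "x \<in> space ?P"
      have [measurable]: "(\<lambda>y. F (x, y)) \<in> borel_measurable ?P" by (rule measurable_compose[OF measurable_Pair1'[OF x] F])
      show "(\<integral>\<^sup>+y. F (x, y) * ennreal (f y) \<partial>?P) * ennreal (f x) = (\<integral>\<^sup>+y. F (x, y) * ennreal (f x * f y) \<partial>?P)"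
        by (subst nn_integral_multc[symmetric]) (auto simp: ennreal_mult f0 mult_ac)
    qed
    finally show ?thesis .
  qed
  have inv: "(\<integral>\<^sup>+w. F (X w, Y w) \<partial>M) = (\<integral>\<^sup>+w. F (rotv {..<n} c s (X w, Y w)) \<partial>M)"
    if F[measurable]: "F \<in> borel_measurable (?P \<Otimes>\<^sub>M ?P)" for F
  proof -
    have ff: "f (fst (rotv {..<n} c s (x, y))) * f (snd (rotv {..<n} c s (x, y))) = f x * f y" for x y
    proof -
      have "f (fst (rotv {..<n} c s (x, y))) = f (\<lambda>i. c * x i - s * y i)" by (rule fcong) (simp add: rotv_def vadd_def)
      moreover have "f (snd (rotv {..<n} c s (x, y))) = f (\<lambda>i. s * x i + c * y i)" by (rule fcong) (simp add: rotv_def vadd_def)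
      ultimately show ?thesis by (simp add: frot)
    qed
    have Frot: "(\<lambda>z. F (rotv {..<n} c s z)) \<in> borel_measurable (?P \<Otimes>\<^sub>M ?P)" by (rule measurable_compose[OF measurable_rotv F])
    have "(\<integral>\<^sup>+w. F (rotv {..<n} c s (X w, Y w)) \<partial>M) = (\<integral>\<^sup>+x. \<integral>\<^sup>+y. (\<lambda>z. F z * ennreal (f (fst z) * f (snd z))) (rotv {..<n} c s (x, y)) \<partial>?P \<partial>?P)"
      unfolding law[OF Frot] by (simp add: ff)
    also have "\<dots> = (\<integral>\<^sup>+x. \<integral>\<^sup>+y. F (x, y) * ennreal (f x * f y) \<partial>?P \<partial>?P)"
      by (subst nn_integral_rotv[OF _ cs]) (simp_all, measurable)
    finally show ?thesis by (simp add: law)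
  qed
  show ?thesis
  proof (rule measure_eqI)
    fix A assume A: "A \<in> sets (distr M (?P \<Otimes>\<^sub>M ?P) (\<lambda>w. (X w, Y w)))"
    then have A'[measurable]: "A \<in> sets (?P \<Otimes>\<^sub>M ?P)" by simp
    have "emeasure (distr M (?P \<Otimes>\<^sub>M ?P) Z) A = (\<integral>\<^sup>+w. indicator A (Z w) \<partial>M)" if "Z \<in> M \<rightarrow>\<^sub>M (?P \<Otimes>\<^sub>M ?P)" for Z
      using nn_integral_distr[OF that, of "indicator A"] by simp
    then show "emeasure (distr M (?P \<Otimes>\<^sub>M ?P) (\<lambda>w. (X w, Y w))) A = emeasure (distr M (?P \<Otimes>\<^sub>M ?P) (\<lambda>w. rotv {..<n} c s (X w, Y w))) A"
      using inv[of "indicator A"] by simp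
  qed simp
qed

section \<open>Elementary integrals\<close>

lemma nn_integral_even:
  fixes f :: "real \<Rightarrow> ennreal"
  assumes [measurable]: "f \<in> borel_measurable borel" and even: "\<And>x. f (- x) = f x"
  shows "(\<integral>\<^sup>+x. f x \<partial>lborel) = (\<integral>\<^sup>+x. of_bool (0 < x) * (2 * f x) \<partial>lborel)"
proof -
  have "(\<integral>\<^sup>+x. f x \<partial>lborel) = (\<integral>\<^sup>+x. of_bool (0 < x) * f x + of_bool (x < 0) * f x \<partial>lborel)"
    by (rule nn_integral_cong_AE) (use AE_lborel_singleton[of 0] in \<open>eventually_elim, auto simp: of_bool_def\<close>)
  also have "\<dots> = (\<integral>\<^sup>+x. of_bool (0 < x) * f x \<partial>lborel) + (\<integral>\<^sup>+x. of_bool (x < 0) * f x \<partial>lborel)"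
    by (rule nn_integral_add) measurable
  also have "(\<integral>\<^sup>+x. of_bool (x < 0) * f x \<partial>lborel) = (\<integral>\<^sup>+x. of_bool (0 < x) * f x \<partial>lborel)"
    by (subst nn_integral_reflect[of _ 0]) (auto simp: even)
  also have "(\<integral>\<^sup>+x. of_bool (0 < x) * f x \<partial>lborel) + (\<integral>\<^sup>+x. of_bool (0 < x) * f x \<partial>lborel) = (\<integral>\<^sup>+x. of_bool (0 < x) * f x + of_bool (0 < x) * f x \<partial>lborel)"
    by (rule nn_integral_add[symmetric]) measurable
  finally show ?thesis by (simp add: mult_2 distrib_left)
qed

lemma nn_integral_FTC_Ioi:
  fixes f :: "real \<Rightarrow> real"
  assumes "f \<in> borel_measurable borel" "\<And>x. a \<le> x \<Longrightarrow> (F has_real_derivative f x) (at x)"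
    "\<And>x. a \<le> x \<Longrightarrow> 0 \<le> f x" "(F \<longlongrightarrow> T) at_top"
  shows "(\<integral>\<^sup>+x. of_bool (a < x) * ennreal (f x) \<partial>lborel) = ennreal (T - F a)"
proof -
  have "(\<integral>\<^sup>+x. of_bool (a < x) * ennreal (f x) \<partial>lborel) = (\<integral>\<^sup>+x. ennreal (f x) * indicator {a..} x \<partial>lborel)"
    by (rule nn_integral_cong_AE) (use of_bool_less_AE_indicator[of a] in \<open>eventually_elim, simp add: mult.commute\<close>)
  then show ?thesis using nn_integral_FTC_atLeast[OF assms] by simp
qed

lemma integral_x3_gaussian:
  assumes c: "0 < c"
  shows "(\<integral>\<^sup>+x. of_bool (0 < x) * ennreal (x ^ 3 * exp (- c * x\<^sup>2 / 2)) \<partial>lborel) = ennreal (2 / c\<^sup>2)"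
proof -
  have "(\<integral>\<^sup>+x. of_bool (0 < x) * ennreal (x ^ 3 * exp (- c * x\<^sup>2 / 2)) \<partial>lborel)
    = ennreal (0 - (- (0\<^sup>2 / c + 2 / c\<^sup>2) * exp (- c * 0\<^sup>2 / 2)))"
  proof (rule nn_integral_FTC_Ioi)
    show "((\<lambda>x. - (x\<^sup>2 / c + 2 / c\<^sup>2) * exp (- c * x\<^sup>2 / 2)) has_real_derivative x ^ 3 * exp (- c * x\<^sup>2 / 2)) (at x)" for x
      using c by (auto intro!: derivative_eq_intros simp: field_simps power2_eq_square power3_eq_cube)
    show "((\<lambda>x. - (x\<^sup>2 / c + 2 / c\<^sup>2) * exp (- c * x\<^sup>2 / 2)) \<longlongrightarrow> 0) at_top"
      using c by real_asymp
  qed auto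
  then show ?thesis by simp
qed

lemma integral_x_gaussian_diff:
  assumes c: "0 < c" "c \<le> d"
  shows "(\<integral>\<^sup>+x. of_bool (0 < x) * ennreal (x * (exp (- c * x\<^sup>2 / 2) - exp (- d * x\<^sup>2 / 2))) \<partial>lborel) = ennreal (1 / c - 1 / d)"
proof -
  have "(\<integral>\<^sup>+x. of_bool (0 < x) * ennreal (x * (exp (- c * x\<^sup>2 / 2) - exp (- d * x\<^sup>2 / 2))) \<partial>lborel)
    = ennreal (0 - (- exp (- c * 0\<^sup>2 / 2) / c + exp (- d * 0\<^sup>2 / 2) / d))"
  proof (rule nn_integral_FTC_Ioi)
    show "((\<lambda>x. - exp (- c * x\<^sup>2 / 2) / c + exp (- d * x\<^sup>2 / 2) / d) has_real_derivative x * (exp (- c * x\<^sup>2 / 2) - exp (- d * x\<^sup>2 / 2))) (at x)" for x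
      using c by (auto intro!: derivative_eq_intros simp: field_simps)
    have "((\<lambda>x. - exp (- c * x\<^sup>2 / 2) / c) \<longlongrightarrow> 0) at_top" "((\<lambda>x. exp (- d * x\<^sup>2 / 2) / d) \<longlongrightarrow> 0) at_top"
      using c by real_asymp+
    from tendsto_add[OF this] show "((\<lambda>x. - exp (- c * x\<^sup>2 / 2) / c + exp (- d * x\<^sup>2 / 2) / d) \<longlongrightarrow> 0) at_top" by simp
    show "0 \<le> x * (exp (- c * x\<^sup>2 / 2) - exp (- d * x\<^sup>2 / 2))" if "0 \<le> x" for x
      using c that by (intro mult_nonneg_nonneg) (auto intro!: divide_right_mono mult_right_mono)
  qed measurable
  then show ?thesis by simp
qed

lemma integral_rational_W:
  "(\<integral>\<^sup>+u. of_bool (0 < u) * ennreal (u\<^sup>2 / (1 + u\<^sup>2) * (1 / (1 + u\<^sup>2) - 1 / (5 + u\<^sup>2))) \<partial>lborel) = ennreal (pi / 4 - (sqrt 5 - 1) * pi / 8)"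
proof -
  \<comment> \<open>Partial fractions: \<open>u^2 / (1 + u^2)^2\<close> gives the first term, and
    \<open>u^2 / ((1 + u^2) * (5 + u^2)) = (5 / (5 + u^2) - 1 / (1 + u^2)) / 4\<close> the
    second.\<close>
  define F where "F u = (arctan u - u / (1 + u\<^sup>2)) / 2 - (sqrt 5 * arctan (u / sqrt 5) - arctan u) / 4" for u :: real
  have d5: "((\<lambda>u. sqrt 5 * arctan (u / sqrt 5)) has_real_derivative 5 / (5 + u\<^sup>2)) (at u)" for u :: real
    by (auto intro!: derivative_eq_intros simp: power_divide field_simps add_pos_nonneg)
  have p: "1 + u\<^sup>2 > 0" "5 + u\<^sup>2 > 0" for u :: real by (auto intro: add_pos_nonneg)
  have "(\<integral>\<^sup>+u. of_bool (0 < u) * ennreal (u\<^sup>2 / (1 + u\<^sup>2) * (1 / (1 + u\<^sup>2) - 1 / (5 + u\<^sup>2))) \<partial>lborel) = ennreal ((pi / 4 - (sqrt 5 - 1) * pi / 8) - F 0)"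
  proof (rule nn_integral_FTC_Ioi)
    fix u :: real
    have "(F has_real_derivative (1 / (1 + u\<^sup>2) - (1 * (1 + u\<^sup>2) - u * (2 * u)) / ((1 + u\<^sup>2) * (1 + u\<^sup>2))) / 2 - (5 / (5 + u\<^sup>2) - 1 / (1 + u\<^sup>2)) / 4) (at u)"
    proof -
      have "((\<lambda>u. u / (1 + u\<^sup>2)) has_real_derivative (1 * (1 + u\<^sup>2) - u * (2 * u)) / ((1 + u\<^sup>2) * (1 + u\<^sup>2))) (at u)"
        using p[of u] by (auto intro!: derivative_eq_intros)
      moreover have "(arctan has_real_derivative 1 / (1 + u\<^sup>2)) (at u)" using DERIV_arctan[of u] by (simp add: inverse_eq_divide)
      ultimately show ?thesis unfolding F_def by (intro DERIV_diff DERIV_cdivide d5)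
    qed
    also have "(1 / (1 + u\<^sup>2) - (1 * (1 + u\<^sup>2) - u * (2 * u)) / ((1 + u\<^sup>2) * (1 + u\<^sup>2))) / 2 - (5 / (5 + u\<^sup>2) - 1 / (1 + u\<^sup>2)) / 4 = u\<^sup>2 / (1 + u\<^sup>2) * (1 / (1 + u\<^sup>2) - 1 / (5 + u\<^sup>2))"
      using p[of u] by (simp add: divide_simps) (simp add: power2_eq_square algebra_simps)
    finally show "(F has_real_derivative u\<^sup>2 / (1 + u\<^sup>2) * (1 / (1 + u\<^sup>2) - 1 / (5 + u\<^sup>2))) (at u)" .
    show "0 \<le> u\<^sup>2 / (1 + u\<^sup>2) * (1 / (1 + u\<^sup>2) - 1 / (5 + u\<^sup>2))"
      using p[of u] by (intro mult_nonneg_nonneg) (auto intro!: divide_left_mono)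
  next
    have "(F \<longlongrightarrow> (pi / 2 - 0) / 2 - (sqrt 5 * (pi / 2) - pi / 2) / 4) at_top"
      unfolding F_def
    proof (intro tendsto_intros)
      show "((\<lambda>u :: real. u / (1 + u\<^sup>2)) \<longlongrightarrow> 0) at_top" by real_asymp
      have "filterlim (\<lambda>u :: real. u / sqrt 5) at_top at_top" by real_asymp
      from filterlim_compose[OF tendsto_arctan_at_top this] show "((\<lambda>u. arctan (u / sqrt 5)) \<longlongrightarrow> pi / 2) at_top" .
    qed (rule tendsto_arctan_at_top | simp)+
    also have "(pi / 2 - 0) / 2 - (sqrt 5 * (pi / 2) - pi / 2) / 4 = pi / 4 - (sqrt 5 - 1) * pi / 8" by (simp add: field_simps)
    finally show "(F \<longlongrightarrow> pi / 4 - (sqrt 5 - 1) * pi / 8) at_top" .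
  qed measurable
  then show ?thesis by (simp add: F_def)
qed

lemma integral_rational_B:
  assumes b: "1 < b"
  shows "(\<integral>\<^sup>+u. ennreal (1 / ((1 + u\<^sup>2) * (u\<^sup>2 + b\<^sup>2)\<^sup>2)) \<partial>lborel) = ennreal (pi * (1 + 2 * b) / (2 * b ^ 3 * (1 + b)\<^sup>2))"
proof -
  define \<delta> where "\<delta> = b\<^sup>2 - 1"
  have \<delta>: "\<delta> > 0" using b by (simp add: \<delta>_def power2_eq_square mult_strict_mono less_1_mult)
  have p: "1 + u\<^sup>2 > 0" "u\<^sup>2 + b\<^sup>2 > 0" for u :: real using b by (auto intro: add_pos_nonneg add_nonneg_pos)
  \<comment> \<open>Partial fractions with \<open>Q = u^2 + b^2\<close>: \<open>1 / ((1 + u^2) *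
    Q^2) = (1 / (1 + u^2) - 1 / Q) / \<delta>^2 - 1 / (\<delta> * Q^2)\<close>. The factor 2 comes
    from folding the line onto a half-line.\<close>
  define F where "F u = 2 * ((arctan u - arctan (u / b) / b) / \<delta>\<^sup>2 - (u / (2 * b\<^sup>2 * (u\<^sup>2 + b\<^sup>2)) + arctan (u / b) / (2 * b ^ 3)) / \<delta>)" for u
  have db: "((\<lambda>u. arctan (u / b)) has_real_derivative b / (u\<^sup>2 + b\<^sup>2)) (at u)" for u
    using b p[of u] by (auto intro!: derivative_eq_intros simp: power_divide divide_simps power2_eq_square add_pos_pos) (simp add: algebra_simps)?
  have d1: "((\<lambda>u. u / (2 * b\<^sup>2 * (u\<^sup>2 + b\<^sup>2))) has_real_derivative (b\<^sup>2 - u\<^sup>2) / (2 * b\<^sup>2 * (u\<^sup>2 + b\<^sup>2)\<^sup>2)) (at u)" for u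
  proof -
    have "2 * b\<^sup>2 * (u\<^sup>2 + b\<^sup>2) \<noteq> 0" using b p[of u] by simp
    then show ?thesis using b p[of u]
      by (auto intro!: derivative_eq_intros simp: divide_simps power2_eq_square) (simp add: algebra_simps)?
  qed
  have "(\<integral>\<^sup>+u. ennreal (1 / ((1 + u\<^sup>2) * (u\<^sup>2 + b\<^sup>2)\<^sup>2)) \<partial>lborel) = (\<integral>\<^sup>+u. of_bool (0 < u) * (2 * ennreal (1 / ((1 + u\<^sup>2) * (u\<^sup>2 + b\<^sup>2)\<^sup>2))) \<partial>lborel)"
    by (rule nn_integral_even) auto
  also have "\<dots> = (\<integral>\<^sup>+u. of_bool (0 < u) * ennreal (2 / ((1 + u\<^sup>2) * (u\<^sup>2 + b\<^sup>2)\<^sup>2)) \<partial>lborel)"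
    by (intro nn_integral_cong) (simp add: ennreal_numeral[symmetric] ennreal_mult[symmetric] del: ennreal_numeral)
  also have "\<dots> = ennreal (pi * (1 + 2 * b) / (2 * b ^ 3 * (1 + b)\<^sup>2) - F 0)"
  proof (rule nn_integral_FTC_Ioi)
    fix u :: real
    have "(F has_real_derivative 2 * ((1 / (1 + u\<^sup>2) - (b / (u\<^sup>2 + b\<^sup>2)) / b) / \<delta>\<^sup>2 - ((b\<^sup>2 - u\<^sup>2) / (2 * b\<^sup>2 * (u\<^sup>2 + b\<^sup>2)\<^sup>2) + (b / (u\<^sup>2 + b\<^sup>2)) / (2 * b ^ 3)) / \<delta>)) (at u)"
      unfolding F_def by (intro DERIV_cmult DERIV_diff DERIV_add DERIV_cdivide db d1) (use DERIV_arctan[of u] in \<open>simp add: inverse_eq_divide\<close>)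
    also have "2 * ((1 / (1 + u\<^sup>2) - (b / (u\<^sup>2 + b\<^sup>2)) / b) / \<delta>\<^sup>2 - ((b\<^sup>2 - u\<^sup>2) / (2 * b\<^sup>2 * (u\<^sup>2 + b\<^sup>2)\<^sup>2) + (b / (u\<^sup>2 + b\<^sup>2)) / (2 * b ^ 3)) / \<delta>)
      = 2 / ((1 + u\<^sup>2) * (u\<^sup>2 + b\<^sup>2)\<^sup>2)"
    proof -
      have A: "(b\<^sup>2 - u\<^sup>2) / (2 * b\<^sup>2 * (u\<^sup>2 + b\<^sup>2)\<^sup>2) + (b / (u\<^sup>2 + b\<^sup>2)) / (2 * b ^ 3) = 1 / (u\<^sup>2 + b\<^sup>2)\<^sup>2"
        using b p(2)[of u] by (simp add: divide_simps) (simp add: power2_eq_square power3_eq_cube algebra_simps)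
      have B: "1 / (1 + u\<^sup>2) - (b / (u\<^sup>2 + b\<^sup>2)) / b = \<delta> / ((1 + u\<^sup>2) * (u\<^sup>2 + b\<^sup>2))"
        using b p[of u] by (simp add: divide_simps \<delta>_def)
      have C: "2 * (\<delta> / (P * Q) / \<delta>\<^sup>2 - 1 / Q\<^sup>2 / \<delta>) = 2 / (P * Q\<^sup>2)" if "P > 0" "Q > 0" "Q = P + \<delta>" for P Q
        using that \<delta> by (simp add: divide_simps) (simp add: power2_eq_square algebra_simps)
      show ?thesis unfolding A B by (rule C) (use p[of u] in \<open>auto simp: \<delta>_def\<close>)
    qed
    finally show "(F has_real_derivative 2 / ((1 + u\<^sup>2) * (u\<^sup>2 + b\<^sup>2)\<^sup>2)) (at u)" .
    show "0 \<le> 2 / ((1 + u\<^sup>2) * (u\<^sup>2 + b\<^sup>2)\<^sup>2)" using p[of u] by simp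
  next
    have "filterlim (\<lambda>u. u / b) at_top at_top" using b by real_asymp
    note ab = filterlim_compose[OF tendsto_arctan_at_top this]
    have "(F \<longlongrightarrow> 2 * ((pi / 2 - (pi / 2) / b) / \<delta>\<^sup>2 - (0 + (pi / 2) / (2 * b ^ 3)) / \<delta>)) at_top"
      unfolding F_def
    proof (intro tendsto_intros ab tendsto_arctan_at_top)
      show "((\<lambda>u. u / (2 * b\<^sup>2 * (u\<^sup>2 + b\<^sup>2))) \<longlongrightarrow> 0) at_top" using b by real_asymp
    qed (use b \<delta> in auto)
    also have "2 * ((pi / 2 - (pi / 2) / b) / \<delta>\<^sup>2 - (0 + (pi / 2) / (2 * b ^ 3)) / \<delta>) = pi * (1 + 2 * b) / (2 * b ^ 3 * (1 + b)\<^sup>2)"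
    proof -
      have "\<delta> = (b - 1) * (b + 1)" by (simp add: \<delta>_def power2_eq_square algebra_simps)
      then show ?thesis using b by (simp add: divide_simps) (simp add: power2_eq_square power3_eq_cube algebra_simps)
    qed
    finally show "(F \<longlongrightarrow> pi * (1 + 2 * b) / (2 * b ^ 3 * (1 + b)\<^sup>2)) at_top" .
  qed measurable
  finally show ?thesis by (simp add: F_def)
qed

lemma integral_algebraic_B:
  "(\<integral>\<^sup>+v. of_bool (0 < v \<and> v \<le> 1) * ennreal ((1 + 2 * sqrt (1 + v\<^sup>2 / 4)) / (sqrt (1 + v\<^sup>2 / 4) ^ 3 * (1 + sqrt (1 + v\<^sup>2 / 4))\<^sup>2)) \<partial>lborel)
    = ennreal (76 / 15 * sqrt 5 - 32 / 3)"
proof -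
  define b where "b v = sqrt (1 + v\<^sup>2 / 4)" for v :: real
  \<comment> \<open>For \<open>v = 2 sinh x\<close> one has \<open>b v = cosh x\<close>, and
    \<open>q v = 2 tanh (x / 2)\<close> is the variable in which the integrand is rational. The
    primitive uses \<open>(v / b)' = 1 / b^3\<close>, \<open>q' = 1 / (b * (1 + b))\<close> and
    \<open>q^2 = 4 * (b - 1) / (1 + b)\<close>.\<close>
  define q where "q v = v / (1 + b v)" for v
  define F where "F v = v / b v - q v / 2 + q v ^ 3 / 24" for v
  have b: "b v > 0" "1 + b v > 0" "v\<^sup>2 = 4 * ((b v)\<^sup>2 - 1)" for v
  proof -
    have pos: "1 + v\<^sup>2 / 4 > 0" by (simp add: add_pos_nonneg)
    then show "b v > 0" by (simp add: b_def)
    then show "1 + b v > 0" by simp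
    show "v\<^sup>2 = 4 * ((b v)\<^sup>2 - 1)" using pos by (simp add: b_def)
  qed
  have db: "(b has_real_derivative v / (4 * b v)) (at v)" for v
  proof -
    have "1 + v\<^sup>2 / 4 > 0" by (simp add: add_pos_nonneg)
    then show ?thesis unfolding b_def by (auto intro!: derivative_eq_intros simp: field_simps)
  qed
  have dq: "(q has_real_derivative 1 / (b v * (1 + b v))) (at v)" for v
  proof -
    have "(q has_real_derivative (1 * (1 + b v) - v * (0 + v / (4 * b v))) / ((1 + b v) * (1 + b v))) (at v)"
      unfolding q_def by (intro DERIV_divide DERIV_ident DERIV_add DERIV_const db) (use b[of v] in simp)
    also have "(1 * (1 + b v) - v * (0 + v / (4 * b v))) / ((1 + b v) * (1 + b v)) = 1 / (b v * (1 + b v))"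
    proof -
      have "v * (0 + v / (4 * b v)) = ((b v)\<^sup>2 - 1) / b v" using b[of v] by (simp add: power2_eq_square divide_simps)
      then show ?thesis using b(1,2)[of v] by (simp add: divide_simps) (simp add: power2_eq_square algebra_simps)
    qed
    finally show ?thesis .
  qed
  have dF: "(F has_real_derivative (1 + 2 * b v) / (b v ^ 3 * (1 + b v)\<^sup>2)) (at v)" for v
  proof -
    have "(F has_real_derivative (1 * b v - v * (v / (4 * b v))) / (b v * b v) - (1 / (b v * (1 + b v))) / 2 + (of_nat 3 * (1 / (b v * (1 + b v)) * q v ^ (3 - Suc 0))) / 24) (at v)"
      unfolding F_def by (intro DERIV_add DERIV_diff DERIV_cdivide DERIV_divide DERIV_ident db dq DERIV_power) (use b[of v] in simp)
    also have "(1 * b v - v * (v / (4 * b v))) / (b v * b v) = 1 / b v ^ 3"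
    proof -
      have "v * (v / (4 * b v)) = ((b v)\<^sup>2 - 1) / b v" using b[of v] by (simp add: power2_eq_square divide_simps)
      then show ?thesis using b(1,2)[of v] by (simp add: divide_simps) (simp add: power2_eq_square power3_eq_cube algebra_simps)
    qed
    also have "q v ^ (3 - Suc 0) = 4 * (b v - 1) / (1 + b v)"
    proof -
      have "q v ^ (3 - Suc 0) = v\<^sup>2 / (1 + b v)\<^sup>2" by (simp add: q_def power_divide numeral_2_eq_2)
      also have "\<dots> = 4 * ((b v)\<^sup>2 - 1) / (1 + b v)\<^sup>2" by (simp only: b(3)[of v])
      also have "\<dots> = 4 * (b v - 1) / (1 + b v)"
        using b(2)[of v] by (simp add: divide_simps) (simp add: power2_eq_square algebra_simps)
      finally show ?thesis .
    qed
    also have "1 / b v ^ 3 - (1 / (b v * (1 + b v))) / 2 + (of_nat 3 * (1 / (b v * (1 + b v)) * (4 * (b v - 1) / (1 + b v)))) / 24 = (1 + 2 * b v) / (b v ^ 3 * (1 + b v)\<^sup>2)"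
      using b(1,2)[of v] by (simp add: divide_simps) (simp add: power2_eq_square power3_eq_cube algebra_simps)
    finally show ?thesis .
  qed
  have "(\<integral>\<^sup>+v. of_bool (0 < v \<and> v \<le> 1) * ennreal ((1 + 2 * b v) / (b v ^ 3 * (1 + b v)\<^sup>2)) \<partial>lborel)
    = (\<integral>\<^sup>+v. ennreal ((1 + 2 * b v) / (b v ^ 3 * (1 + b v)\<^sup>2)) * indicator {0..1} v \<partial>lborel)"
    by (rule nn_integral_cong_AE) (use AE_lborel_singleton[of 0] in \<open>eventually_elim, auto split: split_indicator\<close>)
  also have "\<dots> = ennreal (F 1 - F 0)"
  proof (rule nn_integral_FTC_Icc)
    show "(F has_real_derivative (1 + 2 * b v) / (b v ^ 3 * (1 + b v)\<^sup>2)) (at v)" for v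
      by (rule dF)
    show "(\<lambda>v. (1 + 2 * b v) / (b v ^ 3 * (1 + b v)\<^sup>2)) \<in> borel_measurable borel"
      unfolding b_def by measurable
    show "0 \<le> (1 + 2 * b v) / (b v ^ 3 * (1 + b v)\<^sup>2)" for v using b[of v] by (intro divide_nonneg_nonneg) auto
  qed simp
  also have "F 1 - F 0 = 76 / 15 * sqrt 5 - 32 / 3"
  proof -
    have b1: "b 1 = sqrt 5 / 2" by (simp add: b_def real_sqrt_divide)
    have q1: "q 1 = 2 * (sqrt 5 - 2)"
    proof -
      have "2 * (sqrt 5 - 2) * (1 + sqrt 5 / 2) = 1" by (simp add: algebra_simps)
      moreover have "1 + sqrt 5 / 2 \<noteq> (0::real)" by (smt (verit) real_sqrt_ge_0_iff divide_nonneg_pos)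
      ultimately show ?thesis by (simp add: q_def b1 field_simps)
    qed
    have "(sqrt 5 - 2) ^ 3 = 17 * sqrt 5 - 38" by (simp add: power3_eq_cube algebra_simps)
    then have q3: "q 1 ^ 3 = 8 * (17 * sqrt 5 - 38)" by (simp only: q1 power_mult_distrib) simp
    have "1 / b 1 = 2 * sqrt 5 / 5" by (simp add: b1 field_simps)
    then show ?thesis unfolding F_def q3 unfolding q1 by (simp add: q_def field_simps)
  qed
  finally show ?thesis by (simp only: b_def)
qed

section \<open>Tangents to a finite convex hull\<close>

definition cross2 :: "real \<times> real \<Rightarrow> real \<times> real \<Rightarrow> real" where
  "cross2 u v = fst u * snd v - snd u * fst v"

text \<open>Seen from \<open>x\<close>, a separating direction \<open>v\<close> puts all points into
  an open half-plane. There the slope \<open>f\<close> orders them by angle, and the one of least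
  slope has all others on its left, strictly by general position.\<close>

lemma not_in_convex_hull_imp_tangent:
  fixes p :: "'i \<Rightarrow> real \<times> real"
  assumes fin: "finite I" "I \<noteq> {}"
    and gen: "\<And>i j. i \<in> I \<Longrightarrow> j \<in> I \<Longrightarrow> i \<noteq> j \<Longrightarrow> cross2 (p i - x) (p j - x) \<noteq> 0"
    and x: "x \<notin> convex hull (p ` I)"
  shows "\<exists>i\<in>I. \<forall>j\<in>I - {i}. cross2 (p i - x) (p j - x) > 0"
proof -
  have "closed (convex hull (p ` I))" "convex (convex hull (p ` I))"
    using fin by (auto intro!: compact_imp_closed finite_imp_compact_convex_hull)
  from separating_hyperplane_closed_point[OF this(2,1) x]
  obtain v c where v: "v \<bullet> x < c" "\<And>y. y \<in> convex hull (p ` I) \<Longrightarrow> v \<bullet> y > c" by blast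
  have pos: "v \<bullet> (p j - x) > 0" if "j \<in> I" for j
    using v(1) v(2)[OF hull_inc, of "p j"] that by (auto simp: inner_diff_right)
  define f where "f j = cross2 v (p j - x) / (v \<bullet> (p j - x))" for j
  obtain i where i: "i \<in> I" "\<And>j. j \<in> I \<Longrightarrow> f i \<le> f j"
    using fin by (metis (no_types, lifting) arg_min_if_finite(1) arg_min_least)
  have "v \<noteq> 0" using pos[OF i(1)] by auto
  then have vv: "v \<bullet> v > 0" by simp
  \<comment> \<open>Cross products in terms of components along \<open>v\<close> and across it; it
    turns the comparison of slopes into the sign of a cross product.\<close>
  have id: "(v \<bullet> v) * cross2 a b = (v \<bullet> a) * cross2 v b - (v \<bullet> b) * cross2 v a" for a b
    by (simp add: cross2_def inner_prod_def algebra_simps)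
  show ?thesis
  proof (intro bexI[OF _ i(1)] ballI)
    fix j assume j: "j \<in> I - {i}"
    have "cross2 v (p i - x) * (v \<bullet> (p j - x)) \<le> cross2 v (p j - x) * (v \<bullet> (p i - x))"
      using i(2)[of j] j pos[of j] pos[of i] i(1) by (simp add: f_def field_simps)
    then have "(v \<bullet> v) * cross2 (p i - x) (p j - x) \<ge> 0"
      unfolding id by (simp add: algebra_simps)
    then have "cross2 (p i - x) (p j - x) \<ge> 0" using vv by (simp add: zero_le_mult_iff)
    then show "cross2 (p i - x) (p j - x) > 0" using gen[of i j] i(1) j by force
  qed
qed

text \<open>If \<open>x\<close> were a convex combination, the weighted sum of the vectors
  \<open>y - x\<close> would vanish. Its cross product with \<open>p i - x\<close> is a sum of
  nonnegative terms, so all weight sits on \<open>p i\<close> and \<open>x = p i\<close>.\<close>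

lemma tangent_imp_not_in_convex_hull:
  fixes p :: "'i \<Rightarrow> real \<times> real"
  assumes fin: "finite I" and i: "i \<in> I" "\<And>j. j \<in> I - {i} \<Longrightarrow> cross2 (p i - x) (p j - x) > 0"
    and ne: "p i \<noteq> x"
  shows "x \<notin> convex hull (p ` I)"
proof
  assume "x \<in> convex hull (p ` I)"
  then obtain u where u: "\<And>j. j \<in> p ` I \<Longrightarrow> 0 \<le> u j" "sum u (p ` I) = 1" "(\<Sum>y\<in>p ` I. u y *\<^sub>R y) = x"
    using fin unfolding convex_hull_finite[OF finite_imageI[OF fin]] by blast
  have lin: "cross2 (p i - x) (\<Sum>y\<in>T. g y) = (\<Sum>y\<in>T. cross2 (p i - x) (g y))" for g and T :: "(real\<times>real) set"
    by (induction T rule: infinite_finite_induct) (auto simp: cross2_def algebra_simps)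
  have sc: "cross2 w (t *\<^sub>R y) = t * cross2 w y" for w t y by (simp add: cross2_def algebra_simps)
  have "(\<Sum>y\<in>p ` I. u y *\<^sub>R (y - x)) = 0"
    using u by (simp add: scaleR_diff_right sum_subtractf flip: scaleR_left.sum)
  then have "0 = (\<Sum>y\<in>p ` I. u y * cross2 (p i - x) (y - x))"
    using lin[of "\<lambda>y. u y *\<^sub>R (y - x)" "p ` I"] by (simp add: sc) (simp add: cross2_def)
  moreover have "0 \<le> u y * cross2 (p i - x) (y - x)" if y: "y \<in> p ` I" for y
  proof (cases "y = p i")
    case False
    then obtain j where "j \<in> I - {i}" "y = p j" using y by auto
    then show ?thesis using u(1)[OF y] i(2)[of j] by simp
  qed (simp add: cross2_def)
  ultimately have z: "u y * cross2 (p i - x) (y - x) = 0" if "y \<in> p ` I" for y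
    using fin that by (metis (mono_tags, lifting) finite_imageI sum_nonneg_eq_0_iff)
  have "u y = 0" if y: "y \<in> p ` I" "y \<noteq> p i" for y
  proof -
    obtain j where "j \<in> I - {i}" "y = p j" using y by auto
    then show ?thesis using z[OF y(1)] i(2)[of j] by auto
  qed
  then have "(\<Sum>y\<in>p ` I. u y *\<^sub>R y) = u (p i) *\<^sub>R p i" "sum u (p ` I) = u (p i)"
    using fin i(1) by (subst sum.remove[of _ "p i"], auto intro!: sum.neutral)+
  then show False using u ne by simp
qed

lemma cross2_antisym: "cross2 u v = - cross2 v u"
  by (simp add: cross2_def)

text \<open>At most one tangent point exists, since of two each would have the other strictly on its
  left, against antisymmetry of \<open>cross2\<close>.\<close>

lemma sum_tangent_indicator:
  fixes p :: "'i \<Rightarrow> real \<times> real"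
  assumes fin: "finite I" "I \<noteq> {}"
    and gen: "\<And>i j. i \<in> I \<Longrightarrow> j \<in> I \<Longrightarrow> i \<noteq> j \<Longrightarrow> cross2 (p i - x) (p j - x) \<noteq> 0"
    and ne: "\<And>i. i \<in> I \<Longrightarrow> p i \<noteq> x"
  shows "(\<Sum>i\<in>I. of_bool (\<forall>j\<in>I - {i}. cross2 (p i - x) (p j - x) > 0)) + of_bool (x \<in> convex hull (p ` I))
      = (1 :: ennreal)"
proof (cases "x \<in> convex hull (p ` I)")
  case True
  then have "\<not> (\<forall>j\<in>I - {i}. cross2 (p i - x) (p j - x) > 0)" if "i \<in> I" for i
    using tangent_imp_not_in_convex_hull[OF fin(1) that, of p x] ne[OF that] by blast
  then have "(\<Sum>i\<in>I. of_bool (\<forall>j\<in>I - {i}. cross2 (p i - x) (p j - x) > 0)) = (0 :: ennreal)"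
    by (intro sum.neutral) auto
  with True show ?thesis by simp
next
  case False
  obtain i where i: "i \<in> I" "\<forall>j\<in>I - {i}. cross2 (p i - x) (p j - x) > 0"
    using not_in_convex_hull_imp_tangent[OF fin gen False] by blast
  have "\<not> (\<forall>j\<in>I - {k}. cross2 (p k - x) (p j - x) > 0)" if "k \<in> I - {i}" for k
    using i that cross2_antisym[of "p k - x" "p i - x"] by force
  then have "(\<Sum>k\<in>I. of_bool (\<forall>j\<in>I - {k}. cross2 (p k - x) (p j - x) > 0)) = (1 :: ennreal)"
    using i fin by (subst sum.remove[of _ i]) (auto intro!: sum.neutral)
  with False show ?thesis by simp
qed

text \<open>Strict separation from finitely many points is an open condition on the normal vector,
  so countably many half-planes cut out the hull. This makes membership jointly measurable in the
  points and \<open>x\<close>.\<close>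

lemma in_convex_hull_iff_rational:
  fixes K :: "(real \<times> real) set"
  assumes fin: "finite I" "I \<noteq> {}"
  shows "x \<in> convex hull (p ` I) \<longleftrightarrow>
    (\<forall>v\<in>\<rat> \<times> \<rat>. \<exists>i\<in>I. v \<bullet> x \<le> v \<bullet> (p i :: real \<times> real))"
proof
  assume x: "x \<in> convex hull (p ` I)"
  show "\<forall>v\<in>\<rat> \<times> \<rat>. \<exists>i\<in>I. v \<bullet> x \<le> v \<bullet> p i"
  proof (intro ballI, rule ccontr)
    fix v assume "\<not> (\<exists>i\<in>I. v \<bullet> x \<le> v \<bullet> p i)"
    then have "p ` I \<subseteq> {y. v \<bullet> y < v \<bullet> x}" by auto
    then have "convex hull (p ` I) \<subseteq> {y. v \<bullet> y < v \<bullet> x}"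
      by (intro hull_minimal convex_halfspace_lt)
    with x show False by auto
  qed
next
  assume r: "\<forall>v\<in>\<rat> \<times> \<rat>. \<exists>i\<in>I. v \<bullet> x \<le> v \<bullet> p i"
  show "x \<in> convex hull (p ` I)"
  proof (rule ccontr)
    assume x: "x \<notin> convex hull (p ` I)"
    have "closed (convex hull (p ` I))" "convex (convex hull (p ` I))"
      using fin by (auto intro!: compact_imp_closed finite_imp_compact_convex_hull)
    from separating_hyperplane_closed_point[OF this(2,1) x]
    obtain v c where v: "v \<bullet> x < c" "\<And>y. y \<in> convex hull (p ` I) \<Longrightarrow> v \<bullet> y > c" by blast
    have pos: "v \<bullet> (p j - x) > 0" if "j \<in> I" for j
      using v(1) v(2)[OF hull_inc, of "p j"] that by (auto simp: inner_diff_right)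
    define S where "S = (\<Inter>j\<in>I. {w. w \<bullet> (p j - x) > 0})"
    have "open S" unfolding S_def
      by (intro open_INT ballI, rule fin, subst inner_commute, rule open_halfspace_gt)
    moreover have "v \<in> S" using pos by (auto simp: S_def)
    ultimately obtain e where e: "e > 0" "ball v e \<subseteq> S" by (auto simp: open_contains_ball)
    have "fst v - e/2 < fst v + e/2" using e by simp
    then obtain q1 where q1: "q1 \<in> \<rat>" "fst v - e/2 < q1" "q1 < fst v + e/2"
      using Rats_dense_in_real by blast
    have d1: "\<bar>q1 - fst v\<bar> < e / 2" using q1(2,3) by linarith
    have "snd v - e/2 < snd v + e/2" using e by simp
    then obtain q2 where q2: "q2 \<in> \<rat>" "snd v - e/2 < q2" "q2 < snd v + e/2"
      using Rats_dense_in_real by blast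
    have d2: "\<bar>q2 - snd v\<bar> < e / 2" using q2(2,3) by linarith
    have "dist v (q1, q2) \<le> \<bar>q1 - fst v\<bar> + \<bar>q2 - snd v\<bar>"
      using sqrt_sum_squares_le_sum_abs[of "fst v - q1" "snd v - q2"]
      by (simp add: dist_prod_def dist_real_def abs_minus_commute power2_commute)
    then have "(q1, q2) \<in> ball v e" using d1 d2 by simp
    then have "(q1, q2) \<in> S" using e by blast
    then have S: "\<And>j. j \<in> I \<Longrightarrow> (- q1, - q2) \<bullet> p j < (- q1, - q2) \<bullet> x"
      by (auto simp: S_def inner_prod_def algebra_simps)
    have "(- q1, - q2) \<in> \<rat> \<times> \<rat>" using q1 q2 by auto
    with r obtain i where "i \<in> I" "(- q1, - q2) \<bullet> x \<le> (- q1, - q2) \<bullet> p i" by blast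
    with S[of i] show False by simp
  qed
qed

lemma measurable_in_convex_hull:
  fixes p :: "'i \<Rightarrow> 'w \<Rightarrow> real \<times> real"
  assumes fin: "finite I" and [measurable]: "\<And>i. i \<in> I \<Longrightarrow> p i \<in> borel_measurable M"
  shows "Measurable.pred (M \<Otimes>\<^sub>M borel) (\<lambda>(w, x). x \<in> convex hull ((\<lambda>i. p i w) ` I))"
proof (cases "I = {}")
  case False
  have [measurable]: "countable (\<rat> \<times> \<rat> :: (real \<times> real) set)"
    by (simp add: countable_rat)
  show ?thesis unfolding in_convex_hull_iff_rational[OF fin False] case_prod_beta
    using fin by measurable
qed simp

section \<open>The expected area of an isotropic random polygon\<close>

text \<open>An exceptional \<open>x\<close> lies on one of finitely many lines through two of the
  points, or is a point itself.\<close>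

lemma AE_lborel_generic:
  fixes p :: "'i \<Rightarrow> real \<times> real"
  assumes fin: "finite I" and ne: "\<And>i j. i \<in> I \<Longrightarrow> j \<in> I \<Longrightarrow> i \<noteq> j \<Longrightarrow> p i \<noteq> p j"
  shows "AE x in lborel. (\<forall>i\<in>I. \<forall>j\<in>I. i \<noteq> j \<longrightarrow> cross2 (p i - x) (p j - x) \<noteq> 0) \<and> (\<forall>i\<in>I. p i \<noteq> x)"
proof -
  have 1: "AE x in lborel. i \<noteq> j \<longrightarrow> cross2 (p i - x) (p j - x) \<noteq> 0" if ij: "i \<in> I" "j \<in> I" for i j
  proof (cases "i = j")
    case False
    define d where "d = p j - p i"
    define a where "a = (snd d, - fst d)"
    have "d \<noteq> 0" using ne[OF ij False] by (simp add: d_def)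
    then have a: "a \<noteq> 0" by (auto simp: a_def prod_eq_iff)
    have "cross2 (p i - x) (p j - x) = a \<bullet> p i - a \<bullet> x" for x
      by (simp add: cross2_def a_def d_def inner_prod_def algebra_simps)
    then have eq: "{x. cross2 (p i - x) (p j - x) = 0} = {x. a \<bullet> x = a \<bullet> p i}" by auto
    have "{x. a \<bullet> x = a \<bullet> p i} \<in> null_sets (completion lborel)"
      using negligible_hyperplane[of a "a \<bullet> p i"] a by (simp add: negligible_iff_null_sets)
    then have "{x. a \<bullet> x = a \<bullet> p i} \<in> null_sets lborel"
      by (subst (asm) null_sets_completion_iff) (auto intro!: borel_closed closed_hyperplane)
    then show ?thesis using eq by (intro AE_I'[of "{x. a \<bullet> x = a \<bullet> p i}"]) auto
  qed simp
  have 2: "AE x in lborel. p i \<noteq> x" for i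
    using AE_lborel_singleton[of "p i"] by (auto elim: AE_mp)
  show ?thesis
    using fin 1 2 by (simp add: AE_finite_all)
qed

lemma borel_measurable_cross2 [measurable (raw)]:
  assumes "f \<in> borel_measurable M" "g \<in> borel_measurable M"
  shows "(\<lambda>x. cross2 (f x) (g x)) \<in> borel_measurable M"
  using assms by (rule borel_measurable_continuous_Pair) (auto simp: cross2_def intro!: continuous_intros)

lemma ennreal_of_bool: "ennreal (of_bool P) = of_bool P"
  by (cases P) auto

lemma nn_integral_gaussian:
  assumes "\<alpha> > 0"
  shows "(\<integral>\<^sup>+x. ennreal (exp (- \<alpha> * x\<^sup>2 / 2)) \<partial>lborel) = ennreal (sqrt (2 * pi / \<alpha>))"
proof -
  have *: "exp (- \<alpha> * x\<^sup>2 / 2) = sqrt (2 * pi / \<alpha>) * normal_density 0 (1 / sqrt \<alpha>) x" for x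
    using assms by (simp add: normal_density_def field_simps power_divide real_sqrt_divide real_sqrt_mult)
  interpret N: prob_space "density lborel (normal_density 0 (1 / sqrt \<alpha>))"
    by (rule prob_space_normal_density) (use assms in simp)
  have "(\<integral>\<^sup>+x. ennreal (normal_density 0 (1 / sqrt \<alpha>) x) \<partial>lborel) = 1"
    using N.emeasure_space_1 by (simp add: emeasure_density)
  then show ?thesis unfolding * using assms
    by (simp add: ennreal_mult nn_integral_cmult)
qed

lemma nn_integral_gaussian_plane:
  assumes "\<alpha> > 0"
  shows "(\<integral>\<^sup>+z. ennreal (exp (- \<alpha> * (norm z)\<^sup>2 / 2)) \<partial>(lborel :: (real \<times> real) measure)) = ennreal (2 * pi / \<alpha>)"
proof -
  have m: "(\<lambda>z. ennreal (exp (- \<alpha> * (norm z)\<^sup>2 / 2))) \<in> borel_measurable (lborel \<Otimes>\<^sub>M (lborel :: real measure) :: (real \<times> real) measure)"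
    unfolding lborel_prod by measurable
  have "(\<integral>\<^sup>+z. ennreal (exp (- \<alpha> * (norm z)\<^sup>2 / 2)) \<partial>(lborel :: (real \<times> real) measure))
      = (\<integral>\<^sup>+x. \<integral>\<^sup>+y. ennreal (exp (- \<alpha> * x\<^sup>2 / 2)) * ennreal (exp (- \<alpha> * y\<^sup>2 / 2)) \<partial>lborel \<partial>lborel)"
    by (subst lborel_prod[symmetric], subst lborel.nn_integral_fst[symmetric], rule m)
       (simp_all add: norm_Pair exp_add[symmetric] ennreal_mult[symmetric] field_simps add_divide_distrib)
  also have "\<dots> = ennreal (sqrt (2 * pi / \<alpha>)) * ennreal (sqrt (2 * pi / \<alpha>))"
    using nn_integral_gaussian[OF assms] by (simp add: nn_integral_cmult nn_integral_multc)
  also have "\<dots> = ennreal (2 * pi / \<alpha>)"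
    using assms by (simp add: ennreal_mult[symmetric])
  finally show ?thesis .
qed

text \<open>\<open>indep\<close> concerns one second coordinate at a time against all first
  coordinates. \<open>gauss\<close> expresses that \<open>Y i\<close> is centred Gaussian of
  variance \<open>K i\<close> through a transform, which also covers the point at the origin, where
  \<open>K i = 0\<close> and there is no density.\<close>

locale isotropic_points = prob_space M for M :: "'w measure" +
  fixes I :: "'i set" and X Y :: "'i \<Rightarrow> 'w \<Rightarrow> real" and K :: "'i \<Rightarrow> real"
  assumes fin: "finite I" and ne: "I \<noteq> {}"
    and X_rv [measurable]: "\<And>i. i \<in> I \<Longrightarrow> X i \<in> borel_measurable M"
    and Y_rv [measurable]: "\<And>i. i \<in> I \<Longrightarrow> Y i \<in> borel_measurable M"
    and K_nonneg: "\<And>i. i \<in> I \<Longrightarrow> 0 \<le> K i"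
    and rot: "\<And>c s. c\<^sup>2 + s\<^sup>2 = 1 \<Longrightarrow>
      distr M (\<Pi>\<^sub>M i\<in>I. borel) (\<lambda>w. \<lambda>i\<in>I. (X i w, Y i w))
      = distr M (\<Pi>\<^sub>M i\<in>I. borel) (\<lambda>w. \<lambda>i\<in>I. (c * X i w - s * Y i w, s * X i w + c * Y i w))"
    and indep: "\<And>i G k. i \<in> I \<Longrightarrow> G \<in> borel_measurable (\<Pi>\<^sub>M i\<in>I. borel) \<Longrightarrow> k \<in> borel_measurable borel \<Longrightarrow>
      (\<integral>\<^sup>+w. G (\<lambda>j\<in>I. X j w) * k (Y i w) \<partial>M) = (\<integral>\<^sup>+w. G (\<lambda>j\<in>I. X j w) \<partial>M) * (\<integral>\<^sup>+w. k (Y i w) \<partial>M)"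
    and gauss: "\<And>i \<epsilon> \<rho>. i \<in> I \<Longrightarrow> 0 < \<epsilon> \<Longrightarrow>
      (\<integral>\<^sup>+w. ennreal (exp (- \<epsilon> * (Y i w - \<rho>)\<^sup>2 / 2)) \<partial>M)
      = ennreal (exp (- \<epsilon> * \<rho>\<^sup>2 / (2 * (1 + \<epsilon> * K i))) / sqrt (1 + \<epsilon> * K i))"
    and distinct: "\<And>i j. i \<in> I \<Longrightarrow> j \<in> I \<Longrightarrow> i \<noteq> j \<Longrightarrow> AE w in M. X i w \<noteq> X j w"
    and X_sq: "\<And>i. i \<in> I \<Longrightarrow> integrable M (\<lambda>w. (X i w)\<^sup>2)"
begin

definition pt where "pt i w = (X i w, Y i w)"
definition top where "top i w \<longleftrightarrow> (\<forall>j\<in>I - {i}. X j w < X i w)"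

lemma pt_rv [measurable]: "i \<in> I \<Longrightarrow> pt i \<in> borel_measurable M"
  unfolding pt_def by measurable

lemma top_rv [measurable]: "i \<in> I \<Longrightarrow> Measurable.pred M (top i)"
proof -
  assume [measurable]: "i \<in> I"
  have [measurable]: "finite (I - {i})" using fin by simp
  have [measurable]: "j \<in> I - {i} \<Longrightarrow> X j \<in> borel_measurable M" for j by simp
  show ?thesis unfolding top_def by measurable
qed

text \<open>The observer is placed at \<open>pt i w + z\<close>; the tangent condition then depends
  on differences of sample points only, with the sign flipped because \<open>pt i\<close> is seen in
  direction \<open>- z\<close>.\<close>

abbreviation (input) shifted_weight where
  "shifted_weight \<epsilon> i z w \<equiv> ennreal (exp (- \<epsilon> * (norm (pt i w + z))\<^sup>2 / 2)) * of_bool (\<forall>j\<in>I - {i}. cross2 z (pt j w - pt i w) < 0)"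

abbreviation (input) in_hull where "in_hull x w \<equiv> x \<in> convex hull ((\<lambda>i. pt i w) ` I)"

text \<open>Rotate so that \<open>z\<close> points straight down. Being the tangent point seen from
  below at distance \<open>norm z\<close> means having the largest first coordinate, and the weight
  splits into a function of \<open>X i\<close> times one of \<open>Y i\<close>.\<close>

lemma rotate_tangent_integral:
  assumes i: "i \<in> I" and z: "z \<noteq> 0" and e: "\<epsilon> > 0"
  shows "(\<integral>\<^sup>+w. shifted_weight \<epsilon> i z w \<partial>M)
   = (\<integral>\<^sup>+w. ennreal (exp (- \<epsilon> * (X i w)\<^sup>2 / 2)) * of_bool (top i w) * ennreal (exp (- \<epsilon> * (Y i w - norm z)\<^sup>2 / 2)) \<partial>M)"
proof -
  define \<rho> where "\<rho> = norm z"
  obtain z1 z2 where zz: "z = (z1, z2)" by (cases z)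
  have \<rho>: "\<rho> > 0" "\<rho>\<^sup>2 = z1\<^sup>2 + z2\<^sup>2" using z by (auto simp: \<rho>_def zz norm_Pair zero_prod_def sum_power2_gt_zero_iff[of z1 z2])
  \<comment> \<open>Cosine and sine of the rotation that takes \<open>z\<close> to
    \<open>(0, - \<rho>)\<close>.\<close>
  define c where "c = - z2 / \<rho>" define s where "s = - z1 / \<rho>"
  have cs: "c\<^sup>2 + s\<^sup>2 = 1"
  proof -
    have "c\<^sup>2 + s\<^sup>2 = (z1\<^sup>2 + z2\<^sup>2) / \<rho>\<^sup>2" by (simp add: c_def s_def power_divide add_divide_distrib)
    then show ?thesis using \<rho>(1) by (simp add: \<rho>(2)[symmetric])
  qed
  have z1: "z1 = - \<rho> * s" "z2 = - \<rho> * c" using \<rho> by (auto simp: c_def s_def)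
  define F where "F q = ennreal (exp (- \<epsilon> * (norm (q i + (0, - \<rho>)))\<^sup>2 / 2)) *
      of_bool (\<forall>j\<in>I - {i}. cross2 (0, - \<rho>) (q j - q i) < 0)" for q :: "'i \<Rightarrow> real \<times> real"
  have F[measurable]: "F \<in> borel_measurable (\<Pi>\<^sub>M i\<in>I. borel)"
  proof -
    have [measurable]: "finite (I - {i})" "i \<in> I" using fin i by simp_all
    have [measurable]: "j \<in> I - {i} \<Longrightarrow> j \<in> I" for j by simp
    show ?thesis unfolding F_def by measurable
  qed
  have P[measurable]: "(\<lambda>w. \<lambda>i\<in>I. (X i w, Y i w)) \<in> M \<rightarrow>\<^sub>M (\<Pi>\<^sub>M i\<in>I. borel)"
    "(\<lambda>w. \<lambda>i\<in>I. (c * X i w - s * Y i w, s * X i w + c * Y i w)) \<in> M \<rightarrow>\<^sub>M (\<Pi>\<^sub>M i\<in>I. borel)"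
    by measurable
  have n2: "(norm (pt i w + z))\<^sup>2 = (c * X i w - s * Y i w)\<^sup>2 + (s * X i w + c * Y i w - \<rho>)\<^sup>2" for w
  proof -
    have "(c * X i w - s * Y i w)\<^sup>2 + (s * X i w + c * Y i w - \<rho>)\<^sup>2
      = (c\<^sup>2 + s\<^sup>2) * ((X i w)\<^sup>2 + (Y i w)\<^sup>2) + \<rho>\<^sup>2 * 1 - 2 * \<rho> * (s * X i w + c * Y i w)"
      by (simp add: power2_eq_square algebra_simps)
    also have "\<dots> = (X i w + z1)\<^sup>2 + (Y i w + z2)\<^sup>2"
    proof -
      have "(X i w + z1)\<^sup>2 + (Y i w + z2)\<^sup>2
        = (X i w)\<^sup>2 + (Y i w)\<^sup>2 + \<rho>\<^sup>2 * (c\<^sup>2 + s\<^sup>2) - 2 * \<rho> * (s * X i w + c * Y i w)"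
        unfolding z1 by (simp add: power2_eq_square algebra_simps)
      then show ?thesis by (simp add: cs)
    qed
    finally show ?thesis by (simp add: pt_def zz norm_Pair)
  qed
  have cr: "cross2 z (pt j w - pt i w) = \<rho> * (c * X j w - s * Y j w - (c * X i w - s * Y i w))" for j w
    by (simp add: cross2_def zz z1 pt_def algebra_simps)
  have "(\<integral>\<^sup>+w. shifted_weight \<epsilon> i z w \<partial>M)
     = (\<integral>\<^sup>+w. F (\<lambda>i\<in>I. (c * X i w - s * Y i w, s * X i w + c * Y i w)) \<partial>M)"
    unfolding n2 cr F_def using i \<rho>
    by (intro nn_integral_cong) (auto simp: norm_Pair cross2_def mult_less_0_iff of_bool_def)
  also have "\<dots> = (\<integral>\<^sup>+w. F (\<lambda>i\<in>I. (X i w, Y i w)) \<partial>M)"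
  proof -
    have "(\<integral>\<^sup>+w. F (\<lambda>i\<in>I. (X i w, Y i w)) \<partial>M) = (\<integral>\<^sup>+q. F q \<partial>distr M (\<Pi>\<^sub>M i\<in>I. borel) (\<lambda>w. \<lambda>i\<in>I. (X i w, Y i w)))"
      by (simp add: nn_integral_distr)
    also have "\<dots> = (\<integral>\<^sup>+w. F (\<lambda>i\<in>I. (c * X i w - s * Y i w, s * X i w + c * Y i w)) \<partial>M)"
      unfolding rot[OF cs] by (simp add: nn_integral_distr)
    finally show ?thesis by simp
  qed
  also have "\<dots> = (\<integral>\<^sup>+w. ennreal (exp (- \<epsilon> * (X i w)\<^sup>2 / 2)) * of_bool (top i w) * ennreal (exp (- \<epsilon> * (Y i w - norm z)\<^sup>2 / 2)) \<partial>M)"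
  proof (intro nn_integral_cong)
    fix w
    have A: "F (\<lambda>i\<in>I. (X i w, Y i w)) = ennreal (exp (- \<epsilon> * ((X i w)\<^sup>2 + (Y i w - \<rho>)\<^sup>2) / 2)) * of_bool (top i w)"
      using i \<rho> by (auto simp: F_def norm_Pair cross2_def mult_less_0_iff of_bool_def top_def)
    have B: "exp (- \<epsilon> * ((X i w)\<^sup>2 + (Y i w - \<rho>)\<^sup>2) / 2) = exp (- \<epsilon> * (X i w)\<^sup>2 / 2) * exp (- \<epsilon> * (Y i w - \<rho>)\<^sup>2 / 2)"
      by (simp add: exp_add[symmetric] algebra_simps add_divide_distrib diff_divide_distrib)
    show "F (\<lambda>i\<in>I. (X i w, Y i w)) = ennreal (exp (- \<epsilon> * (X i w)\<^sup>2 / 2)) * of_bool (top i w) * ennreal (exp (- \<epsilon> * (Y i w - norm z)\<^sup>2 / 2))"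
      unfolding A B by (simp add: \<rho>_def ennreal_mult' mult_ac)
  qed
  finally show ?thesis .
qed

definition wtop where "wtop \<epsilon> i = (\<integral>w. exp (- \<epsilon> * (X i w)\<^sup>2 / 2) * of_bool (top i w) \<partial>M)"

abbreviation (input) top_mass where "top_mass \<epsilon> i \<equiv> wtop \<epsilon> i * (2 * pi * sqrt (1 + \<epsilon> * K i) / \<epsilon>)"

lemma integrable_wtop: "i \<in> I \<Longrightarrow> \<epsilon> \<ge> 0 \<Longrightarrow> integrable M (\<lambda>w. exp (- \<epsilon> * (X i w)\<^sup>2 / 2) * of_bool (top i w))"
  by (rule integrable_const_bound[of _ 1]) (auto simp: abs_mult)

lemma wtop_nonneg: "0 \<le> wtop \<epsilon> i"
  unfolding wtop_def by (intro integral_nonneg_AE) auto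

text \<open>For fixed \<open>z\<close> the rotated integral factorises into \<open>wtop\<close> and
  the Gaussian transform of \<open>Y i\<close> at \<open>norm z\<close>. What is left is a planar
  Gaussian in \<open>z\<close> with parameter \<open>\<epsilon> / (1 + \<epsilon> * K i)\<close>, of
  mass \<open>2 * pi * (1 + \<epsilon> * K i) / \<epsilon>\<close>.\<close>

lemma tangent_integral:
  assumes i: "i \<in> I" and e: "\<epsilon> > 0"
  shows "(\<integral>\<^sup>+w. \<integral>\<^sup>+x. ennreal (exp (- \<epsilon> * (norm x)\<^sup>2 / 2)) * of_bool (\<forall>j\<in>I - {i}. cross2 (pt i w - x) (pt j w - x) > 0) \<partial>lborel \<partial>M)
    = ennreal (top_mass \<epsilon> i)"
proof -
  interpret pair_sigma_finite M "lborel :: (real \<times> real) measure" ..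
  have a: "1 + \<epsilon> * K i > 0" using K_nonneg[OF i] e by (simp add: add_pos_nonneg)
  have [measurable]: "finite (I - {i})" "i \<in> I" using fin i by simp_all
  have [measurable]: "j \<in> I - {i} \<Longrightarrow> pt j \<in> borel_measurable M" for j by simp
  have tr: "(\<integral>\<^sup>+x. f x \<partial>lborel) = (\<integral>\<^sup>+x. f (a + x) \<partial>lborel)" if [measurable]: "f \<in> borel_measurable borel" for f and a :: "real \<times> real"
    using nn_integral_distr[of "(+) a" lborel borel f] lborel_distr_plus[of a] by simp
  have "(\<integral>\<^sup>+w. \<integral>\<^sup>+x. ennreal (exp (- \<epsilon> * (norm x)\<^sup>2 / 2)) * of_bool (\<forall>j\<in>I - {i}. cross2 (pt i w - x) (pt j w - x) > 0) \<partial>lborel \<partial>M)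
    = (\<integral>\<^sup>+w. \<integral>\<^sup>+z. shifted_weight \<epsilon> i z w \<partial>lborel \<partial>M)"
  proof (rule nn_integral_cong)
    fix w
    have c: "(cross2 (pt i w - (pt i w + z)) (pt j w - (pt i w + z)) > 0) \<longleftrightarrow> (cross2 z (pt j w - pt i w) < 0)" for j z
      by (simp add: cross2_def algebra_simps)
    show "(\<integral>\<^sup>+x. ennreal (exp (- \<epsilon> * (norm x)\<^sup>2 / 2)) * of_bool (\<forall>j\<in>I - {i}. cross2 (pt i w - x) (pt j w - x) > 0) \<partial>lborel)
      = (\<integral>\<^sup>+z. shifted_weight \<epsilon> i z w \<partial>lborel)"
      unfolding c[symmetric] by (rule tr) measurable
  qed
  also have "\<dots> = (\<integral>\<^sup>+z. \<integral>\<^sup>+w. shifted_weight \<epsilon> i z w \<partial>M \<partial>lborel)"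
    by (rule Fubini'[symmetric]) measurable
  also have "\<dots> = (\<integral>\<^sup>+z. ennreal (wtop \<epsilon> i / sqrt (1 + \<epsilon> * K i)) * ennreal (exp (- (\<epsilon> / (1 + \<epsilon> * K i)) * (norm z)\<^sup>2 / 2)) \<partial>(lborel :: (real \<times> real) measure))"
  proof (rule nn_integral_cong_AE)
    show "AE z in lborel. (\<integral>\<^sup>+w. shifted_weight \<epsilon> i z w \<partial>M)
       = ennreal (wtop \<epsilon> i / sqrt (1 + \<epsilon> * K i)) * ennreal (exp (- (\<epsilon> / (1 + \<epsilon> * K i)) * (norm z)\<^sup>2 / 2))"
      using AE_lborel_singleton[of "0 :: real \<times> real"]
    proof eventually_elim
      case (elim z)
      define G where "G q = ennreal (exp (- \<epsilon> * (q i)\<^sup>2 / 2)) * of_bool (\<forall>j\<in>I - {i}. q j < q i)" for q :: "'i \<Rightarrow> real"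
      have G: "G \<in> borel_measurable (\<Pi>\<^sub>M i\<in>I. borel)"
        unfolding G_def using fin i by measurable
      have GX: "G (\<lambda>j\<in>I. X j w) = ennreal (exp (- \<epsilon> * (X i w)\<^sup>2 / 2)) * of_bool (top i w)" for w
        using i by (auto simp: G_def top_def of_bool_def)
      have "(\<integral>\<^sup>+w. G (\<lambda>j\<in>I. X j w) \<partial>M) = ennreal (wtop \<epsilon> i)"
      proof -
        have "ennreal (wtop \<epsilon> i) = (\<integral>\<^sup>+w. ennreal (exp (- \<epsilon> * (X i w)\<^sup>2 / 2) * of_bool (top i w)) \<partial>M)"
          unfolding wtop_def by (rule nn_integral_eq_integral[OF integrable_wtop[OF i less_imp_le[OF e]], symmetric]) simp
        then show ?thesis unfolding GX by (simp add: ennreal_mult' ennreal_of_bool)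
      qed
      moreover have "(\<integral>\<^sup>+w. shifted_weight \<epsilon> i z w \<partial>M)
        = (\<integral>\<^sup>+w. G (\<lambda>j\<in>I. X j w) \<partial>M) * (\<integral>\<^sup>+w. ennreal (exp (- \<epsilon> * (Y i w - norm z)\<^sup>2 / 2)) \<partial>M)"
        unfolding rotate_tangent_integral[OF i elim e] GX[symmetric]
        by (rule indep[OF i G]) measurable
      moreover have "wtop \<epsilon> i \<ge> 0" by (rule wtop_nonneg)
      ultimately show ?case
        unfolding gauss[OF i e] using a by (simp add: ennreal_mult'[symmetric] field_simps)
    qed
  qed
  also have "\<dots> = ennreal (top_mass \<epsilon> i)"
  proof -
    have "wtop \<epsilon> i \<ge> 0" by (rule wtop_nonneg)
    moreover have "wtop \<epsilon> i / sqrt (1 + \<epsilon> * K i) * (2 * pi / (\<epsilon> / (1 + \<epsilon> * K i))) = top_mass \<epsilon> i"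
    proof -
      define q where "q = sqrt (1 + \<epsilon> * K i)"
      have "q > 0" "1 + \<epsilon> * K i = q * q" using a by (auto simp: q_def)
      then show ?thesis using e unfolding q_def[symmetric] by (simp add: field_simps)
    qed
    ultimately show ?thesis using a e
      by (subst nn_integral_cmult, simp, subst nn_integral_gaussian_plane)
         (simp_all only: ennreal_mult'[symmetric] divide_nonneg_pos real_sqrt_gt_zero divide_pos_pos)
  qed
  finally show ?thesis .
qed

lemma measurable_hull [measurable]:
  "Measurable.pred (M \<Otimes>\<^sub>M lborel) (\<lambda>(w, x). in_hull x w)"
proof -
  have "sets (M \<Otimes>\<^sub>M (lborel :: (real \<times> real) measure)) = sets (M \<Otimes>\<^sub>M borel)"
    by (rule sets_pair_measure_cong) auto
  from measurable_cong_sets[OF this refl] show ?thesis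
    using measurable_in_convex_hull[OF fin, of pt M] pt_rv by simp
qed

text \<open>The dichotomy of \<open>sum_tangent_indicator\<close> integrated over \<open>x\<close>
  and \<open>w\<close>; the form as a sum avoids subtraction of extended reals.\<close>

lemma weighted_hull_integral:
  assumes e: "\<epsilon> > 0"
  shows "(\<integral>\<^sup>+w. \<integral>\<^sup>+x. ennreal (exp (- \<epsilon> * (norm x)\<^sup>2 / 2)) * of_bool (in_hull x w) \<partial>lborel \<partial>M)
    + ennreal (\<Sum>i\<in>I. top_mass \<epsilon> i) = ennreal (2 * pi / \<epsilon>)"
proof -
  define wt where "wt x = ennreal (exp (- \<epsilon> * (norm x)\<^sup>2 / 2))" for x :: "real \<times> real"
  have wt[measurable]: "wt \<in> borel_measurable borel" unfolding wt_def by measurable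
  define T where "T i w x \<longleftrightarrow> (\<forall>j\<in>I - {i}. cross2 (pt i w - x) (pt j w - x) > 0)" for i w x
  have T[measurable]: "Measurable.pred (M \<Otimes>\<^sub>M lborel) (\<lambda>(w, x). T i w x)" if [measurable]: "i \<in> I" for i
  proof -
    have [measurable]: "finite (I - {i})" using fin by simp_all
    have [measurable]: "j \<in> I - {i} \<Longrightarrow> pt j \<in> borel_measurable M" for j by simp
    show ?thesis unfolding T_def by measurable
  qed
  have T1: "(\<lambda>x. T i w x) \<in> measurable lborel (count_space UNIV)" if "w \<in> space M" "i \<in> I" for w i
    using measurable_Pair2[OF T[OF that(2)] that(1)] by simp
  have H1: "(\<lambda>x. in_hull x w) \<in> measurable lborel (count_space UNIV)" if "w \<in> space M" for w
    using measurable_Pair2[OF measurable_hull that] by simp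
  have "ennreal (2 * pi / \<epsilon>) = (\<integral>\<^sup>+w. \<integral>\<^sup>+x. wt x \<partial>lborel \<partial>M)"
    unfolding wt_def nn_integral_gaussian_plane[OF e] by (simp add: emeasure_space_1)
  also have "\<dots> = (\<integral>\<^sup>+w. (\<integral>\<^sup>+x. wt x * of_bool (in_hull x w) \<partial>lborel)
     + (\<Sum>i\<in>I. \<integral>\<^sup>+x. wt x * of_bool (T i w x) \<partial>lborel) \<partial>M)"
  proof (rule nn_integral_cong_AE)
    have "AE w in M. \<forall>i\<in>I. \<forall>j\<in>I. i \<noteq> j \<longrightarrow> X i w \<noteq> X j w"
      using fin distinct by (simp add: AE_finite_all)
    then show "AE w in M. (\<integral>\<^sup>+x. wt x \<partial>lborel) = (\<integral>\<^sup>+x. wt x * of_bool (in_hull x w) \<partial>lborel)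
     + (\<Sum>i\<in>I. \<integral>\<^sup>+x. wt x * of_bool (T i w x) \<partial>lborel)"
      using AE_space
    proof eventually_elim
      case (elim w)
      note [measurable] = T1[OF elim(2)] H1[OF elim(2)]
      have "AE x in lborel. wt x = wt x * of_bool (in_hull x w) + (\<Sum>i\<in>I. wt x * of_bool (T i w x))"
        using AE_lborel_generic[of I "\<lambda>i. pt i w"]
      proof (rule AE_mp)
        show "AE x in lborel. (\<forall>i\<in>I. \<forall>j\<in>I. i \<noteq> j \<longrightarrow> cross2 (pt i w - x) (pt j w - x) \<noteq> 0) \<and> (\<forall>i\<in>I. pt i w \<noteq> x) \<longrightarrow>
           wt x = wt x * of_bool (in_hull x w) + (\<Sum>i\<in>I. wt x * of_bool (T i w x))"
        proof (intro always_eventually allI impI, elim conjE)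
          fix x assume *: "\<forall>i\<in>I. \<forall>j\<in>I. i \<noteq> j \<longrightarrow> cross2 (pt i w - x) (pt j w - x) \<noteq> 0" "\<forall>i\<in>I. pt i w \<noteq> x"
          have "(\<Sum>i\<in>I. of_bool (T i w x)) + of_bool (in_hull x w) = (1 :: ennreal)"
            unfolding T_def using * by (intro sum_tangent_indicator fin ne) auto
          then have "wt x * ((\<Sum>i\<in>I. of_bool (T i w x)) + of_bool (in_hull x w)) = wt x" by (simp only: mult_1_right)
          then show "wt x = wt x * of_bool (in_hull x w) + (\<Sum>i\<in>I. wt x * of_bool (T i w x))"
            by (simp only: distrib_left sum_distrib_left add.commute)
        qed
      qed (use fin elim(1) in \<open>auto simp: pt_def\<close>)
      then have "(\<integral>\<^sup>+x. wt x \<partial>lborel) = (\<integral>\<^sup>+x. wt x * of_bool (in_hull x w) + (\<Sum>i\<in>I. wt x * of_bool (T i w x)) \<partial>lborel)"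
        by (rule nn_integral_cong_AE)
      also have "\<dots> = (\<integral>\<^sup>+x. wt x * of_bool (in_hull x w) \<partial>lborel) + (\<Sum>i\<in>I. \<integral>\<^sup>+x. wt x * of_bool (T i w x) \<partial>lborel)"
        by (subst nn_integral_add) (auto simp: nn_integral_sum)
      finally show ?case .
    qed
  qed
  also have "\<dots> = (\<integral>\<^sup>+w. \<integral>\<^sup>+x. wt x * of_bool (in_hull x w) \<partial>lborel \<partial>M)
     + (\<Sum>i\<in>I. \<integral>\<^sup>+w. \<integral>\<^sup>+x. wt x * of_bool (T i w x) \<partial>lborel \<partial>M)"
    by (subst nn_integral_add) (auto simp: nn_integral_sum intro!: borel_measurable_sum lborel.borel_measurable_nn_integral)
  also have "(\<Sum>i\<in>I. \<integral>\<^sup>+w. \<integral>\<^sup>+x. wt x * of_bool (T i w x) \<partial>lborel \<partial>M) = ennreal (\<Sum>i\<in>I. top_mass \<epsilon> i)"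
  proof -
    have "(\<Sum>i\<in>I. \<integral>\<^sup>+w. \<integral>\<^sup>+x. wt x * of_bool (T i w x) \<partial>lborel \<partial>M) = (\<Sum>i\<in>I. ennreal (top_mass \<epsilon> i))"
      unfolding wt_def T_def by (intro sum.cong refl tangent_integral e)
    also have "\<dots> = ennreal (\<Sum>i\<in>I. top_mass \<epsilon> i)"
      using e K_nonneg wtop_nonneg by (intro sum_ennreal) (auto intro!: mult_nonneg_nonneg divide_nonneg_nonneg)
    finally show ?thesis .
  qed
  finally show ?thesis by (simp add: wt_def)
qed

lemma sum_top: "AE w in M. (\<Sum>i\<in>I. of_bool (top i w)) = (1 :: real)"
proof -
  have "AE w in M. \<forall>i\<in>I. \<forall>j\<in>I. i \<noteq> j \<longrightarrow> X i w \<noteq> X j w"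
    using fin distinct by (simp add: AE_finite_all)
  then show ?thesis
  proof eventually_elim
    case (elim w)
    have "Max ((\<lambda>i. X i w) ` I) \<in> (\<lambda>i. X i w) ` I" using fin ne by (intro Max_in) auto
    then obtain i where i: "Max ((\<lambda>i. X i w) ` I) = X i w" "i \<in> I" by (rule imageE)
    have le: "X j w \<le> X i w" if "j \<in> I" for j unfolding i(1)[symmetric] using fin that by simp
    have t: "top k w \<longleftrightarrow> k = i" if k: "k \<in> I" for k
    proof
      assume *: "top k w"
      show "k = i"
      proof (rule ccontr)
        assume "k \<noteq> i"
        then have "X i w < X k w" using * i(2) by (auto simp: top_def)
        then show False using le[OF k] by simp
      qed
    next
      assume [simp]: "k = i"
      show "top k w" unfolding top_def
      proof
        fix j assume "j \<in> I - {k}" then show "X j w < X k w" using le[of j] elim i(2) by force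
      qed
    qed
    have "(\<Sum>k\<in>I. of_bool (top k w)) = (\<Sum>k\<in>I. of_bool (k = i) :: real)"
      by (intro sum.cong) (auto simp: t)
    then show ?case using fin i by (simp add: of_bool_def)
  qed
qed

text \<open>The probabilities of the events \<open>top i\<close> add up to 1, so
  \<open>2 * pi / \<epsilon>\<close> can be distributed over the points. Each then contributes a
  difference quotient at \<open>\<epsilon> = 0\<close> of a function with derivative half of
  \<open>X^2 - K\<close>, on the event \<open>top i\<close>.\<close>

theorem expected_hull_area:
  "(\<integral>\<^sup>+w. emeasure lborel (convex hull ((\<lambda>i. (X i w, Y i w)) ` I)) \<partial>M)
   = ennreal (pi * (\<Sum>i\<in>I. \<integral>w. ((X i w)\<^sup>2 - K i) * of_bool (top i w) \<partial>M))"
proof -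
  define H where "H w = convex hull ((\<lambda>i. pt i w) ` I)" for w
  define e where "e n = 1 / real (Suc n)" for n
  have e: "e n > 0" "e n \<le> 1" for n by (auto simp: e_def)
  have e_dec: "e (Suc n) \<le> e n" for n by (auto simp: e_def field_simps)
  have e0: "e \<longlonglongrightarrow> 0" unfolding e_def by (rule LIMSEQ_Suc[OF lim_1_over_n])
  define wt where "wt n x = ennreal (exp (- e n * (norm x)\<^sup>2 / 2))" for n and x :: "real \<times> real"
  have wt[measurable]: "wt n \<in> borel_measurable borel" for n unfolding wt_def by measurable
  have H1[measurable]: "(\<lambda>x. x \<in> H w) \<in> measurable lborel (count_space UNIV)" if "w \<in> space M" for w
    using measurable_Pair2[OF measurable_hull that] by (simp add: H_def)
  have H2[measurable]: "Measurable.pred (M \<Otimes>\<^sub>M lborel) (\<lambda>(w, x). x \<in> H w)"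
    using measurable_hull by (simp add: H_def)
  have wt_inc: "wt n x \<le> wt (Suc n) x" for n x
    unfolding wt_def using mult_right_mono[OF e_dec[of n], of "(norm x)\<^sup>2"] by (intro ennreal_leI) simp
  have wt_lim: "(\<lambda>n. wt n x) \<longlonglongrightarrow> 1" for x
  proof -
    have "(\<lambda>n. exp (- e n * (norm x)\<^sup>2 / 2)) \<longlonglongrightarrow> exp (- 0 * (norm x)\<^sup>2 / 2)"
      by (intro tendsto_intros e0) simp
    then show ?thesis unfolding wt_def by (simp flip: ennreal_1 add: tendsto_ennrealI)
  qed
  have wt_sup: "(SUP n. wt n x) = 1" for x
    using LIMSEQ_unique[OF LIMSEQ_SUP wt_lim] wt_inc by (auto simp: incseq_Suc_iff)
  define J where "J n w = (\<integral>\<^sup>+x. wt n x * of_bool (x \<in> H w) \<partial>lborel)" for n w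
  have J[measurable]: "J n \<in> borel_measurable M" for n
    unfolding J_def by (intro lborel.borel_measurable_nn_integral) measurable
  have J_inc: "incseq J"
    unfolding J_def by (auto simp: incseq_Suc_iff le_fun_def intro!: nn_integral_mono mult_right_mono wt_inc)
  have SJ: "(SUP n. J n w) = emeasure lborel (H w)" if "w \<in> space M" for w
  proof -
    note H1[OF that, measurable]
    have "(SUP n. J n w) = (\<integral>\<^sup>+x. (SUP n. wt n x * of_bool (x \<in> H w)) \<partial>lborel)"
      unfolding J_def
      by (rule nn_integral_monotone_convergence_SUP[symmetric])
         (auto simp: incseq_Suc_iff le_fun_def intro!: mult_right_mono wt_inc)
    also have "\<dots> = (\<integral>\<^sup>+x. indicator (H w) x \<partial>lborel)"
      by (intro nn_integral_cong) (auto simp: wt_sup split: split_indicator)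
    also have "\<dots> = emeasure lborel (H w)"
      using H1[OF that] by (subst nn_integral_indicator) (auto simp: pred_def)
    finally show ?thesis .
  qed
  have "(\<lambda>n. \<integral>\<^sup>+w. J n w \<partial>M) \<longlonglongrightarrow> (SUP n. \<integral>\<^sup>+w. J n w \<partial>M)"
    by (rule LIMSEQ_SUP) (use J_inc in \<open>auto simp: incseq_def le_fun_def intro!: nn_integral_mono\<close>)
  also have "(SUP n. \<integral>\<^sup>+w. J n w \<partial>M) = (\<integral>\<^sup>+w. (SUP n. J n w) \<partial>M)"
    by (rule nn_integral_monotone_convergence_SUP[symmetric]) (use J_inc in auto)
  also have "\<dots> = (\<integral>\<^sup>+w. emeasure lborel (H w) \<partial>M)"
    by (intro nn_integral_cong SJ)
  finally have lim1: "(\<lambda>n. \<integral>\<^sup>+w. J n w \<partial>M) \<longlonglongrightarrow> (\<integral>\<^sup>+w. emeasure lborel (H w) \<partial>M)" .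
  \<comment> \<open>The difference quotient at 0 of
    \<open>1 - sqrt (1 + a * K i) * exp (- a * X^2 / 2)\<close>, a function of \<open>a\<close> that
    vanishes at 0.\<close>
  define D where "D n i w = (1 - sqrt (1 + e n * K i) * exp (- e n * (X i w)\<^sup>2 / 2)) / e n * of_bool (top i w)" for n i w
  have D_meas: "i \<in> I \<Longrightarrow> D n i \<in> borel_measurable M" for n i unfolding D_def[abs_def] by measurable
  \<comment> \<open>A bound uniform in \<open>a \<le> 1\<close>; it provides the integrable majorant
    \<open>X^2 + K\<close>.\<close>
  have bound: "\<bar>(1 - sqrt (1 + a * k) * exp (- a * t / 2)) / a\<bar> \<le> t + k" if a: "0 < a" "a \<le> 1" and k: "0 \<le> k" "0 \<le> t" for a k t :: real
  proof -
    have ak: "0 \<le> a * k" "0 \<le> a * t" using a k by auto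
    have 1: "1 \<le> sqrt (1 + a * k)" using ak by simp
    have 2: "sqrt (1 + a * k) \<le> 1 + a * k"
      using ak self_le_power[of "1 + a * k" 2] by (intro real_le_lsqrt) auto
    have 3: "1 - a * t / 2 \<le> exp (- a * t / 2)" using exp_ge_add_one_self[of "- a * t / 2"] by simp
    have 4: "exp (- a * t / 2) \<le> 1" using ak by simp
    have "1 - sqrt (1 + a * k) * exp (- a * t / 2) \<le> 1 - exp (- a * t / 2)"
      using mult_right_mono[OF 1, of "exp (- a * t / 2)"] by simp
    also have "\<dots> \<le> a * t / 2" using 3 by simp
    finally have u: "1 - sqrt (1 + a * k) * exp (- a * t / 2) \<le> a * (t + k)" using ak by (simp add: algebra_simps)
    have "sqrt (1 + a * k) * exp (- a * t / 2) \<le> (1 + a * k) * 1"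
      by (intro mult_mono 2 4) (use ak in auto)
    then have l: "- (a * (t + k)) \<le> 1 - sqrt (1 + a * k) * exp (- a * t / 2)" using ak by (simp add: algebra_simps)
    show ?thesis using u l a by (simp add: abs_le_iff field_simps)
  qed
  have D_bound: "\<bar>D n i w\<bar> \<le> (X i w)\<^sup>2 + K i" if "i \<in> I" for n i w
    using bound[OF e[of n] K_nonneg[OF that], of "(X i w)\<^sup>2"] K_nonneg[OF that] by (auto simp: D_def abs_mult)
  have D_lim: "(\<lambda>n. D n i w) \<longlonglongrightarrow> ((X i w)\<^sup>2 - K i) / 2 * of_bool (top i w)" if "i \<in> I" for i w
  proof -
    define f where "f a = 1 - sqrt (1 + a * K i) * exp (- a * (X i w)\<^sup>2 / 2)" for a
    have "(f has_field_derivative ((X i w)\<^sup>2 - K i) / 2) (at 0)"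
      unfolding f_def by (auto intro!: derivative_eq_intros simp: field_simps)
    then have "((\<lambda>a. (f a - f 0) / (a - 0)) \<longlongrightarrow> ((X i w)\<^sup>2 - K i) / 2) (at 0)"
      by (simp only: has_field_derivative_iff)
    moreover have "filterlim e (at 0) sequentially"
      using e0 e(1) by (auto simp: filterlim_at intro!: always_eventually) (metis less_irrefl)
    ultimately have "(\<lambda>n. (f (e n) - f 0) / (e n - 0)) \<longlonglongrightarrow> ((X i w)\<^sup>2 - K i) / 2"
      by (rule filterlim_compose)
    then show ?thesis unfolding D_def f_def by (intro tendsto_mult) (auto simp: f_def)
  qed
  have lim2: "(\<lambda>n. \<integral>w. D n i w \<partial>M) \<longlonglongrightarrow> (\<integral>w. ((X i w)\<^sup>2 - K i) / 2 * of_bool (top i w) \<partial>M)" if i: "i \<in> I" for i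
    by (rule integral_dominated_convergence[where w="\<lambda>w. (X i w)\<^sup>2 + K i"])
       (use i D_meas D_bound D_lim X_sq in auto)
  have JD: "(\<integral>\<^sup>+w. J n w \<partial>M) = ennreal (2 * pi * (\<Sum>i\<in>I. \<integral>w. D n i w \<partial>M))" for n
  proof -
    have "(\<Sum>i\<in>I. \<integral>w. of_bool (top i w) \<partial>M) = (\<integral>w. (\<Sum>i\<in>I. of_bool (top i w) :: real) \<partial>M)"
      using integrable_wtop[of _ 0] by (subst Bochner_Integration.integral_sum) auto
    also have "\<dots> = (\<integral>w. 1 \<partial>M)"
      by (rule integral_cong_AE[OF borel_measurable_sum _ sum_top]) measurable
    finally have s1: "(\<Sum>i\<in>I. \<integral>w. of_bool (top i w) \<partial>M) = (1 :: real)" by (simp add: prob_space)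
    have "(\<integral>w. D n i w \<partial>M) = ((\<integral>w. of_bool (top i w) \<partial>M) - sqrt (1 + e n * K i) * wtop (e n) i) / e n" if i: "i \<in> I" for i
    proof -
      have "D n i w = (of_bool (top i w) - sqrt (1 + e n * K i) * (exp (- e n * (X i w)\<^sup>2 / 2) * of_bool (top i w))) / e n" for w
        by (auto simp: D_def)
      then show ?thesis unfolding wtop_def
        using integrable_wtop[OF i, of 0] integrable_wtop[OF i less_imp_le[OF e(1)[of n]]] by simp
    qed
    then have "2 * pi * (\<Sum>i\<in>I. \<integral>w. D n i w \<partial>M) = 2 * pi / e n * (\<Sum>i\<in>I. \<integral>w. of_bool (top i w) \<partial>M) - (\<Sum>i\<in>I. wtop (e n) i * (2 * pi * sqrt (1 + e n * K i) / e n))"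
      unfolding sum_distrib_left sum_subtractf[symmetric]
      by (intro sum.cong refl) (simp add: diff_divide_distrib right_diff_distrib)
    then have id: "2 * pi * (\<Sum>i\<in>I. \<integral>w. D n i w \<partial>M) = 2 * pi / e n - (\<Sum>i\<in>I. wtop (e n) i * (2 * pi * sqrt (1 + e n * K i) / e n))"
      unfolding s1 by simp
    have "(\<integral>\<^sup>+w. J n w \<partial>M) + ennreal (\<Sum>i\<in>I. wtop (e n) i * (2 * pi * sqrt (1 + e n * K i) / e n)) = ennreal (2 * pi / e n)"
      using weighted_hull_integral[OF e(1)[of n]] by (simp add: J_def wt_def H_def)
    moreover have "0 \<le> (\<Sum>i\<in>I. wtop (e n) i * (2 * pi * sqrt (1 + e n * K i) / e n))"
      using wtop_nonneg K_nonneg e(1)[of n] by (intro sum_nonneg mult_nonneg_nonneg divide_nonneg_nonneg) auto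
    ultimately show ?thesis unfolding id
      using e(1)[of n] by (cases "\<integral>\<^sup>+w. J n w \<partial>M" rule: ennreal_cases) (auto simp flip: ennreal_plus)
  qed
  have "(\<lambda>n. \<integral>\<^sup>+w. J n w \<partial>M) \<longlonglongrightarrow> ennreal (2 * pi * (\<Sum>i\<in>I. \<integral>w. ((X i w)\<^sup>2 - K i) / 2 * of_bool (top i w) \<partial>M))"
    unfolding JD by (intro tendsto_ennrealI tendsto_mult tendsto_const tendsto_sum lim2)
  from LIMSEQ_unique[OF lim1 this] show ?thesis
    by (simp add: H_def pt_def sum_divide_distrib[symmetric])
qed

end

section \<open>Integrating out the time of the maximum\<close>

text \<open>The integral over the time \<open>r\<close> is moved innermost, because for fixed
  \<open>a\<close> and \<open>n\<close> the admissible times form an interval ending at 1.\<close>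

lemma nn_integral_swap_inner:
  fixes w :: "real \<Rightarrow> ennreal" and g k :: "real \<Rightarrow> ennreal" and Q :: "real \<Rightarrow> real \<Rightarrow> real \<Rightarrow> bool"
  assumes [measurable]: "w \<in> borel_measurable borel" "g \<in> borel_measurable borel" "k \<in> borel_measurable borel"
    "Measurable.pred (borel \<Otimes>\<^sub>M borel \<Otimes>\<^sub>M borel) (\<lambda>(r, a, n). Q r a n)"
  shows "(\<integral>\<^sup>+r. w r * (\<integral>\<^sup>+a. g a * (\<integral>\<^sup>+n. k n * of_bool (Q r a n) \<partial>lborel) \<partial>lborel) \<partial>lborel)
    = (\<integral>\<^sup>+a. g a * (\<integral>\<^sup>+n. k n * (\<integral>\<^sup>+r. w r * of_bool (Q r a n) \<partial>lborel) \<partial>lborel) \<partial>lborel)"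
proof -
  have Q': "Measurable.pred (borel \<Otimes>\<^sub>M borel \<Otimes>\<^sub>M borel) (\<lambda>z. Q (fst z) (fst (snd z)) (snd (snd z)))"
    using assms(4) by (simp add: case_prod_beta')
  have [measurable (raw)]: "Measurable.pred X (\<lambda>z. Q (f z) (h z) (l z))"
    if [measurable]: "f \<in> borel_measurable X" "h \<in> borel_measurable X" "l \<in> borel_measurable X"
    for X :: "'c measure" and f h l
    using measurable_compose[OF _ Q', of "\<lambda>z. (f z, h z, l z)" X] by simp
  have "(\<integral>\<^sup>+r. w r * (\<integral>\<^sup>+a. g a * (\<integral>\<^sup>+n. k n * of_bool (Q r a n) \<partial>lborel) \<partial>lborel) \<partial>lborel)
    = (\<integral>\<^sup>+r. \<integral>\<^sup>+a. \<integral>\<^sup>+n. w r * (g a * (k n * of_bool (Q r a n))) \<partial>lborel \<partial>lborel \<partial>lborel)"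
    by (simp add: nn_integral_cmult[symmetric])
  also have "\<dots> = (\<integral>\<^sup>+a. \<integral>\<^sup>+r. \<integral>\<^sup>+n. w r * (g a * (k n * of_bool (Q r a n))) \<partial>lborel \<partial>lborel \<partial>lborel)"
    by (rule lborel_pair.Fubini'[symmetric]) measurable
  also have "\<dots> = (\<integral>\<^sup>+a. \<integral>\<^sup>+n. \<integral>\<^sup>+r. w r * (g a * (k n * of_bool (Q r a n))) \<partial>lborel \<partial>lborel \<partial>lborel)"
    by (rule nn_integral_cong, rule lborel_pair.Fubini'[symmetric]) measurable
  also have "\<dots> = (\<integral>\<^sup>+a. \<integral>\<^sup>+n. \<integral>\<^sup>+r. g a * (k n * (w r * of_bool (Q r a n))) \<partial>lborel \<partial>lborel \<partial>lborel)"
    by (simp only: mult.left_commute)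
  also have "\<dots> = (\<integral>\<^sup>+a. g a * (\<integral>\<^sup>+n. k n * (\<integral>\<^sup>+r. w r * of_bool (Q r a n) \<partial>lborel) \<partial>lborel) \<partial>lborel)"
    by (simp add: nn_integral_cmult)
  finally show ?thesis .
qed

lemma nn_integral_scale:
  fixes f :: "real \<Rightarrow> ennreal"
  assumes "f \<in> borel_measurable borel" "0 < c"
  shows "(\<integral>\<^sup>+x. f x \<partial>lborel) = (\<integral>\<^sup>+x. ennreal c * f (c * x) \<partial>lborel)"
  using assms nn_integral_real_affine[of f c 0] by (simp add: nn_integral_cmult)

text \<open>For \<open>n > 0\<close> squaring turns the condition into
  \<open>r > a^2 / (n^2 + a^2)\<close>, so given the maximum \<open>a\<close> the time of the
  maximum is distributed like this ratio. Nonpositive \<open>n\<close> contributes nothing; this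
  half makes up for the factor 4 in \<open>argmax_law\<close> against the factor 2 in the density of
  the maximum.\<close>

lemma argmax_time_W_inner:
  fixes a n :: real
  assumes a: "0 < a"
  shows "(\<integral>\<^sup>+r. in_01 r * of_bool (a * (1 - r) < sqrt (r * (1 - r)) * n) \<partial>lborel) = of_bool (0 < n) * ennreal (n\<^sup>2 / (n\<^sup>2 + a\<^sup>2))"
proof (cases "0 < n")
  case False
  have "\<not> a * (1 - r) < sqrt (r * (1 - r)) * n" if "0 < r" "r < 1" for r
  proof -
    have "0 < a * (1 - r)" using that a by simp
    moreover have "sqrt (r * (1 - r)) * n \<le> 0" using False that by (simp add: mult_nonneg_nonpos)
    ultimately show ?thesis by simp
  qed
  then have "(\<lambda>r. in_01 r * of_bool (a * (1 - r) < sqrt (r * (1 - r)) * n) :: ennreal) = (\<lambda>_. 0)" by auto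
  then show ?thesis using False by simp
next
  case True
  have s: "0 < n\<^sup>2 + a\<^sup>2" using a by (simp add: add_nonneg_pos)
  have iff: "a * (1 - r) < sqrt (r * (1 - r)) * n \<longleftrightarrow> a\<^sup>2 / (n\<^sup>2 + a\<^sup>2) < r" if r: "0 < r" "r < 1" for r
  proof -
    have 1: "a * (1 - r) = (a * sqrt (1 - r)) * sqrt (1 - r)" using r by simp
    have 2: "sqrt (r * (1 - r)) * n = (sqrt r * n) * sqrt (1 - r)" by (simp add: real_sqrt_mult)
    have "a * (1 - r) < sqrt (r * (1 - r)) * n \<longleftrightarrow> a * sqrt (1 - r) < sqrt r * n"
      unfolding 1 2 using r by (subst mult_less_cancel_right_pos) simp_all
    also have "\<dots> \<longleftrightarrow> (a * sqrt (1 - r))\<^sup>2 < (sqrt r * n)\<^sup>2" using a True r by (auto intro: power_strict_mono power2_less_imp_less)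
    also have "\<dots> \<longleftrightarrow> a\<^sup>2 < r * (n\<^sup>2 + a\<^sup>2)" using r by (simp add: power_mult_distrib algebra_simps)
    also have "\<dots> \<longleftrightarrow> a\<^sup>2 / (n\<^sup>2 + a\<^sup>2) < r" using s by (simp add: divide_less_eq)
    finally show ?thesis .
  qed
  have b: "0 < a\<^sup>2 / (n\<^sup>2 + a\<^sup>2)" "a\<^sup>2 / (n\<^sup>2 + a\<^sup>2) < 1" using a True s by (auto simp: divide_less_eq)
  have "(\<integral>\<^sup>+r. in_01 r * of_bool (a * (1 - r) < sqrt (r * (1 - r)) * n) \<partial>lborel) = (\<integral>\<^sup>+r. indicator {a\<^sup>2 / (n\<^sup>2 + a\<^sup>2)<..<1} r \<partial>lborel)"
    using b by (intro nn_integral_cong) (auto simp: iff split: split_indicator)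
  also have "\<dots> = ennreal (1 - a\<^sup>2 / (n\<^sup>2 + a\<^sup>2))" using b by simp
  also have "1 - a\<^sup>2 / (n\<^sup>2 + a\<^sup>2) = n\<^sup>2 / (n\<^sup>2 + a\<^sup>2)" using a by (simp add: diff_eq_eq add_divide_distrib[symmetric])
  finally show ?thesis using True by simp
qed

text \<open>This is the mean of 1 - \<tau> on the event that the motion wins. The scaling
  \<open>n = a * u\<close> makes the time factor a function of \<open>u\<close> alone, after which
  the integral over \<open>a\<close> is elementary and the one over \<open>u\<close> is
  rational.\<close>

lemma argmax_time_W_integral:
  "(\<integral>\<^sup>+r. in_01 r * (\<integral>\<^sup>+a. ennreal (1 - exp (- 2 * a\<^sup>2)) * (of_bool (0 < a) * ennreal (4 * heat 1 a))
      * normal_above (a * (1 - r)) (sqrt (r * (1 - r))) \<partial>lborel) \<partial>lborel) = ennreal (3 / 4 - sqrt 5 / 4)"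
proof -
  define g where "g a = ennreal (1 - exp (- 2 * a\<^sup>2)) * (of_bool (0 < a) * ennreal (4 * heat 1 a))" for a :: real
  define h where "h u = u\<^sup>2 / (1 + u\<^sup>2)" for u :: real
  let ?T = "\<lambda>a n. (\<integral>\<^sup>+r. in_01 r * of_bool (a * (1 - r) < sqrt (r * (1 - r)) * n) \<partial>lborel)"
  let ?E = "\<lambda>u (a :: real). of_bool (0 < a) * ennreal (a * (exp (- (1 + u\<^sup>2) * a\<^sup>2 / 2) - exp (- (5 + u\<^sup>2) * a\<^sup>2 / 2)))"
  have h0: "0 \<le> h u" for u by (simp add: h_def)
  have [measurable]: "g \<in> borel_measurable borel" "h \<in> borel_measurable borel" unfolding g_def h_def by measurable
  have "(\<integral>\<^sup>+r. in_01 r * (\<integral>\<^sup>+a. g a * normal_above (a * (1 - r)) (sqrt (r * (1 - r))) \<partial>lborel) \<partial>lborel)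
    = (\<integral>\<^sup>+a. g a * (\<integral>\<^sup>+n. ennreal (heat 1 n) * (?T a n) \<partial>lborel) \<partial>lborel)"
    by (rule nn_integral_swap_inner) (unfold case_prod_beta', measurable)
  also have "\<dots> = (\<integral>\<^sup>+a. \<integral>\<^sup>+u. of_bool (0 < u) * ennreal (2 / pi * h u) * (?E u a) \<partial>lborel \<partial>lborel)"
  proof (rule nn_integral_cong)
    fix a :: real
    show "g a * (\<integral>\<^sup>+n. ennreal (heat 1 n) * (?T a n) \<partial>lborel)
      = (\<integral>\<^sup>+u. of_bool (0 < u) * ennreal (2 / pi * h u) * (?E u a) \<partial>lborel)"
    proof (cases "0 < a")
      case False then show ?thesis by (simp add: g_def)
    next
      case a: True
      have "g a * (\<integral>\<^sup>+n. ennreal (heat 1 n) * (?T a n) \<partial>lborel)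
        = g a * (\<integral>\<^sup>+n. ennreal (heat 1 n) * (of_bool (0 < n) * ennreal (n\<^sup>2 / (n\<^sup>2 + a\<^sup>2))) \<partial>lborel)"
        by (simp only: argmax_time_W_inner[OF a])
      also have "\<dots> = (\<integral>\<^sup>+u. g a * (ennreal a * (ennreal (heat 1 (a * u)) * (of_bool (0 < a * u) * ennreal ((a * u)\<^sup>2 / ((a * u)\<^sup>2 + a\<^sup>2))))) \<partial>lborel)"
        by (subst nn_integral_scale[OF _ a]) (auto simp: nn_integral_cmult)
      also have "\<dots> = (\<integral>\<^sup>+u. of_bool (0 < u) * ennreal (2 / pi * h u) * (?E u a) \<partial>lborel)"
      proof (rule nn_integral_cong)
        fix u :: real
        have q: "(a * u)\<^sup>2 / ((a * u)\<^sup>2 + a\<^sup>2) = h u"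
        proof -
          have "(a * u)\<^sup>2 / ((a * u)\<^sup>2 + a\<^sup>2) = (a\<^sup>2 * u\<^sup>2) / (a\<^sup>2 * (1 + u\<^sup>2))" by (simp add: power_mult_distrib algebra_simps)
          also have "\<dots> = h u" using a by (simp add: h_def)
          finally show ?thesis .
        qed
        have e1: "exp (- (1 + u\<^sup>2) * a\<^sup>2 / 2) = exp (- a\<^sup>2 / 2) * exp (- (a * u)\<^sup>2 / 2)"
          by (simp add: exp_add[symmetric] power_mult_distrib field_simps)
        have e2: "exp (- (5 + u\<^sup>2) * a\<^sup>2 / 2) = exp (- 2 * a\<^sup>2) * (exp (- a\<^sup>2 / 2) * exp (- (a * u)\<^sup>2 / 2))"
          by (simp add: exp_add[symmetric] power_mult_distrib field_simps)
        have ex: "exp (- 2 * a\<^sup>2) \<le> 1" by simp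
        have hh: "heat 1 a = exp (- a\<^sup>2 / 2) / sqrt (2 * pi)" "heat 1 (a * u) = exp (- (a * u)\<^sup>2 / 2) / sqrt (2 * pi)" by (simp_all add: heat_eq)
        have "(1 - exp (- 2 * a\<^sup>2)) * (4 * heat 1 a) * (a * (heat 1 (a * u) * h u)) = 2 / pi * h u * (a * (exp (- (1 + u\<^sup>2) * a\<^sup>2 / 2) - exp (- (5 + u\<^sup>2) * a\<^sup>2 / 2)))"
          unfolding hh e1 e2 by (simp add: field_simps real_sqrt_mult[symmetric] power2_eq_square[symmetric])
        moreover have "0 \<le> (exp (- (1 + u\<^sup>2) * a\<^sup>2 / 2) - exp (- (5 + u\<^sup>2) * a\<^sup>2 / 2))" unfolding e1 e2 using ex by (simp add: mult_left_le_one_le)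
        ultimately show "g a * (ennreal a * (ennreal (heat 1 (a * u)) * (of_bool (0 < a * u) * ennreal ((a * u)\<^sup>2 / ((a * u)\<^sup>2 + a\<^sup>2)))))
          = of_bool (0 < u) * ennreal (2 / pi * h u) * (?E u a)"
          using a h0[of u] ex unfolding q g_def by (simp add: zero_less_mult_iff ennreal_mult[symmetric])
      qed
      finally show ?thesis .
    qed
  qed
  also have "\<dots> = (\<integral>\<^sup>+u. \<integral>\<^sup>+a. of_bool (0 < u) * ennreal (2 / pi * h u) * (?E u a) \<partial>lborel \<partial>lborel)"
    by (rule lborel_pair.Fubini') measurable
  also have "\<dots> = (\<integral>\<^sup>+u. of_bool (0 < u) * ennreal (2 / pi * h u) * ennreal (1 / (1 + u\<^sup>2) - 1 / (5 + u\<^sup>2)) \<partial>lborel)"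
  proof (rule nn_integral_cong)
    fix u :: real
    have c: "0 < 1 + u\<^sup>2" "1 + u\<^sup>2 \<le> 5 + u\<^sup>2" by (auto simp: add_pos_nonneg)
    show "(\<integral>\<^sup>+a. of_bool (0 < u) * ennreal (2 / pi * h u) * (?E u a) \<partial>lborel)
      = of_bool (0 < u) * ennreal (2 / pi * h u) * ennreal (1 / (1 + u\<^sup>2) - 1 / (5 + u\<^sup>2))"
      by (subst nn_integral_cmult, measurable) (simp only: integral_x_gaussian_diff[OF c])
  qed
  also have "\<dots> = (\<integral>\<^sup>+u. ennreal (2 / pi) * (of_bool (0 < u) * ennreal (u\<^sup>2 / (1 + u\<^sup>2) * (1 / (1 + u\<^sup>2) - 1 / (5 + u\<^sup>2)))) \<partial>lborel)"
  proof (rule nn_integral_cong)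
    fix u :: real
    have "1 / (5 + u\<^sup>2) \<le> 1 / (1 + u\<^sup>2)" by (rule divide_left_mono) (auto simp: add_pos_nonneg)
    then show "of_bool (0 < u) * ennreal (2 / pi * h u) * ennreal (1 / (1 + u\<^sup>2) - 1 / (5 + u\<^sup>2)) = ennreal (2 / pi) * (of_bool (0 < u) * ennreal (u\<^sup>2 / (1 + u\<^sup>2) * (1 / (1 + u\<^sup>2) - 1 / (5 + u\<^sup>2))))"
      by (simp add: h_def ennreal_mult[symmetric])
  qed
  also have "\<dots> = ennreal (2 / pi) * ennreal (pi / 4 - (sqrt 5 - 1) * pi / 8)"
    by (subst nn_integral_cmult, measurable) (simp only: integral_rational_W)
  also have "\<dots> = ennreal (2 / pi * (pi / 4 - (sqrt 5 - 1) * pi / 8))" by (rule ennreal_mult'[symmetric]) simp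
  also have "2 / pi * (pi / 4 - (sqrt 5 - 1) * pi / 8) = 3 / 4 - sqrt 5 / 4" by (simp add: field_simps)
  finally show ?thesis unfolding g_def .
qed

text \<open>\<open>p / sqrt (1 - p^2)\<close> is the tangent of \<open>arcsin p\<close>, a
  composition of increasing functions.\<close>

lemma less_over_sqrt_iff:
  fixes p q :: real
  assumes "- 1 < p" "p < 1" "- 1 < q" "q < 1"
  shows "p / sqrt (1 - p\<^sup>2) < q / sqrt (1 - q\<^sup>2) \<longleftrightarrow> p < q"
proof -
  have "tan (arcsin p) < tan (arcsin q) \<longleftrightarrow> arcsin p < arcsin q"
    using assms arcsin_lt_bounded by (intro tan_mono_lt_eq) auto
  also have "\<dots> \<longleftrightarrow> p < q" using assms by (intro arcsin_less_mono) auto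
  finally show ?thesis using assms by (simp add: tan_def cos_arcsin)
qed

text \<open>With \<open>p = 1 - 2 * r\<close> the condition compares
  \<open>p / sqrt (1 - p^2)\<close> with the same expression in \<open>q\<close>, so it reads
  \<open>r > r0\<close> for \<open>r0 = (1 - q) / 2\<close>. The integral of \<open>2 * r\<close>
  over (r0, 1) exceeds its length by \<open>r0 * (1 - r0)\<close>. The sum form avoids the signed
  weight \<open>2 * r - 1\<close>.\<close>

lemma argmax_time_B_inner:
  fixes a n :: real
  assumes a: "0 < a"
  shows "(\<integral>\<^sup>+r. in_01 r * ennreal (2 * r) * of_bool (a * (1 - 2 * r) < sqrt (r * (1 - r)) * n) \<partial>lborel)
    = (\<integral>\<^sup>+r. in_01 r * of_bool (a * (1 - 2 * r) < sqrt (r * (1 - r)) * n) \<partial>lborel) + ennreal (a\<^sup>2 / (n\<^sup>2 + 4 * a\<^sup>2))"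
proof -
  define S where "S = sqrt (n\<^sup>2 + 4 * a\<^sup>2)"
  define q where "q = n / S"
  have s: "0 < n\<^sup>2 + 4 * a\<^sup>2" using a by (simp add: add_nonneg_pos)
  have S: "0 < S" "S\<^sup>2 = n\<^sup>2 + 4 * a\<^sup>2" using s by (simp_all add: S_def)
  have q2: "1 - q\<^sup>2 = (2 * a / S)\<^sup>2" using S(1) s unfolding q_def power_divide S(2) by (simp add: field_simps power2_eq_square)
  have sq: "sqrt (1 - q\<^sup>2) = 2 * a / S" unfolding q2 using a S by simp
  have "0 < 1 - q\<^sup>2" unfolding q2 using a S(1) by simp
  then have q1: "- 1 < q" "q < 1" using abs_square_less_1[of q] by auto
  have iff: "a * (1 - 2 * r) < sqrt (r * (1 - r)) * n \<longleftrightarrow> (1 - q) / 2 < r" if r: "0 < r" "r < 1" for r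
  proof -
    define p where "p = 1 - 2 * r"
    have p: "- 1 < p" "p < 1" using r by (auto simp: p_def)
    have "1 - p\<^sup>2 = 2\<^sup>2 * (r * (1 - r))" by (simp add: p_def power2_eq_square algebra_simps)
    then have sp: "sqrt (1 - p\<^sup>2) = 2 * sqrt (r * (1 - r))" by (simp add: real_sqrt_mult)
    have pos: "0 < sqrt (r * (1 - r))" using r by simp
    have "p / sqrt (1 - p\<^sup>2) < q / sqrt (1 - q\<^sup>2) \<longleftrightarrow> p / (2 * sqrt (r * (1 - r))) < n / (2 * a)"
      unfolding sp sq using S(1) by (simp add: q_def)
    also have "\<dots> \<longleftrightarrow> a * p < sqrt (r * (1 - r)) * n"
      using pos a by (simp add: field_simps)
    finally show ?thesis using less_over_sqrt_iff[OF p q1] by (auto simp: p_def)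
  qed
  define r0 where "r0 = (1 - q) / 2"
  have r0: "0 < r0" "r0 < 1" using q1 by (auto simp: r0_def)
  have e: "in_01 r * of_bool (a * (1 - 2 * r) < sqrt (r * (1 - r)) * n) = (indicator {r0<..<1} r :: ennreal)" for r
    using r0 iff[of r] by (cases "0 < r \<and> r < 1") (auto simp: r0_def[symmetric] split: split_indicator)
  have 1: "(\<integral>\<^sup>+r. in_01 r * of_bool (a * (1 - 2 * r) < sqrt (r * (1 - r)) * n) \<partial>lborel) = ennreal (1 - r0)"
    unfolding e using r0 by simp
  have "(\<integral>\<^sup>+r. in_01 r * ennreal (2 * r) * of_bool (a * (1 - 2 * r) < sqrt (r * (1 - r)) * n) \<partial>lborel)
    = (\<integral>\<^sup>+r. ennreal (2 * r) * indicator {r0<..<1} r \<partial>lborel)"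
    unfolding e[symmetric] by (simp add: mult_ac)
  also have "\<dots> = (\<integral>\<^sup>+r. ennreal (2 * r) * indicator {r0..1} r \<partial>lborel)"
  proof (rule nn_integral_cong_AE)
    show "AE r in lborel. ennreal (2 * r) * indicator {r0<..<1} r = ennreal (2 * r) * indicator {r0..1} r"
      using AE_lborel_singleton[of r0] AE_lborel_singleton[of 1] by eventually_elim (auto split: split_indicator)
  qed
  also have "\<dots> = ennreal (1\<^sup>2 - r0\<^sup>2)"
    using r0 by (intro nn_integral_FTC_Icc) (auto intro!: derivative_eq_intros)
  also have "1\<^sup>2 - r0\<^sup>2 = (1 - r0) + a\<^sup>2 / (n\<^sup>2 + 4 * a\<^sup>2)"
  proof -
    have "r0 - r0\<^sup>2 = (1 - q\<^sup>2) / 4" by (simp add: r0_def power2_eq_square field_simps)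
    also have "\<dots> = a\<^sup>2 / (n\<^sup>2 + 4 * a\<^sup>2)" unfolding q2 S(2)[symmetric] by (simp add: power_divide power_mult_distrib)
    finally show ?thesis by simp
  qed
  finally show ?thesis unfolding 1 using r0 s by (simp add: ennreal_plus)
qed

text \<open>This is the mean of \<tau> (1 - \<tau>) on the event that the bridge wins. The scalings
  \<open>y = a * v\<close> and \<open>n = 2 * a * u\<close> make the exponent quadratic in
  \<open>a\<close>; the integrals over \<open>a\<close>, \<open>u\<close> and \<open>v\<close> are
  then done in this order.\<close>

lemma argmax_time_B_defect:
  "(\<integral>\<^sup>+a. half_normal_cdf a * rayleigh a
      * time_defect a \<partial>lborel) = ennreal (19 * sqrt 5 / 30 - 4 / 3)"
proof -
  define b where "b v = sqrt (1 + v\<^sup>2 / 4)" for v :: real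
  let ?U = "\<lambda>v u. of_bool (0 < v \<and> v \<le> 1) * ennreal (2 / pi / (1 + u\<^sup>2))"
  let ?E = "\<lambda>v u (a :: real). of_bool (0 < a) * ennreal (a ^ 3 * exp (- (4 + v\<^sup>2 + 4 * u\<^sup>2) * a\<^sup>2 / 2))"
  have b: "1 < b v" "(b v)\<^sup>2 = 1 + v\<^sup>2 / 4" if "0 < v" for v using that by (auto simp: b_def)
  have [measurable]: "b \<in> borel_measurable borel" unfolding b_def by measurable
  have "(\<integral>\<^sup>+a. half_normal_cdf a * rayleigh a
      * time_defect a \<partial>lborel)
    = (\<integral>\<^sup>+a. \<integral>\<^sup>+v. \<integral>\<^sup>+u. ?U v u * (?E v u a) \<partial>lborel \<partial>lborel \<partial>lborel)"
  proof (rule nn_integral_cong)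
    fix a :: real
    show "half_normal_cdf a * rayleigh a
      * time_defect a
      = (\<integral>\<^sup>+v. \<integral>\<^sup>+u. ?U v u * (?E v u a) \<partial>lborel \<partial>lborel)"
    proof (cases "0 < a")
      case False then show ?thesis by simp
    next
      case a: True
      have y: "half_normal_cdf a = (\<integral>\<^sup>+v. ennreal a * (of_bool (0 < v \<and> v \<le> 1) * ennreal (2 * heat 1 (a * v))) \<partial>lborel)"
        using a by (subst nn_integral_scale[OF _ a]) (auto simp: zero_less_mult_iff)
      have n: "time_defect a = (\<integral>\<^sup>+u. ennreal (2 * a) * (ennreal (heat 1 (2 * a * u)) * ennreal (a\<^sup>2 / ((2 * a * u)\<^sup>2 + 4 * a\<^sup>2))) \<partial>lborel)"
        using a by (subst nn_integral_scale[of _ "2 * a"]) auto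
      define c where "c = of_bool (0 < a) * ennreal (4 * a * exp (- 2 * a\<^sup>2))"
      have "half_normal_cdf a * c
          * time_defect a
        = (\<integral>\<^sup>+v. \<integral>\<^sup>+u. ennreal a * (of_bool (0 < v \<and> v \<le> 1) * ennreal (2 * heat 1 (a * v))) * c * (ennreal (2 * a) * (ennreal (heat 1 (2 * a * u)) * ennreal (a\<^sup>2 / ((2 * a * u)\<^sup>2 + 4 * a\<^sup>2)))) \<partial>lborel \<partial>lborel)"
        unfolding y n by (subst nn_integral_cmult, measurable) (subst nn_integral_multc, measurable, subst nn_integral_multc, measurable)
      also have "\<dots> = (\<integral>\<^sup>+v. \<integral>\<^sup>+u. ?U v u * (?E v u a) \<partial>lborel \<partial>lborel)"
      proof (intro nn_integral_cong)
        fix v u :: real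
        have q: "a\<^sup>2 / ((2 * a * u)\<^sup>2 + 4 * a\<^sup>2) = 1 / (4 * (1 + u\<^sup>2))"
        proof -
          have "a\<^sup>2 / ((2 * a * u)\<^sup>2 + 4 * a\<^sup>2) = (a\<^sup>2 * 1) / (a\<^sup>2 * (4 * (1 + u\<^sup>2)))" by (simp add: power_mult_distrib algebra_simps)
          then show ?thesis using a by simp
        qed
        have ex: "exp (- (4 + v\<^sup>2 + 4 * u\<^sup>2) * a\<^sup>2 / 2) = exp (- 2 * a\<^sup>2) * exp (- (a * v)\<^sup>2 / 2) * exp (- (2 * a * u)\<^sup>2 / 2)"
          by (simp add: exp_add[symmetric] power_mult_distrib field_simps)
        have hh: "heat 1 (a * v) = exp (- (a * v)\<^sup>2 / 2) / sqrt (2 * pi)" "heat 1 (2 * a * u) = exp (- (2 * a * u)\<^sup>2 / 2) / sqrt (2 * pi)" by (simp_all add: heat_eq)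
        have up: "1 + u\<^sup>2 > 0" by (simp add: add_pos_nonneg)
        have sp: "sqrt (2 * pi) * sqrt (2 * pi) = 2 * pi" by simp
        have "a * (2 * heat 1 (a * v)) * (4 * a * exp (- 2 * a\<^sup>2)) * (2 * a * (heat 1 (2 * a * u) * (1 / (4 * (1 + u\<^sup>2)))))
          = 2 / pi / (1 + u\<^sup>2) * (a ^ 3 * exp (- (4 + v\<^sup>2 + 4 * u\<^sup>2) * a\<^sup>2 / 2))"
        proof -
          have key: "a * (2 * (E1 / S)) * (4 * a * E0) * (2 * a * ((E2 / S) * (1 / (4 * U)))) = 4 / (S * S) / U * (a ^ 3 * (E0 * E1 * E2))" for E0 E1 E2 S U :: real
            by (simp add: power3_eq_cube mult_ac)
          have "4 / (sqrt (2 * pi) * sqrt (2 * pi)) = 2 / pi" unfolding sp by simp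
          then show ?thesis unfolding hh ex key by simp
        qed
        then show "ennreal a * (of_bool (0 < v \<and> v \<le> 1) * ennreal (2 * heat 1 (a * v))) * c * (ennreal (2 * a) * (ennreal (heat 1 (2 * a * u)) * ennreal (a\<^sup>2 / ((2 * a * u)\<^sup>2 + 4 * a\<^sup>2))))
          = ?U v u * (?E v u a)"
          using a up unfolding q c_def by (cases "0 < v \<and> v \<le> 1") (simp_all add: ennreal_mult[symmetric])
      qed
      finally show ?thesis unfolding c_def .
    qed
  qed
  also have "\<dots> = (\<integral>\<^sup>+v. \<integral>\<^sup>+a. \<integral>\<^sup>+u. ?U v u * (?E v u a) \<partial>lborel \<partial>lborel \<partial>lborel)"
    by (rule lborel_pair.Fubini') measurable
  also have "\<dots> = (\<integral>\<^sup>+v. \<integral>\<^sup>+u. \<integral>\<^sup>+a. ?U v u * (?E v u a) \<partial>lborel \<partial>lborel \<partial>lborel)"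
    by (rule nn_integral_cong, rule lborel_pair.Fubini') measurable
  also have "\<dots> = (\<integral>\<^sup>+v. \<integral>\<^sup>+u. of_bool (0 < v \<and> v \<le> 1) * ennreal (1 / (4 * pi)) * ennreal (1 / ((1 + u\<^sup>2) * (u\<^sup>2 + (b v)\<^sup>2)\<^sup>2)) \<partial>lborel \<partial>lborel)"
  proof (intro nn_integral_cong, goal_cases)
    case (1 v u)
    show ?case
    proof (cases "0 < v \<and> v \<le> 1")
      case False then show ?thesis by (auto simp: )
    next
      case True
      define c where "c = 4 + v\<^sup>2 + 4 * u\<^sup>2"
      have c: "0 < c" "c = 4 * (u\<^sup>2 + (b v)\<^sup>2)" using True b(2)[of v] by (simp_all add: c_def add_pos_nonneg)
      have up: "1 + u\<^sup>2 > 0" by (simp add: add_pos_nonneg)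
      have "(\<integral>\<^sup>+a. ?U v u * (of_bool (0 < a) * ennreal (a ^ 3 * exp (- c * a\<^sup>2 / 2))) \<partial>lborel)
        = ennreal (2 / pi / (1 + u\<^sup>2)) * ennreal (2 / c\<^sup>2)"
        using True by (subst nn_integral_cmult, measurable) (simp only: integral_x3_gaussian[OF c(1)], simp)
      also have "\<dots> = ennreal (2 / pi / (1 + u\<^sup>2) * (2 / c\<^sup>2))" using up by (intro ennreal_mult[symmetric]) auto
      also have "2 / pi / (1 + u\<^sup>2) * (2 / c\<^sup>2) = 1 / (4 * pi) * (1 / ((1 + u\<^sup>2) * (u\<^sup>2 + (b v)\<^sup>2)\<^sup>2))"
      proof -
        have "2 / pi / U * (2 / (4 * V)\<^sup>2) = 1 / (4 * pi) * (1 / (U * V\<^sup>2))" for U V :: real by (simp add: power_mult_distrib)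
        then show ?thesis unfolding c(2) .
      qed
      finally show ?thesis using True up unfolding c_def by (simp add: ennreal_mult[symmetric])
    qed
  qed
  also have "\<dots> = (\<integral>\<^sup>+v. ennreal (1 / 8) * (of_bool (0 < v \<and> v \<le> 1) * ennreal ((1 + 2 * b v) / (b v ^ 3 * (1 + b v)\<^sup>2))) \<partial>lborel)"
  proof (rule nn_integral_cong)
    fix v :: real
    show "(\<integral>\<^sup>+u. of_bool (0 < v \<and> v \<le> 1) * ennreal (1 / (4 * pi)) * ennreal (1 / ((1 + u\<^sup>2) * (u\<^sup>2 + (b v)\<^sup>2)\<^sup>2)) \<partial>lborel)
      = ennreal (1 / 8) * (of_bool (0 < v \<and> v \<le> 1) * ennreal ((1 + 2 * b v) / (b v ^ 3 * (1 + b v)\<^sup>2)))"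
    proof (cases "0 < v \<and> v \<le> 1")
      case False then show ?thesis by (auto simp: )
    next
      case True
      then have bv: "1 < b v" using b(1)[of v] by simp
      have "(\<integral>\<^sup>+u. of_bool (0 < v \<and> v \<le> 1) * ennreal (1 / (4 * pi)) * ennreal (1 / ((1 + u\<^sup>2) * (u\<^sup>2 + (b v)\<^sup>2)\<^sup>2)) \<partial>lborel)
        = ennreal (1 / (4 * pi)) * ennreal (pi * (1 + 2 * b v) / (2 * b v ^ 3 * (1 + b v)\<^sup>2))"
        using True by (subst nn_integral_cmult, measurable) (simp only: integral_rational_B[OF bv], simp)
      also have "\<dots> = ennreal (1 / (4 * pi) * (pi * (1 + 2 * b v) / (2 * b v ^ 3 * (1 + b v)\<^sup>2)))"
        using bv by (intro ennreal_mult[symmetric]) auto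
      also have "1 / (4 * pi) * (pi * (1 + 2 * b v) / (2 * b v ^ 3 * (1 + b v)\<^sup>2)) = 1 / 8 * ((1 + 2 * b v) / (b v ^ 3 * (1 + b v)\<^sup>2))" by simp
      finally show ?thesis using True bv by (simp add: ennreal_mult[symmetric])
    qed
  qed
  also have "\<dots> = ennreal (1 / 8) * ennreal (76 / 15 * sqrt 5 - 32 / 3)"
    by (subst nn_integral_cmult, measurable) (simp only: b_def integral_algebraic_B)
  also have "\<dots> = ennreal (1 / 8 * (76 / 15 * sqrt 5 - 32 / 3))" by (rule ennreal_mult'[symmetric]) simp
  also have "1 / 8 * (76 / 15 * sqrt 5 - 32 / 3) = 19 * sqrt 5 / 30 - 4 / 3" by simp
  finally show ?thesis .
qed

section \<open>The maxima of a motion and an independent bridge\<close>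

lemma (in prob_space) indep_rv_sym: "indep_rv S X T Y \<Longrightarrow> indep_rv T Y S X"
proof -
  assume i: "indep_rv S X T Y"
  have "Y -` B \<inter> X -` A \<inter> space M = X -` A \<inter> Y -` B \<inter> space M" for A B by auto
  then show ?thesis using i by (simp add: indep_rv_def mult.commute)
qed

lemma (in prob_space) indep_rv_no_tie:
  fixes X Y :: "'a \<Rightarrow> real"
  assumes ind: "indep_rv borel X borel Y" and Y: "\<And>c. AE w in M. Y w \<noteq> c"
  shows "AE w in M. X w \<noteq> Y w"
proof -
  have [measurable]: "X \<in> borel_measurable M" "Y \<in> borel_measurable M" using ind by (auto simp: indep_rv_def)
  have "(\<integral>\<^sup>+w. of_bool (X w = Y w) \<partial>M) = (\<integral>\<^sup>+w. \<integral>\<^sup>+w'. of_bool (X w = Y w') \<partial>M \<partial>M)"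
    using indep_rv_nn_integral[OF ind, of "\<lambda>z. of_bool (fst z = snd z)"] by simp
  also have "\<dots> = (\<integral>\<^sup>+w. 0 \<partial>M)"
  proof (rule nn_integral_cong)
    fix w assume "w \<in> space M"
    have "(\<integral>\<^sup>+w'. of_bool (X w = Y w') \<partial>M) = (\<integral>\<^sup>+w'. 0 \<partial>M)"
      by (rule nn_integral_cong_AE) (use Y[of "X w"] in eventually_elim, auto)
    then show "(\<integral>\<^sup>+w'. of_bool (X w = Y w') \<partial>M) = 0" by simp
  qed
  finally have "(\<integral>\<^sup>+w. of_bool (X w = Y w) \<partial>M) = 0" by simp
  then have "AE w in M. of_bool (X w = Y w) = (0 :: ennreal)" by (subst (asm) nn_integral_0_iff_AE) auto
  then show ?thesis by eventually_elim auto
qed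

text \<open>Ties being null, strict inequalities become weak ones, as in the argmax laws.
  Integrating out \<open>Z\<close> first leaves its distribution function at
  \<open>X\<close>.\<close>

lemma (in prob_space) strict_max_law:
  fixes X Y Z :: "'a \<Rightarrow> real"
  assumes ind: "indep_rv borel2 (\<lambda>w. (X w, Y w)) borel Z"
    and XY: "AE w in M. X w \<noteq> Y w" and XZ: "AE w in M. X w \<noteq> Z w"
  shows "emeasure M {w \<in> space M. Y w < X w \<and> Z w < X w}
    = (\<integral>\<^sup>+w. emeasure M {w' \<in> space M. Z w' \<le> X w} * of_bool (Y w \<le> X w) \<partial>M)"
proof -
  have xy: "(\<lambda>w. (X w, Y w)) \<in> M \<rightarrow>\<^sub>M borel2" and [measurable]: "Z \<in> borel_measurable M" using ind by (auto simp: indep_rv_def)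
  have [measurable]: "X \<in> borel_measurable M" "Y \<in> borel_measurable M"
    using measurable_compose[OF xy measurable_fst] measurable_compose[OF xy measurable_snd] by simp_all
  let ?F = "\<lambda>z. of_bool (snd (fst z) \<le> fst (fst z)) * of_bool (snd z \<le> fst (fst z)) :: ennreal"
  have "emeasure M {w \<in> space M. Y w < X w \<and> Z w < X w} = (\<integral>\<^sup>+w. of_bool (Y w < X w \<and> Z w < X w) \<partial>M)"
    by (simp add: nn_integral_of_bool)
  also have "\<dots> = (\<integral>\<^sup>+w. ?F ((X w, Y w), Z w) \<partial>M)"
    by (rule nn_integral_cong_AE) (use XY XZ in eventually_elim, auto)
  also have "\<dots> = (\<integral>\<^sup>+w. \<integral>\<^sup>+w'. ?F ((X w, Y w), Z w') \<partial>M \<partial>M)"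
    by (rule indep_rv_nn_integral[OF ind]) measurable
  also have "\<dots> = (\<integral>\<^sup>+w. emeasure M {w' \<in> space M. Z w' \<le> X w} * of_bool (Y w \<le> X w) \<partial>M)"
    by (rule nn_integral_cong) (simp add: nn_integral_cmult nn_integral_of_bool mult.commute)
  finally show ?thesis .
qed

text \<open>The supremum over an interval of times is not measurable on an uncountable product
  space. This limit reads countably many coordinates, and on continuous paths it is the maximum; it
  turns independence of processes into independence of maxima.\<close>

definition coord_max :: "real \<Rightarrow> real \<Rightarrow> (real \<Rightarrow> real) \<Rightarrow> real" where
  "coord_max a b x = lim (\<lambda>N. Max (x ` grid a b N ` {..Suc N}))"

lemma borel_measurable_coord_max:
  assumes "a < b" "{a..b} \<subseteq> I"
  shows "coord_max a b \<in> borel_measurable (\<Pi>\<^sub>M i\<in>I. borel)"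
  unfolding coord_max_def[abs_def] image_image
proof (intro borel_measurable_lim_metric borel_measurable_Max)
  fix N k assume "k \<in> {..Suc N}"
  then have "grid a b N k \<in> I" using grid_in[OF assms(1), of k N] assms(2) by auto
  then show "(\<lambda>x. x (grid a b N k)) \<in> borel_measurable (\<Pi>\<^sub>M i\<in>I. borel)" by (rule measurable_component_singleton)
qed auto

lemma coord_max_eq:
  assumes "a < b" "{a..b} \<subseteq> I" "continuous_on {a..b} f"
  shows "coord_max a b (restrict f I) = path_max f a b"
proof -
  have "grid a b N k \<in> I" if "k \<le> Suc N" for N k
    using grid_in[OF assms(1) that] assms(2) by auto
  then have "restrict f I ` grid a b N ` {..Suc N} = f ` grid a b N ` {..Suc N}" for N
    by (intro image_cong refl) auto
  then show ?thesis unfolding coord_max_def using grid_max_tendsto[OF assms(1,3)] by (simp add: limI)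
qed

locale motion_bridge = bridge_and_motion M B M W for M :: "'w measure" and B W :: "real \<Rightarrow> 'w \<Rightarrow> real" +
  assumes indep_WB: "indep_processes {0..} W {0..1} B"
begin

lemma indep_rv_WB: "indep_rv (\<Pi>\<^sub>M i\<in>{0..}. borel) (\<lambda>w. \<lambda>i\<in>{0..}. W i w) (\<Pi>\<^sub>M j\<in>{0..1}. borel) (\<lambda>w. \<lambda>j\<in>{0..1}. B j w)"
  using indep_WB unfolding indep_processes_def by (rule indep_rv_of_indep_var)

lemma indep_W_blocks:
  assumes r: "0 < r" "r < 1"
  shows "indep_rv borel2 (\<lambda>w. (wmx 0 r w, wmx r 1 w)) borel (\<lambda>w. bmx 0 1 w)"
proof -
  have "indep_rv borel2 (\<lambda>w. (\<lambda>x. (coord_max 0 r x, coord_max r 1 x)) (\<lambda>i\<in>{0..}. W i w)) borel (\<lambda>w. coord_max 0 1 (\<lambda>j\<in>{0..1}. B j w))"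
    by (rule indep_rv_compose[OF indep_rv_WB]) (intro measurable_Pair borel_measurable_coord_max; use r in auto)+
  then show ?thesis
    by (rule indep_rv_cong) (use r in \<open>simp_all add: coord_max_eq W.W_cont B_cont\<close>)
qed

lemma indep_B_blocks:
  assumes r: "0 < r" "r < 1"
  shows "indep_rv borel2 (\<lambda>w. (bmx 0 r w, bmx r 1 w)) borel (\<lambda>w. wmx 0 1 w)"
proof -
  have "indep_rv borel (\<lambda>w. coord_max 0 1 (\<lambda>i\<in>{0..}. W i w)) borel2 (\<lambda>w. (\<lambda>x. (coord_max 0 r x, coord_max r 1 x)) (\<lambda>j\<in>{0..1}. B j w))"
    by (rule indep_rv_compose[OF indep_rv_WB]) (intro measurable_Pair borel_measurable_coord_max; use r in auto)+
  then have "indep_rv borel (\<lambda>w. wmx 0 1 w) borel2 (\<lambda>w. (bmx 0 r w, bmx r 1 w))"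
    by (rule indep_rv_cong) (use r in \<open>simp_all add: coord_max_eq W.W_cont B_cont\<close>)
  then show ?thesis by (rule indep_rv_sym)
qed

lemma indep_maxima: "indep_rv borel (\<lambda>w. wmx 0 1 w) borel (\<lambda>w. bmx 0 1 w)"
proof -
  have "indep_rv borel (\<lambda>w. coord_max 0 1 (\<lambda>i\<in>{0..}. W i w)) borel (\<lambda>w. coord_max 0 1 (\<lambda>j\<in>{0..1}. B j w))"
    by (rule indep_rv_compose[OF indep_rv_WB]; rule borel_measurable_coord_max) auto
  then show ?thesis
    by (rule indep_rv_cong) (simp_all add: coord_max_eq W.W_cont B_cont)
qed

lemma no_tie_bmx:
  assumes r: "0 < r" "r < 1"
  shows "AE w in M. bmx 0 r w \<noteq> wmx 0 1 w"
proof -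
  have "indep_rv borel (\<lambda>w. fst (bmx 0 r w, bmx r 1 w)) borel (\<lambda>w. wmx 0 1 w)"
    by (rule indep_rv_compose[OF indep_B_blocks[OF r]]) auto
  then show ?thesis using indep_rv_no_tie[OF _ W.mx_no_atom] by simp
qed

lemma no_tie_wmx:
  assumes r: "0 < r" "r < 1"
  shows "AE w in M. wmx 0 r w \<noteq> bmx 0 1 w"
proof -
  have "indep_rv borel (\<lambda>w. fst (wmx 0 r w, wmx r 1 w)) borel (\<lambda>w. bmx 0 1 w)"
    by (rule indep_rv_compose[OF indep_W_blocks[OF r]]) auto
  then have "indep_rv borel (\<lambda>w. bmx 0 1 w) borel (\<lambda>w. wmx 0 r w)" by (simp add: indep_rv_sym)
  from indep_rv_no_tie[OF this W.mx_no_atom[OF r(1)]] show ?thesis by eventually_elim auto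
qed

lemma no_tie_maxima: "AE w in M. wmx 0 1 w \<noteq> bmx 0 1 w"
proof -
  have "AE w in M. bmx 0 1 w \<noteq> wmx 0 1 w"
    by (rule indep_rv_no_tie[OF indep_rv_sym[OF indep_maxima] W.mx_no_atom]) simp
  then show ?thesis by eventually_elim auto
qed

lemma wmx_pos: "0 < s \<Longrightarrow> AE w in M. 0 < wmx 0 s w"
proof -
  assume s: "0 < s"
  show ?thesis
    using W.mx_no_atom[OF s, of 0] AE_space by eventually_elim (use W.mx_nonneg[OF s] in \<open>force simp: less_le\<close>)
qed

text \<open>The overall maximum of the first coordinates is attained by the motion up to time
  \<open>r\<close>; \<open>winB\<close> is the analogue for the bridge. These events stand in for
  the time of the maximum.\<close>

definition winW where "winW r w \<longleftrightarrow> wmx r 1 w < wmx 0 r w \<and> bmx 0 1 w < wmx 0 r w"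
definition winB where "winB r w \<longleftrightarrow> bmx r 1 w < bmx 0 r w \<and> wmx 0 1 w < bmx 0 r w"

lemma measurable_winW [measurable]: "0 < r \<Longrightarrow> r < 1 \<Longrightarrow> Measurable.pred M (winW r)"
  unfolding winW_def[abs_def] by (intro pred_intros_logic borel_measurable_pred_less) simp_all

lemma measurable_winB [measurable]: "0 < r \<Longrightarrow> r < 1 \<Longrightarrow> Measurable.pred M (winB r)"
  unfolding winB_def[abs_def] by (intro pred_intros_logic borel_measurable_pred_less) simp_all

lemma winW_law:
  assumes r: "0 < r" "r < 1"
  shows "emeasure M {w \<in> space M. winW r w} = (\<integral>\<^sup>+a. ennreal (1 - exp (- 2 * a\<^sup>2)) * (of_bool (0 < a) * ennreal (4 * heat 1 a))
      * normal_above (a * (1 - r)) (sqrt (r * (1 - r))) \<partial>lborel)"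
proof -
  have "emeasure M {w \<in> space M. winW r w} = (\<integral>\<^sup>+w. emeasure M {w' \<in> space M. bmx 0 1 w' \<le> wmx 0 r w} * of_bool (wmx r 1 w \<le> wmx 0 r w) \<partial>M)"
    unfolding winW_def by (rule strict_max_law[OF indep_W_blocks[OF r] W.block_no_tie[OF r] no_tie_wmx[OF r]])
  also have "\<dots> = (\<integral>\<^sup>+w. ennreal (1 - exp (- 2 * (wmx 0 r w)\<^sup>2)) * of_bool (wmx r 1 w \<le> wmx 0 r w) \<partial>M)"
    by (rule nn_integral_cong_AE) (use wmx_pos[OF r(1)] in eventually_elim, simp add: bmx_cdf)
  also have "\<dots> = (\<integral>\<^sup>+a. ennreal (1 - exp (- 2 * a\<^sup>2)) * (of_bool (0 < a) * ennreal (4 * heat 1 a))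
      * normal_above (a * (1 - r)) (sqrt (r * (1 - r))) \<partial>lborel)"
    by (rule W.argmax_law[OF r]) measurable
  finally show ?thesis .
qed

lemma wmx_cdf: "emeasure M {w \<in> space M. wmx 0 1 w \<le> a} = half_normal_cdf a"
proof -
  have [measurable]: "(\<lambda>w. wmx 0 1 w) \<in> borel_measurable M" by simp
  have "emeasure M {w \<in> space M. wmx 0 1 w \<le> a} = (\<integral>\<^sup>+w. of_bool (wmx 0 1 w \<le> a) \<partial>M)" by (simp add: nn_integral_of_bool)
  also have "\<dots> = (\<integral>\<^sup>+y. of_bool (y \<le> a) * (of_bool (0 < y) * ennreal (2 * heat 1 y)) \<partial>lborel)"
    by (rule W.mx_nn_integral) auto
  also have "\<dots> = half_normal_cdf a"
    by (intro nn_integral_cong) auto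
  finally show ?thesis .
qed

lemma winB_law:
  assumes r: "0 < r" "r < 1"
  shows "emeasure M {w \<in> space M. winB r w} = (\<integral>\<^sup>+a. half_normal_cdf a * rayleigh a
      * normal_above (a * (1 - 2 * r)) (sqrt (r * (1 - r))) \<partial>lborel)"
proof -
  have "emeasure M {w \<in> space M. winB r w} = (\<integral>\<^sup>+w. emeasure M {w' \<in> space M. wmx 0 1 w' \<le> bmx 0 r w} * of_bool (bmx r 1 w \<le> bmx 0 r w) \<partial>M)"
    unfolding winB_def by (rule strict_max_law[OF indep_B_blocks[OF r] bridge_no_tie[OF r] no_tie_bmx[OF r]])
  also have "\<dots> = (\<integral>\<^sup>+a. emeasure M {w' \<in> space M. wmx 0 1 w' \<le> a} * rayleigh a
      * normal_above (a * (1 - 2 * r)) (sqrt (r * (1 - r))) \<partial>lborel)"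
  proof (rule bridge_argmax_law[OF r])
    show "(\<lambda>a. emeasure M {w' \<in> space M. wmx 0 1 w' \<le> a}) \<in> borel_measurable borel" unfolding wmx_cdf by measurable
  qed (rule emeasure_le_1)
  finally show ?thesis unfolding wmx_cdf .
qed

lemma winW_integral: "(\<integral>\<^sup>+r. in_01 r * emeasure M {w \<in> space M. winW r w} \<partial>lborel) = ennreal (3 / 4 - sqrt 5 / 4)"
  unfolding argmax_time_W_integral[symmetric] by (rule nn_integral_cong) (auto simp: winW_law)

text \<open>Says without subtraction that the integral of \<open>2 * r - 1\<close> against the
  probability of \<open>winB r\<close> is the mean of \<tau> (1 - \<tau>) on the event that the
  bridge wins.\<close>

lemma winB_integral:
  "(\<integral>\<^sup>+r. in_01 r * ennreal (2 * r) * emeasure M {w \<in> space M. winB r w} \<partial>lborel)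
    = (\<integral>\<^sup>+r. in_01 r * emeasure M {w \<in> space M. winB r w} \<partial>lborel) + ennreal (19 * sqrt 5 / 30 - 4 / 3)"
proof -
  define g where "g a = half_normal_cdf a * rayleigh a" for a
  have [measurable]: "g \<in> borel_measurable borel" unfolding g_def by measurable
  define Q where "Q r a n \<longleftrightarrow> a * (1 - 2 * r) < sqrt (r * (1 - r)) * n" for r a n :: real
  have [measurable]: "Measurable.pred (borel \<Otimes>\<^sub>M borel \<Otimes>\<^sub>M borel) (\<lambda>(r, a, n). Q r a n)"
    unfolding Q_def case_prod_beta' by measurable
  have [measurable (raw)]: "Measurable.pred X (\<lambda>z. Q (f z) (h z) (l z))"
    if [measurable]: "f \<in> borel_measurable X" "h \<in> borel_measurable X" "l \<in> borel_measurable X"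
    for X :: "'c measure" and f h l unfolding Q_def by measurable
  have law: "emeasure M {w \<in> space M. winB r w} = (\<integral>\<^sup>+a. g a * (\<integral>\<^sup>+n. ennreal (heat 1 n) * of_bool (Q r a n) \<partial>lborel) \<partial>lborel)"
    if "0 < r \<and> r < 1" for r unfolding g_def Q_def using that by (intro winB_law) auto
  let ?T = "\<lambda>a. (\<integral>\<^sup>+n. ennreal (heat 1 n) * (\<integral>\<^sup>+r. in_01 r * of_bool (Q r a n) \<partial>lborel) \<partial>lborel)"
  have "(\<integral>\<^sup>+r. in_01 r * ennreal (2 * r) * emeasure M {w \<in> space M. winB r w} \<partial>lborel)
    = (\<integral>\<^sup>+r. (in_01 r * ennreal (2 * r)) * (\<integral>\<^sup>+a. g a * (\<integral>\<^sup>+n. ennreal (heat 1 n) * of_bool (Q r a n) \<partial>lborel) \<partial>lborel) \<partial>lborel)"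
    by (rule nn_integral_cong) (auto simp: law)
  also have "\<dots> = (\<integral>\<^sup>+a. g a * (\<integral>\<^sup>+n. ennreal (heat 1 n) * (\<integral>\<^sup>+r. (in_01 r * ennreal (2 * r)) * of_bool (Q r a n) \<partial>lborel) \<partial>lborel) \<partial>lborel)"
    by (rule nn_integral_swap_inner) measurable
  also have "\<dots> = (\<integral>\<^sup>+a. g a * (?T a)
      + g a * time_defect a \<partial>lborel)"
  proof (rule nn_integral_cong)
    fix a :: real
    show "g a * (\<integral>\<^sup>+n. ennreal (heat 1 n) * (\<integral>\<^sup>+r. (in_01 r * ennreal (2 * r)) * of_bool (Q r a n) \<partial>lborel) \<partial>lborel)
      = g a * (?T a)
      + g a * time_defect a"
    proof (cases "0 < a")
      case False then show ?thesis by (simp add: g_def)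
    next
      case a: True
      have "(\<integral>\<^sup>+r. (in_01 r * ennreal (2 * r)) * of_bool (Q r a n) \<partial>lborel)
        = (\<integral>\<^sup>+r. in_01 r * of_bool (Q r a n) \<partial>lborel) + ennreal (a\<^sup>2 / (n\<^sup>2 + 4 * a\<^sup>2))" for n
        unfolding Q_def by (rule argmax_time_B_inner[OF a])
      then show ?thesis
        unfolding distrib_left[symmetric] by (subst nn_integral_add[symmetric]) (measurable, simp add: distrib_left)
    qed
  qed
  also have "\<dots> = (\<integral>\<^sup>+a. g a * (?T a) \<partial>lborel)
      + (\<integral>\<^sup>+a. g a * time_defect a \<partial>lborel)"
    by (rule nn_integral_add) measurable
  also have "(\<integral>\<^sup>+a. g a * (?T a) \<partial>lborel)
    = (\<integral>\<^sup>+r. in_01 r * (\<integral>\<^sup>+a. g a * (\<integral>\<^sup>+n. ennreal (heat 1 n) * of_bool (Q r a n) \<partial>lborel) \<partial>lborel) \<partial>lborel)"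
    by (rule nn_integral_swap_inner[symmetric]) measurable
  also have "\<dots> = (\<integral>\<^sup>+r. in_01 r * emeasure M {w \<in> space M. winB r w} \<partial>lborel)"
    by (rule nn_integral_cong) (auto simp: law)
  also have "(\<integral>\<^sup>+a. g a * time_defect a \<partial>lborel) = ennreal (19 * sqrt 5 / 30 - 4 / 3)"
    unfolding g_def by (rule argmax_time_B_defect)
  finally show ?thesis .
qed

text \<open>The probability that the bridge has the larger maximum: the bridge tail
  \<open>exp (- 2 * a^2)\<close> averaged over the maximum of the motion, whose law is that of the
  modulus of a standard normal.\<close>

lemma heat_gaussian_integral: "(\<integral>\<^sup>+a. of_bool (0 < a) * (2 * (ennreal (heat 1 a) * ennreal (exp (- 2 * a\<^sup>2)))) \<partial>lborel) = ennreal (1 / sqrt 5)"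
proof -
  have "(\<integral>\<^sup>+a. of_bool (0 < a) * (2 * (ennreal (heat 1 a) * ennreal (exp (- 2 * a\<^sup>2)))) \<partial>lborel) = (\<integral>\<^sup>+a. ennreal (heat 1 a) * ennreal (exp (- 2 * a\<^sup>2)) \<partial>lborel)"
    by (rule nn_integral_even[symmetric]) auto
  also have "\<dots> = (\<integral>\<^sup>+a. ennreal (1 / sqrt (2 * pi)) * ennreal (exp (- 5 * a\<^sup>2 / 2)) \<partial>lborel)"
  proof (rule nn_integral_cong)
    fix a :: real
    have "heat 1 a * exp (- 2 * a\<^sup>2) = 1 / sqrt (2 * pi) * exp (- 5 * a\<^sup>2 / 2)"
      by (simp add: heat_eq exp_add[symmetric])
    then show "ennreal (heat 1 a) * ennreal (exp (- 2 * a\<^sup>2)) = ennreal (1 / sqrt (2 * pi)) * ennreal (exp (- 5 * a\<^sup>2 / 2))"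
      by (simp only: ennreal_mult[symmetric] heat_nonneg exp_ge_zero) (simp add: ennreal_mult[symmetric])
  qed
  also have "\<dots> = ennreal (1 / sqrt (2 * pi)) * ennreal (sqrt (2 * pi / 5))"
    by (subst nn_integral_cmult) (simp_all only: nn_integral_gaussian, simp_all)
  also have "\<dots> = ennreal (1 / sqrt 5)" by (simp add: ennreal_mult[symmetric] real_sqrt_divide)
  finally show ?thesis .
qed

lemma prob_W_above_B: "emeasure M {w \<in> space M. bmx 0 1 w < wmx 0 1 w} = ennreal (1 - 1 / sqrt 5)"
proof -
  have [measurable]: "(\<lambda>w. wmx 0 1 w) \<in> borel_measurable M" "(\<lambda>w. bmx 0 1 w) \<in> borel_measurable M" by simp_all
  have "emeasure M {w \<in> space M. bmx 0 1 w < wmx 0 1 w} = (\<integral>\<^sup>+w. of_bool (bmx 0 1 w < wmx 0 1 w) \<partial>M)" by (simp add: nn_integral_of_bool)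
  also have "\<dots> = (\<integral>\<^sup>+w. (\<lambda>z. of_bool (snd z \<le> fst z)) (wmx 0 1 w, bmx 0 1 w) \<partial>M)"
    by (rule nn_integral_cong_AE) (use no_tie_maxima in eventually_elim, auto)
  also have "\<dots> = (\<integral>\<^sup>+w. \<integral>\<^sup>+w'. (\<lambda>z. of_bool (snd z \<le> fst z)) (wmx 0 1 w, bmx 0 1 w') \<partial>M \<partial>M)"
    by (rule indep_rv_nn_integral[OF indep_maxima]) measurable
  also have "\<dots> = (\<integral>\<^sup>+w. ennreal (1 - exp (- 2 * (wmx 0 1 w)\<^sup>2)) \<partial>M)"
  proof (rule nn_integral_cong_AE)
    show "AE w in M. (\<integral>\<^sup>+w'. (\<lambda>z. of_bool (snd z \<le> fst z)) (wmx 0 1 w, bmx 0 1 w') \<partial>M) = ennreal (1 - exp (- 2 * (wmx 0 1 w)\<^sup>2))"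
      using wmx_pos[of 1, simplified] by eventually_elim (simp add: nn_integral_of_bool bmx_cdf)
  qed
  finally have e: "emeasure M {w \<in> space M. bmx 0 1 w < wmx 0 1 w} = (\<integral>\<^sup>+w. ennreal (1 - exp (- 2 * (wmx 0 1 w)\<^sup>2)) \<partial>M)" .
  have "(\<integral>\<^sup>+w. ennreal (exp (- 2 * (wmx 0 1 w)\<^sup>2)) \<partial>M) = (\<integral>\<^sup>+a. ennreal (exp (- 2 * a\<^sup>2)) * (of_bool (0 < a) * ennreal (2 * heat 1 a)) \<partial>lborel)"
    by (rule W.mx_nn_integral) auto
  also have "\<dots> = ennreal (1 / sqrt 5)"
    unfolding heat_gaussian_integral[symmetric] by (rule nn_integral_cong) (simp add: ennreal_mult mult_ac)
  finally have g: "(\<integral>\<^sup>+w. ennreal (exp (- 2 * (wmx 0 1 w)\<^sup>2)) \<partial>M) = ennreal (1 / sqrt 5)" .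
  have "emeasure M {w \<in> space M. bmx 0 1 w < wmx 0 1 w} + ennreal (1 / sqrt 5)
    = (\<integral>\<^sup>+w. ennreal (1 - exp (- 2 * (wmx 0 1 w)\<^sup>2)) + ennreal (exp (- 2 * (wmx 0 1 w)\<^sup>2)) \<partial>M)"
    unfolding e g[symmetric] by (rule nn_integral_add[symmetric]) measurable
  also have "\<dots> = (\<integral>\<^sup>+w. 1 \<partial>M)" by (rule nn_integral_cong) (simp add: ennreal_plus[symmetric] del: ennreal_plus)
  finally have "emeasure M {w \<in> space M. bmx 0 1 w < wmx 0 1 w} + ennreal (1 / sqrt 5) = 1" by (simp add: emeasure_space_1)
  then have "ennreal (prob {w \<in> space M. bmx 0 1 w < wmx 0 1 w} + 1 / sqrt 5) = ennreal 1" by (simp add: emeasure_eq_measure)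
  then have "prob {w \<in> space M. bmx 0 1 w < wmx 0 1 w} = 1 - 1 / sqrt 5" by (subst (asm) ennreal_inj) auto
  then show ?thesis by (simp add: emeasure_eq_measure)
qed

text \<open>Layer cake: the square of the larger value is \<open>a^2\<close> plus the integral of
  \<open>2 * x\<close> from \<open>a\<close> up to the bridge maximum, and the tail of that maximum
  is known.\<close>

lemma max_sq_bridge:
  assumes a: "0 \<le> a"
  shows "(\<integral>\<^sup>+w. ennreal ((max a (bmx 0 1 w))\<^sup>2) \<partial>M) = ennreal (a\<^sup>2) + ennreal (exp (- 2 * a\<^sup>2) / 2)"
proof -
  have [measurable]: "(\<lambda>w. bmx 0 1 w) \<in> borel_measurable M" by simp
  have pt: "ennreal ((max a b)\<^sup>2) = ennreal (a\<^sup>2) + (\<integral>\<^sup>+x. of_bool (a < x) * ennreal (2 * x) * of_bool (x < b) \<partial>lborel)" for b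
  proof (cases "a < b")
    case False
    then have "(\<lambda>x. of_bool (a < x) * ennreal (2 * x) * of_bool (x < b) :: ennreal) = (\<lambda>_. 0)" by auto
    then show ?thesis using False by (simp add: max_def)
  next
    case True
    have "(\<integral>\<^sup>+x. of_bool (a < x) * ennreal (2 * x) * of_bool (x < b) \<partial>lborel) = (\<integral>\<^sup>+x. ennreal (2 * x) * indicator {a..b} x \<partial>lborel)"
    proof (rule nn_integral_cong_AE)
      show "AE x in lborel. of_bool (a < x) * ennreal (2 * x) * of_bool (x < b) = ennreal (2 * x) * indicator {a..b} x"
        using AE_lborel_singleton[of a] AE_lborel_singleton[of b] by eventually_elim (auto split: split_indicator)
    qed
    also have "\<dots> = ennreal (b\<^sup>2 - a\<^sup>2)" using a True by (intro nn_integral_FTC_Icc) (auto intro!: derivative_eq_intros)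
    finally have "(\<integral>\<^sup>+x. of_bool (a < x) * ennreal (2 * x) * of_bool (x < b) \<partial>lborel) = ennreal (b\<^sup>2 - a\<^sup>2)" .
    moreover have "a\<^sup>2 \<le> b\<^sup>2" using a True by (intro power_mono) auto
    ultimately show ?thesis using True by (simp add: max_def ennreal_plus[symmetric] del: ennreal_plus)
  qed
  have "(\<integral>\<^sup>+w. ennreal ((max a (bmx 0 1 w))\<^sup>2) \<partial>M) = (\<integral>\<^sup>+w. ennreal (a\<^sup>2) \<partial>M) + (\<integral>\<^sup>+w. \<integral>\<^sup>+x. of_bool (a < x) * ennreal (2 * x) * of_bool (x < bmx 0 1 w) \<partial>lborel \<partial>M)"
    unfolding pt by (rule nn_integral_add) measurable
  also have "(\<integral>\<^sup>+w. \<integral>\<^sup>+x. of_bool (a < x) * ennreal (2 * x) * of_bool (x < bmx 0 1 w) \<partial>lborel \<partial>M)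
    = (\<integral>\<^sup>+x. \<integral>\<^sup>+w. of_bool (a < x) * ennreal (2 * x) * of_bool (x < bmx 0 1 w) \<partial>M \<partial>lborel)"
  proof -
    interpret P: pair_sigma_finite M "lborel :: real measure" ..
    show ?thesis by (rule P.Fubini'[symmetric]) measurable
  qed
  also have "\<dots> = (\<integral>\<^sup>+x. of_bool (a < x) * ennreal (2 * x * exp (- 2 * x\<^sup>2)) \<partial>lborel)"
  proof (rule nn_integral_cong)
    fix x :: real
    show "(\<integral>\<^sup>+w. of_bool (a < x) * ennreal (2 * x) * of_bool (x < bmx 0 1 w) \<partial>M) = of_bool (a < x) * ennreal (2 * x * exp (- 2 * x\<^sup>2))"
    proof (cases "a < x")
      case False then show ?thesis by simp
    next
      case True
      then have x: "0 < x" using a by simp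
      have "prob {w \<in> space M. bmx 0 1 w \<le> x} = 1 - exp (- 2 * x\<^sup>2)"
        using bmx_cdf[OF x] by (simp add: emeasure_eq_measure)
      moreover have "prob {w \<in> space M. x < bmx 0 1 w} = 1 - prob {w \<in> space M. bmx 0 1 w \<le> x}"
        by (subst prob_compl[symmetric]) (auto intro!: arg_cong[where f=prob])
      ultimately have "emeasure M {w \<in> space M. x < bmx 0 1 w} = ennreal (exp (- 2 * x\<^sup>2))" by (simp add: emeasure_eq_measure)
      then show ?thesis using True x by (simp add: nn_integral_cmult nn_integral_of_bool ennreal_mult)
    qed
  qed
  also have "\<dots> = ennreal (0 - - (1 / 2) * exp (- 2 * a\<^sup>2))"
  proof (rule nn_integral_FTC_Ioi)
    show "((\<lambda>x. - (1 / 2) * exp (- 2 * x\<^sup>2)) has_real_derivative 2 * x * exp (- 2 * x\<^sup>2)) (at x)" for x :: real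
    proof -
      have key: "- (1 / 2) * (E * (- 4 * x)) = 2 * x * E" for E by simp
      have "((\<lambda>x. - 2 * x\<^sup>2) has_real_derivative (- 4 * x)) (at x)" by (auto intro!: derivative_eq_intros)
      from DERIV_fun_exp[OF this] have "((\<lambda>x. exp (- 2 * x\<^sup>2)) has_real_derivative exp (- 2 * x\<^sup>2) * (- 4 * x)) (at x)" .
      from DERIV_cmult[OF this, of "- (1 / 2)"] show ?thesis
        by (rule DERIV_cong) (rule key)
    qed
    show "((\<lambda>x :: real. - (1 / 2) * exp (- 2 * x\<^sup>2)) \<longlongrightarrow> 0) at_top" by real_asymp
  qed (use a in auto)
  finally show ?thesis by (simp add: emeasure_space_1)
qed

text \<open>The maximum of the motion has second moment 1, and the excess from
  \<open>max_sq_bridge\<close> averages to half of \<open>1 / sqrt 5\<close>.\<close>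

lemma max_sq_integral: "(\<integral>\<^sup>+w. ennreal ((max (wmx 0 1 w) (bmx 0 1 w))\<^sup>2) \<partial>M) = ennreal (1 + sqrt 5 / 10)"
proof -
  have [measurable]: "(\<lambda>w. wmx 0 1 w) \<in> borel_measurable M" "(\<lambda>w. bmx 0 1 w) \<in> borel_measurable M" by simp_all
  have "(\<integral>\<^sup>+w. ennreal ((max (wmx 0 1 w) (bmx 0 1 w))\<^sup>2) \<partial>M) = (\<integral>\<^sup>+w. \<integral>\<^sup>+w'. ennreal ((max (wmx 0 1 w) (bmx 0 1 w'))\<^sup>2) \<partial>M \<partial>M)"
    using indep_rv_nn_integral[OF indep_maxima, of "\<lambda>z. ennreal ((max (fst z) (snd z))\<^sup>2)"] by simp
  also have "\<dots> = (\<integral>\<^sup>+w. ennreal ((wmx 0 1 w)\<^sup>2) + ennreal (exp (- 2 * (wmx 0 1 w)\<^sup>2) / 2) \<partial>M)"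
    by (rule nn_integral_cong) (rule max_sq_bridge, rule W.mx_nonneg, auto)
  also have "\<dots> = (\<integral>\<^sup>+a. (ennreal (a\<^sup>2) + ennreal (exp (- 2 * a\<^sup>2) / 2)) * (of_bool (0 < a) * ennreal (2 * heat 1 a)) \<partial>lborel)"
    by (rule W.mx_nn_integral) auto
  also have "\<dots> = (\<integral>\<^sup>+a. of_bool (0 < a) * (2 * (ennreal (heat 1 a) * ennreal (a\<^sup>2))) + ennreal (1 / 2) * (of_bool (0 < a) * (2 * (ennreal (heat 1 a) * ennreal (exp (- 2 * a\<^sup>2))))) \<partial>lborel)"
  proof (rule nn_integral_cong)
    fix a :: real
    have "ennreal (exp (- 2 * a\<^sup>2) / 2) = ennreal (1 / 2) * ennreal (exp (- 2 * a\<^sup>2))" by (subst ennreal_mult[symmetric]) simp_all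
    moreover have "ennreal (2 * heat 1 a) = 2 * ennreal (heat 1 a)" by (simp add: ennreal_mult)
    ultimately show "(ennreal (a\<^sup>2) + ennreal (exp (- 2 * a\<^sup>2) / 2)) * (of_bool (0 < a) * ennreal (2 * heat 1 a))
      = of_bool (0 < a) * (2 * (ennreal (heat 1 a) * ennreal (a\<^sup>2))) + ennreal (1 / 2) * (of_bool (0 < a) * (2 * (ennreal (heat 1 a) * ennreal (exp (- 2 * a\<^sup>2)))))"
      by (simp only: distrib_left distrib_right mult_ac)
  qed
  also have "\<dots> = (\<integral>\<^sup>+a. of_bool (0 < a) * (2 * (ennreal (heat 1 a) * ennreal (a\<^sup>2))) \<partial>lborel) + ennreal (1 / 2) * ennreal (1 / sqrt 5)"
    unfolding heat_gaussian_integral[symmetric] by (subst nn_integral_add) (simp_all add: nn_integral_cmult)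
  also have "(\<integral>\<^sup>+a. of_bool (0 < a) * (2 * (ennreal (heat 1 a) * ennreal (a\<^sup>2))) \<partial>lborel) = (\<integral>\<^sup>+a. ennreal (heat 1 a) * ennreal (a\<^sup>2) \<partial>lborel)"
    by (rule nn_integral_even[symmetric]) auto
  also have "\<dots> = (\<integral>\<^sup>+a. ennreal (normal_density 0 1 a * (a - 0) ^ (2 * 1)) \<partial>lborel)"
    by (rule nn_integral_cong) (simp add: heat_def ennreal_mult)
  also have "\<dots> = ennreal 1"
    using normal_moment_even[of 1 0 1] by (subst nn_integral_eq_integral) (auto simp: has_bochner_integral_iff)
  also have "ennreal 1 + ennreal (1 / 2) * ennreal (1 / sqrt 5) = ennreal (1 + 1 / 2 * (1 / sqrt 5))"
    by (subst ennreal_mult[symmetric], simp, simp, subst ennreal_plus[symmetric]) simp_all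
  also have "1 + 1 / 2 * (1 / sqrt 5) = 1 + sqrt 5 / 10" by (simp add: field_simps)
  finally show ?thesis .
qed

end

section \<open>Sampling the planar paths\<close>

text \<open>Up to the constant \<open>c\<close> the exponential is a Gaussian density of variance
  \<open>1 / \<epsilon>\<close>, so the integral is a convolution of two Gaussians at
  \<rho>.\<close>

lemma nn_integral_heat_gaussian:
  assumes v: "0 < v" and e: "0 < \<epsilon>"
  shows "(\<integral>\<^sup>+y. ennreal (exp (- \<epsilon> * (y - \<rho>)\<^sup>2 / 2)) * ennreal (heat v y) \<partial>lborel)
    = ennreal (exp (- \<epsilon> * \<rho>\<^sup>2 / (2 * (1 + \<epsilon> * v))) / sqrt (1 + \<epsilon> * v))"
proof -
  define c where "c = sqrt (2 * pi / \<epsilon>)"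
  have c: "0 < c" using e by (simp add: c_def)
  have pos: "0 < 1 + \<epsilon> * v" using v e by (simp add: add_pos_pos)
  have k: "exp (- \<epsilon> * (y - \<rho>)\<^sup>2 / 2) = c * heat (1 / \<epsilon>) (\<rho> - y)" for y
  proof -
    have "heat (1 / \<epsilon>) (\<rho> - y) = exp (- \<epsilon> * (y - \<rho>)\<^sup>2 / 2) / c"
      using e by (subst heat_diff_commute) (simp add: heat_eq c_def)
    then show ?thesis using c by simp
  qed
  have "(\<integral>\<^sup>+y. ennreal (exp (- \<epsilon> * (y - \<rho>)\<^sup>2 / 2)) * ennreal (heat v y) \<partial>lborel)
    = (\<integral>\<^sup>+y. ennreal c * ennreal (heat (1 / \<epsilon>) (\<rho> - y) * heat v y) \<partial>lborel)"
    unfolding k using c by (simp add: ennreal_mult[symmetric] mult.assoc)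
  also have "\<dots> = ennreal c * (\<integral>\<^sup>+y. ennreal (heat (1 / \<epsilon>) (\<rho> - y) * heat v y) \<partial>lborel)"
    by (rule nn_integral_cmult) measurable
  also have "(\<integral>\<^sup>+y. ennreal (heat (1 / \<epsilon>) (\<rho> - y) * heat v y) \<partial>lborel) = ennreal (normal_density 0 (sqrt ((sqrt (1 / \<epsilon>))\<^sup>2 + (sqrt v)\<^sup>2)) \<rho>)"
    unfolding heat_def using v e by (subst fun_cong[OF conv_normal_density_zero_mean]) simp_all
  also have "normal_density 0 (sqrt ((sqrt (1 / \<epsilon>))\<^sup>2 + (sqrt v)\<^sup>2)) \<rho> = heat (1 / \<epsilon> + v) \<rho>"
    using v e by (simp add: heat_def)
  also have "ennreal c * ennreal (heat (1 / \<epsilon> + v) \<rho>) = ennreal (c * heat (1 / \<epsilon> + v) \<rho>)"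
    using c by (simp add: ennreal_mult)
  also have "c * heat (1 / \<epsilon> + v) \<rho> = exp (- \<epsilon> * \<rho>\<^sup>2 / (2 * (1 + \<epsilon> * v))) / sqrt (1 + \<epsilon> * v)"
  proof -
    have s: "1 / \<epsilon> + v = (1 + \<epsilon> * v) / \<epsilon>" using e by (simp add: field_simps)
    have "sqrt (2 * pi * ((1 + \<epsilon> * v) / \<epsilon>)) = c * sqrt (1 + \<epsilon> * v)" by (simp add: c_def real_sqrt_mult[symmetric])
    moreover have "- \<rho>\<^sup>2 / (2 * ((1 + \<epsilon> * v) / \<epsilon>)) = - \<epsilon> * \<rho>\<^sup>2 / (2 * (1 + \<epsilon> * v))" using e by simp
    moreover have "0 < (1 + \<epsilon> * v) / \<epsilon>" using pos e by simp
    ultimately have "heat (1 / \<epsilon> + v) \<rho> = exp (- \<epsilon> * \<rho>\<^sup>2 / (2 * (1 + \<epsilon> * v))) / (c * sqrt (1 + \<epsilon> * v))"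
      unfolding s by (simp only: heat_eq)
    then show ?thesis using c by simp
  qed
  finally show ?thesis .
qed

context prob_space begin

definition gaussian_rv :: "('a \<Rightarrow> real) \<Rightarrow> real \<Rightarrow> bool" where
  "gaussian_rv Y v \<longleftrightarrow> Y \<in> borel_measurable M \<and> 0 \<le> v \<and>
     (if v = 0 then \<forall>w\<in>space M. Y w = 0
      else \<forall>F\<in>borel_measurable borel. (\<integral>\<^sup>+w. F (Y w) \<partial>M) = (\<integral>\<^sup>+y. F y * ennreal (heat v y) \<partial>lborel))"

lemma gaussian_rvD:
  "gaussian_rv Y v \<Longrightarrow> v \<noteq> 0 \<Longrightarrow> F \<in> borel_measurable borel \<Longrightarrow>
    (\<integral>\<^sup>+w. F (Y w) \<partial>M) = (\<integral>\<^sup>+y. F y * ennreal (heat v y) \<partial>lborel)"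
  by (simp add: gaussian_rv_def)

lemma gaussian_rv_exp:
  assumes Y: "gaussian_rv Y v" and e: "0 < \<epsilon>"
  shows "(\<integral>\<^sup>+w. ennreal (exp (- \<epsilon> * (Y w - \<rho>)\<^sup>2 / 2)) \<partial>M)
      = ennreal (exp (- \<epsilon> * \<rho>\<^sup>2 / (2 * (1 + \<epsilon> * v))) / sqrt (1 + \<epsilon> * v))"
proof (cases "v = 0")
  case True
  then have "(\<integral>\<^sup>+w. ennreal (exp (- \<epsilon> * (Y w - \<rho>)\<^sup>2 / 2)) \<partial>M) = (\<integral>\<^sup>+w. ennreal (exp (- \<epsilon> * (0 - \<rho>)\<^sup>2 / 2)) \<partial>M)"
    using Y by (intro nn_integral_cong) (simp add: gaussian_rv_def)
  then show ?thesis using True by (simp add: emeasure_space_1)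
next
  case False
  then have v: "0 < v" using Y by (simp add: gaussian_rv_def)
  have "(\<lambda>y. ennreal (exp (- \<epsilon> * (y - \<rho>)\<^sup>2 / 2))) \<in> borel_measurable borel" by measurable
  then have "(\<integral>\<^sup>+w. (\<lambda>y. ennreal (exp (- \<epsilon> * (y - \<rho>)\<^sup>2 / 2))) (Y w) \<partial>M) = (\<integral>\<^sup>+y. ennreal (exp (- \<epsilon> * (y - \<rho>)\<^sup>2 / 2)) * ennreal (heat v y) \<partial>lborel)"
    by (rule gaussian_rvD[OF Y False])
  then show ?thesis using nn_integral_heat_gaussian[OF v e] by simp
qed

lemma gaussian_rv_sq:
  assumes Y: "gaussian_rv Y v"
  shows "integrable M (\<lambda>w. (Y w)\<^sup>2)"
proof (cases "v = 0")
  case True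
  then have "integrable M (\<lambda>w. (Y w)\<^sup>2) \<longleftrightarrow> integrable M (\<lambda>w. 0 :: real)"
    using Y by (intro Bochner_Integration.integrable_cong) (simp_all add: gaussian_rv_def)
  then show ?thesis by simp
next
  case False
  then have v: "0 < v" using Y by (simp add: gaussian_rv_def)
  have [measurable]: "Y \<in> borel_measurable M" using Y by (simp add: gaussian_rv_def)
  have "(\<lambda>y :: real. ennreal (y\<^sup>2)) \<in> borel_measurable borel" by measurable
  then have "(\<integral>\<^sup>+w. (\<lambda>y. ennreal (y\<^sup>2)) (Y w) \<partial>M) = (\<integral>\<^sup>+y. ennreal (y\<^sup>2) * ennreal (heat v y) \<partial>lborel)"
    by (rule gaussian_rvD[OF Y False])
  also have "\<dots> = (\<integral>\<^sup>+y. ennreal (normal_density 0 (sqrt v) y * (y - 0) ^ (2 * 1)) \<partial>lborel)"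
    by (rule nn_integral_cong) (simp add: heat_def ennreal_mult mult.commute)
  also have "\<dots> < \<infinity>"
    using normal_moment_even[of "sqrt v" 0 1] v by (subst nn_integral_eq_integral) (auto simp: has_bochner_integral_iff)
  finally show ?thesis by (intro integrableI_bounded) auto
qed

lemma gaussian_rv_no_atom:
  assumes Y: "gaussian_rv Y v" and v: "v \<noteq> 0"
  shows "AE w in M. Y w \<noteq> c"
proof -
  have [measurable]: "Y \<in> borel_measurable M" using Y by (simp add: gaussian_rv_def)
  have "(\<lambda>y :: real. of_bool (y = c) :: ennreal) \<in> borel_measurable borel" by measurable
  then have "(\<integral>\<^sup>+w. (\<lambda>y. of_bool (y = c)) (Y w) \<partial>M) = (\<integral>\<^sup>+y. of_bool (y = c) * ennreal (heat v y) \<partial>lborel)"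
    by (rule gaussian_rvD[OF Y v])
  also have "\<dots> = (\<integral>\<^sup>+y. 0 \<partial>(lborel :: real measure))"
    by (rule nn_integral_cong_AE) (use AE_lborel_singleton[of c] in eventually_elim, simp)
  finally have "(\<integral>\<^sup>+w. of_bool (Y w = c) \<partial>M) = 0" by simp
  then have "AE w in M. of_bool (Y w = c) = (0 :: ennreal)" by (subst (asm) nn_integral_0_iff_AE) auto
  then show ?thesis by eventually_elim auto
qed

text \<open>Integrating out \<open>Z\<close> leaves a function of \<open>X1\<close>, which is
  independent of \<open>X2\<close>. In the application \<open>X1\<close> and \<open>X2\<close> are
  the two coordinates of one process and \<open>Z\<close> is the first coordinate of the
  other.\<close>

lemma indep_rv_factor:
  assumes XZ: "indep_rv (S1 \<Otimes>\<^sub>M S2) (\<lambda>w. (X1 w, X2 w)) T Z" and X: "indep_rv S1 X1 S2 X2"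
    and G[measurable]: "G \<in> borel_measurable (S1 \<Otimes>\<^sub>M T)" and k[measurable]: "k \<in> borel_measurable S2"
  shows "(\<integral>\<^sup>+w. G (X1 w, Z w) * k (X2 w) \<partial>M) = (\<integral>\<^sup>+w. G (X1 w, Z w) \<partial>M) * (\<integral>\<^sup>+w. k (X2 w) \<partial>M)"
proof -
  have [measurable]: "X1 \<in> M \<rightarrow>\<^sub>M S1" "X2 \<in> M \<rightarrow>\<^sub>M S2" "Z \<in> M \<rightarrow>\<^sub>M T" using XZ X by (auto simp: indep_rv_def)
  define h where "h x = (\<integral>\<^sup>+w'. G (x, Z w') \<partial>M)" for x
  have [measurable]: "h \<in> borel_measurable S1" unfolding h_def by measurable
  have XZ1: "indep_rv S1 X1 T Z" using indep_rv_compose[OF XZ, of fst S1 "\<lambda>z. z" T] by simp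
  have "(\<integral>\<^sup>+w. (\<lambda>z. G (fst (fst z), snd z) * k (snd (fst z))) ((X1 w, X2 w), Z w) \<partial>M)
    = (\<integral>\<^sup>+w. \<integral>\<^sup>+w'. (\<lambda>z. G (fst (fst z), snd z) * k (snd (fst z))) ((X1 w, X2 w), Z w') \<partial>M \<partial>M)"
    by (rule indep_rv_nn_integral[OF XZ]) measurable
  also have "\<dots> = (\<integral>\<^sup>+w. h (X1 w) * k (X2 w) \<partial>M)"
  proof (rule nn_integral_cong)
    fix w assume "w \<in> space M"
    then have x: "X1 w \<in> space S1" by (rule measurable_space[rotated]) simp
    have "(\<lambda>w'. G (X1 w, Z w')) \<in> borel_measurable M"
      by (rule measurable_compose[OF _ measurable_compose[OF measurable_Pair1'[OF x] G]]) simp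
    then show "(\<integral>\<^sup>+w'. (\<lambda>z. G (fst (fst z), snd z) * k (snd (fst z))) ((X1 w, X2 w), Z w') \<partial>M) = h (X1 w) * k (X2 w)"
      by (simp add: h_def nn_integral_multc)
  qed
  also have "\<dots> = (\<integral>\<^sup>+w. \<integral>\<^sup>+w'. h (X1 w) * k (X2 w') \<partial>M \<partial>M)"
    using indep_rv_nn_integral[OF X, of "\<lambda>z. h (fst z) * k (snd z)"] by simp
  also have "\<dots> = (\<integral>\<^sup>+w. h (X1 w) * (\<integral>\<^sup>+w'. k (X2 w') \<partial>M) \<partial>M)"
    by (rule nn_integral_cong) (simp add: nn_integral_cmult)
  also have "\<dots> = (\<integral>\<^sup>+w. h (X1 w) \<partial>M) * (\<integral>\<^sup>+w'. k (X2 w') \<partial>M)"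
    by (rule nn_integral_multc) measurable
  also have "(\<integral>\<^sup>+w. h (X1 w) \<partial>M) = (\<integral>\<^sup>+w. G (X1 w, Z w) \<partial>M)"
    unfolding h_def by (rule indep_rv_nn_integral[OF XZ1 G, symmetric])
  finally show ?thesis by simp
qed

end

lemma (in brownian_motion) gaussian_rv_W: "0 \<le> t \<Longrightarrow> gaussian_rv (W t) t"
  using W_nn_integral[of t] bm_measurable[of t] bm_start by (auto simp: gaussian_rv_def mult.commute)

lemma (in bridge_and_motion) gaussian_rv_B:
  assumes t: "0 < t" "t < 1"
  shows "gaussian_rv (B t) (t * (1 - t))"
proof -
  have [measurable]: "B t \<in> borel_measurable M" using bridge_measurable[of t] t by simp
  have "(\<integral>\<^sup>+w. F (B t w) \<partial>M) = (\<integral>\<^sup>+y. F y * ennreal (heat (t * (1 - t)) y) \<partial>lborel)"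
    if F[measurable]: "F \<in> borel_measurable borel" for F
  proof -
    have sm: "strict_mono_on {..<1 :: nat} (\<lambda>_. t)" by (rule strict_mono_onI) simp
    have c: "(\<lambda>x. x 0) \<in> borel_measurable (lvec {..<1 :: nat})"
      using measurable_component_singleton[of 0 "{..<1 :: nat}" "\<lambda>_. lborel :: real measure"] by simp
    have "(\<integral>\<^sup>+w. (\<lambda>x. F (x 0)) (\<lambda>i\<in>{..<1 :: nat}. B t w) \<partial>M)
      = (\<integral>\<^sup>+w. (\<lambda>x. F (x 0)) (\<lambda>i\<in>{..<1 :: nat}. W t w) * ennreal (heat (1 - t) (W t w) / heat 1 0) \<partial>N)"
      by (rule bridge_transfer[OF W.brownian_motion_axioms _ sm]) (use t measurable_compose[OF c F] in auto)
    then have "(\<integral>\<^sup>+w. F (B t w) \<partial>M) = (\<integral>\<^sup>+w. (\<lambda>y. F y * ennreal (heat (1 - t) y / heat 1 0)) (W t w) \<partial>N)" by simp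
    also have "\<dots> = (\<integral>\<^sup>+y. ennreal (heat t y) * (F y * ennreal (heat (1 - t) y / heat 1 0)) \<partial>lborel)"
      using t by (intro W.W_nn_integral) auto
    also have "\<dots> = (\<integral>\<^sup>+y. F y * ennreal (heat (t * (1 - t)) y) \<partial>lborel)"
    proof (rule nn_integral_cong)
      fix y
      have "heat t y * (heat (1 - t) y / heat 1 0) = heat (t * (1 - t)) y"
        using heat_mult[OF t, of y 0] heat_1_0_pos by (simp add: field_simps)
      then have "ennreal (heat t y) * ennreal (heat (1 - t) y / heat 1 0) = ennreal (heat (t * (1 - t)) y)"
        by (simp add: ennreal_mult'[symmetric])
      then show "ennreal (heat t y) * (F y * ennreal (heat (1 - t) y / heat 1 0)) = F y * ennreal (heat (t * (1 - t)) y)"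
        by (simp add: mult.left_commute)
    qed
    finally show ?thesis .
  qed
  then show ?thesis using t by (simp add: gaussian_rv_def)
qed

lemma (in bridge_and_motion) B_distinct:
  assumes s: "0 < s" "s < t" "t < 1"
  shows "AE w in M. B s w \<noteq> B t w"
proof -
  define \<tau> where "\<tau> i = (if i = 0 then s else t)" for i :: nat
  have [measurable]: "B s \<in> borel_measurable M" "B t \<in> borel_measurable M" using bridge_measurable[of t] bridge_measurable[of s] s by auto
  have i2: "{..<2 :: nat} = {0, 1}" by auto
  have t: "\<tau> ` {..<2} \<subseteq> {0<..<1}" "strict_mono_on {..<2} \<tau>"
    using s by (auto simp: \<tau>_def i2 strict_mono_on_def)
  have c: "(\<lambda>x. x i) \<in> borel_measurable (lvec {..<2 :: nat})" if "i < 2" for i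
    using measurable_component_singleton[of i "{..<2 :: nat}" "\<lambda>_. lborel :: real measure"] that by simp
  have [measurable]: "Measurable.pred (lvec {..<2 :: nat}) (\<lambda>x. x 0 = x 1)"
    unfolding pred_def by (rule borel_measurable_eq; rule c) simp_all
  have [measurable]: "(\<lambda>x. of_bool (x 0 = x 1) :: ennreal) \<in> borel_measurable (lvec {..<2 :: nat})"
    by measurable
  have "(\<integral>\<^sup>+w. (\<lambda>x. of_bool (x 0 = x 1)) (\<lambda>i\<in>{..<2}. B (\<tau> i) w) \<partial>M)
    = (\<integral>\<^sup>+w. (\<lambda>x. of_bool (x 0 = x 1)) (\<lambda>i\<in>{..<2}. W (\<tau> i) w) * ennreal (heat (1 - \<tau> (2 - 1)) (W (\<tau> (2 - 1)) w) / heat 1 0) \<partial>N)"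
    by (rule bridge_transfer[OF W.brownian_motion_axioms t]) (simp, measurable)
  also have "\<dots> = (\<integral>\<^sup>+w. 0 \<partial>N)"
  proof (rule nn_integral_cong_AE)
    have "AE w in N. W t w - W s w \<noteq> 0"
      by (rule W.normal_no_atom[OF W.bm_increments_normal]) (use s in auto)
    then show "AE w in N. (\<lambda>x. of_bool (x 0 = x 1)) (\<lambda>i\<in>{..<2}. W (\<tau> i) w) * ennreal (heat (1 - \<tau> (2 - 1)) (W (\<tau> (2 - 1)) w) / heat 1 0) = 0"
      by eventually_elim (auto simp: \<tau>_def)
  qed
  finally have "(\<integral>\<^sup>+w. of_bool (B s w = B t w) \<partial>M) = 0" by (simp add: \<tau>_def)
  then have "AE w in M. of_bool (B s w = B t w) = (0 :: ennreal)" by (subst (asm) nn_integral_0_iff_AE) auto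
  then show ?thesis by eventually_elim auto
qed

lemma measurable_select:
  assumes "\<And>i. i < n \<Longrightarrow> t i \<in> J"
  shows "(\<lambda>x. \<lambda>i\<in>{..<n}. x (t i)) \<in> (\<Pi>\<^sub>M j\<in>J. borel) \<rightarrow>\<^sub>M (lvec {..<n})"
proof (rule measurable_restrict)
  fix i assume "i \<in> {..<n}"
  then have "(\<lambda>x. x (t i)) \<in> (\<Pi>\<^sub>M j\<in>J. borel) \<rightarrow>\<^sub>M (borel :: real measure)" using assms by (intro measurable_component_singleton) auto
  then show "(\<lambda>x. x (t i)) \<in> (\<Pi>\<^sub>M j\<in>J. borel) \<rightarrow>\<^sub>M (lborel :: real measure)" by simp
qed

lemma borel_measurable_fst_plane: "fst \<in> (borel :: (real \<times> real) measure) \<rightarrow>\<^sub>M borel"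
  and borel_measurable_snd_plane: "snd \<in> (borel :: (real \<times> real) measure) \<rightarrow>\<^sub>M borel"
  by (auto intro!: borel_measurable_continuous_onI continuous_intros)

lemma measurable_select2:
  assumes "\<And>i. i < n \<Longrightarrow> t i \<in> J"
  shows "(\<lambda>x. (\<lambda>i\<in>{..<n}. fst (x (t i)), \<lambda>i\<in>{..<n}. snd (x (t i))))
    \<in> (\<Pi>\<^sub>M j\<in>J. borel :: (real \<times> real) measure) \<rightarrow>\<^sub>M (lvec {..<n}) \<Otimes>\<^sub>M (lvec {..<n})"
proof (intro measurable_Pair measurable_restrict)
  fix i assume "i \<in> {..<n}"
  then have c: "(\<lambda>x. x (t i)) \<in> (\<Pi>\<^sub>M j\<in>J. borel) \<rightarrow>\<^sub>M (borel :: (real \<times> real) measure)" using assms by (intro measurable_component_singleton) auto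
  show "(\<lambda>x. fst (x (t i))) \<in> (\<Pi>\<^sub>M j\<in>J. borel :: (real \<times> real) measure) \<rightarrow>\<^sub>M (lborel :: real measure)"
    using measurable_compose[OF c borel_measurable_fst_plane] by simp
  show "(\<lambda>x. snd (x (t i))) \<in> (\<Pi>\<^sub>M j\<in>J. borel :: (real \<times> real) measure) \<rightarrow>\<^sub>M (lborel :: real measure)"
    using measurable_compose[OF c borel_measurable_snd_plane] by simp
qed

lemma measurable_lborel_component: "i < n \<Longrightarrow> (\<lambda>x. x i) \<in> borel_measurable (lvec {..<n})"
  using measurable_component_singleton[of i "{..<n}" "\<lambda>_. lborel :: real measure"] by simp

section \<open>The planar sample: variances, rotation invariance, independence of
  coordinates\<close>

locale planar_motion_bridge = prob_space M + W: planar_brownian_motion M W + B: planar_brownian_bridge M B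
  for M :: "'w measure" and W B :: "real \<Rightarrow> 'w \<Rightarrow> real \<times> real" +
  assumes planar_indep: "indep_processes {0..} W {0..1} B"
begin

lemma planar_indep_var: "indep_var (\<Pi>\<^sub>M i\<in>{0..}. borel) (\<lambda>w. \<lambda>i\<in>{0..}. W i w) (\<Pi>\<^sub>M j\<in>{0..1}. borel) (\<lambda>w. \<lambda>j\<in>{0..1}. B j w)"
  using planar_indep by (simp add: indep_processes_def)

lemma coordinate_indep:
  assumes [measurable]: "h \<in> (borel :: (real \<times> real) measure) \<rightarrow>\<^sub>M (borel :: real measure)"
  shows "indep_processes {0..} (\<lambda>t w. h (W t w)) {0..1} (\<lambda>t w. h (B t w))"
proof -
  have m: "(\<lambda>x. \<lambda>i\<in>J. h (x i)) \<in> (\<Pi>\<^sub>M i\<in>J. borel) \<rightarrow>\<^sub>M (\<Pi>\<^sub>M i\<in>J. borel)" for J :: "real set"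
    by (intro measurable_restrict measurable_compose[OF _ assms] measurable_component_singleton)
  have e: "(\<lambda>x. \<lambda>i\<in>J. h (x i)) \<circ> (\<lambda>w. \<lambda>i\<in>J. Z i w) = (\<lambda>w. \<lambda>i\<in>J. h (Z i w))" for J :: "real set" and Z :: "real \<Rightarrow> 'w \<Rightarrow> real \<times> real"
    by (auto simp: fun_eq_iff)
  show ?thesis unfolding indep_processes_def
    using indep_var_compose[OF planar_indep_var m m] by (simp add: e)
qed

sublocale X: motion_bridge M "\<lambda>t w. fst (B t w)" "\<lambda>t w. fst (W t w)"
proof
  show "indep_processes {0..} (\<lambda>t w. fst (W t w)) {0..1} (\<lambda>t w. fst (B t w))" by (rule coordinate_indep[OF borel_measurable_fst_plane])
qed

sublocale Y: motion_bridge M "\<lambda>t w. snd (B t w)" "\<lambda>t w. snd (W t w)"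
proof
  show "indep_processes {0..} (\<lambda>t w. snd (W t w)) {0..1} (\<lambda>t w. snd (B t w))" by (rule coordinate_indep[OF borel_measurable_snd_plane])
qed

text \<open>The sample points are \<open>W (k / N)\<close> for \<open>k \<le> N\<close> and \<open>B (l / N)\<close> for \<open>0 < l < N\<close>; the end
  points of the bridge are \<open>0 = W 0\<close>.\<close>

definition ix :: "nat \<Rightarrow> (nat + nat) set" where "ix N = Inl ` {..N} \<union> Inr ` {1..<N}"

definition pt :: "nat \<Rightarrow> nat + nat \<Rightarrow> 'w \<Rightarrow> real \<times> real" where
  "pt N i w = (case i of Inl k \<Rightarrow> W (real k / real N) w | Inr l \<Rightarrow> B (real l / real N) w)"

definition var :: "nat \<Rightarrow> nat + nat \<Rightarrow> real" where
  "var N i = (case i of Inl k \<Rightarrow> real k / real N | Inr l \<Rightarrow> real l / real N * (1 - real l / real N))"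

lemma gaussian_pt:
  assumes "i \<in> ix N"
  shows "gaussian_rv (\<lambda>w. fst (pt N i w)) (var N i)" "gaussian_rv (\<lambda>w. snd (pt N i w)) (var N i)"
proof -
  have "gaussian_rv (\<lambda>w. fst (pt N i w)) (var N i) \<and> gaussian_rv (\<lambda>w. snd (pt N i w)) (var N i)"
  proof (cases i)
    case (Inl k)
    then show ?thesis using W.W1.gaussian_rv_W[of "real k / real N"] W.W2.gaussian_rv_W[of "real k / real N"] by (simp add: pt_def var_def)
  next
    case (Inr l)
    then have "0 < real l / real N" "real l / real N < 1" using assms by (auto simp: ix_def)
    from X.gaussian_rv_B[OF this] Y.gaussian_rv_B[OF this] show ?thesis using Inr by (simp add: pt_def var_def)
  qed
  then show "gaussian_rv (\<lambda>w. fst (pt N i w)) (var N i)" "gaussian_rv (\<lambda>w. snd (pt N i w)) (var N i)" by auto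
qed

abbreviation (input) \<tau> :: "nat \<Rightarrow> nat \<Rightarrow> real" where "\<tau> N i \<equiv> real (Suc i) / real N"

definition Wx where "Wx N w = (\<lambda>i\<in>{..<N}. fst (W (\<tau> N i) w))"
definition Wy where "Wy N w = (\<lambda>i\<in>{..<N}. snd (W (\<tau> N i) w))"
definition Bx where "Bx N w = (\<lambda>i\<in>{..<N - 1}. fst (B (\<tau> N i) w))"
definition By where "By N w = (\<lambda>i\<in>{..<N - 1}. snd (B (\<tau> N i) w))"

abbreviation (input) P :: "nat \<Rightarrow> (nat \<Rightarrow> real) measure" where "P n \<equiv> lvec {..<n}"

lemma \<tau>:
  shows "i < N \<Longrightarrow> 0 < \<tau> N i" and "i < N - 1 \<Longrightarrow> \<tau> N i \<in> {0<..<1}" and "0 < N \<Longrightarrow> strict_mono_on S (\<tau> N)"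
  by (auto simp: strict_mono_on_def divide_strict_right_mono)

lemma indep_Wxy: "indep_rv (P N) (Wx N) (P N) (Wy N)"
proof -
  have m: "(\<lambda>x. \<lambda>i\<in>{..<N}. x (\<tau> N i)) \<in> (\<Pi>\<^sub>M j\<in>{0..}. borel) \<rightarrow>\<^sub>M P N" by (rule measurable_select) auto
  have "indep_rv (P N) (\<lambda>w. (\<lambda>x. \<lambda>i\<in>{..<N}. x (\<tau> N i)) (\<lambda>i\<in>{0..}. fst (W i w))) (P N) (\<lambda>w. (\<lambda>x. \<lambda>i\<in>{..<N}. x (\<tau> N i)) (\<lambda>i\<in>{0..}. snd (W i w)))"
    by (rule indep_rv_compose[OF indep_rv_of_indep_var[OF W.components_indep[unfolded indep_processes_def]] m m])
  then show ?thesis by (rule indep_rv_cong) (simp_all add: Wx_def Wy_def cong: restrict_cong)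
qed

lemma indep_Bxy: "indep_rv (P (N - 1)) (Bx N) (P (N - 1)) (By N)"
proof -
  have in1: "\<tau> N i \<in> {0..1}" if "i < N - 1" for i using \<tau>(2)[OF that] by auto
  have m: "(\<lambda>x. \<lambda>i\<in>{..<N - 1}. x (\<tau> N i)) \<in> (\<Pi>\<^sub>M j\<in>{0..1}. borel) \<rightarrow>\<^sub>M P (N - 1)" by (rule measurable_select[OF in1])
  have "indep_rv (P (N - 1)) (\<lambda>w. (\<lambda>x. \<lambda>i\<in>{..<N - 1}. x (\<tau> N i)) (\<lambda>i\<in>{0..1}. fst (B i w))) (P (N - 1)) (\<lambda>w. (\<lambda>x. \<lambda>i\<in>{..<N - 1}. x (\<tau> N i)) (\<lambda>i\<in>{0..1}. snd (B i w)))"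
    by (rule indep_rv_compose[OF indep_rv_of_indep_var[OF B.components_indep[unfolded indep_processes_def]] m m])
  then show ?thesis
  proof (rule indep_rv_cong)
    show "(\<lambda>x. \<lambda>i\<in>{..<N - 1}. x (\<tau> N i)) (\<lambda>i\<in>{0..1}. fst (B i w)) = Bx N w" "(\<lambda>x. \<lambda>i\<in>{..<N - 1}. x (\<tau> N i)) (\<lambda>i\<in>{0..1}. snd (B i w)) = By N w" for w
      using in1 unfolding Bx_def By_def by (auto simp: restrict_def fun_eq_iff)
  qed
qed

lemma indep_Wxy_Bxy:
  "indep_rv (P N \<Otimes>\<^sub>M P N) (\<lambda>w. (Wx N w, Wy N w)) (P (N - 1) \<Otimes>\<^sub>M P (N - 1)) (\<lambda>w. (Bx N w, By N w))"
proof -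
  have in1: "\<tau> N i \<in> {0..1}" if "i < N - 1" for i using \<tau>(2)[OF that] by auto
  have m1: "(\<lambda>x. (\<lambda>i\<in>{..<N}. fst (x (\<tau> N i)), \<lambda>i\<in>{..<N}. snd (x (\<tau> N i)))) \<in> (\<Pi>\<^sub>M j\<in>{0..}. borel :: (real \<times> real) measure) \<rightarrow>\<^sub>M P N \<Otimes>\<^sub>M P N"
    by (rule measurable_select2) auto
  have m2: "(\<lambda>x. (\<lambda>i\<in>{..<N - 1}. fst (x (\<tau> N i)), \<lambda>i\<in>{..<N - 1}. snd (x (\<tau> N i)))) \<in> (\<Pi>\<^sub>M j\<in>{0..1}. borel :: (real \<times> real) measure) \<rightarrow>\<^sub>M P (N - 1) \<Otimes>\<^sub>M P (N - 1)"
    by (rule measurable_select2[OF in1])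
  show ?thesis
  proof (rule indep_rv_cong[OF indep_rv_compose[OF indep_rv_of_indep_var[OF planar_indep_var] m1 m2]])
    show "(\<lambda>i\<in>{..<N}. fst ((\<lambda>i\<in>{0..}. W i w) (\<tau> N i)), \<lambda>i\<in>{..<N}. snd ((\<lambda>i\<in>{0..}. W i w) (\<tau> N i))) = (Wx N w, Wy N w)" for w
      by (auto simp: Wx_def Wy_def)
    show "(\<lambda>i\<in>{..<N - 1}. fst ((\<lambda>i\<in>{0..1}. B i w) (\<tau> N i)), \<lambda>i\<in>{..<N - 1}. snd ((\<lambda>i\<in>{0..1}. B i w) (\<tau> N i))) = (Bx N w, By N w)" for w
      using in1 unfolding Bx_def By_def by (auto simp: restrict_def fun_eq_iff)
  qed
qed

lemma rotate_Wxy: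
  assumes cs: "c\<^sup>2 + s\<^sup>2 = 1" and N: "0 < N"
  shows "distr M (P N \<Otimes>\<^sub>M P N) (\<lambda>w. (Wx N w, Wy N w)) = distr M (P N \<Otimes>\<^sub>M P N) (\<lambda>w. rotv {..<N} c s (Wx N w, Wy N w))"
proof (rule rotation_invariant_law[OF indep_Wxy, where f = "bm_joint_density N (\<tau> N)"])
  show "(\<integral>\<^sup>+w. F (Wx N w) \<partial>M) = (\<integral>\<^sup>+x. F x * ennreal (bm_joint_density N (\<tau> N) x) \<partial>P N)" if "F \<in> borel_measurable (P N)" for F
    unfolding Wx_def by (rule W.W1.bm_joint_nn_integral[OF _ \<tau>(3)[OF N] that]) auto
  show "(\<integral>\<^sup>+w. F (Wy N w) \<partial>M) = (\<integral>\<^sup>+x. F x * ennreal (bm_joint_density N (\<tau> N) x) \<partial>P N)" if "F \<in> borel_measurable (P N)" for F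
    unfolding Wy_def by (rule W.W2.bm_joint_nn_integral[OF _ \<tau>(3)[OF N] that]) auto
qed (auto simp: bm_joint_density_rotate[OF cs] bm_joint_density_nonneg cs intro: bm_joint_density_cong)

lemma rotate_Bxy:
  assumes cs: "c\<^sup>2 + s\<^sup>2 = 1" and N: "0 < N"
  shows "distr M (P (N - 1) \<Otimes>\<^sub>M P (N - 1)) (\<lambda>w. (Bx N w, By N w)) = distr M (P (N - 1) \<Otimes>\<^sub>M P (N - 1)) (\<lambda>w. rotv {..<N - 1} c s (Bx N w, By N w))"
proof (rule rotation_invariant_law[OF indep_Bxy, where f = "bm_bridge_density (N - 1) (\<tau> N)"])
  have t: "\<tau> N ` {..<N - 1} \<subseteq> {0<..<1}" using \<tau>(2) by blast
  note dx = B.B1.bridge_distributed[OF t \<tau>(3)[OF N]] and dy = B.B2.bridge_distributed[OF t \<tau>(3)[OF N]]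
  show "(\<integral>\<^sup>+w. F (Bx N w) \<partial>M) = (\<integral>\<^sup>+x. F x * ennreal (bm_bridge_density (N - 1) (\<tau> N) x) \<partial>P (N - 1))" if "F \<in> borel_measurable (P (N - 1))" for F
    unfolding Bx_def by (subst distributed_nn_integral[OF dx that, symmetric]) (simp add: mult.commute)
  show "(\<integral>\<^sup>+w. F (By N w) \<partial>M) = (\<integral>\<^sup>+x. F x * ennreal (bm_bridge_density (N - 1) (\<tau> N) x) \<partial>P (N - 1))" if "F \<in> borel_measurable (P (N - 1))" for F
    unfolding By_def by (subst distributed_nn_integral[OF dy that, symmetric]) (simp add: mult.commute)
  show "bm_bridge_density (N - 1) (\<tau> N) \<in> borel_measurable (P (N - 1))"
  proof (cases "N - 1")
    case 0
    show ?thesis unfolding 0 by (simp add: PiM_empty)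
  next
    case (Suc m)
    have "(\<lambda>x. x (N - 1 - 1)) \<in> borel_measurable (P (N - 1))" using Suc by (intro measurable_lborel_component) simp
    then have "(\<lambda>x. heat (1 - \<tau> N (N - 1 - 1)) (x (N - 1 - 1))) \<in> borel_measurable (P (N - 1))" by (rule measurable_compose) measurable
    then have "(\<lambda>x. bm_joint_density (N - 1) (\<tau> N) x * (heat (1 - \<tau> N (N - 1 - 1)) (x (N - 1 - 1)) / heat 1 0)) \<in> borel_measurable (P (N - 1))"
      by measurable
    then show ?thesis using Suc by (subst measurable_cong[OF B.B1.bridge_density_eq]) auto
  qed
  show "0 \<le> bm_bridge_density (N - 1) (\<tau> N) x" for x
    unfolding bm_bridge_density_def by (intro divide_nonneg_nonneg bm_joint_density_nonneg)
qed (auto simp: bm_bridge_density_rotate[OF cs] cs intro: bm_bridge_density_cong)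

lemma distinct_pt:
  assumes ij: "i \<in> ix N" "j \<in> ix N" "i \<noteq> j"
  shows "AE w in M. fst (pt N i w) \<noteq> fst (pt N j w)"
proof -
  have WW: "AE w in M. fst (W (real k / real N) w) \<noteq> fst (W (real l / real N) w)" if "k < l" "l \<le> N" for k l
  proof -
    have "AE w in M. fst (W (real l / real N) w) - fst (W (real k / real N) w) \<noteq> 0"
      by (rule W.W1.normal_no_atom[OF W.W1.bm_increments_normal]) (use that in \<open>auto simp: divide_strict_right_mono\<close>)
    then show ?thesis by eventually_elim auto
  qed
  have BB: "AE w in M. fst (B (real k / real N) w) \<noteq> fst (B (real l / real N) w)" if "k < l" "0 < k" "l < N" for k l
    using that by (intro X.B_distinct) (auto simp: divide_strict_right_mono)
  have WB: "AE w in M. fst (W (real k / real N) w) \<noteq> fst (B (real l / real N) w)" if "0 < l" "l < N" for k l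
  proof -
    have t: "0 < real l / real N" "real l / real N < 1" using that by auto
    have "indep_rv borel (\<lambda>w. (\<lambda>i\<in>{0..}. fst (W i w)) (real k / real N)) borel (\<lambda>w. (\<lambda>j\<in>{0..1}. fst (B j w)) (real l / real N))"
      by (rule indep_rv_compose[OF X.indep_rv_WB]; rule measurable_component_singleton) (use t in auto)
    then have ind: "indep_rv borel (\<lambda>w. fst (W (real k / real N) w)) borel (\<lambda>w. fst (B (real l / real N) w))"
      using t by simp
    show ?thesis
      by (rule indep_rv_no_tie[OF ind gaussian_rv_no_atom[OF X.gaussian_rv_B[OF t]]]) (use that in auto)
  qed
  have sym: "AE w in M. f w \<noteq> g w \<Longrightarrow> AE w in M. g w \<noteq> f w" for f g :: "'w \<Rightarrow> real"
    by (auto elim: eventually_mono)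
  show ?thesis
  proof (cases i)
    case i: (Inl k)
    show ?thesis
    proof (cases j)
      case j: (Inl l)
      then show ?thesis using ij i WW[of k l] sym[OF WW[of l k]] by (cases "k < l") (auto simp: ix_def pt_def)
    next
      case j: (Inr l)
      then show ?thesis using ij i WB[of l k] by (auto simp: ix_def pt_def)
    qed
  next
    case i: (Inr k)
    show ?thesis
    proof (cases j)
      case j: (Inl l)
      then show ?thesis using ij i sym[OF WB[of k l]] by (auto simp: ix_def pt_def)
    next
      case j: (Inr l)
      then show ?thesis using ij i BB[of k l] sym[OF BB[of l k]] by (cases "k < l") (auto simp: ix_def pt_def)
    qed
  qed
qed

text \<open>Recovers a coordinate of sample point \<open>i\<close> from the vector \<open>u\<close>
  of the motion and \<open>v\<close> of the bridge. The vectors begin at time \<open>1 / N\<close>,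
  whence the shift by one; time 0 of the motion is the origin.\<close>

definition sel :: "nat + nat \<Rightarrow> (nat \<Rightarrow> real) \<Rightarrow> (nat \<Rightarrow> real) \<Rightarrow> real" where
  "sel i u v = (case i of Inl k \<Rightarrow> (if k = 0 then 0 else u (k - 1)) | Inr l \<Rightarrow> v (l - 1))"

lemma measurable_sel:
  assumes i: "i \<in> ix N" and f: "f \<in> Q \<rightarrow>\<^sub>M P N" and g: "g \<in> Q \<rightarrow>\<^sub>M P (N - 1)"
  shows "(\<lambda>x. sel i (f x) (g x)) \<in> borel_measurable Q"
proof (cases i)
  case (Inl k)
  then have "k = 0 \<or> k - 1 < N" using i by (auto simp: ix_def)
  then show ?thesis using Inl measurable_compose[OF f measurable_lborel_component[of "k - 1" N]] by (cases "k = 0") (simp_all add: sel_def)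
next
  case (Inr l)
  then have "l - 1 < N - 1" using i by (auto simp: ix_def)
  then show ?thesis using Inr measurable_compose[OF g measurable_lborel_component[of "l - 1" "N - 1"]] by (simp add: sel_def)
qed

lemma pt_eq_sel:
  assumes i: "i \<in> ix N" and w: "w \<in> space M"
  shows "fst (pt N i w) = sel i (Wx N w) (Bx N w)" "snd (pt N i w) = sel i (Wy N w) (By N w)"
proof -
  have "fst (pt N i w) = sel i (Wx N w) (Bx N w) \<and> snd (pt N i w) = sel i (Wy N w) (By N w)"
  proof (cases i)
    case (Inl k)
    show ?thesis
    proof (cases k)
      case 0
      then show ?thesis using Inl W.W1.bm_start[OF w] W.W2.bm_start[OF w] by (simp add: pt_def sel_def)
    next
      case (Suc m)
      then have "m < N" using Inl i by (auto simp: ix_def)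
      then show ?thesis using Inl Suc by (simp add: pt_def sel_def Wx_def Wy_def)
    qed
  next
    case (Inr l)
    then have l: "1 \<le> l" "l < N" using i by (auto simp: ix_def)
    then obtain m where m: "l = Suc m" by (cases l) auto
    then have "m < N - 1" using l by simp
    then show ?thesis using Inr m by (simp add: pt_def sel_def Bx_def By_def)
  qed
  then show "fst (pt N i w) = sel i (Wx N w) (Bx N w)" "snd (pt N i w) = sel i (Wy N w) (By N w)" by auto
qed

lemma sel_rotv:
  assumes i: "i \<in> ix N"
  shows "sel i (fst (rotv {..<N} c s (u, u'))) (fst (rotv {..<N - 1} c s (v, v'))) = c * sel i u v - s * sel i u' v'"
    "sel i (snd (rotv {..<N} c s (u, u'))) (snd (rotv {..<N - 1} c s (v, v'))) = s * sel i u v + c * sel i u' v'"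
proof -
  have "\<And>k. i = Inl k \<Longrightarrow> k \<noteq> 0 \<Longrightarrow> k - 1 < N" "\<And>l. i = Inr l \<Longrightarrow> l - 1 < N - 1" using i by (auto simp: ix_def)
  then show "sel i (fst (rotv {..<N} c s (u, u'))) (fst (rotv {..<N - 1} c s (v, v'))) = c * sel i u v - s * sel i u' v'"
    "sel i (snd (rotv {..<N} c s (u, u'))) (snd (rotv {..<N - 1} c s (v, v'))) = s * sel i u v + c * sel i u' v'"
    by (auto simp: sel_def rotv_def vadd_def split: sum.split)
qed

text \<open>Motion and bridge are separately invariant under the same rotation; their independence
  combines the two laws into the law of the whole sample.\<close>

lemma rotate_pt:
  assumes cs: "c\<^sup>2 + s\<^sup>2 = 1" and N: "0 < N"
  shows "distr M (\<Pi>\<^sub>M i\<in>ix N. borel) (\<lambda>w. \<lambda>i\<in>ix N. (fst (pt N i w), snd (pt N i w)))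
    = distr M (\<Pi>\<^sub>M i\<in>ix N. borel) (\<lambda>w. \<lambda>i\<in>ix N. (c * fst (pt N i w) - s * snd (pt N i w), s * fst (pt N i w) + c * snd (pt N i w)))"
proof -
  let ?S = "P N \<Otimes>\<^sub>M P N" and ?T = "P (N - 1) \<Otimes>\<^sub>M P (N - 1)"
  define f where "f z = (\<lambda>i\<in>ix N. (sel i (fst (fst z)) (fst (snd z)), sel i (snd (fst z)) (snd (snd z))))" for z :: "((nat \<Rightarrow> real) \<times> (nat \<Rightarrow> real)) \<times> ((nat \<Rightarrow> real) \<times> (nat \<Rightarrow> real))"
  have f: "f \<in> ?S \<Otimes>\<^sub>M ?T \<rightarrow>\<^sub>M (\<Pi>\<^sub>M i\<in>ix N. borel)"
    unfolding f_def[abs_def]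
    by (intro measurable_restrict borel_measurable_Pair measurable_sel) measurable
  define v where "v w = (Wx N w, Wy N w)" for w
  define b where "b w = (Bx N w, By N w)" for w
  define v' where "v' w = rotv {..<N} c s (v w)" for w
  define b' where "b' w = rotv {..<N - 1} c s (b w)" for w
  have ind: "indep_rv ?S v ?T b" using indep_Wxy_Bxy[of N] by (simp add: v_def[abs_def] b_def[abs_def])
  have ind': "indep_rv ?S v' ?T b'"
    unfolding v'_def[abs_def] b'_def[abs_def] by (rule indep_rv_compose[OF ind measurable_rotv measurable_rotv])
  have "distr M (?S \<Otimes>\<^sub>M ?T) (\<lambda>w. (v w, b w)) = distr M ?S v \<Otimes>\<^sub>M distr M ?T b" by (rule indep_rv_distr[OF ind])
  also have "distr M ?S v = distr M ?S v'" unfolding v'_def v_def by (rule rotate_Wxy[OF cs N])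
  also have "distr M ?T b = distr M ?T b'" unfolding b'_def b_def by (rule rotate_Bxy[OF cs N])
  also have "distr M ?S v' \<Otimes>\<^sub>M distr M ?T b' = distr M (?S \<Otimes>\<^sub>M ?T) (\<lambda>w. (v' w, b' w))" by (rule indep_rv_distr[OF ind', symmetric])
  finally have eq: "distr M (?S \<Otimes>\<^sub>M ?T) (\<lambda>w. (v w, b w)) = distr M (?S \<Otimes>\<^sub>M ?T) (\<lambda>w. (v' w, b' w))" .
  have m: "(\<lambda>w. (v w, b w)) \<in> M \<rightarrow>\<^sub>M ?S \<Otimes>\<^sub>M ?T" "(\<lambda>w. (v' w, b' w)) \<in> M \<rightarrow>\<^sub>M ?S \<Otimes>\<^sub>M ?T"
    using ind ind' by (auto simp: indep_rv_def intro: measurable_Pair)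
  have "distr M (\<Pi>\<^sub>M i\<in>ix N. borel) (\<lambda>w. \<lambda>i\<in>ix N. (fst (pt N i w), snd (pt N i w))) = distr M (\<Pi>\<^sub>M i\<in>ix N. borel) (f \<circ> (\<lambda>w. (v w, b w)))"
  proof (intro distr_cong refl)
    fix w assume "w \<in> space M"
    then show "(\<lambda>i\<in>ix N. (fst (pt N i w), snd (pt N i w))) = (f \<circ> (\<lambda>w. (v w, b w))) w"
      by (simp add: f_def v_def b_def pt_eq_sel cong: restrict_cong)
  qed
  also have "\<dots> = distr (distr M (?S \<Otimes>\<^sub>M ?T) (\<lambda>w. (v w, b w))) (\<Pi>\<^sub>M i\<in>ix N. borel) f"
    by (rule distr_distr[OF f m(1), symmetric])
  also have "\<dots> = distr M (\<Pi>\<^sub>M i\<in>ix N. borel) (f \<circ> (\<lambda>w. (v' w, b' w)))"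
    unfolding eq by (rule distr_distr[OF f m(2)])
  also have "\<dots> = distr M (\<Pi>\<^sub>M i\<in>ix N. borel) (\<lambda>w. \<lambda>i\<in>ix N. (c * fst (pt N i w) - s * snd (pt N i w), s * fst (pt N i w) + c * snd (pt N i w)))"
  proof (intro distr_cong refl)
    fix w assume "w \<in> space M"
    then show "(f \<circ> (\<lambda>w. (v' w, b' w))) w = (\<lambda>i\<in>ix N. (c * fst (pt N i w) - s * snd (pt N i w), s * fst (pt N i w) + c * snd (pt N i w)))"
      by (simp add: f_def v'_def b'_def v_def b_def pt_eq_sel sel_rotv cong: restrict_cong del: One_nat_def)
  qed
  finally show ?thesis .
qed

text \<open>The second coordinate of a point belongs to one process only. It is independent of the
  first coordinate of that process and of the other process, which is the situation of
  \<open>indep_rv_factor\<close>.\<close>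

lemma factor_pt:
  assumes i: "i \<in> ix N" and G: "G \<in> borel_measurable (\<Pi>\<^sub>M i\<in>ix N. borel)" and k: "k \<in> borel_measurable borel"
  shows "(\<integral>\<^sup>+w. G (\<lambda>j\<in>ix N. fst (pt N j w)) * k (snd (pt N i w)) \<partial>M) = (\<integral>\<^sup>+w. G (\<lambda>j\<in>ix N. fst (pt N j w)) \<partial>M) * (\<integral>\<^sup>+w. k (snd (pt N i w)) \<partial>M)"
proof -
  define G' where "G' u v = G (\<lambda>j\<in>ix N. sel j u v)" for u v
  have GX: "G (\<lambda>j\<in>ix N. fst (pt N j w)) = G' (Wx N w) (Bx N w)" if "w \<in> space M" for w
    using that by (simp add: G'_def pt_eq_sel cong: restrict_cong)
  have G'm: "(\<lambda>x. G' (f x) (g x)) \<in> borel_measurable Q" if "f \<in> Q \<rightarrow>\<^sub>M P N" "g \<in> Q \<rightarrow>\<^sub>M P (N - 1)" for f g and Q :: "((nat \<Rightarrow> real) \<times> (nat \<Rightarrow> real)) measure"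
    unfolding G'_def by (rule measurable_compose[OF _ G], rule measurable_restrict, rule measurable_sel[OF _ that])
  have eq: "(\<integral>\<^sup>+w. G (\<lambda>j\<in>ix N. fst (pt N j w)) \<partial>M) = (\<integral>\<^sup>+w. G' (Wx N w) (Bx N w) \<partial>M)"
    by (rule nn_integral_cong) (rule GX)
  show ?thesis
  proof (cases i)
    case (Inl l)
    \<comment> \<open>For this \<open>i\<close> the value of \<open>sel i\<close> is read off its
      first vector alone, so any second vector may be inserted.\<close>
    define k' where "k' u = k (sel i u undefined)" for u
    have k': "k' \<in> borel_measurable (P N)"
    proof -
      have "(\<lambda>u. sel i u (undefined :: nat \<Rightarrow> real)) \<in> borel_measurable (P N)"
        using Inl i measurable_lborel_component[of "l - 1" N] by (cases "l = 0") (auto simp: sel_def ix_def)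
      from measurable_compose[OF this k] show ?thesis by (simp add: k'_def[abs_def])
    qed
    have kY: "k (snd (pt N i w)) = k' (Wy N w)" if "w \<in> space M" for w
      using that i Inl by (simp add: pt_eq_sel k'_def) (simp add: sel_def)
    have "(\<integral>\<^sup>+w. G (\<lambda>j\<in>ix N. fst (pt N j w)) * k (snd (pt N i w)) \<partial>M) = (\<integral>\<^sup>+w. (\<lambda>z. G' (fst z) (snd z)) (Wx N w, Bx N w) * k' (Wy N w) \<partial>M)"
      by (rule nn_integral_cong) (simp add: GX kY)
    also have "\<dots> = (\<integral>\<^sup>+w. (\<lambda>z. G' (fst z) (snd z)) (Wx N w, Bx N w) \<partial>M) * (\<integral>\<^sup>+w. k' (Wy N w) \<partial>M)"
    proof (rule indep_rv_factor[OF _ indep_Wxy _ k'])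
      have "indep_rv (P N \<Otimes>\<^sub>M P N) (\<lambda>w. (\<lambda>z. z) (Wx N w, Wy N w)) (P (N - 1)) (\<lambda>w. fst (Bx N w, By N w))"
        by (rule indep_rv_compose[OF indep_Wxy_Bxy]) auto
      then show "indep_rv (P N \<Otimes>\<^sub>M P N) (\<lambda>w. (Wx N w, Wy N w)) (P (N - 1)) (Bx N)" by simp
      show "(\<lambda>z. G' (fst z) (snd z)) \<in> borel_measurable (P N \<Otimes>\<^sub>M P (N - 1))" by (rule G'm) auto
    qed
    also have "(\<integral>\<^sup>+w. k' (Wy N w) \<partial>M) = (\<integral>\<^sup>+w. k (snd (pt N i w)) \<partial>M)"
      by (rule nn_integral_cong) (simp add: kY)
    finally show ?thesis by (simp only: eq fst_conv snd_conv)
  next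
    case (Inr l)
    define k' where "k' u = k (sel i undefined u)" for u
    have k': "k' \<in> borel_measurable (P (N - 1))"
    proof -
      have "(\<lambda>u. sel i (undefined :: nat \<Rightarrow> real) u) \<in> borel_measurable (P (N - 1))"
        using Inr i measurable_lborel_component[of "l - 1" "N - 1"] by (auto simp: sel_def ix_def)
      from measurable_compose[OF this k] show ?thesis by (simp add: k'_def[abs_def])
    qed
    have kY: "k (snd (pt N i w)) = k' (By N w)" if "w \<in> space M" for w
      using that i Inr by (simp add: pt_eq_sel k'_def) (simp add: sel_def)
    have "(\<integral>\<^sup>+w. G (\<lambda>j\<in>ix N. fst (pt N j w)) * k (snd (pt N i w)) \<partial>M) = (\<integral>\<^sup>+w. (\<lambda>z. G' (snd z) (fst z)) (Bx N w, Wx N w) * k' (By N w) \<partial>M)"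
      by (rule nn_integral_cong) (simp add: GX kY)
    also have "\<dots> = (\<integral>\<^sup>+w. (\<lambda>z. G' (snd z) (fst z)) (Bx N w, Wx N w) \<partial>M) * (\<integral>\<^sup>+w. k' (By N w) \<partial>M)"
    proof (rule indep_rv_factor[OF _ indep_Bxy _ k'])
      have "indep_rv (P (N - 1) \<Otimes>\<^sub>M P (N - 1)) (\<lambda>w. (\<lambda>z. z) (Bx N w, By N w)) (P N) (\<lambda>w. fst (Wx N w, Wy N w))"
        by (rule indep_rv_compose[OF indep_rv_sym[OF indep_Wxy_Bxy]]) auto
      then show "indep_rv (P (N - 1) \<Otimes>\<^sub>M P (N - 1)) (\<lambda>w. (Bx N w, By N w)) (P N) (Wx N)" by simp
      show "(\<lambda>z. G' (snd z) (fst z)) \<in> borel_measurable (P (N - 1) \<Otimes>\<^sub>M P N)" by (rule G'm) auto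
    qed
    also have "(\<integral>\<^sup>+w. k' (By N w) \<partial>M) = (\<integral>\<^sup>+w. k (snd (pt N i w)) \<partial>M)"
      by (rule nn_integral_cong) (simp add: kY)
    finally show ?thesis by (simp only: eq fst_conv snd_conv)
  qed
qed

lemma isotropic_pt:
  assumes N: "0 < N"
  shows "isotropic_points M (ix N) (\<lambda>i w. fst (pt N i w)) (\<lambda>i w. snd (pt N i w)) (var N)"
proof
  show "finite (ix N)" "ix N \<noteq> {}" by (auto simp: ix_def)
  show "(\<lambda>w. fst (pt N i w)) \<in> borel_measurable M" "(\<lambda>w. snd (pt N i w)) \<in> borel_measurable M" "0 \<le> var N i" if "i \<in> ix N" for i
    using gaussian_pt[OF that] by (auto simp: gaussian_rv_def)
  show "integrable M (\<lambda>w. (fst (pt N i w))\<^sup>2)" if "i \<in> ix N" for i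
    by (rule gaussian_rv_sq[OF gaussian_pt(1)[OF that]])
  show "(\<integral>\<^sup>+w. ennreal (exp (- \<epsilon> * (snd (pt N i w) - \<rho>)\<^sup>2 / 2)) \<partial>M) = ennreal (exp (- \<epsilon> * \<rho>\<^sup>2 / (2 * (1 + \<epsilon> * var N i))) / sqrt (1 + \<epsilon> * var N i))"
    if "i \<in> ix N" "0 < \<epsilon>" for i \<epsilon> \<rho>
    by (rule gaussian_rv_exp[OF gaussian_pt(2)[OF that(1)] that(2)])
qed (use rotate_pt[OF _ N] factor_pt distinct_pt in blast)+

end

section \<open>Refining the sample\<close>

lemma grid_point_limit:
  assumes t: "0 \<le> t"
  shows "(\<lambda>N. real (nat \<lfloor>t * real N\<rfloor>) / real N) \<longlonglongrightarrow> t"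
proof -
  have b: "t * real N - 1 \<le> real (nat \<lfloor>t * real N\<rfloor>)" "real (nat \<lfloor>t * real N\<rfloor>) \<le> t * real N" for N
  proof -
    have "real (nat \<lfloor>t * real N\<rfloor>) = of_int \<lfloor>t * real N\<rfloor>" using t by simp
    then show "t * real N - 1 \<le> real (nat \<lfloor>t * real N\<rfloor>)" "real (nat \<lfloor>t * real N\<rfloor>) \<le> t * real N" by linarith+
  qed
  have l: "(\<lambda>N. (t * real N - 1) / real N) \<longlonglongrightarrow> t" by real_asymp
  have u: "(\<lambda>N. (t * real N) / real N) \<longlonglongrightarrow> t" by real_asymp
  show ?thesis
    by (rule tendsto_sandwich[OF _ _ l u]) (intro always_eventually allI divide_right_mono b of_nat_0_le_iff)+
qed

text \<open>Rounding \<open>t\<close> down to the grid keeps the sampled time at most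
  \<open>t\<close>; a positive \<open>t\<close> eventually rounds to a positive index, as required
  of bridge indices.\<close>

lemma eventually_grid_left:
  assumes t: "0 \<le> t" "t \<le> 1" and f: "continuous_on {0..1} f" and U: "open U" "f t \<in> U"
  shows "\<forall>\<^sub>F N in sequentially. \<exists>k. real k / real N \<le> t \<and> (0 < t \<longrightarrow> 0 < k) \<and> f (real k / real N) \<in> U"
proof -
  let ?k = "\<lambda>N. nat \<lfloor>t * real N\<rfloor>"
  have le: "real (?k N) / real N \<le> t" if "0 < N" for N
  proof -
    have "real (?k N) = of_int \<lfloor>t * real N\<rfloor>" using t by simp
    also have "\<dots> \<le> t * real N" by linarith
    finally show ?thesis using that by (simp add: divide_le_eq)
  qed
  have "\<forall>\<^sub>F N in sequentially. real (?k N) / real N \<in> {0..1}"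
    using eventually_gt_at_top[of 0]
  proof eventually_elim
    fix N :: nat assume "0 < N"
    have "real (?k N) / real N \<le> 1" by (rule order_trans[OF le[OF \<open>0 < N\<close>] t(2)])
    then show "real (?k N) / real N \<in> {0..1}" unfolding atLeastAtMost_iff by (intro conjI divide_nonneg_nonneg of_nat_0_le_iff)
  qed
  then have "(\<lambda>N. f (real (?k N) / real N)) \<longlonglongrightarrow> f t"
    by (rule continuous_on_tendsto_compose[OF f grid_point_limit[OF t(1)], rotated]) (use t in auto)
  from topological_tendstoD[OF this U] have 1: "\<forall>\<^sub>F N in sequentially. f (real (?k N) / real N) \<in> U" .
  have 2: "\<forall>\<^sub>F N in sequentially. 0 < t \<longrightarrow> 0 < real (?k N) / real N"
    using order_tendstoD(1)[OF grid_point_limit[OF t(1)], of 0] by (cases "0 < t") auto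
  show ?thesis using 1 2 eventually_gt_at_top[of 0]
  proof eventually_elim
    fix N :: nat assume h: "f (real (?k N) / real N) \<in> U" "0 < t \<longrightarrow> 0 < real (?k N) / real N" "0 < N"
    have "0 < t \<longrightarrow> 0 < ?k N" using h(2,3) by (auto simp: zero_less_divide_iff)
    then show "\<exists>k. real k / real N \<le> t \<and> (0 < t \<longrightarrow> 0 < k) \<and> f (real k / real N) \<in> U" using h(1) le[OF h(3)] by blast
  qed
qed

context planar_motion_bridge begin

abbreviation (input) mw where "mw a b w \<equiv> path_max (\<lambda>t. fst (W t w)) a b"
abbreviation (input) mb where "mb a b w \<equiv> path_max (\<lambda>t. fst (B t w)) a b"

definition rightmost :: "nat \<Rightarrow> nat + nat \<Rightarrow> 'w \<Rightarrow> bool" where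
  "rightmost N i w \<longleftrightarrow> (\<forall>j\<in>ix N - {i}. fst (pt N j w) < fst (pt N i w))"

text \<open>Almost surely the whole sample has exactly one rightmost point, and then this is the
  indicator that it lies in \<open>S\<close>, in a form that is additive in
  \<open>S\<close>.\<close>

definition hits :: "nat \<Rightarrow> (nat + nat) set \<Rightarrow> 'w \<Rightarrow> real" where
  "hits N S w = (\<Sum>i\<in>S. of_bool (rightmost N i w))"

abbreviation (input) sq_top :: "nat \<Rightarrow> 'w \<Rightarrow> real" where
  "sq_top N w \<equiv> \<Sum>i\<in>ix N. (fst (pt N i w))\<^sup>2 * of_bool (rightmost N i w)"

abbreviation (input) m_all where "m_all w \<equiv> max (mw 0 1 w) (mb 0 1 w)"

lemma finite_ix [simp]: "finite (ix N)" by (simp add: ix_def)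

lemma hits_eq_0:
  assumes "S \<subseteq> ix N" "j \<in> ix N - S" "\<And>k. k \<in> S \<Longrightarrow> fst (pt N k w) \<le> fst (pt N j w)"
  shows "hits N S w = 0"
  unfolding hits_def
proof (rule sum.neutral, rule)
  fix k assume "k \<in> S"
  then have "j \<in> ix N - {k}" "fst (pt N k w) \<le> fst (pt N j w)" using assms by auto
  then have "\<not> rightmost N k w" unfolding rightmost_def by (meson not_le)
  then show "of_bool (rightmost N k w) = (0 :: real)" by simp
qed

lemma hits_eq_1:
  assumes one: "hits N (ix N) w = 1" and S: "S \<subseteq> ix N" "j \<in> S" and le: "\<And>k. k \<in> ix N - S \<Longrightarrow> fst (pt N k w) \<le> fst (pt N j w)"
  shows "hits N S w = 1"
proof -
  have "hits N (ix N - S) w = 0" by (rule hits_eq_0[of _ _ j]) (use S le in auto)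
  moreover have "hits N (ix N) w = hits N (ix N - S) w + hits N S w"
    unfolding hits_def by (rule sum.subset_diff[OF S(1)]) simp
  ultimately show ?thesis using one by simp
qed

definition ixW :: "nat \<Rightarrow> real \<Rightarrow> (nat + nat) set" where "ixW N r = Inl ` {k \<in> {..N}. real k / real N \<le> r}"
definition ixB :: "nat \<Rightarrow> real \<Rightarrow> (nat + nat) set" where "ixB N r = Inr ` {l \<in> {1..<N}. real l / real N \<le> r}"

lemma ixW_subset: "ixW N r \<subseteq> ix N" and ixB_subset: "ixB N r \<subseteq> ix N" by (auto simp: ixW_def ixB_def ix_def)

context
  fixes w assumes w: "w \<in> space M"
begin

lemma cont_W: "continuous_on {0..1} (\<lambda>t. fst (W t w))" using W.W1.W_cont[OF w] by simp
lemma cont_B: "continuous_on {0..1} (\<lambda>t. fst (B t w))" using B.B1.B_cont[OF w] by simp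

lemma W_le_max: "0 \<le> a \<Longrightarrow> a \<le> t \<Longrightarrow> t \<le> b \<Longrightarrow> fst (W t w) \<le> mw a b w"
  by (rule path_max_upper) (auto intro: W.W1.W_cont[OF w])

lemma B_le_max: "0 \<le> a \<Longrightarrow> a \<le> t \<Longrightarrow> t \<le> b \<Longrightarrow> b \<le> 1 \<Longrightarrow> fst (B t w) \<le> mb a b w"
  by (rule path_max_upper) (auto intro: B.B1.B_cont[OF w])

lemma W_attained:
  assumes "0 \<le> a" "a \<le> b" "b \<le> 1"
  obtains t where "a \<le> t" "t \<le> b" "fst (W t w) = mw a b w"
  using path_max_attained[of a b "\<lambda>t. fst (W t w)"] W.W1.W_cont[OF w, of a b] assms by (metis atLeastAtMost_iff)

lemma B_attained:
  assumes "0 \<le> a" "a \<le> b" "b \<le> 1"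
  obtains t where "a \<le> t" "t \<le> b" "fst (B t w) = mb a b w"
  using path_max_attained[of a b "\<lambda>t. fst (B t w)"] B.B1.B_cont[OF w, of a b] assms by (metis atLeastAtMost_iff)

lemma W_0: "fst (W 0 w) = 0" and B_0: "fst (B 0 w) = 0" and B_1: "fst (B 1 w) = 0"
  using W.W1.bm_start[OF w] B.B1.bridge_start[OF w] B.B1.bridge_end[OF w] by auto

lemma W_max_nonneg: "0 < r \<Longrightarrow> 0 \<le> mw 0 r w" using W_le_max[of 0 0 r] W_0 by simp
lemma B_max_nonneg: "0 < r \<Longrightarrow> r \<le> 1 \<Longrightarrow> 0 \<le> mb 0 r w" using B_le_max[of 0 0 r] B_0 by simp

lemma pt_le_max:
  assumes "i \<in> ix N" "0 < N"
  shows "fst (pt N i w) \<le> m_all w"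
proof (cases i)
  case (Inl k)
  then show ?thesis using assms W_le_max[of 0 "real k / real N" 1] by (auto simp: ix_def pt_def le_max_iff_disj)
next
  case (Inr l)
  then show ?thesis using assms B_le_max[of 0 "real l / real N" 1] by (auto simp: ix_def pt_def le_max_iff_disj)
qed

text \<open>By continuity the sample gets close to the maximiser. The end points of the bridge are
  not sampled under bridge indices, but there the bridge is 0, which does not exceed
  \<open>c\<close>.\<close>

lemma eventually_pt_above:
  assumes c: "0 \<le> c" "c < m_all w"
  shows "\<forall>\<^sub>F N in sequentially. \<exists>i\<in>ix N. c < fst (pt N i w)"
proof (cases "c < mw 0 1 w")
  case True
  obtain t where t: "0 \<le> t" "t \<le> 1" "fst (W t w) = mw 0 1 w" using W_attained[of 0 1] by auto
  have "\<forall>\<^sub>F N in sequentially. \<exists>k. real k / real N \<le> t \<and> (0 < t \<longrightarrow> 0 < k) \<and> fst (W (real k / real N) w) \<in> {c<..}"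
    by (rule eventually_grid_left) (use t True cont_W in auto)
  then show ?thesis using eventually_gt_at_top[of 0]
  proof eventually_elim
    case (elim N)
    then obtain k where k: "real k / real N \<le> t" "c < fst (W (real k / real N) w)" by auto
    have "real k / real N \<le> 1" by (rule order_trans[OF k(1) t(2)])
    then have "k \<le> N" using elim by simp
    then show ?case using k by (intro bexI[of _ "Inl k"]) (auto simp: ix_def pt_def)
  qed
next
  case False
  then have mb: "c < mb 0 1 w" using c by (simp add: less_max_iff_disj)
  obtain t where t: "0 \<le> t" "t \<le> 1" "fst (B t w) = mb 0 1 w" using B_attained[of 0 1] by auto
  have "t \<noteq> 0" "t \<noteq> 1" using t mb c B_0 B_1 by auto
  then have t01: "0 < t" "t < 1" using t by auto
  have "\<forall>\<^sub>F N in sequentially. \<exists>k. real k / real N \<le> t \<and> (0 < t \<longrightarrow> 0 < k) \<and> fst (B (real k / real N) w) \<in> {c<..}"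
    by (rule eventually_grid_left) (use t mb cont_B in auto)
  then show ?thesis using eventually_gt_at_top[of 0]
  proof eventually_elim
    case (elim N)
    then obtain k where k: "real k / real N \<le> t" "0 < k" "c < fst (B (real k / real N) w)" using t01 by auto
    have "real k / real N < 1" by (rule le_less_trans[OF k(1) t01(2)])
    then have "k < N" using elim by simp
    then show ?case using k by (intro bexI[of _ "Inr k"]) (auto simp: ix_def pt_def)
  qed
qed

context
  assumes one: "\<And>N. 0 < N \<Longrightarrow> hits N (ix N) w = 1"
begin

text \<open>The points of \<open>S\<close> are bounded by \<open>a\<close>, the others by
  \<open>b\<close>. A fine sample has a point above the smaller bound; that point lies on the side
  of the larger bound and beats every point of the other side.\<close>

lemma hits_limit:
  assumes S: "\<And>N. S N \<subseteq> ix N" and ab: "a \<noteq> b" "0 \<le> a" "0 \<le> b" "max a b = m_all w"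
    and le: "\<And>N i. 0 < N \<Longrightarrow> i \<in> S N \<Longrightarrow> fst (pt N i w) \<le> a"
      "\<And>N i. 0 < N \<Longrightarrow> i \<in> ix N - S N \<Longrightarrow> fst (pt N i w) \<le> b"
  shows "(\<lambda>N. hits N (S N) w) \<longlonglongrightarrow> of_bool (b < a)"
proof (rule tendsto_eventually)
  have "\<forall>\<^sub>F N in sequentially. \<exists>i\<in>ix N. min a b < fst (pt N i w)"
    by (rule eventually_pt_above) (use ab in auto)
  then show "\<forall>\<^sub>F N in sequentially. hits N (S N) w = of_bool (b < a)" using eventually_gt_at_top[of 0]
  proof eventually_elim
    case (elim N)
    then obtain i where i: "i \<in> ix N" "min a b < fst (pt N i w)" by auto
    show ?case
    proof (cases "b < a")
      case True
      then have "i \<in> S N" using le(2)[of N i] i elim(2) by force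
      moreover have "fst (pt N k w) \<le> fst (pt N i w)" if "k \<in> ix N - S N" for k
        using le(2)[OF elim(2) that] i(2) True by linarith
      ultimately have "hits N (S N) w = 1" by (rule hits_eq_1[OF one[OF elim(2)] S])
      then show ?thesis using True by simp
    next
      case False
      then have "i \<in> ix N - S N" using le(1)[of N i] i elim(2) by force
      moreover have "fst (pt N k w) \<le> fst (pt N i w)" if "k \<in> S N" for k
        using le(1)[OF elim(2) that] i(2) False by linarith
      ultimately have "hits N (S N) w = 0" by (rule hits_eq_0[OF S])
      then show ?thesis using False by simp
    qed
  qed
qed

lemma hits_W_limit:
  assumes r: "0 < r" "r < 1" and tie: "mw 0 r w \<noteq> mw r 1 w" "mw 0 r w \<noteq> mb 0 1 w"
  shows "(\<lambda>N. hits N (ixW N r) w) \<longlonglongrightarrow> of_bool (X.winW r w)"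
proof -
  have "(\<lambda>N. hits N (ixW N r) w) \<longlonglongrightarrow> of_bool (max (mw r 1 w) (mb 0 1 w) < mw 0 r w)"
  proof (rule hits_limit[OF ixW_subset])
    show "max (mw 0 r w) (max (mw r 1 w) (mb 0 1 w)) = m_all w"
      using path_max_union[OF _ _ cont_W, of r] r by (simp add: max.assoc)
    show "fst (pt N i w) \<le> mw 0 r w" if "i \<in> ixW N r" for N i
      using that by (auto simp: ixW_def pt_def intro!: W_le_max)
    show "fst (pt N i w) \<le> max (mw r 1 w) (mb 0 1 w)" if "0 < N" "i \<in> ix N - ixW N r" for N i
    proof (cases i)
      case (Inl k)
      then show ?thesis using that r W_le_max[of r "real k / real N" 1] by (auto simp: ix_def ixW_def pt_def le_max_iff_disj image_iff)
    next
      case (Inr l)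
      then show ?thesis using that B_le_max[of 0 "real l / real N" 1] by (auto simp: ix_def pt_def le_max_iff_disj)
    qed
  qed (use r tie W_max_nonneg[of r] B_max_nonneg[of 1] in \<open>auto simp: max_def\<close>)
  then show ?thesis by (simp add: X.winW_def)
qed

lemma hits_B_limit:
  assumes r: "0 < r" "r < 1" and tie: "mb 0 r w \<noteq> mb r 1 w" "mb 0 r w \<noteq> mw 0 1 w"
  shows "(\<lambda>N. hits N (ixB N r) w) \<longlonglongrightarrow> of_bool (X.winB r w)"
proof -
  have "(\<lambda>N. hits N (ixB N r) w) \<longlonglongrightarrow> of_bool (max (mb r 1 w) (mw 0 1 w) < mb 0 r w)"
  proof (rule hits_limit[OF ixB_subset])
    show "max (mb 0 r w) (max (mb r 1 w) (mw 0 1 w)) = m_all w"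
      using path_max_union[OF _ _ cont_B, of r] r by (simp add: max.assoc max.commute)
    show "fst (pt N i w) \<le> mb 0 r w" if "i \<in> ixB N r" for N i
      using that r by (auto simp: ixB_def pt_def intro!: B_le_max)
    show "fst (pt N i w) \<le> max (mb r 1 w) (mw 0 1 w)" if "0 < N" "i \<in> ix N - ixB N r" for N i
    proof (cases i)
      case (Inl k)
      then show ?thesis using that W_le_max[of 0 "real k / real N" 1] by (auto simp: ix_def pt_def le_max_iff_disj)
    next
      case (Inr l)
      then show ?thesis using that r B_le_max[of r "real l / real N" 1] by (auto simp: ix_def ixB_def pt_def le_max_iff_disj image_iff)
    qed
  qed (use r tie W_max_nonneg[of 1] B_max_nonneg[of r] in \<open>auto simp: max_def\<close>)
  then show ?thesis by (simp add: X.winB_def)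
qed

lemma hits_W_all_limit:
  assumes tie: "mw 0 1 w \<noteq> mb 0 1 w"
  shows "(\<lambda>N. hits N (Inl ` {..N}) w) \<longlonglongrightarrow> of_bool (mb 0 1 w < mw 0 1 w)"
  by (rule hits_limit) (use tie W_max_nonneg[of 1] B_max_nonneg[of 1] in \<open>auto simp: ix_def pt_def intro!: W_le_max B_le_max\<close>)

lemma rightmost_sq_le:
  assumes N: "0 < N"
  shows "sq_top N w \<le> (m_all w)\<^sup>2"
proof -
  have "sq_top N w \<le> (\<Sum>i\<in>ix N. (m_all w)\<^sup>2 * of_bool (rightmost N i w))"
  proof (rule sum_mono)
    fix i assume i: "i \<in> ix N"
    show "(fst (pt N i w))\<^sup>2 * of_bool (rightmost N i w) \<le> (m_all w)\<^sup>2 * of_bool (rightmost N i w)"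
    proof (cases "rightmost N i w")
      case True
      \<comment> \<open>The origin is a sample point, so a rightmost point has nonnegative first
        coordinate and squaring preserves the order.\<close>
      have z: "Inl 0 \<in> ix N" "fst (pt N (Inl 0) w) = 0" by (auto simp: ix_def pt_def W_0)
      have "fst (pt N (Inl 0) w) < fst (pt N i w)" if "i \<noteq> Inl 0" using True z(1) that unfolding rightmost_def by auto
      then have "0 \<le> fst (pt N i w)" using z(2) by (cases "i = Inl 0") auto
      then show ?thesis using pt_le_max[OF i N] by (intro mult_right_mono power_mono) auto
    qed simp
  qed
  also have "\<dots> = (m_all w)\<^sup>2 * hits N (ix N) w" by (simp only: hits_def sum_distrib_left)
  finally show ?thesis using one[OF N] by simp
qed

lemma rightmost_sq_limit:
  assumes pos: "0 < mw 0 1 w"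
  shows "(\<lambda>N. sq_top N w) \<longlonglongrightarrow> (m_all w)\<^sup>2"
proof (rule order_tendstoI)
  fix a assume a: "(m_all w)\<^sup>2 < a"
  show "\<forall>\<^sub>F N in sequentially. sq_top N w < a"
    using eventually_gt_at_top[of 0] by eventually_elim (rule le_less_trans[OF rightmost_sq_le a])
next
  fix a assume a: "a < (m_all w)\<^sup>2"
  \<comment> \<open>Levels below 0 are covered by the truncation \<open>max 0 a\<close>, which keeps
    \<open>c\<close> nonnegative.\<close>
  define c where "c = sqrt (max 0 a)"
  have "c < sqrt ((m_all w)\<^sup>2)" unfolding c_def using a pos by (intro real_sqrt_less_mono) auto
  then have c: "0 \<le> c" "c < m_all w" "a \<le> c\<^sup>2" using pos by (auto simp: c_def)
  from eventually_pt_above[OF c(1,2)]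
  show "\<forall>\<^sub>F N in sequentially. a < sq_top N w"
    using eventually_gt_at_top[of 0]
  proof eventually_elim
    fix N :: nat assume N: "0 < N" and "\<exists>i\<in>ix N. c < fst (pt N i w)"
    then obtain j where j: "j \<in> ix N" "c < fst (pt N j w)" by auto
    obtain i where i: "i \<in> ix N" "rightmost N i w"
    proof -
      have "\<not> (\<forall>i\<in>ix N. \<not> rightmost N i w)"
      proof
        assume "\<forall>i\<in>ix N. \<not> rightmost N i w"
        then have "hits N (ix N) w = 0" unfolding hits_def by (intro sum.neutral) auto
        then show False using one[OF N] by simp
      qed
      then show ?thesis using that by auto
    qed
    have "fst (pt N j w) < fst (pt N i w)" if "i \<noteq> j" using i(2) j(1) that unfolding rightmost_def by auto
    then have "c < fst (pt N i w)" using j(2) by (cases "i = j") auto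
    then have "c\<^sup>2 < (fst (pt N i w))\<^sup>2" using c(1) by (intro power_strict_mono) auto
    then have "a < (fst (pt N i w))\<^sup>2 * of_bool (rightmost N i w)" using c(3) i(2) by simp
    also have "\<dots> \<le> sq_top N w"
      by (rule member_le_sum[OF i(1)]) auto
    finally show "a < sq_top N w" .
  qed
qed

end

end

end

text \<open>Writes a function of a time \<open>t\<close> that vanishes at 1 as an integral of
  indicators \<open>t \<le> r\<close>, so that moments of a random time become integrals of
  probabilities.\<close>

lemma integral_indicator_ge:
  assumes t: "0 \<le> t" "t \<le> 1" and F: "\<And>x. (F has_real_derivative f x) (at x)" and f: "continuous_on UNIV f"
  shows "has_bochner_integral lborel (\<lambda>r. indicator {0<..<1} r * f r * of_bool (t \<le> r)) (F 1 - F t :: real)"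
proof -
  have "has_bochner_integral lborel (\<lambda>r. f r * indicator {t..1} r) (F 1 - F t)"
    using t F f by (intro has_bochner_integral_FTC_Icc_real) (auto simp: continuous_on_eq_continuous_at)
  moreover have "AE r in lborel. f r * indicator {t..1} r = indicator {0<..<1} r * f r * of_bool (t \<le> r)"
    using AE_lborel_singleton[of 0] AE_lborel_singleton[of 1]
    by eventually_elim (use t in \<open>auto split: split_indicator\<close>)
  moreover have [measurable]: "f \<in> borel_measurable borel" by (rule borel_measurable_continuous_onI[OF f])
  ultimately show ?thesis
    by (subst (asm) has_bochner_integral_cong_AE) auto
qed

section \<open>Limits of the sampled means\<close>

context planar_motion_bridge begin

lemma measurable_rightmost:
  assumes "0 < N" "i \<in> ix N" shows "Measurable.pred M (rightmost N i)"
proof -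
  interpret I: isotropic_points M "ix N" "\<lambda>i w. fst (pt N i w)" "\<lambda>i w. snd (pt N i w)" "var N" by (rule isotropic_pt[OF assms(1)])
  have "I.top i = rightmost N i" by (auto simp: I.top_def rightmost_def fun_eq_iff)
  then show ?thesis using I.top_rv[OF assms(2)] by simp
qed

lemma AE_hits_all: "AE w in M. \<forall>N>0. hits N (ix N) w = 1"
proof -
  have "AE w in M. 0 < N \<longrightarrow> hits N (ix N) w = 1" for N
  proof (cases "0 < N")
    case True
    interpret I: isotropic_points M "ix N" "\<lambda>i w. fst (pt N i w)" "\<lambda>i w. snd (pt N i w)" "var N" by (rule isotropic_pt[OF True])
    have "I.top i = rightmost N i" for i by (auto simp: I.top_def rightmost_def fun_eq_iff)
    then show ?thesis using I.sum_top by (simp only: hits_def) simp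
  qed simp
  then show ?thesis by (simp add: AE_all_countable)
qed

definition drift :: "nat \<Rightarrow> real" where
  "drift N = (\<Sum>i\<in>ix N. \<integral>w. ((fst (pt N i w))\<^sup>2 - var N i) * of_bool (rightmost N i w) \<partial>M)"

lemma area_law:
  assumes N: "0 < N"
  shows "(\<integral>\<^sup>+w. emeasure lborel (convex hull ((\<lambda>i. pt N i w) ` ix N)) \<partial>M) = ennreal (pi * drift N)"
proof -
  interpret I: isotropic_points M "ix N" "\<lambda>i w. fst (pt N i w)" "\<lambda>i w. snd (pt N i w)" "var N" by (rule isotropic_pt[OF N])
  have "I.top i = rightmost N i" for i by (auto simp: I.top_def rightmost_def fun_eq_iff)
  then show ?thesis using I.expected_hull_area by (simp add: drift_def)
qed

definition meanW :: "nat \<Rightarrow> real \<Rightarrow> real" where "meanW N r = (\<integral>w. hits N (ixW N r) w \<partial>M)"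
definition meanB :: "nat \<Rightarrow> real \<Rightarrow> real" where "meanB N r = (\<integral>w. hits N (ixB N r) w \<partial>M)"
definition prt :: "nat \<Rightarrow> nat + nat \<Rightarrow> real" where "prt N i = (\<integral>w. of_bool (rightmost N i w) \<partial>M)"

lemma integrable_rightmost: "0 < N \<Longrightarrow> i \<in> ix N \<Longrightarrow> integrable M (\<lambda>w. of_bool (rightmost N i w) :: real)"
  using measurable_rightmost[of N i] by (intro integrable_const_bound[of _ 1]) auto

lemma integrable_sq_rightmost:
  assumes "0 < N" "i \<in> ix N"
  shows "integrable M (\<lambda>w. (fst (pt N i w))\<^sup>2 * of_bool (rightmost N i w))"
proof (rule Bochner_Integration.integrable_bound[OF gaussian_rv_sq[OF gaussian_pt(1)[OF assms(2)]]])
  have [measurable]: "Measurable.pred M (rightmost N i)" by (rule measurable_rightmost[OF assms])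
  have [measurable]: "(\<lambda>w. fst (pt N i w)) \<in> borel_measurable M" using gaussian_pt(1)[OF assms(2)] by (simp add: gaussian_rv_def)
  show "(\<lambda>w. (fst (pt N i w))\<^sup>2 * of_bool (rightmost N i w)) \<in> borel_measurable M" by measurable
qed auto

lemma mean_hits: "0 < N \<Longrightarrow> S \<subseteq> ix N \<Longrightarrow> (\<integral>w. hits N S w \<partial>M) = (\<Sum>i\<in>S. prt N i)"
  unfolding hits_def prt_def by (subst Bochner_Integration.integral_sum) (auto intro: integrable_rightmost)

lemma meanW_eq: "0 < N \<Longrightarrow> meanW N r = (\<Sum>k\<le>N. prt N (Inl k) * of_bool (real k / real N \<le> r))"
proof -
  assume N: "0 < N"
  have "meanW N r = (\<Sum>i\<in>ixW N r. prt N i)" unfolding meanW_def by (rule mean_hits[OF N ixW_subset])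
  also have "\<dots> = (\<Sum>k\<in>{k \<in> {..N}. real k / real N \<le> r}. prt N (Inl k))"
    unfolding ixW_def by (rule sum.reindex_cong[of Inl]) auto
  also have "\<dots> = (\<Sum>k\<le>N. if real k / real N \<le> r then prt N (Inl k) else 0)" by (rule sum.inter_filter) simp
  also have "\<dots> = (\<Sum>k\<le>N. prt N (Inl k) * of_bool (real k / real N \<le> r))" by (intro sum.cong) auto
  finally show ?thesis .
qed

lemma meanB_eq: "0 < N \<Longrightarrow> meanB N r = (\<Sum>l\<in>{1..<N}. prt N (Inr l) * of_bool (real l / real N \<le> r))"
proof -
  assume N: "0 < N"
  have "meanB N r = (\<Sum>i\<in>ixB N r. prt N i)" unfolding meanB_def by (rule mean_hits[OF N ixB_subset])
  also have "\<dots> = (\<Sum>l\<in>{l \<in> {1..<N}. real l / real N \<le> r}. prt N (Inr l))"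
    unfolding ixB_def by (rule sum.reindex_cong[of Inr]) auto
  also have "\<dots> = (\<Sum>l\<in>{1..<N}. if real l / real N \<le> r then prt N (Inr l) else 0)" by (rule sum.inter_filter) simp
  also have "\<dots> = (\<Sum>l\<in>{1..<N}. prt N (Inr l) * of_bool (real l / real N \<le> r))" by (intro sum.cong) auto
  finally show ?thesis .
qed

text \<open>The variance of a sample point is a function of its time: \<open>t = 1 - (1 - t)\<close>
  for the motion and \<open>t * (1 - t)\<close> for the bridge. By
  \<open>integral_indicator_ge\<close>, with primitives \<open>r\<close> and \<open>r^2 - r\<close>,
  it is replaced by integrals of \<open>meanW\<close> and \<open>meanB\<close>, whose limits are
  known.\<close>

lemma drift_eq:
  assumes N: "0 < N"
  shows "drift N = (\<integral>w. sq_top N w \<partial>M) - ((\<integral>w. hits N (Inl ` {..N}) w \<partial>M)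
    - (\<integral>r. indicator {0<..<1} r * 1 * meanW N r \<partial>lborel) + (\<integral>r. indicator {0<..<1} r * (2 * r - 1) * meanB N r \<partial>lborel))"
proof -
  let ?S = "\<lambda>i. (\<integral>w. (fst (pt N i w))\<^sup>2 * of_bool (rightmost N i w) \<partial>M)"
  have "drift N = (\<Sum>i\<in>ix N. (?S i) - var N i * prt N i)"
    unfolding drift_def
  proof (rule sum.cong[OF refl])
    fix i assume i: "i \<in> ix N"
    have "(\<integral>w. ((fst (pt N i w))\<^sup>2 - var N i) * of_bool (rightmost N i w) \<partial>M)
      = (\<integral>w. (fst (pt N i w))\<^sup>2 * of_bool (rightmost N i w) - var N i * of_bool (rightmost N i w) \<partial>M)"
      by (simp only: left_diff_distrib)
    also have "\<dots> = (?S i) - (\<integral>w. var N i * of_bool (rightmost N i w) \<partial>M)"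
      by (intro Bochner_Integration.integral_diff integrable_sq_rightmost N i integrable_mult_right integrable_rightmost)
    also have "(\<integral>w. var N i * of_bool (rightmost N i w) \<partial>M) = var N i * prt N i" unfolding prt_def by (rule integral_mult_right_zero)
    finally show "(\<integral>w. ((fst (pt N i w))\<^sup>2 - var N i) * of_bool (rightmost N i w) \<partial>M)
      = (?S i) - var N i * prt N i" .
  qed
  also have "\<dots> = (\<Sum>i\<in>ix N. (?S i)) - (\<Sum>i\<in>ix N. var N i * prt N i)"
    by (rule sum_subtractf)
  also have "(\<Sum>i\<in>ix N. (?S i)) = (\<integral>w. sq_top N w \<partial>M)"
    by (rule Bochner_Integration.integral_sum[symmetric]) (rule integrable_sq_rightmost[OF N])
  also have "(\<Sum>i\<in>ix N. var N i * prt N i) = (\<Sum>i\<in>Inl ` {..N}. var N i * prt N i) + (\<Sum>i\<in>Inr ` {1..<N}. var N i * prt N i)"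
    unfolding ix_def by (rule sum.union_disjoint) auto
  also have "(\<Sum>i\<in>Inl ` {..N}. var N i * prt N i) = (\<Sum>k\<le>N. real k / real N * prt N (Inl k))"
    by (rule sum.reindex_cong[of Inl]) (auto simp: var_def)
  also have "\<dots> = (\<Sum>k\<le>N. prt N (Inl k)) - (\<Sum>k\<le>N. prt N (Inl k) * (1 - real k / real N))"
    unfolding sum_subtractf[symmetric] by (intro sum.cong) (auto simp: algebra_simps)
  also have "(\<Sum>k\<le>N. prt N (Inl k)) = (\<integral>w. hits N (Inl ` {..N}) w \<partial>M)"
    by (subst mean_hits[OF N]) (auto simp: ix_def sum.reindex)
  also have "(\<Sum>k\<le>N. prt N (Inl k) * (1 - real k / real N)) = (\<integral>r. indicator {0<..<1} r * 1 * meanW N r \<partial>lborel)"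
  proof -
    have hb: "has_bochner_integral lborel (\<lambda>r. indicator {0<..<1} r * 1 * of_bool (real k / real N \<le> r)) (1 - real k / real N)" if "k \<le> N" for k
      by (rule integral_indicator_ge[where F = "\<lambda>r. r"]) (use that N in \<open>auto intro!: derivative_eq_intros\<close>)
    have "has_bochner_integral lborel (\<lambda>r. \<Sum>k\<le>N. prt N (Inl k) * (indicator {0<..<1} r * 1 * of_bool (real k / real N \<le> r))) (\<Sum>k\<le>N. prt N (Inl k) * (1 - real k / real N))"
      by (intro has_bochner_integral_sum has_bochner_integral_mult_right hb) auto
    moreover have "(\<lambda>r. \<Sum>k\<le>N. prt N (Inl k) * (indicator {0<..<1} r * 1 * of_bool (real k / real N \<le> r))) = (\<lambda>r. indicator {0<..<1} r * 1 * meanW N r)"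
      unfolding meanW_eq[OF N] sum_distrib_left by (intro ext sum.cong refl) (simp only: mult_ac)
    ultimately show ?thesis by (simp only: has_bochner_integral_integral_eq)
  qed
  also have "(\<Sum>i\<in>Inr ` {1..<N}. var N i * prt N i) = (\<Sum>l\<in>{1..<N}. prt N (Inr l) * (real l / real N * (1 - real l / real N)))"
    by (rule sum.reindex_cong[of Inr]) (auto simp: var_def)
  also have "\<dots> = (\<integral>r. indicator {0<..<1} r * (2 * r - 1) * meanB N r \<partial>lborel)"
  proof -
    have hb: "has_bochner_integral lborel (\<lambda>r. indicator {0<..<1} r * (2 * r - 1) * of_bool (real l / real N \<le> r)) (real l / real N * (1 - real l / real N))" if "l \<in> {1..<N}" for l
    proof -
      have "has_bochner_integral lborel (\<lambda>r. indicator {0<..<1} r * (2 * r - 1) * of_bool (real l / real N \<le> r)) ((1 * 1 - 1) - (real l / real N * (real l / real N) - real l / real N))"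
        by (rule integral_indicator_ge[where F = "\<lambda>r. r * r - r"]) (use that in \<open>auto intro!: derivative_eq_intros continuous_intros\<close>)
      moreover have "(1 * 1 - 1) - (x * x - x) = x * (1 - x)" for x :: real by (simp add: algebra_simps)
      ultimately show ?thesis by (simp only:)
    qed
    have "has_bochner_integral lborel (\<lambda>r. \<Sum>l\<in>{1..<N}. prt N (Inr l) * (indicator {0<..<1} r * (2 * r - 1) * of_bool (real l / real N \<le> r))) (\<Sum>l\<in>{1..<N}. prt N (Inr l) * (real l / real N * (1 - real l / real N)))"
      by (intro has_bochner_integral_sum has_bochner_integral_mult_right hb) auto
    moreover have "(\<lambda>r. \<Sum>l\<in>{1..<N}. prt N (Inr l) * (indicator {0<..<1} r * (2 * r - 1) * of_bool (real l / real N \<le> r))) = (\<lambda>r. indicator {0<..<1} r * (2 * r - 1) * meanB N r)"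
      unfolding meanB_eq[OF N] sum_distrib_left by (intro ext sum.cong refl) (simp only: mult_ac)
    ultimately show ?thesis by (simp only: has_bochner_integral_integral_eq)
  qed
  finally show ?thesis .
qed

lemma hits_measurable: "0 < N \<Longrightarrow> S \<subseteq> ix N \<Longrightarrow> hits N S \<in> borel_measurable M"
  unfolding hits_def[abs_def] by (intro borel_measurable_sum borel_measurable_integrable integrable_rightmost) auto

lemma hits_le_1: "hits N (ix N) w = 1 \<Longrightarrow> S \<subseteq> ix N \<Longrightarrow> \<bar>hits N S w\<bar> \<le> 1"
proof -
  assume one: "hits N (ix N) w = 1" and S: "S \<subseteq> ix N"
  have "0 \<le> hits N S w" unfolding hits_def by (intro sum_nonneg) auto
  moreover have "hits N S w \<le> hits N (ix N) w" unfolding hits_def by (rule sum_mono2) (use S in auto)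
  ultimately show ?thesis using one by simp
qed

text \<open>Bounded convergence, as \<open>hits\<close> is almost surely at most 1. It is applied
  along \<open>Suc N\<close> because the facts about samples hold for positive
  \<open>N\<close>.\<close>

lemma mean_limit:
  assumes S: "\<And>N. S N \<subseteq> ix N" and Q: "Measurable.pred M Q"
    and lim: "AE w in M. (\<lambda>N. hits N (S N) w) \<longlonglongrightarrow> of_bool (Q w)"
  shows "(\<lambda>N. \<integral>w. hits N (S N) w \<partial>M) \<longlonglongrightarrow> prob {w \<in> space M. Q w}"
proof -
  have "(\<lambda>N. \<integral>w. hits (Suc N) (S (Suc N)) w \<partial>M) \<longlonglongrightarrow> (\<integral>w. of_bool (Q w) \<partial>M)"
  proof (rule integral_dominated_convergence[where w = "\<lambda>_. 1"])
    show "(\<lambda>w. of_bool (Q w)) \<in> borel_measurable M" using Q by measurable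
    show "AE w in M. (\<lambda>N. hits (Suc N) (S (Suc N)) w) \<longlonglongrightarrow> of_bool (Q w)"
      using lim by eventually_elim (rule LIMSEQ_Suc)
    show "AE w in M. norm (hits (Suc N) (S (Suc N)) w) \<le> 1" for N
      using AE_hits_all by eventually_elim (use S in \<open>auto intro: hits_le_1\<close>)
    show "hits (Suc N) (S (Suc N)) \<in> borel_measurable M" for N by (rule hits_measurable[OF _ S]) simp
  qed simp
  moreover have "(\<integral>w. of_bool (Q w) \<partial>M) = prob {w \<in> space M. Q w}"
  proof -
    have "(\<integral>w. of_bool (Q w) \<partial>M) = (\<integral>w. indicator {w \<in> space M. Q w} w \<partial>M)"
      by (intro Bochner_Integration.integral_cong refl) (auto split: split_indicator)
    also have "\<dots> = prob ({w \<in> space M. Q w} \<inter> space M)" by (rule Bochner_Integration.integral_indicator)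
    also have "{w \<in> space M. Q w} \<inter> space M = {w \<in> space M. Q w}" by auto
    finally show ?thesis .
  qed
  ultimately show ?thesis by (subst filterlim_sequentially_Suc[symmetric]) simp
qed

lemma meanW_limit:
  assumes r: "0 < r" "r < 1"
  shows "(\<lambda>N. meanW N r) \<longlonglongrightarrow> prob {w \<in> space M. X.winW r w}"
  unfolding meanW_def
proof (rule mean_limit[OF ixW_subset])
  show "Measurable.pred M (X.winW r)" using r by (rule X.measurable_winW)
  show "AE w in M. (\<lambda>N. hits N (ixW N r) w) \<longlonglongrightarrow> of_bool (X.winW r w)"
    using AE_hits_all W.W1.block_no_tie[OF r] X.no_tie_wmx[OF r] AE_space
    by eventually_elim (rule hits_W_limit, use r in auto)
qed

lemma meanB_limit:
  assumes r: "0 < r" "r < 1"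
  shows "(\<lambda>N. meanB N r) \<longlonglongrightarrow> prob {w \<in> space M. X.winB r w}"
  unfolding meanB_def
proof (rule mean_limit[OF ixB_subset])
  show "Measurable.pred M (X.winB r)" using r by (rule X.measurable_winB)
  show "AE w in M. (\<lambda>N. hits N (ixB N r) w) \<longlonglongrightarrow> of_bool (X.winB r w)"
    using AE_hits_all X.bridge_no_tie[OF r] X.no_tie_bmx[OF r] AE_space
    by eventually_elim (rule hits_B_limit, use r in auto)
qed

lemma mean_W_all_limit: "(\<lambda>N. \<integral>w. hits N (Inl ` {..N}) w \<partial>M) \<longlonglongrightarrow> 1 - 1 / sqrt 5"
proof -
  have [measurable]: "(\<lambda>w. mw 0 1 w) \<in> borel_measurable M" "(\<lambda>w. mb 0 1 w) \<in> borel_measurable M" by simp_all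
  have "(\<lambda>N. \<integral>w. hits N (Inl ` {..N}) w \<partial>M) \<longlonglongrightarrow> prob {w \<in> space M. mb 0 1 w < mw 0 1 w}"
  proof (rule mean_limit)
    show "AE w in M. (\<lambda>N. hits N (Inl ` {..N}) w) \<longlonglongrightarrow> of_bool (mb 0 1 w < mw 0 1 w)"
      using AE_hits_all X.no_tie_maxima AE_space by eventually_elim (rule hits_W_all_limit, auto)
  qed (auto simp: ix_def)
  moreover have "prob {w \<in> space M. mb 0 1 w < mw 0 1 w} = 1 - 1 / sqrt 5"
    using X.prob_W_above_B by (simp add: emeasure_eq_measure)
  ultimately show ?thesis by simp
qed

lemma mean_sq_limit: "(\<lambda>N. \<integral>w. sq_top N w \<partial>M) \<longlonglongrightarrow> 1 + sqrt 5 / 10"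
proof -
  have [measurable]: "(\<lambda>w. mw 0 1 w) \<in> borel_measurable M" "(\<lambda>w. mb 0 1 w) \<in> borel_measurable M" by simp_all
  have hb: "has_bochner_integral M (\<lambda>w. (m_all w)\<^sup>2) (1 + sqrt 5 / 10)"
    by (rule has_bochner_integral_nn_integral[OF _ _ _ X.max_sq_integral]) auto
  have "(\<lambda>N. \<integral>w. sq_top (Suc N) w \<partial>M) \<longlonglongrightarrow> (\<integral>w. (m_all w)\<^sup>2 \<partial>M)"
  proof (rule integral_dominated_convergence[where w = "\<lambda>w. (m_all w)\<^sup>2"])
    show "integrable M (\<lambda>w. (m_all w)\<^sup>2)" using hb by (rule integrable.intros)
    show "(\<lambda>w. sq_top (Suc N) w) \<in> borel_measurable M" for N
      by (intro borel_measurable_sum borel_measurable_integrable integrable_sq_rightmost) auto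
    show "AE w in M. (\<lambda>N. sq_top (Suc N) w) \<longlonglongrightarrow> (m_all w)\<^sup>2"
      using AE_hits_all X.wmx_pos[of 1, simplified] AE_space
    proof eventually_elim
      fix w assume "\<forall>N>0. hits N (ix N) w = 1" "0 < mw 0 1 w" "w \<in> space M"
      then show "(\<lambda>N. sq_top (Suc N) w) \<longlonglongrightarrow> (m_all w)\<^sup>2"
        by (intro LIMSEQ_Suc rightmost_sq_limit) auto
    qed
    show "AE w in M. norm (sq_top (Suc N) w) \<le> (m_all w)\<^sup>2" for N
      using AE_hits_all AE_space
    proof eventually_elim
      fix w assume "\<forall>N>0. hits N (ix N) w = 1" "w \<in> space M"
      then have "sq_top (Suc N) w \<le> (m_all w)\<^sup>2" by (intro rightmost_sq_le) auto
      moreover have "0 \<le> sq_top (Suc N) w" by (intro sum_nonneg) auto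
      ultimately show "norm (sq_top (Suc N) w) \<le> (m_all w)\<^sup>2" by simp
    qed
  qed measurable
  then show ?thesis unfolding has_bochner_integral_integral_eq[OF hb] by (subst filterlim_sequentially_Suc[symmetric]) simp
qed

lemma time_integral_limit:
  fixes m :: "nat \<Rightarrow> real \<Rightarrow> real" and g :: "real \<Rightarrow> real"
  assumes m: "\<And>N. 0 < N \<Longrightarrow> m N \<in> borel_measurable borel" and m1: "\<And>N r. 0 < N \<Longrightarrow> \<bar>m N r\<bar> \<le> 1"
    and g: "g \<in> borel_measurable borel" "\<And>r. r \<in> {0<..<1} \<Longrightarrow> \<bar>g r\<bar> \<le> 1"
    and lim: "\<And>r. 0 < r \<Longrightarrow> r < 1 \<Longrightarrow> (\<lambda>N. m N r) \<longlonglongrightarrow> q r"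
  shows "(\<lambda>N. \<integral>r. indicator {0<..<1} r * g r * m N r \<partial>lborel) \<longlonglongrightarrow> (\<integral>r. indicator {0<..<1} r * g r * q r \<partial>lborel)"
    "(\<lambda>r. indicator {0<..<1} r * q r) \<in> borel_measurable borel"
proof -
  note [measurable] = g(1)
  have mS[measurable]: "m (Suc N) \<in> borel_measurable borel" for N by (rule m) simp
  have l: "(\<lambda>N. indicator {0<..<1} r * g r * m (Suc N) r) \<longlonglongrightarrow> indicator {0<..<1} r * g r * q r" for r
    using LIMSEQ_Suc[OF lim[of r]] by (cases "r \<in> {0<..<1}") (auto intro!: tendsto_intros)
  have l1: "(\<lambda>N. indicator {0<..<1} r * m (Suc N) r) \<longlonglongrightarrow> indicator {0<..<1} r * q r" for r
    using LIMSEQ_Suc[OF lim[of r]] by (cases "r \<in> {0<..<1}") (auto intro!: tendsto_intros)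
  show q: "(\<lambda>r. indicator {0<..<1} r * q r) \<in> borel_measurable borel"
    by (rule borel_measurable_LIMSEQ_real[OF l1]) measurable
  have "(\<lambda>N. \<integral>r. indicator {0<..<1} r * g r * m (Suc N) r \<partial>lborel) \<longlonglongrightarrow> (\<integral>r. indicator {0<..<1} r * g r * q r \<partial>lborel)"
  proof (rule integral_dominated_convergence[where w = "\<lambda>r. indicator {0<..<1} r"])
    have "(\<lambda>r. g r * (indicator {0<..<1} r * q r)) \<in> borel_measurable lborel" using q by measurable
    then show "(\<lambda>r. indicator {0<..<1} r * g r * q r) \<in> borel_measurable lborel" by (simp only: mult_ac)
    show "AE r in lborel. norm (indicator {0<..<1} r * g r * m (Suc N) r) \<le> indicator {0<..<1} r" for N
    proof (rule AE_I2)
      fix r :: real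
      show "norm (indicator {0<..<1} r * g r * m (Suc N) r) \<le> indicator {0<..<1} r"
        using g(2)[of r] m1[of "Suc N" r] by (auto split: split_indicator simp: abs_mult intro!: mult_le_one)
    qed
  qed (auto simp: l)
  then show "(\<lambda>N. \<integral>r. indicator {0<..<1} r * g r * m N r \<partial>lborel) \<longlonglongrightarrow> (\<integral>r. indicator {0<..<1} r * g r * q r \<partial>lborel)"
    by (subst filterlim_sequentially_Suc[symmetric]) simp
qed

lemma mean_abs_le_1: "0 < N \<Longrightarrow> \<bar>meanW N r\<bar> \<le> 1" "0 < N \<Longrightarrow> \<bar>meanB N r\<bar> \<le> 1"
proof -
  have b: "\<bar>\<integral>w. hits N S w \<partial>M\<bar> \<le> 1" if "0 < N" "S \<subseteq> ix N" for S
  proof -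
    have ae: "AE w in M. \<bar>hits N S w\<bar> \<le> 1" using AE_hits_all by eventually_elim (use that in \<open>auto intro: hits_le_1\<close>)
    have "integrable M (hits N S)" by (rule integrable_const_bound[of _ 1]) (use ae hits_measurable[OF that] in auto)
    then have "\<bar>\<integral>w. hits N S w \<partial>M\<bar> \<le> (\<integral>w. 1 \<partial>M)"
      using ae by (intro order_trans[OF integral_abs_bound] integral_mono_AE) auto
    then show ?thesis by (simp add: prob_space)
  qed
  show "0 < N \<Longrightarrow> \<bar>meanW N r\<bar> \<le> 1" "0 < N \<Longrightarrow> \<bar>meanB N r\<bar> \<le> 1"
    unfolding meanW_def meanB_def by (intro b ixW_subset ixB_subset; assumption)+
qed

lemma measurable_mean: "0 < N \<Longrightarrow> meanW N \<in> borel_measurable borel" "0 < N \<Longrightarrow> meanB N \<in> borel_measurable borel"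
proof -
  assume N: "0 < N"
  have "meanW N = (\<lambda>r. \<Sum>k\<le>N. prt N (Inl k) * of_bool (real k / real N \<le> r))" using meanW_eq[OF N] by auto
  then show "meanW N \<in> borel_measurable borel" by (simp only:) measurable
next
  assume N: "0 < N"
  have "meanB N = (\<lambda>r. \<Sum>l\<in>{1..<N}. prt N (Inr l) * of_bool (real l / real N \<le> r))" using meanB_eq[OF N] by auto
  then show "meanB N \<in> borel_measurable borel" by (simp only:) measurable
qed

lemma mean_W_integral_limit: "(\<lambda>N. \<integral>r. indicator {0<..<1} r * 1 * meanW N r \<partial>lborel) \<longlonglongrightarrow> 3 / 4 - sqrt 5 / 4"
proof -
  define q where "q r = prob {w \<in> space M. X.winW r w}" for r
  note lim = time_integral_limit[of meanW "\<lambda>_. 1" q, OF measurable_mean(1) mean_abs_le_1(1) _ _ meanW_limit[folded q_def]]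
  have "has_bochner_integral lborel (\<lambda>r. indicator {0<..<1} r * q r) (3 / 4 - sqrt 5 / 4)"
  proof (rule has_bochner_integral_nn_integral)
    have "sqrt 5 \<le> sqrt 9" by (rule real_sqrt_le_mono) simp
    then show "0 \<le> 3 / 4 - sqrt 5 / 4" by simp
    show "(\<lambda>r. indicator {0<..<1} r * q r) \<in> borel_measurable lborel" using lim(2) by simp
    show "(\<integral>\<^sup>+r. ennreal (indicator {0<..<1} r * q r) \<partial>lborel) = ennreal (3 / 4 - sqrt 5 / 4)"
      unfolding X.winW_integral[symmetric] by (intro nn_integral_cong) (auto simp: q_def emeasure_eq_measure split: split_indicator)
  qed (simp add: q_def)
  then have "(\<integral>r. indicator {0<..<1} r * 1 * q r \<partial>lborel) = 3 / 4 - sqrt 5 / 4" by (simp add: has_bochner_integral_integral_eq)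
  then show ?thesis using lim(1) by simp
qed

lemma mean_B_integral_limit: "(\<lambda>N. \<integral>r. indicator {0<..<1} r * (2 * r - 1) * meanB N r \<partial>lborel) \<longlonglongrightarrow> 19 * sqrt 5 / 30 - 4 / 3"
proof -
  define q where "q r = prob {w \<in> space M. X.winB r w}" for r
  have q01: "0 \<le> q r" "q r \<le> 1" for r by (auto simp: q_def)
  have lim: "(\<lambda>N. \<integral>r. indicator {0<..<1} r * (2 * r - 1) * meanB N r \<partial>lborel) \<longlonglongrightarrow> (\<integral>r. indicator {0<..<1} r * (2 * r - 1) * q r \<partial>lborel)"
    and qm: "(\<lambda>r. indicator {0<..<1} r * q r) \<in> borel_measurable borel"
    by (rule time_integral_limit[of meanB "\<lambda>r. 2 * r - 1" q, OF measurable_mean(2) mean_abs_le_1(2) _ _ meanB_limit[folded q_def]]; auto simp: abs_le_iff)+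
  have i1: "integrable lborel (\<lambda>r. indicator {0<..<1} r * q r)"
  proof (rule Bochner_Integration.integrable_bound)
    show "integrable lborel (indicator {0<..<1} :: real \<Rightarrow> real)" by (rule integrable_real_indicator) auto
    show "AE r in lborel. norm (indicator {0<..<1} r * q r) \<le> norm (indicator {0<..<1} r :: real)"
      using q01 by (auto split: split_indicator)
  qed (use qm in simp)
  have m2: "(\<lambda>r. 2 * r * (indicator {0<..<1} r * q r)) \<in> borel_measurable borel" using qm by measurable
  define I where "I = (\<integral>r. indicator {0<..<1} r * q r \<partial>lborel)"
  have I0: "0 \<le> I" unfolding I_def by (rule Bochner_Integration.integral_nonneg) (simp add: q01)
  have nnI: "(\<integral>\<^sup>+r. in_01 r * emeasure M {w \<in> space M. X.winB r w} \<partial>lborel) = ennreal I"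
    unfolding I_def nn_integral_eq_integral[OF i1 AE_I2[OF mult_nonneg_nonneg[OF indicator_pos_le q01(1)]], symmetric]
    by (intro nn_integral_cong) (auto simp: q_def emeasure_eq_measure split: split_indicator)
  have D0: "0 \<le> 19 * sqrt 5 / 30 - 4 / 3"
  proof -
    \<comment> \<open>The claim amounts to \<open>sqrt 5 \<ge> 40 / 19\<close>, that is 1600 against
      5 times 361.\<close>
    have "sqrt (40\<^sup>2 / 19\<^sup>2) \<le> sqrt 5" by (rule real_sqrt_le_mono) simp
    then show ?thesis by (simp add: real_sqrt_divide)
  qed
  have hb2: "has_bochner_integral lborel (\<lambda>r. 2 * r * (indicator {0<..<1} r * q r)) (I + (19 * sqrt 5 / 30 - 4 / 3))"
  proof (rule has_bochner_integral_nn_integral)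
    show "(\<integral>\<^sup>+r. ennreal (2 * r * (indicator {0<..<1} r * q r)) \<partial>lborel) = ennreal (I + (19 * sqrt 5 / 30 - 4 / 3))"
    proof -
      have "(\<integral>\<^sup>+r. ennreal (2 * r * (indicator {0<..<1} r * q r)) \<partial>lborel) = (\<integral>\<^sup>+r. in_01 r * ennreal (2 * r) * emeasure M {w \<in> space M. X.winB r w} \<partial>lborel)"
        by (intro nn_integral_cong) (auto simp: q_def emeasure_eq_measure ennreal_mult[symmetric] split: split_indicator)
      also have "\<dots> = ennreal I + ennreal (19 * sqrt 5 / 30 - 4 / 3)" unfolding X.winB_integral nnI ..
      also have "\<dots> = ennreal (I + (19 * sqrt 5 / 30 - 4 / 3))" by (rule ennreal_plus[symmetric]) (use I0 D0 in auto)
      finally show ?thesis .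
    qed
    show "AE r in lborel. 0 \<le> 2 * r * (indicator {0<..<1} r * q r)" using q01 by (auto split: split_indicator)
  qed (use m2 I0 D0 in auto)
  have hb1: "has_bochner_integral lborel (\<lambda>r. indicator {0<..<1} r * q r) I"
    unfolding I_def by (rule has_bochner_integral_integrable[OF i1])
  have "(\<lambda>r. 2 * r * (indicator {0<..<1} r * q r) - indicator {0<..<1} r * q r) = (\<lambda>r. indicator {0<..<1} r * (2 * r - 1) * q r)"
    by (auto simp: algebra_simps)
  with has_bochner_integral_diff[OF hb2 hb1]
  have "(\<integral>r. indicator {0<..<1} r * (2 * r - 1) * q r \<partial>lborel) = 19 * sqrt 5 / 30 - 4 / 3"
    by (simp add: has_bochner_integral_integral_eq)
  then show ?thesis using lim by simp
qed

lemma drift_limit: "drift \<longlonglongrightarrow> (25 - 7 * sqrt 5) / 12"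
proof -
  \<comment> \<open>The four limits: the second moment of the overall maximum, the probability that
    the motion wins, the mean of 1 - \<tau> when it does, and the mean of \<tau> (1 - \<tau>) when
    the bridge wins.\<close>
  have "(\<lambda>N. (\<integral>w. sq_top N w \<partial>M) - ((\<integral>w. hits N (Inl ` {..N}) w \<partial>M)
      - (\<integral>r. indicator {0<..<1} r * 1 * meanW N r \<partial>lborel) + (\<integral>r. indicator {0<..<1} r * (2 * r - 1) * meanB N r \<partial>lborel)))
    \<longlonglongrightarrow> (1 + sqrt 5 / 10) - ((1 - 1 / sqrt 5) - (3 / 4 - sqrt 5 / 4) + (19 * sqrt 5 / 30 - 4 / 3))"
    by (intro tendsto_diff tendsto_add mean_sq_limit mean_W_all_limit mean_W_integral_limit mean_B_integral_limit)
  moreover have "(1 + sqrt 5 / 10) - ((1 - 1 / sqrt 5) - (3 / 4 - sqrt 5 / 4) + (19 * sqrt 5 / 30 - 4 / 3)) = (25 - 7 * sqrt 5) / 12"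
  proof -
    have "1 / sqrt 5 = sqrt 5 / 5" by (simp add: field_simps)
    then show ?thesis by (simp add: field_simps)
  qed
  ultimately show ?thesis
    by (simp only:) (rule Lim_transform_eventually, assumption, rule eventually_mono[OF eventually_gt_at_top[of 0]], simp add: drift_eq)
qed

end

section \<open>The expected area\<close>

text \<open>The frontier of a convex set is a null set, so sets between a convex set and its closure
  have equal area.\<close>

lemma emeasure_convex_squeeze:
  fixes C H :: "'a :: euclidean_space set"
  assumes C: "convex C" "C \<in> sets borel" and H: "H \<in> sets borel" "C \<subseteq> H" "H \<subseteq> closure C"
  shows "emeasure lborel H = emeasure lborel C"
proof -
  have "frontier C \<in> null_sets lborel"
    using negligible_convex_frontier[OF C(1)] by (subst null_sets_completion_iff[symmetric]) (auto simp: negligible_iff_null_sets)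
  then have "H - C \<in> null_sets lborel"
    by (rule null_sets_subset) (use C H interior_subset[of C] in \<open>auto simp: frontier_def\<close>)
  then have "emeasure lborel (C \<union> (H - C)) = emeasure lborel C" using C by (intro emeasure_Un_null_set) auto
  moreover have "C \<union> (H - C) = H" using H by auto
  ultimately show ?thesis by simp
qed

lemma eventually_dyadic: "\<forall>\<^sub>F N in sequentially. R N \<Longrightarrow> \<exists>n. R (2 ^ n)"
proof -
  assume "\<forall>\<^sub>F N in sequentially. R N"
  then obtain N where "\<And>n. N \<le> n \<Longrightarrow> R n" by (auto simp: eventually_sequentially)
  then have "R (2 ^ N)" using less_exp[of N] by (simp add: less_imp_le)
  then show ?thesis ..
qed

context planar_motion_bridge begin

text \<open>Dyadic sample sizes make the samples nested, which gives monotone convergence of the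
  areas.\<close>

definition sample :: "nat \<Rightarrow> 'w \<Rightarrow> (real \<times> real) set" where
  "sample n w = (\<lambda>i. pt (2 ^ n) i w) ` ix (2 ^ n)"

definition track :: "'w \<Rightarrow> (real \<times> real) set" where
  "track w = (\<lambda>t. W t w) ` {0..1} \<union> (\<lambda>t. B t w) ` {0..1}"

lemma sample_Suc: "sample n w \<subseteq> sample (Suc n) w"
proof
  fix x assume "x \<in> sample n w"
  then obtain i where i: "i \<in> ix (2 ^ n)" "x = pt (2 ^ n) i w" by (auto simp: sample_def)
  define j :: "nat + nat" where "j = (case i of Inl k \<Rightarrow> Inl (2 * k) | Inr l \<Rightarrow> Inr (2 * l))"
  have "j \<in> ix (2 ^ Suc n)" using i(1) by (auto simp: ix_def j_def)
  moreover have "pt (2 ^ Suc n) j w = x" using i(2) by (auto simp: pt_def j_def split: sum.split)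
  ultimately show "x \<in> sample (Suc n) w" unfolding sample_def by blast
qed

lemma sample_mono: "m \<le> n \<Longrightarrow> sample m w \<subseteq> sample n w"
  using lift_Suc_mono_le[of "\<lambda>n. sample n w", OF sample_Suc] .

lemma sample_subset_track: "sample n w \<subseteq> track w"
  by (auto simp: sample_def track_def ix_def pt_def)

context
  fixes w assumes w: "w \<in> space M"
begin

lemma continuous_planar_W: "continuous_on {0..1} (\<lambda>t. W t w)"
proof -
  have "continuous_on {0..1} (\<lambda>t. (fst (W t w), snd (W t w)))"
    using W.W1.W_cont[OF w, of 0 1] W.W2.W_cont[OF w, of 0 1] by (intro continuous_on_Pair) auto
  then show ?thesis by simp
qed

lemma continuous_planar_B: "continuous_on {0..1} (\<lambda>t. B t w)"
proof -
  have "continuous_on {0..1} (\<lambda>t. (fst (B t w), snd (B t w)))"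
    using B.B1.B_cont[OF w, of 0 1] B.B2.B_cont[OF w, of 0 1] by (intro continuous_on_Pair) auto
  then show ?thesis by simp
qed

lemma track_subset_closure: "track w \<subseteq> closure (\<Union>n. sample n w)"
proof
  fix x assume "x \<in> track w"
  then consider t where "t \<in> {0..1}" "x = W t w" | t where "t \<in> {0..1}" "x = B t w" by (auto simp: track_def)
  then show "x \<in> closure (\<Union>n. sample n w)"
  proof cases
    case (1 t)
    show ?thesis unfolding closure_approachable
    proof (intro allI impI)
      fix e :: real assume "0 < e"
      then have "\<forall>\<^sub>F N in sequentially. \<exists>k. real k / real N \<le> t \<and> (0 < t \<longrightarrow> 0 < k) \<and> W (real k / real N) w \<in> ball x e"
        using 1 by (intro eventually_grid_left continuous_planar_W) auto
      from eventually_dyadic[OF this] obtain n k where k: "real k / real (2 ^ n) \<le> t" "W (real k / real (2 ^ n)) w \<in> ball x e" by auto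
      have "real k / real (2 ^ n) \<le> 1" by (rule order_trans[OF k(1)]) (use 1 in simp)
      then have "real k \<le> real (2 ^ n)" by (simp add: divide_le_eq)
      then have "Inl k \<in> ix (2 ^ n)" unfolding of_nat_le_iff by (simp add: ix_def)
      moreover have "W (real k / real (2 ^ n)) w = pt (2 ^ n) (Inl k) w" by (simp add: pt_def)
      ultimately have "W (real k / real (2 ^ n)) w \<in> sample n w" unfolding sample_def by blast
      then show "\<exists>y\<in>\<Union>n. sample n w. dist y x < e"
        using k(2) by (intro bexI[of _ "W (real k / real (2 ^ n)) w"] UN_I[of n]) (simp_all add: dist_commute)
    qed
  next
    case (2 t)
    show ?thesis
    proof (cases "t = 0 \<or> t = 1")
      case True
      \<comment> \<open>The end points of the bridge carry no bridge index, but they coincide with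
        the sampled point \<open>W 0\<close>.\<close>
      have "B 0 w = W 0 w"
        by (rule prod_eqI) (simp_all only: W.W1.bm_start[OF w] W.W2.bm_start[OF w] B.B1.bridge_start[OF w] B.B2.bridge_start[OF w])
      moreover have "B 1 w = W 0 w"
        by (rule prod_eqI) (simp_all only: W.W1.bm_start[OF w] W.W2.bm_start[OF w] B.B1.bridge_end[OF w] B.B2.bridge_end[OF w])
      ultimately have "x = W 0 w" using True 2(2) by metis
      then have "x \<in> sample 0 w" unfolding sample_def by (intro image_eqI[of _ _ "Inl 0"]) (auto simp: pt_def ix_def)
      then have "x \<in> (\<Union>n. sample n w)" by blast
      then show ?thesis by (rule subsetD[OF closure_subset])
    next
      case False
      then have t: "0 < t" "t < 1" using 2 by auto
      show ?thesis unfolding closure_approachable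
      proof (intro allI impI)
        fix e :: real assume "0 < e"
        then have "\<forall>\<^sub>F N in sequentially. \<exists>k. real k / real N \<le> t \<and> (0 < t \<longrightarrow> 0 < k) \<and> B (real k / real N) w \<in> ball x e"
          using 2 by (intro eventually_grid_left continuous_planar_B) auto
        from eventually_dyadic[OF this] obtain n k where k: "real k / real (2 ^ n) \<le> t" "0 < k" "B (real k / real (2 ^ n)) w \<in> ball x e" using t by auto
        have "real k / real (2 ^ n) < 1" by (rule le_less_trans[OF k(1) t(2)])
        then have "real k < real (2 ^ n)" by (simp add: divide_less_eq)
        then have "Inr k \<in> ix (2 ^ n)" unfolding of_nat_less_iff using k(2) by (simp add: ix_def)
        moreover have "B (real k / real (2 ^ n)) w = pt (2 ^ n) (Inr k) w" by (simp add: pt_def)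
        ultimately have "B (real k / real (2 ^ n)) w \<in> sample n w" unfolding sample_def by blast
        then show "\<exists>y\<in>\<Union>n. sample n w. dist y x < e"
          using k(3) by (intro bexI[of _ "B (real k / real (2 ^ n)) w"] UN_I[of n]) (simp_all add: dist_commute)
      qed
    qed
  qed
qed

lemma compact_hull_track: "compact (convex hull (track w))"
  unfolding track_def
  by (intro compact_convex_hull compact_Un compact_continuous_image continuous_planar_W continuous_planar_B) auto

lemma compact_hull_sample: "compact (convex hull (sample n w))"
  unfolding sample_def by (intro compact_convex_hull finite_imp_compact) simp

text \<open>The union \<open>C\<close> of the increasing hulls is convex, and the paths lie in its
  closure because the samples are dense in them. So the full hull is squeezed between
  \<open>C\<close> and its closure.\<close>

lemma emeasure_hull_track: "emeasure lborel (convex hull (track w)) = (SUP n. emeasure lborel (convex hull (sample n w)))"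
proof -
  define C where "C = (\<Union>n. convex hull (sample n w))"
  have mono: "convex hull (sample m w) \<subseteq> convex hull (sample n w)" if "m \<le> n" for m n
    by (rule hull_mono[OF sample_mono[OF that]])
  have conv: "convex C"
    unfolding convex_alt
  proof (intro ballI allI impI)
    fix x y u assume "x \<in> C" "y \<in> C" and u: "(0 :: real) \<le> u \<and> u \<le> 1"
    then obtain m n where "x \<in> convex hull (sample m w)" "y \<in> convex hull (sample n w)" by (auto simp: C_def)
    then have "x \<in> convex hull (sample (max m n) w)" "y \<in> convex hull (sample (max m n) w)"
      using mono[of m "max m n"] mono[of n "max m n"] by auto
    then have "(1 - u) *\<^sub>R x + u *\<^sub>R y \<in> convex hull (sample (max m n) w)"
      using convex_convex_hull[of "sample (max m n) w"] u unfolding convex_alt by blast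
    then show "(1 - u) *\<^sub>R x + u *\<^sub>R y \<in> C" by (auto simp: C_def)
  qed
  have meas: "convex hull (sample n w) \<in> sets borel" for n by (intro borel_compact compact_hull_sample)
  have "emeasure lborel (convex hull (track w)) = emeasure lborel C"
  proof (rule emeasure_convex_squeeze[OF conv])
    show "C \<in> sets borel" unfolding C_def using meas by auto
    show "convex hull (track w) \<in> sets borel" by (intro borel_compact compact_hull_track)
    show "C \<subseteq> convex hull (track w)" unfolding C_def by (intro UN_least hull_mono sample_subset_track)
    have "closure (\<Union>n. sample n w) \<subseteq> closure C" unfolding C_def by (intro closure_mono UN_mono hull_subset) auto
    then show "convex hull (track w) \<subseteq> closure C"
      using track_subset_closure by (intro hull_minimal convex_closure conv) auto
  qed
  also have "\<dots> = (SUP n. emeasure lborel (convex hull (sample n w)))"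
    unfolding C_def by (rule SUP_emeasure_incseq[symmetric]) (use meas mono in \<open>auto simp: incseq_def\<close>)
  finally show ?thesis .
qed

end

lemma measurable_hull_sample: "(\<lambda>w. emeasure lborel (convex hull (sample n w))) \<in> borel_measurable M"
proof -
  have p: "pt (2 ^ n) i \<in> borel_measurable M" if "i \<in> ix (2 ^ n)" for i
  proof -
    have "(\<lambda>w. (fst (pt (2 ^ n) i w), snd (pt (2 ^ n) i w))) \<in> borel_measurable M"
      using gaussian_pt[OF that] by (intro borel_measurable_Pair) (auto simp: gaussian_rv_def)
    then show ?thesis by simp
  qed
  have "Measurable.pred (M \<Otimes>\<^sub>M borel) (\<lambda>(w, x). x \<in> convex hull (sample n w))"
    unfolding sample_def by (rule measurable_in_convex_hull) (simp_all add: p)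
  then have [measurable]: "Measurable.pred (M \<Otimes>\<^sub>M lborel) (\<lambda>(w, x). x \<in> convex hull (sample n w))"
    by simp
  have "(\<lambda>w. \<integral>\<^sup>+x. of_bool (x \<in> convex hull (sample n w)) \<partial>lborel) \<in> borel_measurable M"
    by (intro lborel.borel_measurable_nn_integral) measurable
  moreover have "(\<integral>\<^sup>+x. of_bool (x \<in> convex hull (sample n w)) \<partial>lborel) = emeasure lborel (convex hull (sample n w))" if "w \<in> space M" for w
  proof -
    have "(\<integral>\<^sup>+x. of_bool (x \<in> convex hull (sample n w)) \<partial>lborel) = (\<integral>\<^sup>+x. indicator (convex hull (sample n w)) x \<partial>lborel)"
      by (intro nn_integral_cong) (auto split: split_indicator)
    also have "\<dots> = emeasure lborel (convex hull (sample n w))"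
      using borel_compact[OF compact_hull_sample[OF that, of n]] by (intro nn_integral_indicator) simp
    finally show ?thesis .
  qed
  ultimately show ?thesis by (simp cong: measurable_cong)
qed

lemma expected_area: "(\<integral>\<^sup>+w. emeasure lborel (convex hull (track w)) \<partial>M) = ennreal ((25 - 7 * sqrt 5) * pi / 12)"
proof -
  note [measurable] = measurable_hull_sample
  have inc: "emeasure lborel (convex hull (sample m w)) \<le> emeasure lborel (convex hull (sample n w))" if "m \<le> n" "w \<in> space M" for m n w
    using borel_compact[OF compact_hull_sample[OF that(2), of n]]
    by (intro emeasure_mono hull_mono sample_mono that(1)) simp
  define a where "a n = (\<integral>\<^sup>+w. emeasure lborel (convex hull (sample n w)) \<partial>M)" for n
  have "(\<integral>\<^sup>+w. emeasure lborel (convex hull (track w)) \<partial>M) = (\<integral>\<^sup>+w. (SUP n. emeasure lborel (convex hull (sample n w))) \<partial>M)"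
    by (rule nn_integral_cong) (rule emeasure_hull_track)
  also have "\<dots> = (SUP n. a n)"
    unfolding a_def by (rule nn_integral_monotone_convergence_SUP_AE) (auto intro!: inc)
  finally have E: "(\<integral>\<^sup>+w. emeasure lborel (convex hull (track w)) \<partial>M) = (SUP n. a n)" .
  have "incseq a" unfolding a_def incseq_def by (auto intro!: nn_integral_mono inc)
  then have "a \<longlonglongrightarrow> (SUP n. a n)" by (rule LIMSEQ_SUP)
  moreover have "a \<longlonglongrightarrow> ennreal (pi * ((25 - 7 * sqrt 5) / 12))"
  proof -
    have "a = (\<lambda>n. ennreal (pi * drift (2 ^ n)))"
      unfolding a_def sample_def by (intro ext area_law) simp
    moreover have "(\<lambda>n. drift (2 ^ n)) \<longlonglongrightarrow> (25 - 7 * sqrt 5) / 12"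
    proof (rule filterlim_compose[OF drift_limit])
      show "filterlim (\<lambda>n. 2 ^ n :: nat) sequentially sequentially"
        by (rule filterlim_subseq) (simp add: strict_mono_def)
    qed
    ultimately show ?thesis by (simp only:) (intro tendsto_ennrealI tendsto_mult_left)
  qed
  ultimately have "(SUP n. a n) = ennreal (pi * ((25 - 7 * sqrt 5) / 12))" by (rule LIMSEQ_unique)
  then show ?thesis unfolding E by (simp add: mult.commute)
qed

lemma expectation_area:
  "has_bochner_integral M (\<lambda>w. measure lborel (convex hull (track w))) ((25 - 7 * sqrt 5) * pi / 12)"
proof (rule has_bochner_integral_nn_integral)
  have e: "ennreal (measure lborel (convex hull (track w))) = emeasure lborel (convex hull (track w))" if "w \<in> space M" for w
    using emeasure_compact_finite[OF compact_hull_track[OF that]] by (intro emeasure_eq_ennreal_measure[symmetric]) (simp add: less_top)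
  show "(\<integral>\<^sup>+w. ennreal (measure lborel (convex hull (track w))) \<partial>M) = ennreal ((25 - 7 * sqrt 5) * pi / 12)"
    unfolding expected_area[symmetric] by (rule nn_integral_cong) (rule e)
  \<comment> \<open>The area of the hull of whole paths is measurable as a countable supremum of
    areas of sampled hulls.\<close>
  have "(\<lambda>w. enn2real (SUP n. emeasure lborel (convex hull (sample n w)))) \<in> borel_measurable M"
    using measurable_hull_sample by measurable
  moreover have "enn2real (SUP n. emeasure lborel (convex hull (sample n w))) = measure lborel (convex hull (track w))" if "w \<in> space M" for w
    unfolding emeasure_hull_track[OF that, symmetric] measure_def ..
  ultimately show "(\<lambda>w. measure lborel (convex hull (track w))) \<in> borel_measurable M"
    by (simp cong: measurable_cong)
  have "sqrt 5 \<le> sqrt 9" by (rule real_sqrt_le_mono) simp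
  then have "0 \<le> 25 - 7 * sqrt 5" by simp
  then show "0 \<le> (25 - 7 * sqrt 5) * pi / 12" by simp
qed simp

end

theorem theorem1p3:
  fixes M :: "'w measure"
    and W B :: "real \<Rightarrow> 'w \<Rightarrow> real \<times> real"
    and H :: "'w \<Rightarrow> (real \<times> real) set"
    and A :: "'w \<Rightarrow> real"
  assumes "planar_brownian_motion M W"
    and "planar_brownian_bridge M B"
    and "prob_space.indep_processes M {0..} W {0..1} B"
  defines "H \<equiv> \<lambda>\<omega>. convex hull ((\<lambda>t. W t \<omega>) ` {0..1} \<union> (\<lambda>t. B t \<omega>) ` {0..1})"
    and "A \<equiv> \<lambda>\<omega>. measure lborel (H \<omega>)"
  shows "integrable M A \<and> prob_space.expectation M A = (25 - 7 * sqrt 5) * pi / 12"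
proof -
  interpret W: planar_brownian_motion M W by (rule assms(1))
  have "planar_motion_bridge M W B"
    using assms(1-3) W.W1.prob_space_axioms by (intro planar_motion_bridge.intro planar_motion_bridge_axioms.intro)
  then interpret P: planar_motion_bridge M W B .
  show ?thesis
    using P.expectation_area by (simp add: has_bochner_integral_iff A_def H_def P.track_def)
qed

end
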